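(* Let $d\ge3$, $m\ge1$, and let $\Omega\subset\mathbb{R}^d$ be a Lipschitz graph domain with Lipschitz constant $K$. Let $L$ be an elliptic operator with measurable coefficients satisfying the strong ellipticity and boundedness conditions with constants $\lambda,M$ (see context). Assume condition (IH$'$) (see context) and let $N(x,y)$ be the Neumann function of $L$ in $\Omega$. (A) If condition (LB$'$) (see context) is also satisfied with constant $C_1$, then $$|N(x,y)|\le C|x-y|^{2-d}\quad\text{for all }x,y\in\Omega\text{ with }x\ne y,$$ and for all $y\in\Omega$ and $0<r<\infty$ we have: (i) $\|N(\cdot,y)\|_{L^{2d/(d-2)}(\Omega\setminus B_r(y))}+\|DN(\cdot,y)\|_{L^2(\Omega\setminus B_r(y))}\le Cr^{1-d/2}$. (ii) $\|N(\cdot,y)\|_{L^p(\Omega\cap B_r(y))}\le Cr^{2-d+d/p}$ for $p\in[1,\frac d{d-2})$. (iii) $|\{x\in\Omega:|N(x,y)|>t\}|\le Ct^{-d/(d-2)}$ for all $t>0$. (iv) $\|DN(\cdot,y)\|_{L^p(\Omega\cap B_r(y))}\le Cr^{1-d+d/p}$ for $p\in[1,\frac d{d-1})$. (v) $|\{x\in\Omega:|D_xN(x,y)|>t\}|\le Ct^{-d/(d-1)}$ for all $t>0$. Here $C>0$ depends only on $d,m,\lambda,M,K,C_1$, and additionally on $p$ in (ii) and (iv). The estimates (i)–(v) are also valid for the Neumann function $\tilde N$ of the adjoint ${}^tL$. (B) Conversely, suppose there exists a constant $C_2$ such that $|N(x,y)|\le C_2|x-y|^{2-d}$ for all $x,y\in\Omega$,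 $x\ne y$. Then condition (LB$'$) is satisfied in $\Omega$ with a constant $C_1$ depending only on $d,m,\lambda,M,K,C_2$.
   Context: Operator. $Lu=-D_\alpha(A^{\alpha\beta}D_\beta u)$ acts on $u=(u^1,\dots,u^m)^T$ (summation over repeated indices $\alpha,\beta=1,\dots,d$; $i,j=1,\dots,m$), where $A^{\alpha\beta}=A^{\alpha\beta}(x)$ are $m\times m$ matrices with measurable real entries $A^{\alpha\beta}_{ij}$ on $\mathbb{R}^d$ satisfying, for constants $\lambda,M>0$ and all $x\in\mathbb{R}^d$, $\xi,\eta\in\mathbb{R}^{md}$: $$A^{\alpha\beta}_{ij}(x)\xi^j_\beta\xi^i_\alpha\ge\lambda|\xi|^2,\qquad |A^{\alpha\beta}_{ij}(x)\xi^j_\alpha\eta^i_\beta|\le M|\xi||\eta|.$$ No symmetry is assumed. The adjoint ${}^tL$ is the operator of the same form with coefficients ${}^tA^{\alpha\beta}_{ij}=A^{\beta\alpha}_{ji}$. The conormal derivative is $(ADu\cdot n)^i=A^{\alpha\beta}_{ij}D_\beta u^jn_\alpha$ with $n$ the outward unit normal to $\partial\Omega$; similarly ${}^tADu\cdot n$ for ${}^tL$. Domain and spaces. A Lipschitz graph domain with Lipschitz constant $K$ is $\Omega=\{x=(x',x_d)\in\mathbb{R}^d:x_d>\varphi(x')\}$ with $\varphi:\mathbb{R}^{d-1}\to\mathbb{R}$ satisfying $|\varphi(x')-\varphi(y')|\le K|x'-y'|$ for all $x',y'$. $Y^{1,2}(\Omega)$ is the space of weakly differentiable $u\in L^{2d/(d-2)}(\Omega)$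 with weak derivatives in $L^2(\Omega)$, with norm $\|u\|_{L^{2d/(d-2)}(\Omega)}+\|Du\|_{L^2(\Omega)}$. $\Omega_R(x)=\Omega\cap B_R(x)$. Neumann problem. For $f\in L^{2d/(d+2)}(\Omega)^m$, $u$ is the unique (weak) solution in $Y^{1,2}(\Omega)^m$ of $Lu=f$ in $\Omega$, $ADu\cdot n=0$ on $\partial\Omega$ if $u\in Y^{1,2}(\Omega)^m$ and $$\int_\Omega A^{\alpha\beta}_{ij}D_\beta u^jD_\alpha v^i=\int_\Omega f^iv^i\quad\forall v\in Y^{1,2}(\Omega)^m;$$ analogously for ${}^tL$ with ${}^tA$. Neumann function. An $m\times m$ matrix valued function $N(x,y)$ with measurable entries $N_{ij}:\Omega\times\Omega\to\overline{\mathbb{R}}$ is a Neumann function of $L$ in $\Omega$ if: (a) $N(\cdot,y)\in W^{1,1}_{loc}(\Omega)$ and $N(\cdot,y)\in Y^{1,2}(\Omega\setminus B_r(y))$ for all $y\in\Omega$, $r>0$; (b) for all $y\in\Omega$, $k=1,\dots,m$ and $\phi\in C_c^\infty(\overline\Omega)^m$: $\int_\Omega A^{\alpha\beta}_{ij}D_\beta N_{jk}(\cdot,y)D_\alpha\phi^i=\phi^k(y)$; (c) for any $f\in C_c^\infty(\Omega)^m$, the function $u(x)=\int_\Omega N(y,x)^Tf(y)\,dy$ is the unique solution in $Y^{1,2}(\Omega)^m$ of ${}^tLu=f$ in $\Omega$, ${}^tADu\cdot n=0$ on $\partial\Omega$. The Neumann function of ${}^tL$ is defined in the same way with the roles of $L,A$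 and ${}^tL,{}^tA$ exchanged. Under condition (IH$'$) below, the Neumann functions $N$ of $L$ and $\tilde N$ of ${}^tL$ exist, are unique (up to null sets), and are taken to be the representatives with $N(\cdot,y)$, $\tilde N(\cdot,y)$ continuous on $\Omega\setminus\{y\}$ for all $y\in\Omega$ and $\tilde N(x,y)=N(y,x)^T$ for all $x\ne y$. Condition (IH$'$). There exist $\mu_0\in(0,1]$, $R_c\in(0,\infty]$ and $C_0>0$ such that for all $x\in\Omega$ and $R\in(0,d_x')$, where $d_x'=\min(d_x,R_c)$ and $d_x=\operatorname{dist}(x,\partial\Omega)$: if $u\in W^{1,2}(B_R(x))^m$ is a weak solution of either $Lu=0$ or ${}^tLu=0$ in $B_R=B_R(x)$, then $u$ is Hölder continuous in $B_R$ with $$[u]_{C^{\mu_0}(B_{R/2})}\le C_0R^{-\mu_0}\Bigl(\frac1{|B_R|}\int_{B_R}|u|^2\Bigr)^{1/2}.$$ Condition (LB$'$). There exists a constant $C_1>0$ such that for any $f\in C_c^\infty(\Omega)^m$, if $u\in Y^{1,2}(\Omega)^m$ is the unique weak solution of either [$Lu=f$ in $\Omega$, $ADu\cdot n=0$ on $\partial\Omega$] or [${}^tLu=f$ in $\Omega$, ${}^tADu\cdot n=0$ on $\partial\Omega$], then for all $x\in\Omega$ and $R>0$, $$\|u\|_{L^\infty(\Omega_{R/2}(x))}\le C_1\Bigl(R^{-d/2}\|u\|_{L^2(\Omega_R(x))}+R^2\|f\|_{L^\infty(\Omega_R(x))}\Bigr).$$ *)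

theory Defs
  imports "HOL-Analysis.Analysis" "HOL-Probability.Essential_Supremum"
begin

section \<open>Smooth functions\<close>

definition pd :: "'d::finite \<Rightarrow> (real^'d \<Rightarrow> real) \<Rightarrow> real^'d \<Rightarrow> real" where
  "pd \<alpha> f x = frechet_derivative f (at x) (axis \<alpha> 1)"

text \<open>All iterated partial derivatives exist and are again Frechet differentiable everywhere;
  this is the class of infinitely differentiable functions on the whole space.\<close>

definition smooth :: "(real^'d::finite \<Rightarrow> real) \<Rightarrow> bool" where
  "smooth f \<longleftrightarrow> (\<forall>\<alpha>s x. fold pd \<alpha>s f differentiable (at x))"

definition Cc_inf :: "(real^'d::finite) set \<Rightarrow> (real^'d \<Rightarrow> real) set" where
  "Cc_inf S = {f. smooth f \<and> compact (closure {x. f x \<noteq> 0}) \<and> closure {x. f x \<noteq> 0} \<subseteq> S}"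

definition Cc_inf_vec :: "(real^'d::finite) set \<Rightarrow> (real^'d \<Rightarrow> real^'m::finite) set" where
  "Cc_inf_vec S = {f. \<forall>i. (\<lambda>x. f x $ i) \<in> Cc_inf S}"

text \<open>Gradients of vector fields are arranged as $(Du)^i_\alpha = D_\alpha u^i$.\<close>

definition grad :: "(real^'d::finite \<Rightarrow> real^'m::finite) \<Rightarrow> real^'d \<Rightarrow> real^'d^'m" where
  "grad u x = (\<chi> i \<alpha>. pd \<alpha> (\<lambda>z. u z $ i) x)"


section \<open>Lebesgue norms and the Hoelder seminorm\<close>

text \<open>Norms take values in \<^typ>\<open>ennreal\<close>, so that an upper bound on a norm includes its
  finiteness.\<close>

definition Lp_norm ::
  "real \<Rightarrow> 'a::euclidean_space set \<Rightarrow> ('a \<Rightarrow> 'b::euclidean_space) \<Rightarrow> ennreal" where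
  "Lp_norm p S u =
     (let I = (\<integral>\<^sup>+x\<in>S. ennreal (norm (u x) powr p) \<partial>lebesgue)
      in if I = top then top else ennreal (enn2real I powr (1 / p)))"

definition in_Lp ::
  "real \<Rightarrow> 'a::euclidean_space set \<Rightarrow> ('a \<Rightarrow> 'b::euclidean_space) \<Rightarrow> bool" where
  "in_Lp p S u \<longleftrightarrow> set_borel_measurable lebesgue S u \<and> Lp_norm p S u < top"

definition Linf_norm ::
  "'a::euclidean_space set \<Rightarrow> ('a \<Rightarrow> 'b::euclidean_space) \<Rightarrow> ennreal" where
  "Linf_norm S u = esssup (lebesgue_on S) (\<lambda>x. ennreal (norm (u x)))"

definition holder_seminorm ::
  "real \<Rightarrow> 'a::metric_space set \<Rightarrow> ('a \<Rightarrow> 'b::real_normed_vector) \<Rightarrow> ennreal" where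
  "holder_seminorm \<mu> S v =
     (SUP (x, y)\<in>{(x, y). x \<in> S \<and> y \<in> S \<and> x \<noteq> y}.
        ennreal (norm (v x - v y) / dist x y powr \<mu>))"

text \<open>Hoelder continuity inside an open set: weak solutions have no regularity up to the boundary.\<close>

definition locally_holder_on ::
  "real \<Rightarrow> 'a::metric_space set \<Rightarrow> ('a \<Rightarrow> 'b::real_normed_vector) \<Rightarrow> bool" where
  "locally_holder_on \<mu> S v \<longleftrightarrow> (\<forall>T. compact T \<and> T \<subseteq> S \<longrightarrow> holder_seminorm \<mu> T v < top)"


section \<open>Weak derivatives and Sobolev spaces\<close>

definition L1_loc :: "'a::euclidean_space set \<Rightarrow> ('a \<Rightarrow> 'b::euclidean_space) \<Rightarrow> bool" where
  "L1_loc S f \<longleftrightarrow> (\<forall>T. compact T \<and> T \<subseteq> S \<longrightarrow> set_integrable lebesgue T f)"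

definition has_weak_partial ::
  "(real^'d::finite) set \<Rightarrow> 'd \<Rightarrow> (real^'d \<Rightarrow> real) \<Rightarrow> (real^'d \<Rightarrow> real) \<Rightarrow> bool" where
  "has_weak_partial S \<alpha> f g \<longleftrightarrow> L1_loc S f \<and> L1_loc S g \<and>
     (\<forall>\<psi>\<in>Cc_inf S. (LINT x:S|lebesgue. f x * pd \<alpha> \<psi> x) = - (LINT x:S|lebesgue. g x * \<psi> x))"

definition has_weak_gradient ::
  "(real^'d::finite) set \<Rightarrow> (real^'d \<Rightarrow> real^'m::finite) \<Rightarrow> (real^'d \<Rightarrow> real^'d^'m) \<Rightarrow> bool" where
  "has_weak_gradient S u G \<longleftrightarrow>
     (\<forall>i \<alpha>. has_weak_partial S \<alpha> (\<lambda>x. u x $ i) (\<lambda>x. G x $ i $ \<alpha>))"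

text \<open>On an open set the weak gradient is determined up to null sets, and it is only used under
  integrals, in norms and in measures of level sets.\<close>

definition wgrad ::
  "(real^'d::finite) set \<Rightarrow> (real^'d \<Rightarrow> real^'m::finite) \<Rightarrow> real^'d \<Rightarrow> real^'d^'m" where
  "wgrad S u = (SOME G. has_weak_gradient S u G)"

text \<open>Local integrability of the function and of its weak derivatives is part of
  \<^const>\<open>has_weak_partial\<close>.\<close>

definition W11_loc :: "(real^'d::finite) set \<Rightarrow> (real^'d \<Rightarrow> real^'m::finite) \<Rightarrow> bool" where
  "W11_loc S u \<longleftrightarrow> (\<exists>G. has_weak_gradient S u G)"

definition W12 :: "(real^'d::finite) set \<Rightarrow> (real^'d \<Rightarrow> real^'m::finite) \<Rightarrow> bool" where
  "W12 S u \<longleftrightarrow> W11_loc S u \<and> in_Lp 2 S u \<and> in_Lp 2 S (wgrad S u)"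

definition Y12 :: "(real^'d::finite) set \<Rightarrow> (real^'d \<Rightarrow> real^'m::finite) \<Rightarrow> bool" where
  "Y12 S u \<longleftrightarrow> W11_loc S u \<and> in_Lp (2 * real CARD('d) / (real CARD('d) - 2)) S u
     \<and> in_Lp 2 S (wgrad S u)"


section \<open>Domain and operator\<close>

text \<open>The index type \<^typ>\<open>'n option\<close> has \<open>d\<close> elements when \<^typ>\<open>'n\<close> has \<open>d - 1\<close>: the coordinate
  \<^term>\<open>None\<close> is $x_d$, and the coordinates \<^term>\<open>Some i\<close> form $x'$.\<close>

definition graph_domain :: "(real^'n::finite \<Rightarrow> real) \<Rightarrow> (real^'n option) set" where
  "graph_domain \<phi> = {x. x $ None > \<phi> (\<chi> i. x $ Some i)}"

text \<open>\<open>A \<alpha> \<beta> x $ i $ j\<close> is $A^{\alpha\beta}_{ij}(x)$.\<close>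

type_synonym ('d, 'm) coeffs = "'d \<Rightarrow> 'd \<Rightarrow> real^'d \<Rightarrow> real^'m^'m"

definition adjoint_coeffs :: "('d::finite, 'm::finite) coeffs \<Rightarrow> ('d, 'm) coeffs" where
  "adjoint_coeffs A = (\<lambda>\<alpha> \<beta> x. transpose (A \<beta> \<alpha> x))"

text \<open>$A^{\alpha\beta}_{ij}(x)\, \xi^j_\beta \eta^i_\alpha$\<close>

definition coeff_form ::
  "('d::finite, 'm::finite) coeffs \<Rightarrow> real^'d \<Rightarrow> real^'d^'m \<Rightarrow> real^'d^'m \<Rightarrow> real" where
  "coeff_form A x \<xi> \<eta> =
     (\<Sum>\<alpha>\<in>UNIV. \<Sum>\<beta>\<in>UNIV. \<Sum>i\<in>UNIV. \<Sum>j\<in>UNIV. A \<alpha> \<beta> x $ i $ j * \<xi> $ j $ \<beta> * \<eta> $ i $ \<alpha>)"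

text \<open>In the boundedness condition \<open>\<alpha>\<close> is paired with \<open>j\<close> and \<open>\<beta>\<close> with \<open>i\<close>, unlike in
  \<^const>\<open>coeff_form\<close>.\<close>

definition elliptic_coeffs :: "real \<Rightarrow> real \<Rightarrow> ('d::finite, 'm::finite) coeffs \<Rightarrow> bool" where
  "elliptic_coeffs lam M A \<longleftrightarrow>
     (\<forall>\<alpha> \<beta> i j. (\<lambda>x. A \<alpha> \<beta> x $ i $ j) \<in> borel_measurable lebesgue) \<and>
     (\<forall>x \<xi>. coeff_form A x \<xi> \<xi> \<ge> lam * (norm \<xi>)\<^sup>2) \<and>
     (\<forall>x \<xi> \<eta>. \<bar>\<Sum>\<alpha>\<in>UNIV. \<Sum>\<beta>\<in>UNIV. \<Sum>i\<in>UNIV. \<Sum>j\<in>UNIV.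
                 A \<alpha> \<beta> x $ i $ j * \<xi> $ j $ \<alpha> * \<eta> $ i $ \<beta>\<bar> \<le> M * norm \<xi> * norm \<eta>)"


section \<open>Weak solutions and the Neumann problem\<close>

text \<open>$Lu = 0$ in \<open>S\<close>, for \<open>u\<close> in $W^{1,2}(S)$\<close>

definition homogeneous_solution ::
  "(real^'d::finite) set \<Rightarrow> ('d, 'm::finite) coeffs \<Rightarrow> (real^'d \<Rightarrow> real^'m) \<Rightarrow> bool" where
  "homogeneous_solution S A u \<longleftrightarrow> W12 S u \<and>
     (\<forall>\<phi>\<in>Cc_inf_vec S. (LINT x:S|lebesgue. coeff_form A x (wgrad S u x) (grad \<phi> x)) = 0)"

text \<open>$Lu = f$ in \<open>S\<close> with vanishing conormal derivative on the boundary, \<open>u\<close> in $Y^{1,2}(S)$\<close>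

definition neumann_solution ::
  "(real^'d::finite) set \<Rightarrow> ('d, 'm::finite) coeffs \<Rightarrow> (real^'d \<Rightarrow> real^'m) \<Rightarrow> (real^'d \<Rightarrow> real^'m)
     \<Rightarrow> bool" where
  "neumann_solution S A f u \<longleftrightarrow> Y12 S u \<and>
     (\<forall>v. Y12 S v \<longrightarrow>
        (LINT x:S|lebesgue. coeff_form A x (wgrad S u x) (wgrad S v x))
          = (LINT x:S|lebesgue. f x \<bullet> v x))"


section \<open>Neumann functions\<close>

text \<open>Entries are extended reals, finite almost everywhere in the first variable since they are
  required to be locally integrable.\<close>

type_synonym ('d, 'm) kernel = "real^'d \<Rightarrow> real^'d \<Rightarrow> ereal^'m^'m"

definition real_mat :: "ereal^'m::finite^'m \<Rightarrow> real^'m^'m" where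
  "real_mat B = (\<chi> i j. real_of_ereal (B $ i $ j))"

text \<open>The \<open>k\<close>-th column $N_{\cdot k}(\cdot, y)$\<close>

definition kernel_col ::
  "('d::finite, 'm::finite) kernel \<Rightarrow> real^'d \<Rightarrow> 'm \<Rightarrow> real^'d \<Rightarrow> real^'m" where
  "kernel_col N y k = (\<lambda>x. column k (real_mat (N x y)))"

text \<open>$D_x N(x,y)$, with components $D_\alpha N_{ik}$ at \<open>$ k $ i $ \<alpha>\<close>\<close>

definition kernel_grad ::
  "(real^'d::finite) set \<Rightarrow> ('d, 'm::finite) kernel \<Rightarrow> real^'d \<Rightarrow> real^'d \<Rightarrow> real^'d^'m^'m" where
  "kernel_grad S N y = (\<lambda>x. \<chi> k. wgrad S (kernel_col N y k) x)"

text \<open>Functions in $C_c^\infty(\overline S)$ are the restrictions to $\overline S$ of functions in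
  $C_c^\infty(\mathbb{R}^d)$. In the second condition the closed ball is removed so that the
  remaining set is open; this changes it by a null set only.\<close>

definition neumann_function ::
  "(real^'d::finite) set \<Rightarrow> ('d, 'm::finite) coeffs \<Rightarrow> ('d, 'm) kernel \<Rightarrow> bool" where
  "neumann_function S A N \<longleftrightarrow>
     (\<forall>i j. (\<lambda>(x, y). N x y $ i $ j) \<in> borel_measurable (lebesgue_on (S \<times> S))) \<and>
     (\<forall>y\<in>S.
        (\<forall>i j. AE x in lebesgue_on S. \<bar>N x y $ i $ j\<bar> \<noteq> \<infinity>) \<and>
        (\<forall>k. W11_loc S (kernel_col N y k)) \<and>
        (\<forall>k. \<forall>r>0. Y12 (S - cball y r) (kernel_col N y k))) \<and>
     (\<forall>y\<in>S. \<forall>k. \<forall>\<phi>\<in>Cc_inf_vec UNIV.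
        (LINT x:S|lebesgue. coeff_form A x (wgrad S (kernel_col N y k) x) (grad \<phi> x)) = \<phi> y $ k) \<and>
     (\<forall>f\<in>Cc_inf_vec S.
        neumann_solution S (adjoint_coeffs A) f
          (\<lambda>x. LINT y:S|lebesgue. transpose (real_mat (N y x)) *v f y))"

text \<open>The Neumann functions of $L$ and of its adjoint, in the representatives that are finite and
  continuous off the pole and are related to each other by transposition.\<close>

definition neumann_pair ::
  "(real^'d::finite) set \<Rightarrow> ('d, 'm::finite) coeffs \<Rightarrow> ('d, 'm) kernel \<Rightarrow> ('d, 'm) kernel \<Rightarrow> bool" where
  "neumann_pair S A N Nt \<longleftrightarrow>
     neumann_function S A N \<and> neumann_function S (adjoint_coeffs A) Nt \<and>
     (\<forall>G\<in>{N, Nt}. \<forall>y\<in>S.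
        (\<forall>x\<in>S - {y}. \<forall>i j. \<bar>G x y $ i $ j\<bar> \<noteq> \<infinity>) \<and>
        continuous_on (S - {y}) (\<lambda>x. real_mat (G x y))) \<and>
     (\<forall>x\<in>S. \<forall>y\<in>S. x \<noteq> y \<longrightarrow> Nt x y = transpose (N y x))"


section \<open>The conditions (IH') and (LB')\<close>

definition cond_IH :: "(real^'d::finite) set \<Rightarrow> ('d, 'm::finite) coeffs \<Rightarrow> bool" where
  "cond_IH S A \<longleftrightarrow>
     (\<exists>\<mu>::real. \<exists>Rc::ereal. \<exists>C0::real. 0 < \<mu> \<and> \<mu> \<le> 1 \<and> 0 < Rc \<and> 0 < C0 \<and>
        (\<forall>x\<in>S. \<forall>R u.
           0 < R \<and> ereal R < min (ereal (infdist x (frontier S))) Rc \<and>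
           (homogeneous_solution (ball x R) A u \<or>
            homogeneous_solution (ball x R) (adjoint_coeffs A) u) \<longrightarrow>
           (\<exists>v. (AE z in lebesgue_on (ball x R). v z = u z) \<and>
                locally_holder_on \<mu> (ball x R) v \<and>
                holder_seminorm \<mu> (ball x (R / 2)) v
                  \<le> ennreal (C0 * R powr (- \<mu>) *
                      sqrt (1 / measure lebesgue (ball x R) *
                        (LINT z:ball x R|lebesgue. (norm (u z))\<^sup>2))))))"

definition cond_LB :: "(real^'d::finite) set \<Rightarrow> ('d, 'm::finite) coeffs \<Rightarrow> real \<Rightarrow> bool" where
  "cond_LB S A C1 \<longleftrightarrow> 0 < C1 \<and>
     (\<forall>f\<in>Cc_inf_vec S. \<forall>u.
        neumann_solution S A f u \<or> neumann_solution S (adjoint_coeffs A) f u \<longrightarrow>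
        (\<forall>x\<in>S. \<forall>R>0.
           Linf_norm (S \<inter> ball x (R / 2)) u
             \<le> ennreal C1 *
                 (ennreal (R powr (- (real CARD('d) / 2))) * Lp_norm 2 (S \<inter> ball x R) u
                  + ennreal (R\<^sup>2) * Linf_norm (S \<inter> ball x R) f)))"

end

theory Submission
  imports Defs
begin

text \<open>
The two conditions are linked by duality. A solution $u$ of the Neumann problem for $L$ with data
$f$ and a solution $w$ for the adjoint with data $g$ can be tested with each other, which gives
$\int f \cdot w = \int g \cdot u$. Solutions are therefore estimated through pairings with smooth
compactly supported data of the dual problem, and the estimates are turned into norms by
\<open>L2_duality\<close> and \<open>Linf_duality\<close>.

The global ingredient is a bound at every scale, $\|u\|_{L^2(\Omega \cap B_R)} \le C R \|Du\|_{L^2(\Omega)}$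
for $u$ in $Y^{1,2}(\Omega)$ (\<open>graph_domain_local_bound\<close>). Dilations about a point far enough below
the graph map $\Omega \cap B_R$ into $\Omega$. The change of the mean values of $u$ along these
dilations costs $R \|Du\|$, and after a large dilation half of the estimate on a larger ball is
left; the integrability of $u$ keeps these quantities bounded, so the half can be absorbed.

For (A), let $w$ solve the problem with data $g$ supported in a ball of radius $R$. The energy
estimate and the local bound control $w$ in $L^2$ near a point at distance $2R$, and (LB') turns
this into a bound from $L^2$ to $L^\infty$ between separated balls (\<open>L2_Linf_off_diagonal\<close>). The dual
bound goes from $L^1$ to $L^2$, and (LB') again leads from $L^1$ to $L^\infty$ with factor $C R^{2-d}$
(\<open>L1_Linf_off_diagonal\<close>). For data that concentrate at a point the solutions converge to a row of
the Neumann function, which is continuous off its pole, and the bound becomes the pointwise one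
(\<open>neumann_function_pointwise\<close>). The Caccioppoli inequality for the same approximations bounds their
gradients away from the pole by $C r^{1-d/2}$ in $L^2$, and this passes to the limit
(\<open>kernel_gradient_bound\<close>). The pointwise bound makes $N(\cdot, y)$ of weak type $d/(d-2)$; the
exterior $L^2$ bound makes the gradient of weak type $d/(d-1)$, after a splitting at distance
$t^{-1/(d-1)}$ from the pole. Weak type $q$ implies the $L^p$ bounds on balls for $p < q$, and for
$p > q$ where the function is bounded (\<open>kernel_estimates\<close>).

For (B), let $u$ be a solution with data $f$, let $\psi$ be a test function supported in
$\Omega \cap B_{R/2}$, and let $w$ solve the adjoint problem with data $\psi e_k$. Testing both
equations with solutions that are cut off between $B_{R/2}$ and $B_R$ (\<open>localized_reciprocity\<close>)
expresses $\int u^k \psi$ by $f$ and $w$ in $B_R$ and by the two solutions in an annulus. The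
first part is a Riesz potential; in the annulus $w$ is bounded through the pointwise bound, and
the Caccioppoli inequality controls both gradients. So $|\int u^k \psi|$ is at most a multiple of
$\|\psi\|_{L^1}$, which is the asserted bound on $u$ (\<open>local_boundedness\<close>).

The hypotheses and the estimates are symmetric in an operator and its adjoint. The locale
\<open>elliptic_domain\<close> is closed under this exchange, so each estimate is proved once.
\<close>

section \<open>Smooth functions and cutoffs\<close>

lemma pd_eqI:
  fixes f :: "real^'d::finite \<Rightarrow> real"
  assumes "(f has_derivative f') (at x)"
  shows "pd \<alpha> f x = f' (axis \<alpha> 1)"
  using frechet_derivative_at[OF assms] by (simp add: pd_def)

lemma has_derivative_pd:
  fixes f :: "real^'d::finite \<Rightarrow> real"
  assumes "f differentiable (at x)"
  shows "(f has_derivative (\<lambda>h. \<Sum>\<alpha>\<in>UNIV. h $ \<alpha> * pd \<alpha> f x)) (at x)"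
proof -
  let ?D = "frechet_derivative f (at x)"
  have D: "(f has_derivative ?D) (at x)"
    using assms by (simp add: frechet_derivative_works)
  have "linear ?D"
    using D has_derivative_linear by blast
  have "?D h = (\<Sum>\<alpha>\<in>UNIV. h $ \<alpha> * pd \<alpha> f x)" for h
  proof -
    have "?D h = ?D (\<Sum>\<alpha>\<in>UNIV. h $ \<alpha> *\<^sub>R axis \<alpha> 1)"
      using basis_expansion[of h] by (simp add: scalar_mult_eq_scaleR)
    also have "\<dots> = (\<Sum>\<alpha>\<in>UNIV. h $ \<alpha> *\<^sub>R ?D (axis \<alpha> 1))"
      using \<open>linear ?D\<close> by (simp add: linear_sum linear_scale)
    finally show ?thesis
      by (simp add: pd_def)
  qed
  then have "?D = (\<lambda>h. \<Sum>\<alpha>\<in>UNIV. h $ \<alpha> * pd \<alpha> f x)" by auto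
  with D show ?thesis by simp
qed

lemma sum_axis_mult [simp]: "(\<Sum>\<beta>\<in>UNIV. axis \<alpha> 1 $ \<beta> * c \<beta>) = c \<alpha>" for c :: "'d::finite \<Rightarrow> real"
proof -
  have "(\<Sum>\<beta>\<in>UNIV. axis \<alpha> 1 $ \<beta> * c \<beta>) = (\<Sum>\<beta>\<in>UNIV. if \<alpha> = \<beta> then c \<beta> else 0)"
    by (rule sum.cong) (auto simp: axis_def)
  then show ?thesis by simp
qed

lemma pd_add:
  assumes "f differentiable (at x)" "g differentiable (at x)"
  shows "pd \<alpha> (\<lambda>x. f x + g x) x = pd \<alpha> f x + pd \<alpha> g x"
  using pd_eqI[OF has_derivative_add[OF assms[THEN has_derivative_pd]]] by simp

lemma pd_mult:
  assumes "f differentiable (at x)" "g differentiable (at x)"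
  shows "pd \<alpha> (\<lambda>x. f x * g x) x = f x * pd \<alpha> g x + pd \<alpha> f x * g x"
  using pd_eqI[OF has_derivative_mult[OF assms[THEN has_derivative_pd]]] by simp

lemma pd_const [simp]: "pd \<alpha> (\<lambda>x. c) x = 0"
  by (rule pd_eqI[THEN trans]) (auto intro!: derivative_eq_intros)

lemma pd_compose:
  assumes "f differentiable (at x)" "(h has_real_derivative h') (at (f x))"
  shows "pd \<alpha> (\<lambda>x. h (f x)) x = h' * pd \<alpha> f x"
proof -
  have "((\<lambda>x. h (f x)) has_derivative (\<lambda>v. h' * (\<Sum>\<alpha>\<in>UNIV. v $ \<alpha> * pd \<alpha> f x))) (at x)"
    using has_derivative_compose[OF has_derivative_pd[OF assms(1)] assms(2)[unfolded has_field_derivative_def]]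
    by (simp add: o_def)
  from pd_eqI[OF this] show ?thesis
    by simp
qed

lemma pd_affine:
  assumes "f differentiable (at (b + a *\<^sub>R x))"
  shows "pd \<alpha> (\<lambda>x. f (b + a *\<^sub>R x)) x = a * pd \<alpha> f (b + a *\<^sub>R x)"
proof -
  have "((\<lambda>x. b + a *\<^sub>R x) has_derivative (\<lambda>v. a *\<^sub>R v)) (at x)"
    by (auto intro!: derivative_eq_intros)
  from has_derivative_compose[OF this has_derivative_pd[OF assms]]
  have "((\<lambda>x. f (b + a *\<^sub>R x)) has_derivative (\<lambda>v. \<Sum>\<alpha>\<in>UNIV. (a *\<^sub>R v) $ \<alpha> * pd \<alpha> f (b + a *\<^sub>R x))) (at x)" .
  from pd_eqI[OF this] show ?thesis
    by (simp add: mult.assoc flip: sum_distrib_left)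
qed

lemma smooth_differentiable: "smooth f \<Longrightarrow> f differentiable (at x)"
  unfolding smooth_def by (metis fold_simps(1))

lemma smooth_pd: "smooth f \<Longrightarrow> smooth (pd \<alpha> f)"
  unfolding smooth_def by (metis fold_simps(2))

text \<open>Smoothness is a coinductive notion: it holds for all members of a class of differentiable
  functions that is closed under partial derivatives. The class below contains the smooth functions
  and is closed under the operations needed to build cutoff functions, so that one induction gives
  the closure of smoothness under all of them. A function of one real variable enters as the
  sequence of its derivatives.\<close>

inductive smooth_generated :: "(real^'d::finite \<Rightarrow> real) \<Rightarrow> bool" where
  base: "smooth f \<Longrightarrow> smooth_generated f"
| const: "smooth_generated (\<lambda>x. c)"
| linear: "bounded_linear f \<Longrightarrow> smooth_generated f"
| add: "smooth_generated f \<Longrightarrow> smooth_generated g \<Longrightarrow> smooth_generated (\<lambda>x. f x + g x)"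
| mult: "smooth_generated f \<Longrightarrow> smooth_generated g \<Longrightarrow> smooth_generated (\<lambda>x. f x * g x)"
| inverse: "smooth_generated f \<Longrightarrow> (\<And>x. f x > 0) \<Longrightarrow> smooth_generated (\<lambda>x. inverse (f x))"
| compose: "smooth_generated f \<Longrightarrow> (\<And>n t. (H n has_real_derivative H (Suc n) t) (at t)) \<Longrightarrow>
    smooth_generated (\<lambda>x. H n (f x))"
| affine: "smooth_generated f \<Longrightarrow> smooth_generated (\<lambda>x. f (b + a *\<^sub>R x))"

lemma smooth_generated_step:
  "smooth_generated f \<Longrightarrow> (\<forall>x. f differentiable (at x)) \<and> (\<forall>\<alpha>. smooth_generated (pd \<alpha> f))"
proof (induction rule: smooth_generated.induct)
  case (base f)
  then show ?case by (auto intro: smooth_differentiable smooth_generated.base smooth_pd)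
next
  case (const c)
  have "pd \<alpha> (\<lambda>x. c) = (\<lambda>x. 0)" for \<alpha> :: 'a by (rule ext) simp
  then show ?case by (auto intro: smooth_generated.const)
next
  case (linear f)
  then have D: "(f has_derivative f) (at x)" for x
    by (rule bounded_linear_imp_has_derivative)
  then have "pd \<alpha> f = (\<lambda>x. f (axis \<alpha> 1))" for \<alpha>
    by (auto simp: fun_eq_iff intro: pd_eqI)
  with D show ?case by (auto simp: differentiable_def intro: smooth_generated.const)
next
  case (add f g)
  then have "pd \<alpha> (\<lambda>x. f x + g x) = (\<lambda>x. pd \<alpha> f x + pd \<alpha> g x)" for \<alpha>
    by (auto simp: fun_eq_iff pd_add)
  moreover have "smooth_generated (\<lambda>x. pd \<alpha> f x + pd \<alpha> g x)" for \<alpha>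
    using add by (intro smooth_generated.add) auto
  ultimately show ?case using add by auto
next
  case (mult f g)
  then have "pd \<alpha> (\<lambda>x. f x * g x) = (\<lambda>x. f x * pd \<alpha> g x + pd \<alpha> f x * g x)" for \<alpha>
    by (auto simp: fun_eq_iff pd_mult)
  moreover have "smooth_generated (\<lambda>x. f x * pd \<alpha> g x + pd \<alpha> f x * g x)" for \<alpha>
    using mult by (intro smooth_generated.add smooth_generated.mult) auto
  ultimately show ?case using mult by auto
next
  case (inverse f)
  then have nz: "f x \<noteq> 0" for x by (metis less_irrefl)
  have "pd \<alpha> (\<lambda>x. inverse (f x)) = (\<lambda>x. (- 1) * (inverse (f x) * inverse (f x)) * pd \<alpha> f x)" for \<alpha>
  proof
    fix x
    show "pd \<alpha> (\<lambda>x. inverse (f x)) x = (- 1) * (inverse (f x) * inverse (f x)) * pd \<alpha> f x"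
      using inverse nz by (intro pd_compose) (auto intro!: derivative_eq_intros)
  qed
  moreover have "(\<lambda>x. inverse (f x)) differentiable (at x)" for x
    using inverse nz by (intro differentiable_inverse) auto
  moreover have "smooth_generated (\<lambda>x. (- 1) * (inverse (f x) * inverse (f x)) * pd \<alpha> f x)" for \<alpha>
    using inverse by (intro smooth_generated.mult smooth_generated.const smooth_generated.inverse) auto
  ultimately show ?case by simp
next
  case (compose f H n)
  have "pd \<alpha> (\<lambda>x. H n (f x)) = (\<lambda>x. H (Suc n) (f x) * pd \<alpha> f x)" for \<alpha>
  proof
    fix x
    show "pd \<alpha> (\<lambda>x. H n (f x)) x = H (Suc n) (f x) * pd \<alpha> f x"
      using compose by (intro pd_compose) auto
  qed
  moreover have "(\<lambda>x. H n (f x)) differentiable (at x)" for x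
  proof (rule differentiable_compose[of "H n" f])
    show "H n differentiable (at (f x))"
      using compose.hyps(2)[of n "f x"] by (auto simp: has_field_derivative_def differentiable_def)
  qed (use compose in auto)
  moreover have "smooth_generated (\<lambda>x. H (Suc n) (f x) * pd \<alpha> f x)" for \<alpha>
    using compose smooth_generated.compose[of f H "Suc n"] by (intro smooth_generated.mult[of "\<lambda>x. H (Suc n) (f x)"]) auto
  ultimately show ?case by simp
next
  case (affine f b a)
  have "pd \<alpha> (\<lambda>x. f (b + a *\<^sub>R x)) = (\<lambda>x. a * pd \<alpha> f (b + a *\<^sub>R x))" for \<alpha>
    using affine by (auto simp: fun_eq_iff intro!: pd_affine)
  moreover have "(\<lambda>x. f (b + a *\<^sub>R x)) differentiable (at x)" for x
  proof -
    have "((\<lambda>x. b + a *\<^sub>R x) has_derivative (\<lambda>v. a *\<^sub>R v)) (at x)"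
      by (auto intro!: derivative_eq_intros)
    from has_derivative_compose[OF this has_derivative_pd] affine show ?thesis
      by (meson differentiableI)
  qed
  moreover have "smooth_generated (\<lambda>x. a * pd \<alpha> f (b + a *\<^sub>R x))" for \<alpha>
    using affine smooth_generated.affine[of "pd \<alpha> f" b a]
    by (intro smooth_generated.mult[of "\<lambda>x. a"] smooth_generated.const) auto
  ultimately show ?case by simp
qed

lemma smooth_iff_generated: "smooth f \<longleftrightarrow> smooth_generated f"
proof
  assume f: "smooth_generated f"
  have "smooth_generated (fold pd \<alpha>s f)" for \<alpha>s
    using f by (induction \<alpha>s arbitrary: f) (auto simp: smooth_generated_step)
  then show "smooth f"
    using smooth_generated_step unfolding smooth_def by blast
qed (rule smooth_generated.base)

lemma smooth_const: "smooth (\<lambda>x. c)"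
  and smooth_linear: "bounded_linear f \<Longrightarrow> smooth f"
  and smooth_add: "smooth f \<Longrightarrow> smooth g \<Longrightarrow> smooth (\<lambda>x. f x + g x)"
  and smooth_mult: "smooth f \<Longrightarrow> smooth g \<Longrightarrow> smooth (\<lambda>x. f x * g x)"
  and smooth_inverse: "smooth f \<Longrightarrow> (\<And>x. f x > 0) \<Longrightarrow> smooth (\<lambda>x. inverse (f x))"
  and smooth_compose: "smooth f \<Longrightarrow> (\<And>n t. (H n has_real_derivative H (Suc n) t) (at t)) \<Longrightarrow>
    smooth (\<lambda>x. H n (f x))"
  and smooth_affine: "smooth f \<Longrightarrow> smooth (\<lambda>x. f (b + a *\<^sub>R x))"
  unfolding smooth_iff_generated by (fact smooth_generated.intros(2-))+

lemma smooth_uminus: "smooth f \<Longrightarrow> smooth (\<lambda>x. - f x)"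
  using smooth_mult[OF smooth_const[of "-1"]] by simp

lemma smooth_diff: "smooth f \<Longrightarrow> smooth g \<Longrightarrow> smooth (\<lambda>x. f x - g x)"
  using smooth_add[OF _ smooth_uminus] by simp

lemma smooth_prod: "finite I \<Longrightarrow> (\<And>i. i \<in> I \<Longrightarrow> smooth (f i)) \<Longrightarrow> smooth (\<lambda>x. \<Prod>i\<in>I. f i x)"
  by (induction I rule: finite_induct) (auto intro: smooth_const smooth_mult)

lemma smooth_sum: "finite I \<Longrightarrow> (\<And>i. i \<in> I \<Longrightarrow> smooth (f i)) \<Longrightarrow> smooth (\<lambda>x. \<Sum>i\<in>I. f i x)"
  by (induction I rule: finite_induct) (auto intro: smooth_const smooth_add)

lemma smooth_component: "smooth (\<lambda>x. x $ i)"
  by (rule smooth_linear) (rule bounded_linear_vec_nth)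

lemma smooth_real_polynomial_function: "real_polynomial_function f \<Longrightarrow> smooth f"
  by (induction rule: real_polynomial_function.induct)
     (auto intro: smooth_const smooth_add smooth_mult smooth_linear)

lemma smooth_norm_square: "smooth (\<lambda>x::real^'d::finite. (norm x)\<^sup>2)"
proof -
  have "(norm x)\<^sup>2 = (\<Sum>i\<in>UNIV. x $ i * x $ i)" for x :: "real^'d"
    unfolding power2_norm_eq_inner by (simp add: inner_vec_def)
  then show ?thesis
    by (auto intro!: smooth_sum smooth_mult smooth_component)
qed

lemma smooth_continuous_on: "smooth f \<Longrightarrow> continuous_on S f"
  by (meson continuous_at_imp_continuous_on differentiable_imp_continuous_within smooth_differentiable)

text \<open>All derivatives of the flat function $e^{-1/t}$ (extended by zero to $t \le 0$) have the form
  $q(1/t)\,e^{-1/t}$ with a polynomial $q$.\<close>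

definition flat_exp :: "real poly \<Rightarrow> real \<Rightarrow> real" where
  "flat_exp q t = (if t > 0 then poly q (1 / t) * exp (- (1 / t)) else 0)"

lemma poly_times_exp_decay: "((\<lambda>s. poly q s * exp (- s)) \<longlongrightarrow> 0) at_top" for q :: "real poly"
proof (induction q)
  case 0
  then show ?case by simp
next
  case (pCons a q)
  have gen: "((\<lambda>s::real. s ^ k / exp s) \<longlongrightarrow> 0) at_top" for k
    by (rule tendsto_power_div_exp_0)
  have "((\<lambda>s. \<Sum>i\<le>degree (pCons a q). coeff (pCons a q) i * (s ^ i / exp s)) \<longlongrightarrow>
     (\<Sum>i\<le>degree (pCons a q). coeff (pCons a q) i * 0)) at_top"
    by (intro tendsto_intros gen)
  moreover have "(\<Sum>i\<le>degree (pCons a q). coeff (pCons a q) i * (s ^ i / exp s)) = poly (pCons a q) s * exp (- s)" for s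
    unfolding poly_altdef[of "pCons a q"] sum_distrib_right
    by (intro sum.cong) (auto simp: exp_minus divide_inverse)
  ultimately show ?case by simp
qed

lemma flat_exp_derivative:
  "(flat_exp q has_real_derivative flat_exp ([:0, 0, 1:] * (q - pderiv q)) t) (at t)"
proof -
  consider "t > 0" | "t < 0" | "t = 0" by linarith
  then show ?thesis
  proof cases
    case 1
    have "((\<lambda>t. poly q (1 / t) * exp (- (1 / t))) has_real_derivative
        flat_exp ([:0, 0, 1:] * (q - pderiv q)) t) (at t)"
      using 1 by (auto intro!: derivative_eq_intros simp: flat_exp_def field_simps power2_eq_square)
    moreover have "\<forall>\<^sub>F s in nhds t. poly q (1 / s) * exp (- (1 / s)) = flat_exp q s"
      using eventually_nhds_in_open[of "{0<..}" t] 1 by (auto simp: flat_exp_def elim!: eventually_mono)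
    ultimately show ?thesis
      using DERIV_cong_ev[of t t "\<lambda>t. poly q (1 / t) * exp (- (1 / t))" "flat_exp q"] by auto
  next
    case 2
    have "((\<lambda>t. 0) has_real_derivative flat_exp ([:0, 0, 1:] * (q - pderiv q)) t) (at t)"
      using 2 by (auto simp: flat_exp_def)
    moreover have "\<forall>\<^sub>F s in nhds t. 0 = flat_exp q s"
      using eventually_nhds_in_open[of "{..<0}" t] 2 by (auto simp: flat_exp_def elim!: eventually_mono)
    ultimately show ?thesis
      using DERIV_cong_ev[of t t "\<lambda>t. 0" "flat_exp q"] by auto
  next
    case 3
    have lim: "((\<lambda>h. flat_exp q h / h) \<longlongrightarrow> 0) (at_right 0)"
    proof -
      have "((\<lambda>h. poly (pCons 0 q) (inverse h) * exp (- inverse h)) \<longlongrightarrow> 0) (at_right (0::real))"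
        by (rule filterlim_compose[OF poly_times_exp_decay filterlim_inverse_at_top_right])
      then show ?thesis
        by (rule Lim_transform_eventually)
           (auto simp: eventually_at_filter flat_exp_def field_simps intro!: always_eventually)
    qed
    moreover have "((\<lambda>h. flat_exp q h / h) \<longlongrightarrow> 0) (at_left 0)"
      by (rule Lim_transform_eventually[OF tendsto_const])
         (auto simp: eventually_at_filter flat_exp_def intro!: always_eventually)
    ultimately have "((\<lambda>h. flat_exp q h / h) \<longlongrightarrow> 0) (at 0)"
      by (simp add: filterlim_at_split)
    then show ?thesis
      using 3 by (simp add: DERIV_def flat_exp_def)
  qed
qed

lemma smooth_flat_exp: "smooth f \<Longrightarrow> smooth (\<lambda>x. flat_exp 1 (f x))"
proof -
  assume f: "smooth f"
  define H where "H n = flat_exp (((\<lambda>q. [:0, 0, 1:] * (q - pderiv q)) ^^ n) 1)" for n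
  have "smooth (\<lambda>x. H 0 (f x))"
    by (rule smooth_compose[OF f, where H = H and n = 0]) (simp only: H_def funpow.simps o_def flat_exp_derivative)
  then show ?thesis by (simp add: H_def)
qed

text \<open>The flat function is applied to squares of radii, since the norm is not differentiable at the origin.\<close>

definition cutoff :: "real \<Rightarrow> real \<Rightarrow> real^'d::finite \<Rightarrow> real" where
  "cutoff a b x = flat_exp 1 (b\<^sup>2 - (norm x)\<^sup>2)
     * inverse (flat_exp 1 (b\<^sup>2 - (norm x)\<^sup>2) + flat_exp 1 ((norm x)\<^sup>2 - a\<^sup>2))"

lemma flat_exp_nonneg: "flat_exp 1 t \<ge> 0"
  and flat_exp_pos: "t > 0 \<Longrightarrow> flat_exp 1 t > 0"
  and flat_exp_zero: "t \<le> 0 \<Longrightarrow> flat_exp 1 t = 0"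
  by (auto simp: flat_exp_def)

context
  fixes a b :: real
  assumes ab: "0 \<le> a" "a < b"
begin

lemma cutoff_denominator_pos: "flat_exp 1 (b\<^sup>2 - (norm x)\<^sup>2) + flat_exp 1 ((norm x)\<^sup>2 - a\<^sup>2) > 0"
proof (cases "norm x < b")
  case True
  then have "(norm x)\<^sup>2 < b\<^sup>2" by (simp add: power_strict_mono)
  then show ?thesis by (intro add_pos_nonneg flat_exp_pos flat_exp_nonneg) auto
next
  case False
  then have "norm x > a" using ab by linarith
  then have "a\<^sup>2 < (norm x)\<^sup>2" using ab by (simp add: power_strict_mono)
  then show ?thesis by (intro add_nonneg_pos flat_exp_pos flat_exp_nonneg) auto
qed

lemma smooth_cutoff: "smooth (cutoff a b)"
  unfolding cutoff_def[abs_def]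
  by (intro smooth_mult smooth_inverse smooth_add smooth_flat_exp smooth_diff smooth_const
        smooth_norm_square cutoff_denominator_pos)

lemma cutoff_inside: "norm x \<le> a \<Longrightarrow> cutoff a b x = 1"
proof -
  assume "norm x \<le> a"
  then have "(norm x)\<^sup>2 \<le> a\<^sup>2" by (simp add: power_mono)
  then have "flat_exp 1 ((norm x)\<^sup>2 - a\<^sup>2) = 0" by (intro flat_exp_zero) auto
  then show ?thesis using cutoff_denominator_pos[of x] by (simp add: cutoff_def)
qed

lemma cutoff_outside: "norm x \<ge> b \<Longrightarrow> cutoff a b x = 0"
proof -
  assume "norm x \<ge> b"
  then have "b\<^sup>2 \<le> (norm x)\<^sup>2" using ab by (simp add: power_mono)
  then show ?thesis by (simp add: cutoff_def flat_exp_zero)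
qed

lemma cutoff_range: "0 \<le> cutoff a b x" "cutoff a b x \<le> 1"
  using cutoff_denominator_pos[of x] flat_exp_nonneg
  by (auto simp: cutoff_def field_simps intro!: mult_nonneg_nonneg divide_nonneg_pos)

end

section \<open>Test functions\<close>

lemma Cc_infI:
  assumes "smooth f" "compact T" "T \<subseteq> S" "\<And>x. x \<notin> T \<Longrightarrow> f x = 0"
  shows "f \<in> Cc_inf S"
proof -
  have "closure {x. f x \<noteq> 0} \<subseteq> T"
    using assms by (intro closure_minimal) (auto simp: compact_imp_closed)
  moreover from this have "compact (closure {x. f x \<noteq> 0})"
    using assms(2) by (metis closed_closure compact_Int_closed inf.absorb_iff2)
  ultimately show ?thesis using assms by (auto simp: Cc_inf_def)
qed

lemma Cc_infE:
  assumes "f \<in> Cc_inf S"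
  obtains T where "compact T" "T \<subseteq> S" "\<And>x. x \<notin> T \<Longrightarrow> f x = 0" "smooth f"
proof (rule that[of "closure {x. f x \<noteq> 0}"])
  show "x \<notin> closure {x. f x \<noteq> 0} \<Longrightarrow> f x = 0" for x
    using closure_subset[of "{x. f x \<noteq> 0}"] by auto
qed (use assms in \<open>auto simp: Cc_inf_def\<close>)

lemma Cc_inf_smooth: "f \<in> Cc_inf S \<Longrightarrow> smooth f"
  by (simp add: Cc_inf_def)

lemma Cc_inf_mono: "f \<in> Cc_inf S \<Longrightarrow> S \<subseteq> S' \<Longrightarrow> f \<in> Cc_inf S'"
  by (auto simp: Cc_inf_def)

lemma Cc_inf_zero: "(\<lambda>x. 0) \<in> Cc_inf S"
  by (rule Cc_infI[OF smooth_const, of "{}"]) auto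

lemma Cc_inf_outside: "f \<in> Cc_inf S \<Longrightarrow> x \<notin> S \<Longrightarrow> f x = 0"
  by (metis Cc_infE subsetD)

lemma pd_locally_const:
  assumes "open V" "x \<in> V" "\<And>x. x \<in> V \<Longrightarrow> f x = c"
  shows "pd \<alpha> f x = 0"
proof -
  have "((\<lambda>x. c) has_derivative (\<lambda>h. 0)) (at x)" by simp
  then have "(f has_derivative (\<lambda>h. 0)) (at x)"
    by (rule has_derivative_transform_within_open[OF _ assms(1,2)]) (use assms(3) in auto)
  then show ?thesis by (rule pd_eqI)
qed

lemma Cc_inf_pd: "f \<in> Cc_inf S \<Longrightarrow> pd \<alpha> f \<in> Cc_inf S"
proof (elim Cc_infE)
  fix T assume *: "compact T" "T \<subseteq> S" "\<And>x. x \<notin> T \<Longrightarrow> f x = 0" "smooth f"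
  show "pd \<alpha> f \<in> Cc_inf S"
  proof (rule Cc_infI[OF smooth_pd[OF *(4)] *(1,2)])
    fix x assume "x \<notin> T"
    then show "pd \<alpha> f x = 0"
      by (intro pd_locally_const[of "- T" x f 0]) (use * in \<open>auto simp: compact_imp_closed open_Compl\<close>)
  qed
qed

lemma Cc_inf_mult: "smooth g \<Longrightarrow> f \<in> Cc_inf S \<Longrightarrow> (\<lambda>x. g x * f x) \<in> Cc_inf S"
  by (erule Cc_infE, rule Cc_infI) (auto intro: smooth_mult)

lemma Cc_inf_bounded:
  assumes "f \<in> Cc_inf S"
  obtains B where "B > 0" "\<And>x. \<bar>f x\<bar> \<le> B"
proof -
  obtain T where T: "compact T" "\<And>x. x \<notin> T \<Longrightarrow> f x = 0" "smooth f"
    using assms by (metis Cc_infE)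
  have "bounded (f ` T)"
    using T by (intro compact_imp_bounded compact_continuous_image smooth_continuous_on)
  then obtain B where "B > 0" "\<And>y. y \<in> f ` T \<Longrightarrow> norm y \<le> B"
    unfolding bounded_pos by blast
  then show ?thesis
    using T by (intro that[of B]) (metis abs_zero imageI less_imp_le real_norm_def)+
qed

lemma smooth_measurable: "smooth f \<Longrightarrow> f \<in> borel_measurable lebesgue"
  by (rule measurable_completion) (simp add: borel_measurable_continuous_onI smooth_continuous_on)

lemma smooth_cutoff_at: "0 \<le> a \<Longrightarrow> a < b \<Longrightarrow> smooth (\<lambda>y. cutoff a b (y - x))"
  using smooth_affine[OF smooth_cutoff, of a b "- x" 1] by simp

lemma cutoff_compact_support: "0 \<le> a \<Longrightarrow> a < b \<Longrightarrow> (\<lambda>y. cutoff a b (y - x)) \<in> Cc_inf (cball x b)"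
  by (rule Cc_infI[OF smooth_cutoff_at compact_cball subset_refl])
     (auto simp: dist_norm norm_minus_commute intro!: cutoff_outside)

text \<open>Finitely many radial cutoffs that are 1 on balls covering \<open>T\<close> are combined into one minus the
  product of their complements, which is 1 as soon as one of them is.\<close>

lemma compact_cutoff:
  assumes "compact T" "open U" "T \<subseteq> U"
  obtains \<eta> where "\<eta> \<in> Cc_inf U" "\<And>x. x \<in> T \<Longrightarrow> \<eta> x = 1" "\<And>x. 0 \<le> \<eta> x" "\<And>x. \<eta> x \<le> 1"
proof -
  have "\<forall>x\<in>T. \<exists>e>0. cball x e \<subseteq> U"
    using assms open_contains_cball by blast
  then obtain e where e: "\<And>x. x \<in> T \<Longrightarrow> e x > 0" "\<And>x. x \<in> T \<Longrightarrow> cball x (e x) \<subseteq> U"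
    by metis
  have "T \<subseteq> (\<Union>x\<in>T. ball x (e x / 2))" using e(1) by force
  then obtain D where D: "D \<subseteq> T" "finite D" "T \<subseteq> (\<Union>x\<in>D. ball x (e x / 2))"
    using compactE_image[OF assms(1), of T "\<lambda>x. ball x (e x / 2)"] by (metis open_ball)
  define c where "c x y = cutoff (e x / 2) (e x) (y - x)" for x y
  have ab: "0 \<le> e x / 2" "e x / 2 < e x" if "x \<in> D" for x
    using e(1)[of x] that D by auto
  have c01: "0 \<le> c x y" "c x y \<le> 1" if "x \<in> D" for x y
    using cutoff_range[OF ab[OF that]] by (auto simp: c_def)
  define \<eta> where "\<eta> y = 1 - (\<Prod>x\<in>D. 1 - c x y)" for y
  have "\<eta> \<in> Cc_inf U"
  proof (rule Cc_infI[of _ "\<Union>x\<in>D. cball x (e x)"])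
    show "smooth \<eta>"
      unfolding \<eta>_def[abs_def] c_def
      using ab D(2) by (intro smooth_diff smooth_const smooth_prod smooth_cutoff_at)
    show "compact (\<Union>x\<in>D. cball x (e x))" using D(2) by (intro compact_UN) auto
    show "(\<Union>x\<in>D. cball x (e x)) \<subseteq> U" using e D by auto
    fix y assume "y \<notin> (\<Union>x\<in>D. cball x (e x))"
    then have "c x y = 0" if "x \<in> D" for x
      unfolding c_def using that ab[OF that] by (intro cutoff_outside) (auto simp: dist_norm norm_minus_commute)
    then show "\<eta> y = 0" by (simp add: \<eta>_def)
  qed
  moreover have "\<eta> y = 1" if "y \<in> T" for y
  proof -
    from D(3) that have "y \<in> (\<Union>x\<in>D. ball x (e x / 2))" by (rule subsetD)
    then obtain x where x: "x \<in> D" "y \<in> ball x (e x / 2)" by (rule UN_E)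
    then have "c x y = 1"
      unfolding c_def using ab[OF x(1)] by (intro cutoff_inside) (auto simp: dist_norm norm_minus_commute)
    then have "(\<Prod>x\<in>D. 1 - c x y) = 0" using x D(2) by auto
    then show ?thesis by (simp add: \<eta>_def)
  qed
  moreover have "0 \<le> \<eta> y" for y
    using c01 unfolding \<eta>_def by (auto intro!: prod_le_1)
  moreover have "\<eta> y \<le> 1" for y
    using c01 unfolding \<eta>_def by (auto intro!: prod_nonneg)
  ultimately show ?thesis using that by blast
qed

section \<open>Duality with test functions\<close>

lemma set_integrable_lebesgue_on:
  "S \<in> sets lebesgue \<Longrightarrow> set_integrable lebesgue S f \<longleftrightarrow> integrable (lebesgue_on S) f"
  for f :: "'a::euclidean_space \<Rightarrow> 'b::euclidean_space"
  by (simp add: set_integrable_def integrable_restrict_space)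

lemma set_integral_lebesgue_on:
  "S \<in> sets lebesgue \<Longrightarrow> (LINT x:S|lebesgue. f x) = integral\<^sup>L (lebesgue_on S) f"
  for f :: "'a::euclidean_space \<Rightarrow> 'b::euclidean_space"
  by (simp add: set_lebesgue_integral_def integral_restrict_space)

lemma set_measurable_lebesgue_on:
  "S \<in> sets lebesgue \<Longrightarrow> set_borel_measurable lebesgue S f \<longleftrightarrow> f \<in> borel_measurable (lebesgue_on S)"
  for f :: "'a::euclidean_space \<Rightarrow> 'b::euclidean_space"
  by (simp add: set_borel_measurable_def borel_measurable_restrict_space_iff)

lemma lebesgue_compact: "compact T \<Longrightarrow> T \<in> sets lebesgue"
  and lebesgue_open: "open U \<Longrightarrow> U \<in> sets lebesgue"
  by (simp_all add: borel_compact)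

lemma integrable_lebesgue_on_subset:
  fixes f :: "'a::euclidean_space \<Rightarrow> 'b::euclidean_space"
  assumes "integrable (lebesgue_on S) f" "S' \<subseteq> S" "S \<in> sets lebesgue" "S' \<in> sets lebesgue"
  shows "integrable (lebesgue_on S') f"
  using set_integrable_subset[of lebesgue S f S'] assms by (simp add: set_integrable_lebesgue_on)

lemma integral_lebesgue_on_eq:
  fixes f g :: "'a::euclidean_space \<Rightarrow> 'b::euclidean_space"
  assumes "S \<in> sets lebesgue" "S' \<in> sets lebesgue"
    and "\<And>x. x \<in> S \<Longrightarrow> x \<notin> S' \<Longrightarrow> f x = 0" "\<And>x. x \<in> S' \<Longrightarrow> x \<notin> S \<Longrightarrow> g x = 0"
    and "\<And>x. x \<in> S \<Longrightarrow> x \<in> S' \<Longrightarrow> f x = g x"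
  shows "integral\<^sup>L (lebesgue_on S) f = integral\<^sup>L (lebesgue_on S') g"
    and "integrable (lebesgue_on S) f \<longleftrightarrow> integrable (lebesgue_on S') g"
proof -
  have "indicator S x *\<^sub>R f x = indicator S' x *\<^sub>R g x" for x
    using assms(3-5) by (auto simp: indicator_def)
  then show "integral\<^sup>L (lebesgue_on S) f = integral\<^sup>L (lebesgue_on S') g"
    and "integrable (lebesgue_on S) f \<longleftrightarrow> integrable (lebesgue_on S') g"
    using assms(1,2) by (simp_all add: integral_restrict_space integrable_restrict_space)
qed

lemma L1_loc_measurable:
  fixes g :: "'a::euclidean_space \<Rightarrow> 'b::euclidean_space"
  assumes "open U" "L1_loc U g"
  shows "g \<in> borel_measurable (lebesgue_on U)"
proof -
  obtain T where T: "\<And>n. compact (T n)" "\<And>n. T n \<subseteq> U" "\<And>n. T n \<subseteq> interior (T (Suc n))" "\<Union> (range T) = U"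
    using open_Union_compact_subsets[OF assms(1)] by metis
  have "incseq T" using T(3) interior_subset by (intro incseq_SucI) blast
  have "(\<lambda>x. indicator (T n) x *\<^sub>R g x) \<in> borel_measurable (lebesgue_on U)" for n
  proof (rule measurable_restrict_space1)
    have "set_integrable lebesgue (T n) g" using assms(2) T by (auto simp: L1_loc_def)
    then show "(\<lambda>x. indicator (T n) x *\<^sub>R g x) \<in> borel_measurable lebesgue"
      unfolding set_integrable_def by (rule borel_measurable_integrable)
  qed
  moreover have "(\<lambda>n. indicator (T n) x *\<^sub>R g x) \<longlonglongrightarrow> g x" if "x \<in> space (lebesgue_on U)" for x
  proof -
    obtain k where "x \<in> T k" using T(4) \<open>x \<in> space (lebesgue_on U)\<close> by auto
    then have "indicator (T n) x *\<^sub>R g x = g x" if "n \<ge> k" for n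
      using incseqD[OF \<open>incseq T\<close> that] by (auto simp: indicator_def)
    then show ?thesis by (intro tendsto_eventually) (auto simp: eventually_sequentially)
  qed
  ultimately show ?thesis by (rule borel_measurable_LIMSEQ_metric)
qed

lemma L1_loc_mult_integrable:
  fixes g h :: "'a::euclidean_space \<Rightarrow> real"
  assumes "open U" "L1_loc U g" "compact T" "T \<subseteq> U" and h: "h \<in> borel_measurable lebesgue"
    and B: "\<And>x. \<bar>h x\<bar> \<le> B" and "\<And>x. x \<notin> T \<Longrightarrow> h x = 0"
  shows "integrable (lebesgue_on U) (\<lambda>x. g x * h x)"
proof -
  have "integrable (lebesgue_on T) g"
    using assms by (auto simp: L1_loc_def set_integrable_lebesgue_on lebesgue_compact)
  then have "integrable (lebesgue_on T) (\<lambda>x. B *\<^sub>R g x)" by simp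
  then have "integrable (lebesgue_on T) (\<lambda>x. g x * h x)"
  proof (rule Bochner_Integration.integrable_bound)
    show "(\<lambda>x. g x * h x) \<in> borel_measurable (lebesgue_on T)"
      using borel_measurable_integrable[OF \<open>integrable (lebesgue_on T) g\<close>] measurable_restrict_space1[OF h]
      by (rule borel_measurable_times)
    have "\<bar>g x\<bar> * \<bar>h x\<bar> \<le> \<bar>g x\<bar> * \<bar>B\<bar>" for x using B[of x] by (intro mult_left_mono) auto
    then show "AE x in lebesgue_on T. norm (g x * h x) \<le> norm (B *\<^sub>R g x)"
      by (auto simp: abs_mult mult.commute)
  qed
  then show ?thesis
    using assms by (subst integral_lebesgue_on_eq(2)[of _ T _ "\<lambda>x. g x * h x"]) (auto simp: lebesgue_compact lebesgue_open)
qed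

lemma Cc_inf_mult_integrable:
  fixes g :: "real^'d::finite \<Rightarrow> real"
  assumes "open U" "L1_loc U g" "\<psi> \<in> Cc_inf U"
  shows "integrable (lebesgue_on U) (\<lambda>x. g x * \<psi> x)"
proof -
  obtain T where "compact T" "T \<subseteq> U" "\<And>x. x \<notin> T \<Longrightarrow> \<psi> x = 0" "smooth \<psi>" using assms(3) by (metis Cc_infE)
  moreover obtain B where "\<And>x. \<bar>\<psi> x\<bar> \<le> B" using assms(3) by (metis Cc_inf_bounded)
  ultimately show ?thesis using assms by (intro L1_loc_mult_integrable[of U g T \<psi> B] smooth_measurable)
qed

lemma L1_loc_bounded:
  fixes g :: "'a::euclidean_space \<Rightarrow> real"
  assumes "g \<in> borel_measurable lebesgue" "\<And>x. \<bar>g x\<bar> \<le> B"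
  shows "L1_loc U g"
  unfolding L1_loc_def
proof safe
  fix T :: "'a set" assume T: "compact T" "T \<subseteq> U"
  have "finite_measure (lebesgue_on T)"
    using T(1) by (simp add: finite_measure_lebesgue_on lmeasurable_compact)
  then show "set_integrable lebesgue T g"
    using assms T by (auto simp: set_integrable_lebesgue_on lebesgue_compact
        intro!: finite_measure.integrable_const_bound[of _ _ B] measurable_restrict_space1)
qed

lemma Cc_inf_integrable: "\<psi> \<in> Cc_inf U \<Longrightarrow> V \<in> sets lebesgue \<Longrightarrow> integrable (lebesgue_on V) \<psi>"
proof -
  assume *: "\<psi> \<in> Cc_inf U" "V \<in> sets lebesgue"
  have one: "L1_loc UNIV (\<lambda>x. 1::real)" by (rule L1_loc_bounded[of _ 1]) auto
  have "integrable (lebesgue_on UNIV) \<psi>"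
    using Cc_inf_mult_integrable[OF open_UNIV one Cc_inf_mono[OF *(1)]] by simp
  then show ?thesis by (rule integrable_lebesgue_on_subset) (use * in auto)
qed

text \<open>A measurable function is an almost everywhere limit of continuous functions, and these are
  uniform limits of polynomials on compact sets. Multiplication by a smooth cutoff turns the
  polynomials into test functions.\<close>

lemma test_function_approximation:
  fixes h :: "real^'d::finite \<Rightarrow> real"
  assumes U: "open U" and T: "compact T" "T \<subseteq> U" and h: "h \<in> borel_measurable lebesgue"
    and B: "\<And>x. \<bar>h x\<bar> \<le> B" and h0: "\<And>x. x \<notin> T \<Longrightarrow> h x = 0"
  obtains \<psi> T' where "\<And>n. \<psi> n \<in> Cc_inf U" "compact T'" "T' \<subseteq> U" "\<And>n x. x \<notin> T' \<Longrightarrow> \<psi> n x = 0"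
    "\<And>n x. \<bar>\<psi> n x\<bar> \<le> B + 1" "AE x in lebesgue. (\<lambda>n. \<psi> n x) \<longlonglongrightarrow> h x"
proof -
  obtain \<eta> where \<eta>: "\<eta> \<in> Cc_inf U" "\<And>x. x \<in> T \<Longrightarrow> \<eta> x = 1" "\<And>x. 0 \<le> \<eta> x" "\<And>x. \<eta> x \<le> 1"
    using compact_cutoff[OF T(1) U T(2)] by metis
  obtain T' where T': "compact T'" "T' \<subseteq> U" "\<And>x. x \<notin> T' \<Longrightarrow> \<eta> x = 0" "smooth \<eta>"
    using \<eta>(1) by (metis Cc_infE)
  have B0: "B \<ge> 0" using B[of undefined] by linarith
  have "h measurable_on UNIV"
    using h by (simp add: lebesgue_measurable_imp_measurable_on)
  then obtain N g where N: "negligible N" and g: "\<And>n. continuous_on UNIV (g n)"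
    "\<And>x. x \<notin> N \<Longrightarrow> (\<lambda>n. g n x) \<longlonglongrightarrow> h x"
    unfolding measurable_on_def by auto
  define g' where "g' n x = max (- B) (min B (g n x))" for n x
  have g': "continuous_on T' (g' n)" for n
    unfolding g'_def by (intro continuous_intros continuous_on_subset[OF g(1)]) auto
  have g'B: "\<bar>g' n x\<bar> \<le> B" for n x using B0 by (auto simp: g'_def)
  have g'lim: "(\<lambda>n. g' n x) \<longlonglongrightarrow> h x" if "x \<notin> N" for x
  proof -
    have "(\<lambda>n. g' n x) \<longlonglongrightarrow> max (- B) (min B (h x))"
      unfolding g'_def by (intro tendsto_intros g(2) that)
    then show ?thesis using B[of x] by auto
  qed
  have "\<exists>p. real_polynomial_function p \<and> (\<forall>x\<in>T'. \<bar>g' n x - p x\<bar> < 1 / real (Suc n))" for n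
    using Stone_Weierstrass_real_polynomial_function[OF T'(1) g', of "1 / real (Suc n)" n]
    by (metis of_nat_0_less_iff zero_less_Suc zero_less_divide_1_iff)
  then obtain p where p: "\<And>n. real_polynomial_function (p n)"
    "\<And>n x. x \<in> T' \<Longrightarrow> \<bar>g' n x - p n x\<bar> < 1 / real (Suc n)" by metis
  define \<psi> where "\<psi> n x = p n x * \<eta> x" for n x
  have "\<psi> n \<in> Cc_inf U" for n
    unfolding \<psi>_def[abs_def] by (intro Cc_inf_mult smooth_real_polynomial_function p \<eta>)
  moreover have "\<psi> n x = 0" if "x \<notin> T'" for n x using T'(3)[OF that] by (simp add: \<psi>_def)
  moreover have "\<bar>\<psi> n x\<bar> \<le> B + 1" for n x
  proof (cases "x \<in> T'")
    case True
    have "1 / real (Suc n) \<le> 1" by simp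
    with p(2)[OF True, of n] g'B[of n x] have "\<bar>p n x\<bar> \<le> B + 1" by linarith
    then have "\<bar>p n x\<bar> * \<eta> x \<le> (B + 1) * 1" using \<eta> B0 by (intro mult_mono) auto
    then show ?thesis using \<eta>(3)[of x] by (simp add: \<psi>_def abs_mult)
  qed (use T'(3) B0 in \<open>auto simp: \<psi>_def\<close>)
  moreover have "AE x in lebesgue. (\<lambda>n. \<psi> n x) \<longlonglongrightarrow> h x"
  proof (rule AE_I')
    show "N \<in> null_sets lebesgue" using N by (simp add: negligible_iff_null_sets)
    have "(\<lambda>n. \<psi> n x) \<longlonglongrightarrow> h x" if "x \<notin> N" for x
    proof (cases "x \<in> T'")
      case True
      have "(\<lambda>n. g' n x - p n x) \<longlonglongrightarrow> 0"
      proof (rule Lim_null_comparison)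
        show "\<forall>\<^sub>F n in sequentially. norm (g' n x - p n x) \<le> 1 / real (Suc n)"
          using p(2)[OF True] by (auto intro!: always_eventually less_imp_le)
        show "(\<lambda>n. 1 / real (Suc n)) \<longlonglongrightarrow> 0"
          by (intro LIMSEQ_Suc lim_1_over_n)
      qed
      from tendsto_diff[OF g'lim[OF that] this] have "(\<lambda>n. p n x) \<longlonglongrightarrow> h x" by simp
      then have "(\<lambda>n. p n x * \<eta> x) \<longlonglongrightarrow> h x * \<eta> x" by (intro tendsto_intros)
      moreover have "h x * \<eta> x = h x" using h0[of x] \<eta>(2)[of x] by (cases "x \<in> T") auto
      ultimately show ?thesis by (simp add: \<psi>_def)
    next
      case False
      then have "x \<notin> T" using \<eta>(2) T'(3) by force
      then show ?thesis using False T'(3) h0 by (simp add: \<psi>_def)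
    qed
    then show "{x \<in> space lebesgue. \<not> (\<lambda>n. \<psi> n x) \<longlonglongrightarrow> h x} \<subseteq> N" by auto
  qed
  ultimately show ?thesis using that T'(1,2) by blast
qed

text \<open>The approximations have a common bound and a common compact support, so all integrals of
  interest converge by dominated convergence.\<close>

lemma test_function_integral_approximation:
  fixes h g :: "real^'d::finite \<Rightarrow> real"
  assumes U: "open U" and T: "compact T" "T \<subseteq> U" and h: "h \<in> borel_measurable lebesgue"
    and B: "\<And>x. \<bar>h x\<bar> \<le> B" and h0: "\<And>x. x \<notin> T \<Longrightarrow> h x = 0" and g: "L1_loc U g"
  obtains \<psi> where "\<And>n. \<psi> n \<in> Cc_inf U"
    "(\<lambda>n. \<integral>x. g x * \<psi> n x \<partial>lebesgue_on U) \<longlonglongrightarrow> (\<integral>x. g x * h x \<partial>lebesgue_on U)"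
    "(\<lambda>n. \<integral>x. \<bar>\<psi> n x\<bar> \<partial>lebesgue_on U) \<longlonglongrightarrow> (\<integral>x. \<bar>h x\<bar> \<partial>lebesgue_on U)"
    "(\<lambda>n. \<integral>x. (\<psi> n x)\<^sup>2 \<partial>lebesgue_on U) \<longlonglongrightarrow> (\<integral>x. (h x)\<^sup>2 \<partial>lebesgue_on U)"
proof -
  obtain \<psi> T' where \<psi>: "\<And>n. \<psi> n \<in> Cc_inf U" "compact T'" "T' \<subseteq> U" "\<And>n x. x \<notin> T' \<Longrightarrow> \<psi> n x = 0"
    "\<And>n x. \<bar>\<psi> n x\<bar> \<le> B + 1" and lim: "AE x in lebesgue. (\<lambda>n. \<psi> n x) \<longlonglongrightarrow> h x"
    by (rule test_function_approximation[OF U T h B h0]) (assumption, rule that, assumption+)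
  have B0: "B \<ge> 0" using B[of undefined] by linarith
  let ?w = "\<lambda>x. indicator T' x * (B + 1)"
  have Ul: "U \<in> sets lebesgue" using U by (simp add: lebesgue_open)
  have bound: "\<bar>\<psi> n x\<bar> \<le> ?w x" for n x
    using \<psi>(4)[of x n] \<psi>(5)[of n x] by (auto simp: indicator_def)
  have lim': "AE x in lebesgue_on U. (\<lambda>n. \<psi> n x) \<longlonglongrightarrow> h x"
    using lim Ul by (auto simp: AE_restrict_space_iff)
  have m\<psi>: "\<psi> n \<in> borel_measurable (lebesgue_on U)" for n
    by (intro measurable_restrict_space1 smooth_measurable Cc_inf_smooth[OF \<psi>(1)])
  have mh: "h \<in> borel_measurable (lebesgue_on U)" by (intro measurable_restrict_space1 h)
  have mg: "g \<in> borel_measurable (lebesgue_on U)" by (rule L1_loc_measurable[OF U g])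
  have one: "L1_loc U (\<lambda>x. 1::real)" by (rule L1_loc_bounded[of _ 1]) auto
  have wm: "?w \<in> borel_measurable lebesgue"
    by (intro borel_measurable_times borel_measurable_const borel_measurable_indicator lebesgue_compact \<psi>(2))
  have wb: "\<bar>?w x\<bar> \<le> B + 1" for x using B0 by (auto simp: indicator_def)
  have w0: "?w x = 0" if "x \<notin> T'" for x using that by simp
  have w1: "integrable (lebesgue_on U) (\<lambda>x. g x * ?w x)"
    by (rule L1_loc_mult_integrable[OF U g \<psi>(2,3) wm wb w0])
  have w2: "integrable (lebesgue_on U) ?w"
    using L1_loc_mult_integrable[OF U one \<psi>(2,3) wm wb w0] by simp
  have c1: "(\<lambda>n. \<integral>x. g x * \<psi> n x \<partial>lebesgue_on U) \<longlonglongrightarrow> (\<integral>x. g x * h x \<partial>lebesgue_on U)"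
  proof (rule integral_dominated_convergence[where w="\<lambda>x. \<bar>g x * ?w x\<bar>"])
    show "AE x in lebesgue_on U. (\<lambda>n. g x * \<psi> n x) \<longlonglongrightarrow> g x * h x"
      using lim' by eventually_elim (intro tendsto_intros)
    show "AE x in lebesgue_on U. norm (g x * \<psi> n x) \<le> \<bar>g x * ?w x\<bar>" for n
      using bound[of n] B0 by (auto simp: abs_mult mult_left_mono intro!: mult_left_mono)
  qed (use w1 m\<psi> mg mh in auto)
  have c2: "(\<lambda>n. \<integral>x. \<bar>\<psi> n x\<bar> \<partial>lebesgue_on U) \<longlonglongrightarrow> (\<integral>x. \<bar>h x\<bar> \<partial>lebesgue_on U)"
  proof (rule integral_dominated_convergence[where w="?w"])
    show "AE x in lebesgue_on U. (\<lambda>n. \<bar>\<psi> n x\<bar>) \<longlonglongrightarrow> \<bar>h x\<bar>"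
      using lim' by eventually_elim (intro tendsto_intros)
  qed (use w2 m\<psi> mg mh bound in auto)
  have c3: "(\<lambda>n. \<integral>x. (\<psi> n x)\<^sup>2 \<partial>lebesgue_on U) \<longlonglongrightarrow> (\<integral>x. (h x)\<^sup>2 \<partial>lebesgue_on U)"
  proof (rule integral_dominated_convergence[where w="\<lambda>x. (B + 1) * ?w x"])
    show "AE x in lebesgue_on U. (\<lambda>n. (\<psi> n x)\<^sup>2) \<longlonglongrightarrow> (h x)\<^sup>2"
      using lim' by eventually_elim (intro tendsto_intros)
    have "(\<psi> n x)\<^sup>2 \<le> (B + 1) * ?w x" for n x
      using mult_mono[OF \<psi>(5)[of n x] bound[of n x]] B0 by (simp add: power2_eq_square flip: abs_mult)
    then show "AE x in lebesgue_on U. norm ((\<psi> n x)\<^sup>2) \<le> (B + 1) * ?w x" for n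
      by auto
  qed (use w2 m\<psi> mg mh bound in auto)
  from that \<psi>(1) c1 c2 c3 show ?thesis by blast
qed

lemma le_of_square_le: "0 \<le> C \<Longrightarrow> s\<^sup>2 \<le> C * s \<Longrightarrow> s \<le> C" for s C :: real
proof (rule ccontr)
  assume *: "0 \<le> C" "s\<^sup>2 \<le> C * s" "\<not> s \<le> C"
  then have "C * s < s * s" by (intro mult_strict_right_mono) auto
  with * show False by (simp add: power2_eq_square)
qed

text \<open>The approximation admits the truncation \<open>h\<close> of \<open>g\<close> to a compact set and to values of size at most
  \<open>n\<close> as a test function. Since $\int g h = \int h^2$, the norm of \<open>h\<close> is at most \<open>C\<close>, and Fatou's lemma
  gives the bound for \<open>g\<close>.\<close>

lemma L2_duality:
  fixes g :: "real^'d::finite \<Rightarrow> real"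
  assumes U: "open U" and g: "L1_loc U g" and C: "C \<ge> 0"
    and bound: "\<And>\<psi>. \<psi> \<in> Cc_inf U \<Longrightarrow>
      \<bar>\<integral>x. g x * \<psi> x \<partial>lebesgue_on U\<bar> \<le> C * sqrt (\<integral>x. (\<psi> x)\<^sup>2 \<partial>lebesgue_on U)"
  shows "integrable (lebesgue_on U) (\<lambda>x. (g x)\<^sup>2)" "(\<integral>x. (g x)\<^sup>2 \<partial>lebesgue_on U) \<le> C\<^sup>2"
proof -
  obtain T where T: "\<And>n. compact (T n)" "\<And>n. T n \<subseteq> U" "\<And>n. T n \<subseteq> interior (T (Suc n))" "\<Union> (range T) = U"
    using open_Union_compact_subsets[OF U] by metis
  have "incseq T" using T(3) interior_subset by (intro incseq_SucI) blast
  have mg: "g \<in> borel_measurable (lebesgue_on U)" by (rule L1_loc_measurable[OF U g])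
  define h where "h n x = (if x \<in> T n \<and> \<bar>g x\<bar> \<le> real n then g x else 0)" for n x
  have mT: "(\<lambda>x. indicator (T n) x *\<^sub>R g x) \<in> borel_measurable lebesgue" for n
    using g T(1,2) by (auto simp: L1_loc_def set_integrable_def)
  have hm: "h n \<in> borel_measurable lebesgue" for n
  proof -
    have "h n = (\<lambda>x. if \<bar>indicator (T n) x *\<^sub>R g x\<bar> \<le> real n then indicator (T n) x *\<^sub>R g x else 0)"
      by (auto simp: h_def indicator_def fun_eq_iff)
    moreover note mT[of n, measurable]
    have "(\<lambda>x. if \<bar>indicator (T n) x *\<^sub>R g x\<bar> \<le> real n then indicator (T n) x *\<^sub>R g x else 0) \<in> borel_measurable lebesgue"
      by measurable
    ultimately show ?thesis by simp
  qed
  have hb: "\<bar>h n x\<bar> \<le> real n" for n x by (auto simp: h_def)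
  have h0: "x \<notin> T n \<Longrightarrow> h n x = 0" for n x by (auto simp: h_def)
  have gh: "g x * h n x = (h n x)\<^sup>2" for n x by (auto simp: h_def power2_eq_square)
  have int: "integrable (lebesgue_on U) (\<lambda>x. (h n x)\<^sup>2)" for n
    using L1_loc_mult_integrable[OF U g T(1,2) hm hb h0, of n] by (simp add: gh)
  have le: "(\<integral>x. (h n x)\<^sup>2 \<partial>lebesgue_on U) \<le> C\<^sup>2" for n
  proof -
    obtain \<psi> where \<psi>: "\<And>n. \<psi> n \<in> Cc_inf U"
      "(\<lambda>k. \<integral>x. g x * \<psi> k x \<partial>lebesgue_on U) \<longlonglongrightarrow> (\<integral>x. g x * h n x \<partial>lebesgue_on U)"
      "(\<lambda>k. \<integral>x. \<bar>\<psi> k x\<bar> \<partial>lebesgue_on U) \<longlonglongrightarrow> (\<integral>x. \<bar>h n x\<bar> \<partial>lebesgue_on U)"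
      "(\<lambda>k. \<integral>x. (\<psi> k x)\<^sup>2 \<partial>lebesgue_on U) \<longlonglongrightarrow> (\<integral>x. (h n x)\<^sup>2 \<partial>lebesgue_on U)"
      by (rule test_function_integral_approximation
          [OF U T(1)[of n] T(2)[of n] hm[of n] hb[where n=n] h0[where n=n] g]) (assumption, rule that, assumption+)
    have "\<bar>\<integral>x. g x * h n x \<partial>lebesgue_on U\<bar> \<le> C * sqrt (\<integral>x. (h n x)\<^sup>2 \<partial>lebesgue_on U)"
      by (rule LIMSEQ_le[OF tendsto_rabs[OF \<psi>(2)] tendsto_mult[OF tendsto_const tendsto_real_sqrt[OF \<psi>(4)]]])
         (use bound[OF \<psi>(1)] in auto)
    then have "(\<integral>x. (h n x)\<^sup>2 \<partial>lebesgue_on U) \<le> C * sqrt (\<integral>x. (h n x)\<^sup>2 \<partial>lebesgue_on U)"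
      by (simp add: gh)
    moreover have I0: "0 \<le> (\<integral>x. (h n x)\<^sup>2 \<partial>lebesgue_on U)" by simp
    ultimately have "(sqrt (\<integral>x. (h n x)\<^sup>2 \<partial>lebesgue_on U))\<^sup>2 \<le> C * sqrt (\<integral>x. (h n x)\<^sup>2 \<partial>lebesgue_on U)"
      by (simp only: real_sqrt_pow2)
    then have "sqrt (\<integral>x. (h n x)\<^sup>2 \<partial>lebesgue_on U) \<le> C" by (rule le_of_square_le[OF C])
    from power_mono[OF this, of 2] show ?thesis by (simp only: real_sqrt_pow2[OF I0] real_sqrt_ge_zero[OF I0])
  qed
  have lim: "(\<lambda>n. (h n x)\<^sup>2) \<longlonglongrightarrow> (g x)\<^sup>2" if "x \<in> U" for x
  proof -
    obtain k where k: "x \<in> T k" using T(4) \<open>x \<in> U\<close> by auto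
    obtain l where l: "\<bar>g x\<bar> \<le> real l" using real_arch_simple by blast
    have "h n x = g x" if "n \<ge> max k l" for n
      using incseqD[OF \<open>incseq T\<close>, of k n] that k l by (auto simp: h_def)
    then show ?thesis by (intro tendsto_eventually eventually_sequentiallyI[of "max k l"]) simp
  qed
  have nn: "(\<integral>\<^sup>+x. ennreal ((g x)\<^sup>2) \<partial>lebesgue_on U) \<le> ennreal (C\<^sup>2)"
  proof -
    have "(\<integral>\<^sup>+x. ennreal ((g x)\<^sup>2) \<partial>lebesgue_on U) = (\<integral>\<^sup>+x. liminf (\<lambda>n. ennreal ((h n x)\<^sup>2)) \<partial>lebesgue_on U)"
    proof (rule nn_integral_cong)
      fix x assume "x \<in> space (lebesgue_on U)"
      then have "(\<lambda>n. ennreal ((h n x)\<^sup>2)) \<longlonglongrightarrow> ennreal ((g x)\<^sup>2)" by (intro tendsto_ennrealI lim) auto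
      then show "ennreal ((g x)\<^sup>2) = liminf (\<lambda>n. ennreal ((h n x)\<^sup>2))"
        by (rule lim_imp_Liminf[OF sequentially_bot, symmetric])
    qed
    also have "\<dots> \<le> liminf (\<lambda>n. \<integral>\<^sup>+x. ennreal ((h n x)\<^sup>2) \<partial>lebesgue_on U)"
      using int by (intro nn_integral_liminf) auto
    also have "\<dots> \<le> ennreal (C\<^sup>2)"
    proof (rule Liminf_le)
      show "\<forall>\<^sub>F n in sequentially. (\<integral>\<^sup>+x. ennreal ((h n x)\<^sup>2) \<partial>lebesgue_on U) \<le> ennreal (C\<^sup>2)"
        using le int by (auto simp: nn_integral_eq_integral intro!: always_eventually ennreal_leI)
    qed auto
    finally show ?thesis .
  qed
  show "integrable (lebesgue_on U) (\<lambda>x. (g x)\<^sup>2)"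
    using nn mg by (intro integrableI_nonneg) (auto simp: order_le_less_trans)
  then show "(\<integral>x. (g x)\<^sup>2 \<partial>lebesgue_on U) \<le> C\<^sup>2"
    using nn by (subst (asm) nn_integral_eq_integral) auto
qed

text \<open>Here \<open>g\<close> is tested with its sign \<open>h\<close> on the part of a compact set where $|g| > C$. The function
  $g h - C |h|$ is positive there, but its integral is not.\<close>

lemma Linf_duality:
  fixes g :: "real^'d::finite \<Rightarrow> real"
  assumes U: "open U" and g: "L1_loc U g" and C: "C \<ge> 0"
    and bound: "\<And>\<psi>. \<psi> \<in> Cc_inf U \<Longrightarrow>
      \<bar>\<integral>x. g x * \<psi> x \<partial>lebesgue_on U\<bar> \<le> C * (\<integral>x. \<bar>\<psi> x\<bar> \<partial>lebesgue_on U)"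
  shows "AE x in lebesgue_on U. \<bar>g x\<bar> \<le> C"
proof -
  obtain T where T: "\<And>n. compact (T n)" "\<And>n. T n \<subseteq> U" "\<And>n. T n \<subseteq> interior (T (Suc n))" "\<Union> (range T) = U"
    using open_Union_compact_subsets[OF U] by metis
  have one: "L1_loc U (\<lambda>x. 1::real)" by (rule L1_loc_bounded[of _ 1]) auto
  have "AE x in lebesgue_on U. x \<in> T n \<longrightarrow> \<bar>g x\<bar> \<le> C" for n
  proof -
    define h where "h x = (if x \<in> T n \<and> \<bar>g x\<bar> > C then sgn (g x) else 0)" for x
    have mT[measurable]: "(\<lambda>x. indicator (T n) x *\<^sub>R g x) \<in> borel_measurable lebesgue"
      using g T(1,2) by (auto simp: L1_loc_def set_integrable_def)
    have hm: "h \<in> borel_measurable lebesgue"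
    proof -
      have "h = (\<lambda>x. if \<bar>indicator (T n) x *\<^sub>R g x\<bar> > C then sgn (indicator (T n) x *\<^sub>R g x) else 0)"
        using C by (auto simp: h_def indicator_def fun_eq_iff)
      moreover have "(\<lambda>x. if \<bar>indicator (T n) x *\<^sub>R g x\<bar> > C then sgn (indicator (T n) x *\<^sub>R g x) else 0)
          \<in> borel_measurable lebesgue"
        by measurable
      ultimately show ?thesis by simp
    qed
    have hb: "\<bar>h x\<bar> \<le> 1" for x by (auto simp: h_def sgn_if)
    have h0: "x \<notin> T n \<Longrightarrow> h x = 0" for x by (auto simp: h_def)
    obtain \<psi> where \<psi>: "\<And>n. \<psi> n \<in> Cc_inf U"
      "(\<lambda>k. \<integral>x. g x * \<psi> k x \<partial>lebesgue_on U) \<longlonglongrightarrow> (\<integral>x. g x * h x \<partial>lebesgue_on U)"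
      "(\<lambda>k. \<integral>x. \<bar>\<psi> k x\<bar> \<partial>lebesgue_on U) \<longlonglongrightarrow> (\<integral>x. \<bar>h x\<bar> \<partial>lebesgue_on U)"
      "(\<lambda>k. \<integral>x. (\<psi> k x)\<^sup>2 \<partial>lebesgue_on U) \<longlonglongrightarrow> (\<integral>x. (h x)\<^sup>2 \<partial>lebesgue_on U)"
      by (rule test_function_integral_approximation[OF U T(1)[of n] T(2)[of n] hm hb h0 g]) (assumption, rule that, assumption+)
    have le: "\<bar>\<integral>x. g x * h x \<partial>lebesgue_on U\<bar> \<le> C * (\<integral>x. \<bar>h x\<bar> \<partial>lebesgue_on U)"
      by (rule LIMSEQ_le[OF tendsto_rabs[OF \<psi>(2)] tendsto_mult[OF tendsto_const \<psi>(3)]])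
         (use bound[OF \<psi>(1)] in auto)
    have i1: "integrable (lebesgue_on U) (\<lambda>x. g x * h x)"
      by (rule L1_loc_mult_integrable[OF U g T(1,2) hm hb h0])
    have i2: "integrable (lebesgue_on U) (\<lambda>x. \<bar>h x\<bar>)"
      using L1_loc_mult_integrable[OF U one T(1,2) hm hb h0] by simp
    have nonneg: "0 \<le> g x * h x - C * \<bar>h x\<bar>" for x
      by (auto simp: h_def sgn_if)
    have i3: "integrable (lebesgue_on U) (\<lambda>x. g x * h x - C * \<bar>h x\<bar>)" using i1 i2 by auto
    have "(\<integral>x. g x * h x - C * \<bar>h x\<bar> \<partial>lebesgue_on U) = (\<integral>x. g x * h x \<partial>lebesgue_on U) - C * (\<integral>x. \<bar>h x\<bar> \<partial>lebesgue_on U)"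
      using i1 i2 by (subst Bochner_Integration.integral_diff) auto
    then have "(\<integral>x. g x * h x - C * \<bar>h x\<bar> \<partial>lebesgue_on U) \<le> 0" using le by linarith
    moreover have "(\<integral>x. g x * h x - C * \<bar>h x\<bar> \<partial>lebesgue_on U) \<ge> 0"
      using nonneg by (intro integral_nonneg_AE) auto
    ultimately have "AE x in lebesgue_on U. g x * h x - C * \<bar>h x\<bar> = 0"
      using integral_nonneg_eq_0_iff_AE[OF i3] nonneg by auto
    then show ?thesis
    proof eventually_elim
      case (elim x)
      show ?case
      proof (rule ccontr)
        assume "\<not> (x \<in> T n \<longrightarrow> \<bar>g x\<bar> \<le> C)"
        then have *: "x \<in> T n" "\<bar>g x\<bar> > C" by auto
        then have "h x = sgn (g x)" "g x \<noteq> 0" using C by (auto simp: h_def)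
        then have "g x * h x = \<bar>g x\<bar>" "\<bar>h x\<bar> = 1" by (simp_all add: abs_sgn abs_sgn_eq_1)
        with elim * show False by simp
      qed
    qed
  qed
  then have "AE x in lebesgue_on U. \<forall>n. x \<in> T n \<longrightarrow> \<bar>g x\<bar> \<le> C"
    by (intro AE_all_countable[THEN iffD2] allI)
  moreover have "AE x in lebesgue_on U. x \<in> U" using lebesgue_open[OF U] by (auto simp: AE_restrict_space_iff)
  ultimately show ?thesis by eventually_elim (use T(4) in blast)
qed

section \<open>Square integrability and Lebesgue norms\<close>

definition L2_on :: "'a::euclidean_space set \<Rightarrow> ('a \<Rightarrow> 'b::euclidean_space) \<Rightarrow> bool" where
  "L2_on S u \<longleftrightarrow> u \<in> borel_measurable (lebesgue_on S) \<and> integrable (lebesgue_on S) (\<lambda>x. (norm (u x))\<^sup>2)"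

definition L2_norm :: "'a::euclidean_space set \<Rightarrow> ('a \<Rightarrow> 'b::euclidean_space) \<Rightarrow> real" where
  "L2_norm S u = sqrt (\<integral>x. (norm (u x))\<^sup>2 \<partial>lebesgue_on S)"

lemma L2_norm_nonneg [simp]: "L2_norm S u \<ge> 0"
  by (simp add: L2_norm_def)

lemma L2_norm_square: "(L2_norm S u)\<^sup>2 = (\<integral>x. (norm (u x))\<^sup>2 \<partial>lebesgue_on S)"
  by (simp add: L2_norm_def)

lemma L2_integrable_products:
  fixes u :: "'a::euclidean_space \<Rightarrow> 'b::euclidean_space" and v :: "'a \<Rightarrow> 'c::euclidean_space"
  assumes u: "L2_on S u" and v: "L2_on S v"
  shows "integrable (lebesgue_on S) (\<lambda>x. norm (u x) * norm (v x))"
    and "(\<integral>x. norm (u x) * norm (v x) \<partial>lebesgue_on S) \<le> L2_norm S u * L2_norm S v"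
proof -
  let ?M = "lebesgue_on S"
  have [measurable]: "u \<in> borel_measurable ?M" "v \<in> borel_measurable ?M"
    and iu: "integrable ?M (\<lambda>x. (norm (u x))\<^sup>2)" and iv: "integrable ?M (\<lambda>x. (norm (v x))\<^sup>2)"
    using assms by (auto simp: L2_on_def)
  show i: "integrable ?M (\<lambda>x. norm (u x) * norm (v x))"
  proof (rule Bochner_Integration.integrable_bound[OF Bochner_Integration.integrable_add[OF iu iv]])
    have "a * b \<le> a\<^sup>2 + b\<^sup>2" if "0 \<le> a" "0 \<le> b" for a b :: real
      using sum_squares_bound[of a b] mult_nonneg_nonneg[OF that] by linarith
    then show "AE x in ?M. norm (norm (u x) * norm (v x)) \<le> norm ((norm (u x))\<^sup>2 + (norm (v x))\<^sup>2)"
      by auto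
  qed measurable
  have "(\<integral>\<^sup>+x. ennreal (norm (u x)) * ennreal (norm (v x)) \<partial>?M)\<^sup>2
      \<le> (\<integral>\<^sup>+x. ennreal (norm (u x)) ^ 2 \<partial>?M) * (\<integral>\<^sup>+x. ennreal (norm (v x)) ^ 2 \<partial>?M)"
    by (rule Cauchy_Schwarz_nn_integral) measurable
  then have "(\<integral>\<^sup>+x. ennreal (norm (u x) * norm (v x)) \<partial>?M)\<^sup>2
      \<le> (\<integral>\<^sup>+x. ennreal ((norm (u x))\<^sup>2) \<partial>?M) * (\<integral>\<^sup>+x. ennreal ((norm (v x))\<^sup>2) \<partial>?M)"
    by (simp add: ennreal_mult ennreal_power)
  then have "ennreal ((\<integral>x. norm (u x) * norm (v x) \<partial>?M)\<^sup>2)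
      \<le> ennreal ((\<integral>x. (norm (u x))\<^sup>2 \<partial>?M) * (\<integral>x. (norm (v x))\<^sup>2 \<partial>?M))"
    unfolding nn_integral_eq_integral[OF i AE_I2[OF mult_nonneg_nonneg[OF norm_ge_zero norm_ge_zero]]]
      nn_integral_eq_integral[OF iu AE_I2[OF zero_le_power2]]
      nn_integral_eq_integral[OF iv AE_I2[OF zero_le_power2]]
    by (simp add: ennreal_power ennreal_mult)
  then have "(\<integral>x. norm (u x) * norm (v x) \<partial>?M)\<^sup>2 \<le> (\<integral>x. (norm (u x))\<^sup>2 \<partial>?M) * (\<integral>x. (norm (v x))\<^sup>2 \<partial>?M)"
    by (subst (asm) ennreal_le_iff) (auto intro!: mult_nonneg_nonneg)
  then have "\<bar>\<integral>x. norm (u x) * norm (v x) \<partial>?M\<bar> \<le> sqrt ((\<integral>x. (norm (u x))\<^sup>2 \<partial>?M) * (\<integral>x. (norm (v x))\<^sup>2 \<partial>?M))"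
    using real_sqrt_le_mono by fastforce
  then show "(\<integral>x. norm (u x) * norm (v x) \<partial>?M) \<le> L2_norm S u * L2_norm S v"
    by (simp add: L2_norm_def real_sqrt_mult)
qed

lemma L2_on_bound:
  fixes u :: "'a::euclidean_space \<Rightarrow> 'b::euclidean_space" and v :: "'a \<Rightarrow> 'c::euclidean_space"
  assumes "L2_on S u" "v \<in> borel_measurable (lebesgue_on S)"
    and "AE x in lebesgue_on S. norm (v x) \<le> c * norm (u x)"
  shows "L2_on S v"
proof -
  have "integrable (lebesgue_on S) (\<lambda>x. c\<^sup>2 * (norm (u x))\<^sup>2)"
    using assms(1) by (simp add: L2_on_def)
  then have "integrable (lebesgue_on S) (\<lambda>x. (norm (v x))\<^sup>2)"
  proof (rule Bochner_Integration.integrable_bound)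
    show "(\<lambda>x. (norm (v x))\<^sup>2) \<in> borel_measurable (lebesgue_on S)" using assms(2) by measurable
    show "AE x in lebesgue_on S. norm ((norm (v x))\<^sup>2) \<le> norm (c\<^sup>2 * (norm (u x))\<^sup>2)"
      using assms(3) by eventually_elim (metis abs_power2 norm_ge_zero power_mono power_mult_distrib real_norm_def)
  qed
  then show ?thesis using assms(2) by (simp add: L2_on_def)
qed

lemma L2_on_add:
  fixes u v :: "'a::euclidean_space \<Rightarrow> 'b::euclidean_space"
  assumes "L2_on S u" "L2_on S v" shows "L2_on S (\<lambda>x. u x + v x)"
proof -
  have [measurable]: "u \<in> borel_measurable (lebesgue_on S)" "v \<in> borel_measurable (lebesgue_on S)"
    using assms by (auto simp: L2_on_def)
  have "integrable (lebesgue_on S) (\<lambda>x. 2 * (norm (u x))\<^sup>2 + 2 * (norm (v x))\<^sup>2)"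
    using assms by (simp add: L2_on_def)
  then have "integrable (lebesgue_on S) (\<lambda>x. (norm (u x + v x))\<^sup>2)"
  proof (rule Bochner_Integration.integrable_bound)
    have "(norm (a + b))\<^sup>2 \<le> 2 * (norm a)\<^sup>2 + 2 * (norm b)\<^sup>2" for a b :: 'b
    proof -
      have "(norm (a + b))\<^sup>2 \<le> (norm a + norm b)\<^sup>2" by (simp add: norm_triangle_ineq power_mono)
      also have "\<dots> \<le> 2 * (norm a)\<^sup>2 + 2 * (norm b)\<^sup>2"
        using sum_squares_bound[of "norm a" "norm b"] by (simp add: power2_sum)
      finally show ?thesis .
    qed
    then show "AE x in lebesgue_on S. norm ((norm (u x + v x))\<^sup>2) \<le> norm (2 * (norm (u x))\<^sup>2 + 2 * (norm (v x))\<^sup>2)"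
      by auto
  qed measurable
  then show ?thesis by (simp add: L2_on_def)
qed

lemma L2_on_subset:
  fixes u :: "'a::euclidean_space \<Rightarrow> 'b::euclidean_space"
  assumes "L2_on S u" "S' \<subseteq> S" "S \<in> sets lebesgue" "S' \<in> sets lebesgue"
  shows "L2_on S' u"
  using assms unfolding L2_on_def
  by (metis integrable_lebesgue_on_subset measurable_restrict_mono)

lemma integral_subset_le:
  fixes f :: "'a::euclidean_space \<Rightarrow> real"
  assumes "integrable (lebesgue_on S) f" "\<And>x. x \<in> S \<Longrightarrow> 0 \<le> f x" "S' \<subseteq> S" "S \<in> sets lebesgue" "S' \<in> sets lebesgue"
  shows "(\<integral>x. f x \<partial>lebesgue_on S') \<le> (\<integral>x. f x \<partial>lebesgue_on S)"
proof -
  have "integrable (lebesgue_on S') f" by (rule integrable_lebesgue_on_subset[OF assms(1,3,4,5)])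
  then have "(\<integral>x. indicator S' x *\<^sub>R f x \<partial>lebesgue) \<le> (\<integral>x. indicator S x *\<^sub>R f x \<partial>lebesgue)"
    using assms by (intro integral_mono) (auto simp: integrable_restrict_space indicator_def)
  then show ?thesis using assms(4,5) by (simp add: integral_restrict_space)
qed

lemma L2_norm_subset:
  fixes u :: "'a::euclidean_space \<Rightarrow> 'b::euclidean_space"
  assumes "L2_on S u" "S' \<subseteq> S" "S \<in> sets lebesgue" "S' \<in> sets lebesgue"
  shows "L2_norm S' u \<le> L2_norm S u"
  unfolding L2_norm_def using assms
  by (intro real_sqrt_le_mono integral_subset_le) (auto simp: L2_on_def)

lemma nn_integral_set_lebesgue_on:
  "S \<in> sets lebesgue \<Longrightarrow> (\<integral>\<^sup>+x\<in>S. f x \<partial>lebesgue) = (\<integral>\<^sup>+x. f x \<partial>lebesgue_on S)"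
  by (simp add: nn_integral_restrict_space)

lemma in_Lp_iff:
  fixes u :: "'a::euclidean_space \<Rightarrow> 'b::euclidean_space"
  assumes "S \<in> sets lebesgue"
  shows "in_Lp p S u \<longleftrightarrow> u \<in> borel_measurable (lebesgue_on S) \<and>
    integrable (lebesgue_on S) (\<lambda>x. norm (u x) powr p)"
proof -
  have "Lp_norm p S u < top \<longleftrightarrow> (\<integral>\<^sup>+x. ennreal (norm (u x) powr p) \<partial>lebesgue_on S) < top"
    using assms by (auto simp: Lp_norm_def Let_def nn_integral_set_lebesgue_on less_top)
  moreover have "(\<lambda>x. norm (u x) powr p) \<in> borel_measurable (lebesgue_on S)"
    if "u \<in> borel_measurable (lebesgue_on S)" using that by measurable
  ultimately show ?thesis
    using assms by (auto simp: in_Lp_def set_measurable_lebesgue_on integrable_iff_bounded)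
qed

lemma powr_two: "norm x powr 2 = (norm x)\<^sup>2"
  by (simp add: powr_numeral)

lemma in_L2_iff:
  fixes u :: "'a::euclidean_space \<Rightarrow> 'b::euclidean_space"
  assumes "S \<in> sets lebesgue"
  shows "in_Lp 2 S u \<longleftrightarrow> L2_on S u"
  using in_Lp_iff[OF assms, of 2 u] by (simp add: L2_on_def powr_two)

lemma Lp_norm_le:
  fixes u :: "'a::euclidean_space \<Rightarrow> 'b::euclidean_space"
  assumes "S \<in> sets lebesgue" "p > 0" "I \<ge> 0"
    and "(\<integral>\<^sup>+x. ennreal (norm (u x) powr p) \<partial>lebesgue_on S) \<le> ennreal I"
  shows "Lp_norm p S u \<le> ennreal (I powr (1 / p))"
proof -
  let ?J = "\<integral>\<^sup>+x. ennreal (norm (u x) powr p) \<partial>lebesgue_on S"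
  have "?J < top" using assms(4) ennreal_less_top le_less_trans by blast
  moreover from this have "enn2real ?J \<le> I" using assms(3,4) by (metis enn2real_leI)
  then have "enn2real ?J powr (1 / p) \<le> I powr (1 / p)" using assms(2) by (intro powr_mono2) auto
  ultimately show ?thesis
    using assms(1) by (auto simp: Lp_norm_def Let_def nn_integral_set_lebesgue_on intro!: ennreal_leI)
qed

lemma Lp_norm_two:
  fixes u :: "'a::euclidean_space \<Rightarrow> 'b::euclidean_space"
  assumes "S \<in> sets lebesgue" "L2_on S u"
  shows "Lp_norm 2 S u = ennreal (L2_norm S u)"
proof -
  have "(\<integral>\<^sup>+x. ennreal (norm (u x) powr 2) \<partial>lebesgue_on S) = ennreal (\<integral>x. (norm (u x))\<^sup>2 \<partial>lebesgue_on S)"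
    using assms(2) by (subst nn_integral_eq_integral[symmetric]) (auto simp: L2_on_def powr_two)
  then show ?thesis
    using assms(1) by (simp add: Lp_norm_def Let_def nn_integral_set_lebesgue_on L2_norm_def powr_half_sqrt)
qed

lemma superlevel_set_measurable:
  fixes u :: "'a::euclidean_space \<Rightarrow> 'b::euclidean_space"
  assumes "S \<in> sets lebesgue" "u \<in> borel_measurable (lebesgue_on S)"
  shows "{x \<in> S. norm (u x) > t} \<in> sets lebesgue"
proof -
  have "{x \<in> space (lebesgue_on S). norm (u x) > t} \<in> sets (lebesgue_on S)" using assms(2) by measurable
  then show ?thesis using assms(1) by (simp add: sets_restrict_space_iff)
qed

lemma sqrt_power_eq_powr:
  fixes R :: real assumes "R > 0" shows "sqrt (R ^ n) = R powr (real n / 2)"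
  using assms by (simp add: powr_half_sqrt[symmetric] powr_powr flip: powr_realpow)

lemma powr_scaling:
  fixes R :: real assumes "R > 0" shows "(R powr (1 - real n / 2))\<^sup>2 * R ^ n = R\<^sup>2"
proof -
  have "(R powr (1 - real n / 2))\<^sup>2 = R powr (2 - real n)"
    by (simp add: power2_eq_square flip: powr_add)
  moreover have "R ^ n = R powr real n" using assms by (simp add: powr_realpow)
  ultimately have "(R powr (1 - real n / 2))\<^sup>2 * R ^ n = R powr (2 - real n + real n)"
    by (simp only: powr_add)
  then show ?thesis using assms by (simp add: powr_numeral)
qed

text \<open>The power of \<open>R\<close> that results when a function of size $(R/c)^{2-d}$ is multiplied by the gradient of a
  cutoff, of size $1/R$, and measured in $L^2$ of a ball of radius \<open>R\<close>.\<close>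

lemma annulus_scaling:
  fixes R c :: real
  assumes "R > 0" "c > 0"
  shows "(R / c) powr (2 - real n) / R * sqrt (\<omega> * R ^ n) = c powr (real n - 2) * sqrt \<omega> * R powr (1 - real n / 2)"
proof -
  have 1: "(R / c) powr (2 - real n) = c powr (real n - 2) * R powr (2 - real n)"
    using assms by (simp add: powr_divide powr_diff field_simps)
  have 2: "sqrt (\<omega> * R ^ n) = sqrt \<omega> * R powr (real n / 2)"
    by (simp add: real_sqrt_mult sqrt_power_eq_powr[OF assms(1)])
  have 3: "R powr (2 - real n) * (1 / R) * R powr (real n / 2) = R powr (1 - real n / 2)"
  proof -
    have "1 / R = R powr (- 1)" using assms by (simp add: powr_minus_divide)
    then have "R powr (2 - real n) * (1 / R) * R powr (real n / 2) = R powr (2 - real n + - 1 + real n / 2)"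
      by (simp only: powr_add)
    then show ?thesis by simp
  qed
  have 4: "a * b / R * (c * e) = a * c * (b * (1 / R) * e)" for a b c e by simp
  show ?thesis unfolding 1 2 4 3 ..
qed

lemma measurable_vec_nth:
  "u \<in> borel_measurable M \<Longrightarrow> (\<lambda>x. u x $ i) \<in> borel_measurable M"
  for u :: "'a \<Rightarrow> ('b::euclidean_space)^'n::finite"
  by (rule measurable_compose[OF _ borel_measurable_continuous_onI[of "\<lambda>v. v $ i"]])
     (auto intro: continuous_intros)

lemma measurable_vec_lambda:
  fixes u :: "'a \<Rightarrow> ('b::euclidean_space)^'n::finite"
  assumes "\<And>i. (\<lambda>x. u x $ i) \<in> borel_measurable M"
  shows "u \<in> borel_measurable M"
proof (rule borel_measurable_euclidean_space[THEN iffD2], rule ballI)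
  fix b :: "'b^'n" assume "b \<in> Basis"
  have "(\<lambda>x. \<Sum>i\<in>UNIV. u x $ i \<bullet> b $ i) \<in> borel_measurable M"
    using assms by (intro borel_measurable_sum borel_measurable_inner) auto
  then show "(\<lambda>x. u x \<bullet> b) \<in> borel_measurable M" by (simp add: inner_vec_def)
qed

lemma L2_inner:
  fixes u v :: "'a::euclidean_space \<Rightarrow> 'b::euclidean_space"
  assumes u: "L2_on S u" and v: "L2_on S v"
  shows "integrable (lebesgue_on S) (\<lambda>x. u x \<bullet> v x)"
    and "\<bar>\<integral>x. u x \<bullet> v x \<partial>lebesgue_on S\<bar> \<le> L2_norm S u * L2_norm S v"
proof -
  note i = L2_integrable_products[OF u v]
  show *: "integrable (lebesgue_on S) (\<lambda>x. u x \<bullet> v x)"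
    by (rule Bochner_Integration.integrable_bound[OF i(1)])
       (use u v in \<open>auto simp: L2_on_def Cauchy_Schwarz_ineq2 intro!: borel_measurable_inner\<close>)
  have "\<bar>\<integral>x. u x \<bullet> v x \<partial>lebesgue_on S\<bar> \<le> (\<integral>x. norm (u x) * norm (v x) \<partial>lebesgue_on S)"
    using * i(1) by (intro order_trans[OF integral_abs_bound] integral_mono) (auto simp: Cauchy_Schwarz_ineq2)
  with i(2) show "\<bar>\<integral>x. u x \<bullet> v x \<partial>lebesgue_on S\<bar> \<le> L2_norm S u * L2_norm S v" by linarith
qed

lemma L2_on_component:
  fixes u :: "'a::euclidean_space \<Rightarrow> ('b::euclidean_space)^'m::finite"
  assumes "L2_on S u" shows "L2_on S (\<lambda>x. u x $ i)"
proof (rule L2_on_bound[OF assms, of _ 1])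
  show "(\<lambda>x. u x $ i) \<in> borel_measurable (lebesgue_on S)"
    using assms by (intro measurable_vec_nth) (simp add: L2_on_def)
qed (simp add: Finite_Cartesian_Product.norm_nth_le)

lemma L2_norm_mono:
  fixes u :: "'a::euclidean_space \<Rightarrow> 'b::euclidean_space" and v :: "'a \<Rightarrow> 'c::euclidean_space"
  assumes "L2_on S u" "L2_on S v" "AE x in lebesgue_on S. norm (v x) \<le> norm (u x)"
  shows "L2_norm S v \<le> L2_norm S u"
  unfolding L2_norm_def
proof (intro real_sqrt_le_mono integral_mono_AE)
  show "AE x in lebesgue_on S. (norm (v x))\<^sup>2 \<le> (norm (u x))\<^sup>2"
    using assms(3) by eventually_elim (simp add: power_mono)
qed (use assms in \<open>auto simp: L2_on_def\<close>)

lemma L2_norm_component: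
  fixes u :: "'a::euclidean_space \<Rightarrow> ('b::euclidean_space)^'m::finite"
  assumes "L2_on S u" shows "L2_norm S (\<lambda>x. u x $ i) \<le> L2_norm S u"
  by (rule L2_norm_mono[OF assms L2_on_component[OF assms]]) (simp add: Finite_Cartesian_Product.norm_nth_le)

lemma norm_square_components: "(norm v)\<^sup>2 = (\<Sum>i\<in>UNIV. (norm (v $ i))\<^sup>2)"
  for v :: "('b::euclidean_space)^'m::finite"
  by (simp add: norm_vec_def L2_set_def sum_nonneg)

lemma L2_on_components:
  fixes u :: "'a::euclidean_space \<Rightarrow> ('b::euclidean_space)^'m::finite"
  assumes L2: "\<And>i. L2_on S (\<lambda>x. u x $ i)"
  shows "L2_on S u"
proof -
  have i: "integrable (lebesgue_on S) (\<lambda>x. (norm (u x $ i))\<^sup>2)" for i using L2 by (auto simp: L2_on_def)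
  have m: "u \<in> borel_measurable (lebesgue_on S)"
    using L2 by (intro measurable_vec_lambda) (auto simp: L2_on_def)
  show ?thesis
    unfolding L2_on_def norm_square_components using m i by auto
qed

lemma L2_norm_components:
  fixes u :: "'a::euclidean_space \<Rightarrow> ('b::euclidean_space)^'m::finite"
  assumes L2: "\<And>i. L2_on S (\<lambda>x. u x $ i)" and C: "\<And>i. L2_norm S (\<lambda>x. u x $ i) \<le> C"
  shows "L2_norm S u \<le> real CARD('m) * C"
proof -
  have i: "integrable (lebesgue_on S) (\<lambda>x. (norm (u x $ i))\<^sup>2)" for i using L2 by (auto simp: L2_on_def)
  have C0: "C \<ge> 0" using C L2_norm_nonneg order_trans by blast
  have "(L2_norm S u)\<^sup>2 = (\<Sum>i\<in>UNIV. (L2_norm S (\<lambda>x. u x $ i))\<^sup>2)"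
    unfolding L2_norm_square norm_square_components[of "u _"] using i by (simp add: Bochner_Integration.integral_sum)
  also have "\<dots> \<le> (\<Sum>i\<in>(UNIV::'m set). C\<^sup>2)" using C by (intro sum_mono power_mono) auto
  also have "\<dots> \<le> (real CARD('m) * C)\<^sup>2"
  proof -
    have "1 \<le> real CARD('m)" by (simp add: Suc_leI)
    then have "real CARD('m) * C\<^sup>2 \<le> (real CARD('m))\<^sup>2 * C\<^sup>2"
      by (intro mult_right_mono) (auto simp: power2_eq_square)
    then show ?thesis by (simp add: power_mult_distrib)
  qed
  finally show "L2_norm S u \<le> real CARD('m) * C"
    by (rule power2_le_imp_le) (use C0 in simp)
qed

lemma measure_ball_power:
  assumes "r > 0"
  shows "measure lebesgue (ball x r :: (real^'d::finite) set) = unit_ball_vol (real CARD('d)) * r ^ CARD('d)"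
    and "emeasure lebesgue (ball x r :: (real^'d::finite) set) = ennreal (unit_ball_vol (real CARD('d)) * r ^ CARD('d))"
proof -
  show *: "emeasure lebesgue (ball x r :: (real^'d::finite) set) = ennreal (unit_ball_vol (real CARD('d)) * r ^ CARD('d))"
    using emeasure_ball[of r x] assms by simp
  show "measure lebesgue (ball x r :: (real^'d::finite) set) = unit_ball_vol (real CARD('d)) * r ^ CARD('d)"
    using assms unfolding measure_def * by (subst enn2real_ennreal) (auto intro!: mult_nonneg_nonneg)
qed

lemma emeasure_ball_finite: "emeasure lebesgue (ball x r :: (real^'d::finite) set) < \<infinity>"
  using lmeasurable_ball[of x r] by (simp add: fmeasurable_def)

lemma L2_norm_bounded:
  fixes v :: "real^'d::finite \<Rightarrow> 'b::euclidean_space"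
  assumes S: "S \<in> sets lebesgue" and v: "L2_on S v" and B: "\<And>x. x \<in> S \<Longrightarrow> norm (v x) \<le> B"
    and out: "\<And>x. x \<in> S \<Longrightarrow> dist z x \<ge> \<rho> \<Longrightarrow> v x = 0" and \<rho>: "\<rho> > 0" and B0: "B \<ge> 0"
  shows "L2_norm S v \<le> B * sqrt (unit_ball_vol (real CARD('d)) * \<rho> ^ CARD('d))"
proof -
  let ?V = "S \<inter> ball z \<rho>"
  have V: "?V \<in> sets lebesgue" using S by auto
  have fin: "?V \<in> lmeasurable"
    using V lmeasurable_ball[of z \<rho>] by (metis fmeasurable_Int_fmeasurable inf.commute S)
  have "(\<integral>x. (norm (v x))\<^sup>2 \<partial>lebesgue_on S) = (\<integral>x. (norm (v x))\<^sup>2 \<partial>lebesgue_on ?V)"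
    by (rule integral_lebesgue_on_eq) (use S V out in auto)
  also have "\<dots> \<le> (\<integral>x. B\<^sup>2 \<partial>lebesgue_on ?V)"
  proof (rule integral_mono_AE)
    have "L2_on ?V v" by (rule L2_on_subset[OF v]) (use S V in auto)
    then show "integrable (lebesgue_on ?V) (\<lambda>x. (norm (v x))\<^sup>2)" by (simp add: L2_on_def)
    show "integrable (lebesgue_on ?V) (\<lambda>x. B\<^sup>2)"
      using fin by (intro finite_measure.integrable_const finite_measure_lebesgue_on)
    show "AE x in lebesgue_on ?V. (norm (v x))\<^sup>2 \<le> B\<^sup>2"
      using V B by (auto simp: AE_restrict_space_iff power_mono)
  qed
  also have "\<dots> = B\<^sup>2 * measure lebesgue ?V"
    using V by (simp add: measure_restrict_space)
  also have "\<dots> \<le> B\<^sup>2 * measure lebesgue (ball z \<rho>)"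
    using V by (intro mult_left_mono measure_mono_fmeasurable) auto
  also have "\<dots> = B\<^sup>2 * (unit_ball_vol (real CARD('d)) * \<rho> ^ CARD('d))"
    unfolding measure_ball_power(1)[OF \<rho>] ..
  finally have "L2_norm S v \<le> sqrt (B\<^sup>2 * (unit_ball_vol (real CARD('d)) * \<rho> ^ CARD('d)))"
    unfolding L2_norm_def by (rule real_sqrt_le_mono)
  then show ?thesis using B0 by (simp add: real_sqrt_mult)
qed

section \<open>Weak gradients\<close>

lemma has_weak_partial_lebesgue_on:
  assumes "open S"
  shows "has_weak_partial S \<alpha> f g \<longleftrightarrow> L1_loc S f \<and> L1_loc S g \<and>
     (\<forall>\<psi>\<in>Cc_inf S. (\<integral>x. f x * pd \<alpha> \<psi> x \<partial>lebesgue_on S) = - (\<integral>x. g x * \<psi> x \<partial>lebesgue_on S))"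
  using assms by (simp add: has_weak_partial_def set_integral_lebesgue_on lebesgue_open)

lemma L1_loc_diff: "L1_loc S f \<Longrightarrow> L1_loc S g \<Longrightarrow> L1_loc S (\<lambda>x. f x - g x)"
  and L1_loc_add: "L1_loc S f \<Longrightarrow> L1_loc S g \<Longrightarrow> L1_loc S (\<lambda>x. f x + g x)"
  by (auto simp: L1_loc_def)

lemma L1_loc_subset: "L1_loc S f \<Longrightarrow> S' \<subseteq> S \<Longrightarrow> L1_loc S' f"
  unfolding L1_loc_def by blast

lemma L1_loc_mult_smooth:
  assumes "L1_loc S f" "smooth \<zeta>"
  shows "L1_loc S (\<lambda>x. \<zeta> x * f x)"
  unfolding L1_loc_def
proof safe
  fix T assume T: "compact T" "T \<subseteq> S"
  then have f: "integrable (lebesgue_on T) f"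
    using assms(1) by (auto simp: L1_loc_def set_integrable_lebesgue_on lebesgue_compact)
  obtain B where B: "\<And>x. x \<in> T \<Longrightarrow> \<bar>\<zeta> x\<bar> \<le> B"
    using compact_imp_bounded[OF compact_continuous_image[OF smooth_continuous_on[OF assms(2)] T(1)]]
    by (auto simp: bounded_iff)
  have "integrable (lebesgue_on T) (\<lambda>x. B * f x)" using f by simp
  then have "integrable (lebesgue_on T) (\<lambda>x. \<zeta> x * f x)"
  proof (rule Bochner_Integration.integrable_bound)
    show "(\<lambda>x. \<zeta> x * f x) \<in> borel_measurable (lebesgue_on T)"
      by (intro borel_measurable_times measurable_restrict_space1 smooth_measurable assms(2)
          borel_measurable_integrable[OF f])
    have "\<bar>\<zeta> x\<bar> * \<bar>f x\<bar> \<le> \<bar>B\<bar> * \<bar>f x\<bar>" if "x \<in> T" for x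
      using B[OF that] by (intro mult_right_mono) auto
    then show "AE x in lebesgue_on T. norm (\<zeta> x * f x) \<le> norm (B * f x)"
      using T by (auto simp: abs_mult AE_restrict_space_iff lebesgue_compact)
  qed
  then show "set_integrable lebesgue T (\<lambda>x. \<zeta> x * f x)"
    using T by (simp add: set_integrable_lebesgue_on lebesgue_compact)
qed

lemma weak_partial_unique:
  assumes S: "open S" and "has_weak_partial S \<alpha> f g" "has_weak_partial S \<alpha> f g'"
  shows "AE x in lebesgue_on S. g x = g' x"
proof -
  have *: "L1_loc S g" "L1_loc S g'" using assms by (auto simp: has_weak_partial_def)
  have "AE x in lebesgue_on S. \<bar>g x - g' x\<bar> \<le> 0"
  proof (rule Linf_duality[OF S L1_loc_diff[OF *]])
    fix \<psi> assume \<psi>: "\<psi> \<in> Cc_inf S"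
    have "(\<integral>x. (g x - g' x) * \<psi> x \<partial>lebesgue_on S) = (\<integral>x. g x * \<psi> x \<partial>lebesgue_on S) - (\<integral>x. g' x * \<psi> x \<partial>lebesgue_on S)"
      unfolding left_diff_distrib
      by (intro Bochner_Integration.integral_diff Cc_inf_mult_integrable[OF S _ \<psi>] *)
    also have "\<dots> = 0" using assms \<psi> by (simp add: has_weak_partial_lebesgue_on)
    finally show "\<bar>\<integral>x. (g x - g' x) * \<psi> x \<partial>lebesgue_on S\<bar> \<le> 0 * (\<integral>x. \<bar>\<psi> x\<bar> \<partial>lebesgue_on S)" by simp
  qed simp
  then show ?thesis by eventually_elim simp
qed

lemma weak_gradient_unique:
  assumes "open S" "has_weak_gradient S u G" "has_weak_gradient S u G'"
  shows "AE x in lebesgue_on S. G x = G' x"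
proof -
  have "AE x in lebesgue_on S. \<forall>i. \<forall>\<alpha>. G x $ i $ \<alpha> = G' x $ i $ \<alpha>"
    using assms by (auto simp: AE_all_countable has_weak_gradient_def intro!: weak_partial_unique[OF assms(1)])
  then show ?thesis by eventually_elim (simp add: vec_eq_iff)
qed

lemma wgrad_weak_gradient: "W11_loc S u \<Longrightarrow> has_weak_gradient S u (wgrad S u)"
  unfolding W11_loc_def wgrad_def by (erule someI_ex)

lemma wgrad_eq:
  "open S \<Longrightarrow> has_weak_gradient S u G \<Longrightarrow> AE x in lebesgue_on S. wgrad S u x = G x"
  using weak_gradient_unique wgrad_weak_gradient W11_loc_def by blast

lemma has_weak_partial_mult:
  assumes S: "open S" and fg: "has_weak_partial S \<alpha> f g" and \<zeta>: "smooth \<zeta>"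
  shows "has_weak_partial S \<alpha> (\<lambda>x. \<zeta> x * f x) (\<lambda>x. \<zeta> x * g x + pd \<alpha> \<zeta> x * f x)"
proof -
  have f: "L1_loc S f" and g: "L1_loc S g" using fg by (auto simp: has_weak_partial_def)
  have "(\<integral>x. \<zeta> x * f x * pd \<alpha> \<psi> x \<partial>lebesgue_on S)
      = - (\<integral>x. (\<zeta> x * g x + pd \<alpha> \<zeta> x * f x) * \<psi> x \<partial>lebesgue_on S)" if \<psi>: "\<psi> \<in> Cc_inf S" for \<psi>
  proof -
    have \<zeta>\<psi>: "(\<lambda>x. \<zeta> x * \<psi> x) \<in> Cc_inf S" and d\<zeta>\<psi>: "(\<lambda>x. pd \<alpha> \<zeta> x * \<psi> x) \<in> Cc_inf S"
      using \<zeta> \<psi> by (auto intro: Cc_inf_mult smooth_pd)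
    have "pd \<alpha> (\<lambda>x. \<zeta> x * \<psi> x) x = \<zeta> x * pd \<alpha> \<psi> x + pd \<alpha> \<zeta> x * \<psi> x" for x
      by (intro pd_mult smooth_differentiable \<zeta> Cc_inf_smooth[OF \<psi>])
    then have "(\<integral>x. f x * pd \<alpha> (\<lambda>x. \<zeta> x * \<psi> x) x \<partial>lebesgue_on S)
        = (\<integral>x. \<zeta> x * f x * pd \<alpha> \<psi> x + f x * (pd \<alpha> \<zeta> x * \<psi> x) \<partial>lebesgue_on S)"
      by (simp add: algebra_simps)
    also have "\<dots> = (\<integral>x. \<zeta> x * f x * pd \<alpha> \<psi> x \<partial>lebesgue_on S) + (\<integral>x. f x * (pd \<alpha> \<zeta> x * \<psi> x) \<partial>lebesgue_on S)"
      by (intro Bochner_Integration.integral_add Cc_inf_mult_integrable[OF S] L1_loc_mult_smooth f \<zeta> Cc_inf_pd \<psi> d\<zeta>\<psi>)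
    finally have 1: "(\<integral>x. \<zeta> x * f x * pd \<alpha> \<psi> x \<partial>lebesgue_on S) =
        - (\<integral>x. g x * (\<zeta> x * \<psi> x) \<partial>lebesgue_on S) - (\<integral>x. f x * (pd \<alpha> \<zeta> x * \<psi> x) \<partial>lebesgue_on S)"
      using fg \<zeta>\<psi> S by (simp add: has_weak_partial_lebesgue_on)
    have "(\<integral>x. (\<zeta> x * g x + pd \<alpha> \<zeta> x * f x) * \<psi> x \<partial>lebesgue_on S)
        = (\<integral>x. g x * (\<zeta> x * \<psi> x) + f x * (pd \<alpha> \<zeta> x * \<psi> x) \<partial>lebesgue_on S)"
      by (simp add: algebra_simps)
    also have "\<dots> = (\<integral>x. g x * (\<zeta> x * \<psi> x) \<partial>lebesgue_on S) + (\<integral>x. f x * (pd \<alpha> \<zeta> x * \<psi> x) \<partial>lebesgue_on S)"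
      by (intro Bochner_Integration.integral_add Cc_inf_mult_integrable[OF S] f g \<zeta>\<psi> d\<zeta>\<psi>)
    finally show ?thesis using 1 by simp
  qed
  then show ?thesis
    using f g \<zeta> S by (auto simp: has_weak_partial_lebesgue_on intro!: L1_loc_mult_smooth L1_loc_add smooth_pd)
qed

definition gradient :: "(real^'d::finite \<Rightarrow> real) \<Rightarrow> real^'d \<Rightarrow> real^'d" where
  "gradient \<zeta> x = (\<chi> \<alpha>. pd \<alpha> \<zeta> x)"

definition outer :: "real^'m::finite \<Rightarrow> real^'d::finite \<Rightarrow> real^'d^'m" where
  "outer a b = (\<chi> i \<alpha>. a $ i * b $ \<alpha>)"

lemma norm_outer: "norm (outer a b) = norm a * norm b"
proof -
  have "norm (outer a b $ i) = \<bar>a $ i\<bar> * norm b" for i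
  proof -
    have "outer a b $ i = a $ i *\<^sub>R b" by (simp add: outer_def vec_eq_iff)
    then show ?thesis by simp
  qed
  then show ?thesis
    by (simp add: norm_vec_def[of "outer a b"] norm_vec_def[of a] L2_set_right_distrib L2_set_left_distrib)
qed

text \<open>The class contains the test functions and their complements to 1. A function in $Y^{1,2}$ is
  square integrable only locally, so the term with the gradient of the cutoff in the product rule
  has to live on a compact set.\<close>

definition tame_cutoff :: "(real^'d::finite \<Rightarrow> real) \<Rightarrow> bool" where
  "tame_cutoff \<zeta> \<longleftrightarrow> smooth \<zeta> \<and> bounded (range \<zeta>) \<and>
     (\<exists>T. compact T \<and> (\<forall>x. x \<notin> T \<longrightarrow> gradient \<zeta> x = 0))"

lemma tame_cutoff_test_function: "\<zeta> \<in> Cc_inf S \<Longrightarrow> tame_cutoff \<zeta>"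
proof -
  assume \<zeta>: "\<zeta> \<in> Cc_inf S"
  obtain B where "\<And>x. \<bar>\<zeta> x\<bar> \<le> B" using Cc_inf_bounded[OF \<zeta>] by metis
  then have "bounded (range \<zeta>)" by (auto simp: bounded_iff)
  moreover obtain T where T: "compact T" "\<And>x. x \<notin> T \<Longrightarrow> \<zeta> x = 0" using \<zeta> by (metis Cc_infE)
  have "gradient \<zeta> x = 0" if "x \<notin> T" for x
  proof -
    have "pd \<alpha> \<zeta> x = 0" for \<alpha>
      by (intro pd_locally_const[of "- T" x \<zeta> 0]) (use T that in \<open>auto simp: compact_imp_closed open_Compl\<close>)
    then show ?thesis by (simp add: gradient_def vec_eq_iff)
  qed
  ultimately show ?thesis using \<zeta> T(1) by (auto simp: tame_cutoff_def dest: Cc_inf_smooth)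
qed

lemma gradient_mult:
  assumes "smooth f" "smooth g"
  shows "gradient (\<lambda>x. f x * g x) x = f x *\<^sub>R gradient g x + g x *\<^sub>R gradient f x"
  by (simp add: gradient_def vec_eq_iff pd_mult[OF smooth_differentiable smooth_differentiable, OF assms])

lemma tame_cutoff_mult:
  assumes "tame_cutoff f" "tame_cutoff g" shows "tame_cutoff (\<lambda>x. f x * g x)"
proof -
  obtain T T' where T: "compact T" "\<And>x. x \<notin> T \<Longrightarrow> gradient f x = 0"
    "compact T'" "\<And>x. x \<notin> T' \<Longrightarrow> gradient g x = 0" and s: "smooth f" "smooth g"
    using assms unfolding tame_cutoff_def by metis
  obtain a b where "\<And>x. \<bar>f x\<bar> \<le> a" "\<And>x. \<bar>g x\<bar> \<le> b"
    using assms unfolding tame_cutoff_def bounded_iff by (metis rangeI real_norm_def)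
  then have "\<bar>f x * g x\<bar> \<le> a * b" for x
    unfolding abs_mult by (intro mult_mono) (auto intro: order_trans[OF abs_ge_zero])
  then have "bounded (range (\<lambda>x. f x * g x))" by (auto simp: bounded_iff)
  moreover have "gradient (\<lambda>x. f x * g x) x = 0" if "x \<notin> T \<union> T'" for x
    using that T by (simp add: gradient_mult[OF s])
  moreover have "compact (T \<union> T')" using T by auto
  ultimately show ?thesis using s unfolding tame_cutoff_def by (metis smooth_mult)
qed

lemma gradient_complement:
  assumes "smooth f" shows "gradient (\<lambda>x. 1 - f x) x = - gradient f x"
proof -
  have "pd \<alpha> (\<lambda>x. 1 + (- 1) * f x) x = - pd \<alpha> f x" for \<alpha>
    using pd_add[of "\<lambda>x. 1" x "\<lambda>x. (- 1) * f x"] pd_mult[of "\<lambda>x. - 1" x f]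
      smooth_differentiable[OF assms] by simp
  then show ?thesis by (simp add: gradient_def vec_eq_iff)
qed

lemma tame_cutoff_complement:
  assumes "tame_cutoff f" shows "tame_cutoff (\<lambda>x. 1 - f x)"
proof -
  have s: "smooth f" using assms by (simp add: tame_cutoff_def)
  obtain a where "\<And>x. \<bar>f x\<bar> \<le> a"
    using assms unfolding tame_cutoff_def bounded_iff by (metis rangeI real_norm_def)
  then have "\<bar>1 - f x\<bar> \<le> 1 + a" for x
    using abs_triangle_ineq4[of 1 "f x"] by (metis abs_one add_left_mono order_trans)
  then have "bounded (range (\<lambda>x. 1 - f x))" unfolding bounded_iff by (metis rangeE real_norm_def)
  then show ?thesis using assms s by (auto simp: tame_cutoff_def gradient_complement intro!: smooth_diff smooth_const)
qed

lemma smooth_gradient_measurable: "smooth \<zeta> \<Longrightarrow> gradient \<zeta> \<in> borel_measurable lebesgue"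
  by (rule measurable_vec_lambda) (simp add: gradient_def smooth_measurable smooth_pd)

lemma tame_cutoff_gradient_bounded:
  assumes "tame_cutoff \<zeta>"
  obtains B where "B > 0" "\<And>x. \<bar>\<zeta> x\<bar> \<le> B" "\<And>x. norm (gradient \<zeta> x) \<le> B"
proof -
  obtain T where T: "compact T" "\<And>x. x \<notin> T \<Longrightarrow> gradient \<zeta> x = 0" and s: "smooth \<zeta>"
    using assms unfolding tame_cutoff_def by metis
  have "continuous_on T (gradient \<zeta>)"
    unfolding gradient_def[abs_def] by (intro continuous_on_vec_lambda smooth_continuous_on smooth_pd s)
  then have "bounded (gradient \<zeta> ` T)" using T(1) by (intro compact_imp_bounded compact_continuous_image)
  then obtain b where b: "b > 0" "\<And>x. x \<in> T \<Longrightarrow> norm (gradient \<zeta> x) \<le> b"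
    by (auto simp: bounded_pos)
  obtain a where a: "\<And>x. \<bar>\<zeta> x\<bar> \<le> a"
    using assms unfolding tame_cutoff_def bounded_iff by (metis rangeI real_norm_def)
  have "norm (gradient \<zeta> x) \<le> max a b" for x using b T(2)[of x] by (cases "x \<in> T") (auto simp: le_max_iff_disj)
  moreover have "\<bar>\<zeta> x\<bar> \<le> max a b" for x using a[of x] by linarith
  ultimately show ?thesis using b(1) by (intro that[of "max a b"]) auto
qed

section \<open>The bilinear form of the operator\<close>

lemma coeff_form_add_right: "coeff_form A x \<xi> (\<eta> + \<eta>') = coeff_form A x \<xi> \<eta> + coeff_form A x \<xi> \<eta>'"
  by (simp add: coeff_form_def algebra_simps sum.distrib)

lemma coeff_form_scale_right: "coeff_form A x \<xi> (c *\<^sub>R \<eta>) = c * coeff_form A x \<xi> \<eta>"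
  by (simp add: coeff_form_def algebra_simps sum_distrib_left)

lemma coeff_form_adjoint: "coeff_form (adjoint_coeffs A) x \<xi> \<eta> = coeff_form A x \<eta> \<xi>"
proof -
  let ?t = "\<lambda>\<alpha> \<beta> i j. A \<beta> \<alpha> x $ j $ i * \<xi> $ j $ \<beta> * \<eta> $ i $ \<alpha>"
  have "(\<Sum>\<alpha>\<in>UNIV. \<Sum>\<beta>\<in>UNIV. \<Sum>i\<in>UNIV. \<Sum>j\<in>UNIV. ?t \<alpha> \<beta> i j) =
      (\<Sum>\<beta>\<in>UNIV. \<Sum>\<alpha>\<in>UNIV. \<Sum>i\<in>UNIV. \<Sum>j\<in>UNIV. ?t \<alpha> \<beta> i j)"
    by (rule sum.swap)
  also have "\<dots> = (\<Sum>\<beta>\<in>UNIV. \<Sum>\<alpha>\<in>UNIV. \<Sum>j\<in>UNIV. \<Sum>i\<in>UNIV. ?t \<alpha> \<beta> i j)"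
    by (intro sum.cong refl sum.swap)
  finally show ?thesis
    by (simp add: coeff_form_def adjoint_coeffs_def transpose_def algebra_simps)
qed

lemma coeff_form_add_left: "coeff_form A x (\<xi> + \<xi>') \<eta> = coeff_form A x \<xi> \<eta> + coeff_form A x \<xi>' \<eta>"
  and coeff_form_scale_left: "coeff_form A x (c *\<^sub>R \<xi>) \<eta> = c * coeff_form A x \<xi> \<eta>"
  by (simp_all add: coeff_form_adjoint[of A x, symmetric] coeff_form_add_right coeff_form_scale_right)

lemma adjoint_adjoint [simp]: "adjoint_coeffs (adjoint_coeffs A) = A"
  by (simp add: adjoint_coeffs_def transpose_transpose)

lemma elliptic_coeffs_adjoint:
  assumes "elliptic_coeffs lam M A" shows "elliptic_coeffs lam M (adjoint_coeffs A)"
proof -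
  have "\<bar>\<Sum>\<alpha>\<in>UNIV. \<Sum>\<beta>\<in>UNIV. \<Sum>i\<in>UNIV. \<Sum>j\<in>UNIV.
      adjoint_coeffs A \<alpha> \<beta> x $ i $ j * \<xi> $ j $ \<alpha> * \<eta> $ i $ \<beta>\<bar> \<le> M * norm \<xi> * norm \<eta>" for x \<xi> \<eta>
  proof -
    let ?t = "\<lambda>\<alpha> \<beta> i j. A \<beta> \<alpha> x $ j $ i * \<xi> $ j $ \<alpha> * \<eta> $ i $ \<beta>"
    have "(\<Sum>\<alpha>\<in>UNIV. \<Sum>\<beta>\<in>UNIV. \<Sum>i\<in>UNIV. \<Sum>j\<in>UNIV. ?t \<alpha> \<beta> i j) =
        (\<Sum>\<beta>\<in>UNIV. \<Sum>\<alpha>\<in>UNIV. \<Sum>i\<in>UNIV. \<Sum>j\<in>UNIV. ?t \<alpha> \<beta> i j)"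
      by (rule sum.swap)
    also have "\<dots> = (\<Sum>\<beta>\<in>UNIV. \<Sum>\<alpha>\<in>UNIV. \<Sum>j\<in>UNIV. \<Sum>i\<in>UNIV. ?t \<alpha> \<beta> i j)"
      by (intro sum.cong refl sum.swap)
    also have "\<dots> = (\<Sum>\<beta>\<in>UNIV. \<Sum>\<alpha>\<in>UNIV. \<Sum>j\<in>UNIV. \<Sum>i\<in>UNIV. A \<beta> \<alpha> x $ j $ i * \<eta> $ i $ \<beta> * \<xi> $ j $ \<alpha>)"
      by (simp add: algebra_simps)
    finally have eq: "(\<Sum>\<alpha>\<in>UNIV. \<Sum>\<beta>\<in>UNIV. \<Sum>i\<in>UNIV. \<Sum>j\<in>UNIV. ?t \<alpha> \<beta> i j) = \<dots>" .
    have "\<bar>\<Sum>\<beta>\<in>UNIV. \<Sum>\<alpha>\<in>UNIV. \<Sum>j\<in>UNIV. \<Sum>i\<in>UNIV. A \<beta> \<alpha> x $ j $ i * \<eta> $ i $ \<beta> * \<xi> $ j $ \<alpha>\<bar>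
        \<le> M * norm \<eta> * norm \<xi>"
      using assms unfolding elliptic_coeffs_def by blast
    with eq have "\<bar>\<Sum>\<alpha>\<in>UNIV. \<Sum>\<beta>\<in>UNIV. \<Sum>i\<in>UNIV. \<Sum>j\<in>UNIV. ?t \<alpha> \<beta> i j\<bar> \<le> M * norm \<xi> * norm \<eta>"
      by (simp only: mult_ac)
    then show ?thesis by (simp add: adjoint_coeffs_def transpose_def)
  qed
  moreover have "(\<lambda>x. adjoint_coeffs A \<alpha> \<beta> x $ i $ j) \<in> borel_measurable lebesgue" for \<alpha> \<beta> i j
    using assms by (simp add: elliptic_coeffs_def adjoint_coeffs_def transpose_def)
  ultimately show ?thesis
    using assms by (simp add: elliptic_coeffs_def coeff_form_adjoint)
qed

definition form_bound :: "'d::finite itself \<Rightarrow> 'm::finite itself \<Rightarrow> real \<Rightarrow> real" where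
  "form_bound _ _ M = (real CARD('d))\<^sup>2 * (real CARD('m))\<^sup>2 * M"

lemma norm_axis_vec: "norm (axis i x :: 'b::real_normed_vector^'n::finite) = norm x"
proof -
  have "norm (axis i x $ j) = (if j = i then norm x else 0)" for j :: 'n
    by (simp add: axis_def)
  then have "norm (axis i x :: 'b^'n) = L2_set (\<lambda>j. if j = i then norm x else 0) UNIV"
    by (simp add: norm_vec_def)
  also have "\<dots> = norm x"
    by (simp add: L2_set_def if_distrib[of "\<lambda>z. z\<^sup>2"] cong: if_cong)
  finally show ?thesis .
qed

text \<open>The upper bound on the coefficients pairs the indices differently from the form, so it is
  used entrywise.\<close>

lemma coeff_form_bound:
  fixes A :: "('d::finite, 'm::finite) coeffs"
  assumes A: "elliptic_coeffs lam M A"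
  shows "\<bar>coeff_form A x \<xi> \<eta>\<bar> \<le> form_bound TYPE('d) TYPE('m) M * (norm \<xi> * norm \<eta>)"
proof -
  have entry: "\<bar>A \<alpha> \<beta> x $ i $ j\<bar> \<le> M" for \<alpha> \<beta> i j
  proof -
    let ?\<xi> = "axis j (axis \<alpha> 1) :: real^'d^'m" and ?\<eta> = "axis i (axis \<beta> 1) :: real^'d^'m"
    have *: "axis a c $ b $ \<gamma> = (if b = a then c $ \<gamma> else 0)" for a b :: 'm and c :: "real^'d" and \<gamma>
      by (simp add: axis_def)
    have "(\<Sum>\<alpha>'\<in>UNIV. \<Sum>\<beta>'\<in>UNIV. \<Sum>i'\<in>UNIV. \<Sum>j'\<in>UNIV. A \<alpha>' \<beta>' x $ i' $ j' * ?\<xi> $ j' $ \<alpha>' * ?\<eta> $ i' $ \<beta>')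
      = (\<Sum>\<alpha>'\<in>UNIV. \<Sum>\<beta>'\<in>UNIV. A \<alpha>' \<beta>' x $ i $ j * axis \<alpha> 1 $ \<alpha>' * axis \<beta> 1 $ \<beta>')"
    proof -
      have pull: "(\<Sum>j'\<in>UNIV. if P then f j' else 0) = (if P then (\<Sum>j'\<in>UNIV. f j') else 0)"
        for P and f :: "'m \<Rightarrow> real" by simp
      show ?thesis
        by (simp add: * if_distrib[of "\<lambda>z. _ * z"] if_distrib[of "\<lambda>z. z * _"] pull cong: if_cong)
    qed
    also have "\<dots> = A \<alpha> \<beta> x $ i $ j"
      by (simp add: axis_def if_distrib[of "\<lambda>z. _ * z"] if_distrib[of "\<lambda>z. z * _"] cong: if_cong)
    finally have eq: "(\<Sum>\<alpha>'\<in>UNIV. \<Sum>\<beta>'\<in>UNIV. \<Sum>i'\<in>UNIV. \<Sum>j'\<in>UNIV.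
        A \<alpha>' \<beta>' x $ i' $ j' * ?\<xi> $ j' $ \<alpha>' * ?\<eta> $ i' $ \<beta>') = A \<alpha> \<beta> x $ i $ j" .
    have "\<bar>\<Sum>\<alpha>'\<in>UNIV. \<Sum>\<beta>'\<in>UNIV. \<Sum>i'\<in>UNIV. \<Sum>j'\<in>UNIV.
        A \<alpha>' \<beta>' x $ i' $ j' * ?\<xi> $ j' $ \<alpha>' * ?\<eta> $ i' $ \<beta>'\<bar> \<le> M * norm ?\<xi> * norm ?\<eta>"
      using A unfolding elliptic_coeffs_def by blast
    then have "\<bar>A \<alpha> \<beta> x $ i $ j\<bar> \<le> M * norm ?\<xi> * norm ?\<eta>" unfolding eq .
    moreover have "norm ?\<xi> = 1" "norm ?\<eta> = 1" by (simp_all add: norm_axis_vec)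
    ultimately show ?thesis by simp
  qed
  have comp: "\<bar>\<xi> $ j $ \<beta>\<bar> \<le> norm \<xi>" for \<xi> :: "real^'d^'m" and j \<beta>
    by (rule order_trans[OF component_le_norm_cart Finite_Cartesian_Product.norm_nth_le])
  have M: "M \<ge> 0" using entry[of undefined undefined undefined undefined] by linarith
  have "\<bar>coeff_form A x \<xi> \<eta>\<bar> \<le> (\<Sum>\<alpha>\<in>(UNIV::'d set). \<Sum>\<beta>\<in>(UNIV::'d set). \<Sum>i\<in>(UNIV::'m set). \<Sum>j\<in>(UNIV::'m set). M * (norm \<xi> * norm \<eta>))"
    unfolding coeff_form_def
  proof (intro order_trans[OF sum_abs] sum_mono)
    fix \<alpha> \<beta> i j
    have "\<bar>A \<alpha> \<beta> x $ i $ j\<bar> * (\<bar>\<xi> $ j $ \<beta>\<bar> * \<bar>\<eta> $ i $ \<alpha>\<bar>) \<le> M * (norm \<xi> * norm \<eta>)"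
      by (intro mult_mono entry comp) (auto simp: M)
    then show "\<bar>A \<alpha> \<beta> x $ i $ j * \<xi> $ j $ \<beta> * \<eta> $ i $ \<alpha>\<bar> \<le> M * (norm \<xi> * norm \<eta>)"
      by (simp add: abs_mult mult.assoc)
  qed
  then show ?thesis by (simp add: form_bound_def power2_eq_square)
qed

lemma form_bound_pos: "M > 0 \<Longrightarrow> form_bound TYPE('d::finite) TYPE('m::finite) M > 0"
  by (simp add: form_bound_def)

lemma coeff_form_measurable:
  fixes A :: "('d::finite, 'm::finite) coeffs"
  assumes A: "elliptic_coeffs lam M A"
    and \<xi>: "\<xi> \<in> borel_measurable (lebesgue_on S)" and \<eta>: "\<eta> \<in> borel_measurable (lebesgue_on S)"
  shows "(\<lambda>x. coeff_form A x (\<xi> x) (\<eta> x)) \<in> borel_measurable (lebesgue_on S)"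
  unfolding coeff_form_def
proof (intro borel_measurable_sum borel_measurable_times)
  show "(\<lambda>x. A \<alpha> \<beta> x $ i $ j) \<in> borel_measurable (lebesgue_on S)" for \<alpha> \<beta> i j
    using A by (auto simp: elliptic_coeffs_def intro: measurable_restrict_space1)
  show "(\<lambda>x. \<xi> x $ j $ \<beta>) \<in> borel_measurable (lebesgue_on S)" for j \<beta>
    by (intro measurable_vec_nth \<xi>)
  show "(\<lambda>x. \<eta> x $ j $ \<beta>) \<in> borel_measurable (lebesgue_on S)" for j \<beta>
    by (intro measurable_vec_nth \<eta>)
qed

lemma coeff_form_integral:
  fixes A :: "('d::finite, 'm::finite) coeffs"
  assumes A: "elliptic_coeffs lam M A" and \<xi>: "L2_on S \<xi>" and \<eta>: "L2_on S \<eta>"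
  shows "integrable (lebesgue_on S) (\<lambda>x. coeff_form A x (\<xi> x) (\<eta> x))"
    and "\<bar>\<integral>x. coeff_form A x (\<xi> x) (\<eta> x) \<partial>lebesgue_on S\<bar>
      \<le> form_bound TYPE('d) TYPE('m) M * (L2_norm S \<xi> * L2_norm S \<eta>)"
proof -
  let ?c = "form_bound TYPE('d) TYPE('m) M"
  have b: "\<bar>coeff_form A x (\<xi> x) (\<eta> x)\<bar> \<le> ?c * (norm (\<xi> x) * norm (\<eta> x))" for x
    by (rule coeff_form_bound[OF A])
  have M: "M \<ge> 0"
  proof -
    let ?e = "axis undefined (axis undefined 1) :: real^'d^'m"
    have "0 \<le> M * norm ?e * norm ?e"
      using A unfolding elliptic_coeffs_def by (meson abs_ge_zero order_trans)
    moreover have "norm ?e = 1" by (simp add: norm_axis_vec)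
    ultimately show ?thesis by simp
  qed
  then have c0: "?c \<ge> 0" by (simp add: form_bound_def)
  have i: "integrable (lebesgue_on S) (\<lambda>x. ?c * (norm (\<xi> x) * norm (\<eta> x)))"
    using L2_integrable_products(1)[OF \<xi> \<eta>] by (rule integrable_mult_right)
  show "integrable (lebesgue_on S) (\<lambda>x. coeff_form A x (\<xi> x) (\<eta> x))"
    by (rule Bochner_Integration.integrable_bound[OF i])
       (use b \<xi> \<eta> in \<open>auto simp: L2_on_def intro!: coeff_form_measurable[OF A] order_trans[OF b]\<close>)
  then have "\<bar>\<integral>x. coeff_form A x (\<xi> x) (\<eta> x) \<partial>lebesgue_on S\<bar> \<le> (\<integral>x. ?c * (norm (\<xi> x) * norm (\<eta> x)) \<partial>lebesgue_on S)"
    using i b by (intro order_trans[OF integral_abs_bound] integral_mono) auto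
  also have "\<dots> \<le> ?c * (L2_norm S \<xi> * L2_norm S \<eta>)"
    using L2_integrable_products(2)[OF \<xi> \<eta>] c0 by (simp add: mult_left_mono)
  finally show "\<bar>\<integral>x. coeff_form A x (\<xi> x) (\<eta> x) \<partial>lebesgue_on S\<bar> \<le> ?c * (L2_norm S \<xi> * L2_norm S \<eta>)" .
qed

section \<open>Products of $Y^{1,2}$ functions with cutoffs\<close>

definition sobolev_exponent :: "'d::finite itself \<Rightarrow> real" where
  "sobolev_exponent _ = 2 * real CARD('d) / (real CARD('d) - 2)"

lemma sobolev_exponent_ge_2: "CARD('d::finite) \<ge> 3 \<Longrightarrow> sobolev_exponent TYPE('d) \<ge> 2"
  by (simp add: sobolev_exponent_def field_simps)

lemma Y12_iff:
  fixes u :: "real^'d::finite \<Rightarrow> real^'m::finite"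
  assumes "open S"
  shows "Y12 S u \<longleftrightarrow> has_weak_gradient S u (wgrad S u) \<and> u \<in> borel_measurable (lebesgue_on S) \<and>
    integrable (lebesgue_on S) (\<lambda>x. norm (u x) powr sobolev_exponent TYPE('d)) \<and> L2_on S (wgrad S u)"
proof -
  have "W11_loc S u \<longleftrightarrow> has_weak_gradient S u (wgrad S u)"
    using wgrad_weak_gradient[of S u] by (auto simp: W11_loc_def)
  then show ?thesis
    unfolding Y12_def in_L2_iff[OF lebesgue_open[OF assms]] sobolev_exponent_def
    using in_Lp_iff[OF lebesgue_open[OF assms], of "2 * real CARD('d) / (real CARD('d) - 2)" u] by blast
qed

lemma Y12_component_L1_loc: "Y12 S u \<Longrightarrow> S' \<subseteq> S \<Longrightarrow> L1_loc S' (\<lambda>x. u x $ i)"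
  using wgrad_weak_gradient[of S u]
  by (auto simp: Y12_def has_weak_gradient_def has_weak_partial_def intro: L1_loc_subset)

text \<open>The values of \<open>u\<close> below and above the level \<open>\<tau>\<close> are estimated by the measure of \<open>B\<close> and by the
  integral of the higher power. The level is left free so that it can be adapted to the scale.\<close>

lemma Y12_local_L2:
  fixes u :: "real^'d::finite \<Rightarrow> real^'m::finite"
  assumes d: "CARD('d) \<ge> 3" and S: "open S" and u: "Y12 S u" and B: "B \<in> sets lebesgue" "emeasure lebesgue B < \<infinity>"
    and \<tau>: "\<tau> > 0"
  shows "L2_on (S \<inter> B) u"
    and "(L2_norm (S \<inter> B) u)\<^sup>2 \<le> \<tau>\<^sup>2 * measure lebesgue B
      + \<tau> powr (2 - sobolev_exponent TYPE('d)) * (\<integral>x. norm (u x) powr sobolev_exponent TYPE('d) \<partial>lebesgue_on S)"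
proof -
  let ?q = "sobolev_exponent TYPE('d)"
  let ?M = "lebesgue_on (S \<inter> B)"
  have Sl: "S \<in> sets lebesgue" "S \<inter> B \<in> sets lebesgue" using S B by (auto simp: lebesgue_open)
  have q: "?q \<ge> 2" by (rule sobolev_exponent_ge_2[OF d])
  have um: "u \<in> borel_measurable (lebesgue_on S)"
    and ui: "integrable (lebesgue_on S) (\<lambda>x. norm (u x) powr ?q)" using u S by (auto simp: Y12_iff)
  have [measurable]: "u \<in> borel_measurable ?M" by (rule measurable_restrict_mono[OF um]) auto
  have ui': "integrable ?M (\<lambda>x. norm (u x) powr ?q)"
    by (rule integrable_lebesgue_on_subset[OF ui]) (use Sl in auto)
  have fin: "emeasure lebesgue (S \<inter> B) < \<infinity>"
    using B emeasure_mono[of "S \<inter> B" B lebesgue] by (auto simp: less_top top_unique)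
  have ci: "integrable ?M (\<lambda>x. \<tau>\<^sup>2)"
    using fin Sl by (intro finite_measure.integrable_const) (auto simp: finite_measure_lebesgue_on fmeasurable_def)
  have pw: "(norm (u x))\<^sup>2 \<le> \<tau>\<^sup>2 + \<tau> powr (2 - ?q) * norm (u x) powr ?q" for x
  proof (cases "norm (u x) \<le> \<tau>")
    case True
    then have "(norm (u x))\<^sup>2 \<le> \<tau>\<^sup>2" by (simp add: power_mono)
    then show ?thesis by (smt (verit) mult_nonneg_nonneg powr_ge_zero)
  next
    case False
    then have n: "norm (u x) > 0" using \<tau> by linarith
    have "1 \<le> (norm (u x) / \<tau>) powr (?q - 2)"
      using False \<tau> q by (intro ge_one_powr_ge_zero) auto
    then have "(norm (u x))\<^sup>2 * 1 \<le> norm (u x) powr 2 * (norm (u x) / \<tau>) powr (?q - 2)"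
      unfolding powr_two by (intro mult_left_mono) auto
    also have "\<dots> = \<tau> powr (2 - ?q) * norm (u x) powr ?q"
      using n \<tau> by (simp add: powr_divide powr_diff field_simps)
    finally show ?thesis by (simp add: add_increasing)
  qed
  have ri: "integrable ?M (\<lambda>x. \<tau>\<^sup>2 + \<tau> powr (2 - ?q) * norm (u x) powr ?q)"
    by (intro Bochner_Integration.integrable_add ci integrable_mult_right ui')
  have "integrable ?M (\<lambda>x. (norm (u x))\<^sup>2)"
    by (rule Bochner_Integration.integrable_bound[OF ri]) (auto intro!: order_trans[OF pw])
  then show L2: "L2_on (S \<inter> B) u" by (simp add: L2_on_def)
  have "(L2_norm (S \<inter> B) u)\<^sup>2 \<le> (\<integral>x. \<tau>\<^sup>2 + \<tau> powr (2 - ?q) * norm (u x) powr ?q \<partial>?M)"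
    unfolding L2_norm_square using L2 pw by (intro integral_mono ri) (auto simp: L2_on_def)
  also have "\<dots> = \<tau>\<^sup>2 * measure lebesgue (S \<inter> B) + \<tau> powr (2 - ?q) * (\<integral>x. norm (u x) powr ?q \<partial>?M)"
    using ci ui' Sl fin by (simp add: Bochner_Integration.integral_add measure_restrict_space lebesgue_on_UNIV_eq)
  also have "\<dots> \<le> \<tau>\<^sup>2 * measure lebesgue B + \<tau> powr (2 - ?q) * (\<integral>x. norm (u x) powr ?q \<partial>lebesgue_on S)"
  proof (intro add_mono mult_left_mono)
    show "measure lebesgue (S \<inter> B) \<le> measure lebesgue B"
      using B Sl by (intro measure_mono_fmeasurable) (auto simp: fmeasurable_def)
    show "(\<integral>x. norm (u x) powr ?q \<partial>?M) \<le> (\<integral>x. norm (u x) powr ?q \<partial>lebesgue_on S)"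
      by (rule integral_subset_le[OF ui]) (use Sl in auto)
  qed auto
  finally show "(L2_norm (S \<inter> B) u)\<^sup>2 \<le> \<tau>\<^sup>2 * measure lebesgue B
      + \<tau> powr (2 - ?q) * (\<integral>x. norm (u x) powr ?q \<partial>lebesgue_on S)" .
qed

lemma L2_on_outer_gradient:
  fixes u :: "real^'d::finite \<Rightarrow> real^'m::finite"
  assumes d: "CARD('d) \<ge> 3" and S: "open S" and u: "Y12 S u" and \<zeta>: "tame_cutoff \<zeta>"
  shows "L2_on S (\<lambda>x. outer (u x) (gradient \<zeta> x))"
proof -
  obtain B where B: "B > 0" "\<And>x. norm (gradient \<zeta> x) \<le> B" using tame_cutoff_gradient_bounded[OF \<zeta>] by metis
  obtain T where T: "compact T" "\<And>x. x \<notin> T \<Longrightarrow> gradient \<zeta> x = 0" and s: "smooth \<zeta>"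
    using \<zeta> unfolding tame_cutoff_def by metis
  have L2: "L2_on (S \<inter> T) u"
    using T(1) by (intro Y12_local_L2(1)[OF d S u, of _ 1]) (use lmeasurable_compact[of T] in \<open>auto simp: fmeasurable_def\<close>)
  have um: "u \<in> borel_measurable (lebesgue_on S)" using u S by (auto simp: Y12_iff)
  have om: "(\<lambda>x. outer (u x) (gradient \<zeta> x)) \<in> borel_measurable (lebesgue_on S)"
  proof (intro measurable_vec_lambda)
    fix i \<alpha>
    have "(\<lambda>x. u x $ i * gradient \<zeta> x $ \<alpha>) \<in> borel_measurable (lebesgue_on S)"
      by (intro borel_measurable_times measurable_vec_nth um measurable_restrict_space1 smooth_gradient_measurable s)
    then show "(\<lambda>x. outer (u x) (gradient \<zeta> x) $ i $ \<alpha>) \<in> borel_measurable (lebesgue_on S)"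
      by (simp add: outer_def)
  qed
  have "L2_on (S \<inter> T) (\<lambda>x. outer (u x) (gradient \<zeta> x))"
    by (rule L2_on_bound[OF L2, of _ B])
       (use B in \<open>auto simp: norm_outer mult.commute[of B] mult_left_mono intro!: AE_I2 measurable_restrict_mono[OF om]\<close>)
  then have "integrable (lebesgue_on (S \<inter> T)) (\<lambda>x. (norm (outer (u x) (gradient \<zeta> x)))\<^sup>2)" by (simp add: L2_on_def)
  then have "integrable (lebesgue_on S) (\<lambda>x. (norm (outer (u x) (gradient \<zeta> x)))\<^sup>2)"
    by (subst integral_lebesgue_on_eq(2)[of _ "S \<inter> T" _ "\<lambda>x. (norm (outer (u x) (gradient \<zeta> x)))\<^sup>2"])
       (use S T in \<open>auto simp: lebesgue_open lebesgue_compact norm_outer\<close>)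
  with om show ?thesis by (simp add: L2_on_def)
qed

lemma L2_on_scale:
  fixes G :: "real^'d::finite \<Rightarrow> 'b::euclidean_space"
  assumes "L2_on S G" "tame_cutoff \<zeta>"
  shows "L2_on S (\<lambda>x. \<zeta> x *\<^sub>R G x)"
proof -
  obtain B where B: "B > 0" "\<And>x. \<bar>\<zeta> x\<bar> \<le> B" using tame_cutoff_gradient_bounded[OF assms(2)] by metis
  have "smooth \<zeta>" using assms(2) by (simp add: tame_cutoff_def)
  then have "(\<lambda>x. \<zeta> x *\<^sub>R G x) \<in> borel_measurable (lebesgue_on S)"
    using assms(1) borel_measurable_scaleR[OF measurable_restrict_space1[OF smooth_measurable]] by (auto simp: L2_on_def)
  then show ?thesis
    by (rule L2_on_bound[OF assms(1), of _ B]) (use B in \<open>auto intro!: mult_right_mono\<close>)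
qed

lemma Y12_mult:
  fixes u :: "real^'d::finite \<Rightarrow> real^'m::finite"
  assumes d: "CARD('d) \<ge> 3" and S: "open S" and u: "Y12 S u" and \<zeta>: "tame_cutoff \<zeta>"
  shows "Y12 S (\<lambda>x. \<zeta> x *\<^sub>R u x)"
    and "AE x in lebesgue_on S. wgrad S (\<lambda>x. \<zeta> x *\<^sub>R u x) x = \<zeta> x *\<^sub>R wgrad S u x + outer (u x) (gradient \<zeta> x)"
proof -
  let ?G = "\<lambda>x. \<zeta> x *\<^sub>R wgrad S u x + outer (u x) (gradient \<zeta> x)"
  let ?q = "sobolev_exponent TYPE('d)"
  obtain B where B: "B > 0" "\<And>x. \<bar>\<zeta> x\<bar> \<le> B" using tame_cutoff_gradient_bounded[OF \<zeta>] by metis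
  have s: "smooth \<zeta>" using \<zeta> by (simp add: tame_cutoff_def)
  have "has_weak_partial S \<alpha> (\<lambda>x. \<zeta> x * u x $ i) (\<lambda>x. \<zeta> x * wgrad S u x $ i $ \<alpha> + pd \<alpha> \<zeta> x * u x $ i)" for i \<alpha>
    by (rule has_weak_partial_mult[OF S _ s]) (use u S in \<open>auto simp: Y12_iff has_weak_gradient_def\<close>)
  then have G: "has_weak_gradient S (\<lambda>x. \<zeta> x *\<^sub>R u x) ?G"
    by (simp add: has_weak_gradient_def outer_def gradient_def mult.commute)
  show eq: "AE x in lebesgue_on S. wgrad S (\<lambda>x. \<zeta> x *\<^sub>R u x) x = ?G x" by (rule wgrad_eq[OF S G])
  have L2: "L2_on S ?G"
    by (intro L2_on_add L2_on_scale L2_on_outer_gradient d S u \<zeta>) (use u S in \<open>auto simp: Y12_iff\<close>)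
  have w: "has_weak_gradient S (\<lambda>x. \<zeta> x *\<^sub>R u x) (wgrad S (\<lambda>x. \<zeta> x *\<^sub>R u x))"
    using G by (intro wgrad_weak_gradient) (auto simp: W11_loc_def)
  then have "wgrad S (\<lambda>x. \<zeta> x *\<^sub>R u x) \<in> borel_measurable (lebesgue_on S)"
    by (intro measurable_vec_lambda L1_loc_measurable S) (auto simp: has_weak_gradient_def has_weak_partial_def)
  then have L2w: "L2_on S (wgrad S (\<lambda>x. \<zeta> x *\<^sub>R u x))"
    by (rule L2_on_bound[OF L2, of _ 1]) (use eq in eventually_elim, simp)
  have um: "u \<in> borel_measurable (lebesgue_on S)" and ui: "integrable (lebesgue_on S) (\<lambda>x. norm (u x) powr ?q)"
    using u S by (auto simp: Y12_iff)
  have vm: "(\<lambda>x. \<zeta> x *\<^sub>R u x) \<in> borel_measurable (lebesgue_on S)"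
    by (intro borel_measurable_scaleR measurable_restrict_space1 smooth_measurable s um)
  have "integrable (lebesgue_on S) (\<lambda>x. B powr ?q * norm (u x) powr ?q)" using ui by simp
  then have vi: "integrable (lebesgue_on S) (\<lambda>x. norm (\<zeta> x *\<^sub>R u x) powr ?q)"
  proof (rule Bochner_Integration.integrable_bound)
    have "\<bar>\<zeta> x\<bar> powr ?q * norm (u x) powr ?q \<le> B powr ?q * norm (u x) powr ?q" for x
      using B sobolev_exponent_ge_2[OF d] by (intro mult_right_mono powr_mono2) auto
    then show "AE x in lebesgue_on S. norm (norm (\<zeta> x *\<^sub>R u x) powr ?q) \<le> norm (B powr ?q * norm (u x) powr ?q)"
      using B by (auto simp: powr_mult)
  qed (use vm in measurable)
  show "Y12 S (\<lambda>x. \<zeta> x *\<^sub>R u x)" using w vm vi L2w S by (simp add: Y12_iff)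
qed

section \<open>The Caccioppoli inequality\<close>

lemma neumann_solution_test:
  assumes "open S" "neumann_solution S A f u" "Y12 S v"
  shows "(\<integral>x. coeff_form A x (wgrad S u x) (wgrad S v x) \<partial>lebesgue_on S) = (\<integral>x. f x \<bullet> v x \<partial>lebesgue_on S)"
  using assms by (simp add: neumann_solution_def set_integral_lebesgue_on lebesgue_open)

lemma neumann_solution_Y12: "neumann_solution S A f u \<Longrightarrow> Y12 S u"
  by (simp add: neumann_solution_def)

text \<open>The equation is tested with $\zeta^2 u$. The form at $Du$ and $D(\zeta^2 u)$ is the form at $\zeta Du$
  twice, which is coercive, plus a mixed term that Young's inequality absorbs.\<close>

lemma caccioppoli:
  fixes A :: "('d::finite, 'm::finite) coeffs"
  assumes d: "CARD('d) \<ge> 3" and S: "open S" and A: "elliptic_coeffs lam M A" and lam: "lam > 0"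
    and u: "neumann_solution S A f u" and \<zeta>: "tame_cutoff \<zeta>"
  shows "lam * (L2_norm S (\<lambda>x. \<zeta> x *\<^sub>R wgrad S u x))\<^sup>2 \<le>
    2 * (\<integral>x. (\<zeta> x)\<^sup>2 * (f x \<bullet> u x) \<partial>lebesgue_on S)
    + 4 * (form_bound TYPE('d) TYPE('m) M)\<^sup>2 / lam * (L2_norm S (\<lambda>x. outer (u x) (gradient \<zeta> x)))\<^sup>2"
proof -
  let ?c = "form_bound TYPE('d) TYPE('m) M"
  let ?M = "lebesgue_on S"
  let ?D = "wgrad S u"
  let ?v = "\<lambda>x. (\<zeta> x * \<zeta> x) *\<^sub>R u x"
  let ?O = "\<lambda>x. outer (u x) (gradient \<zeta> x)"
  have u12: "Y12 S u" by (rule neumann_solution_Y12[OF u])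
  have s: "smooth \<zeta>" using \<zeta> by (simp add: tame_cutoff_def)
  have \<zeta>2: "tame_cutoff (\<lambda>x. \<zeta> x * \<zeta> x)" by (rule tame_cutoff_mult[OF \<zeta> \<zeta>])
  note v = Y12_mult[OF d S u12 \<zeta>2]
  have D: "L2_on S ?D" using u12 S by (simp add: Y12_iff)
  have \<zeta>D: "L2_on S (\<lambda>x. \<zeta> x *\<^sub>R ?D x)" by (rule L2_on_scale[OF D \<zeta>])
  have O: "L2_on S ?O" by (rule L2_on_outer_gradient[OF d S u12 \<zeta>])
  have 1: "(\<integral>x. coeff_form A x (?D x) (wgrad S ?v x) \<partial>?M)
      = (\<integral>x. coeff_form A x (\<zeta> x *\<^sub>R ?D x) (\<zeta> x *\<^sub>R ?D x) + 2 * coeff_form A x (\<zeta> x *\<^sub>R ?D x) (?O x) \<partial>?M)"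
  proof (rule integral_cong_AE)
    show "AE x in ?M. coeff_form A x (?D x) (wgrad S ?v x)
        = coeff_form A x (\<zeta> x *\<^sub>R ?D x) (\<zeta> x *\<^sub>R ?D x) + 2 * coeff_form A x (\<zeta> x *\<^sub>R ?D x) (?O x)"
      using v(2)
    proof eventually_elim
      case (elim x)
      have "outer (u x) (gradient (\<lambda>x. \<zeta> x * \<zeta> x) x) = (2 * \<zeta> x) *\<^sub>R ?O x"
        by (simp add: gradient_mult[OF s s] outer_def vec_eq_iff algebra_simps)
      then show ?case
        unfolding elim by (simp add: coeff_form_add_right coeff_form_scale_right coeff_form_scale_left)
    qed
  qed (use D \<zeta>D O v(1) S in \<open>auto simp: L2_on_def Y12_iff intro!: borel_measurable_add borel_measurable_times coeff_form_measurable[OF A]\<close>)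
  have i1: "integrable ?M (\<lambda>x. coeff_form A x (\<zeta> x *\<^sub>R ?D x) (\<zeta> x *\<^sub>R ?D x))"
    and i2: "integrable ?M (\<lambda>x. coeff_form A x (\<zeta> x *\<^sub>R ?D x) (?O x))"
    by (intro coeff_form_integral(1)[OF A] \<zeta>D O)+
  let ?X = "L2_norm S (\<lambda>x. \<zeta> x *\<^sub>R ?D x)" and ?Y = "L2_norm S ?O"
  have 2: "(\<integral>x. coeff_form A x (\<zeta> x *\<^sub>R ?D x) (\<zeta> x *\<^sub>R ?D x) \<partial>?M) + 2 * (\<integral>x. coeff_form A x (\<zeta> x *\<^sub>R ?D x) (?O x) \<partial>?M)
      = (\<integral>x. (\<zeta> x)\<^sup>2 * (f x \<bullet> u x) \<partial>?M)"
    using neumann_solution_test[OF S u v(1)] unfolding 1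
    using i1 i2 by (simp add: Bochner_Integration.integral_add power2_eq_square)
  have 3: "lam * ?X\<^sup>2 \<le> (\<integral>x. coeff_form A x (\<zeta> x *\<^sub>R ?D x) (\<zeta> x *\<^sub>R ?D x) \<partial>?M)"
  proof -
    have "lam * ?X\<^sup>2 = (\<integral>x. lam * (norm (\<zeta> x *\<^sub>R ?D x))\<^sup>2 \<partial>?M)"
      by (simp add: L2_norm_square)
    also have "\<dots> \<le> (\<integral>x. coeff_form A x (\<zeta> x *\<^sub>R ?D x) (\<zeta> x *\<^sub>R ?D x) \<partial>?M)"
    proof (rule integral_mono[OF _ i1])
      show "integrable ?M (\<lambda>x. lam * (norm (\<zeta> x *\<^sub>R ?D x))\<^sup>2)"
        using \<zeta>D unfolding L2_on_def by (intro integrable_mult_right) auto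
      show "lam * (norm (\<zeta> x *\<^sub>R ?D x))\<^sup>2 \<le> coeff_form A x (\<zeta> x *\<^sub>R ?D x) (\<zeta> x *\<^sub>R ?D x)" for x
        using A unfolding elliptic_coeffs_def by blast
    qed
    finally show ?thesis .
  qed
  have 4: "\<bar>\<integral>x. coeff_form A x (\<zeta> x *\<^sub>R ?D x) (?O x) \<partial>?M\<bar> \<le> ?c * (?X * ?Y)"
    by (rule coeff_form_integral(2)[OF A \<zeta>D O])
  have 5: "2 * (?c * (?X * ?Y)) \<le> lam / 2 * ?X\<^sup>2 + 2 * ?c\<^sup>2 / lam * ?Y\<^sup>2"
  proof -
    have "0 \<le> (lam * ?X - 2 * ?c * ?Y)\<^sup>2 / (2 * lam)" using lam by simp
    also have "\<dots> = lam / 2 * ?X\<^sup>2 + 2 * ?c\<^sup>2 / lam * ?Y\<^sup>2 - 2 * (?c * (?X * ?Y))"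
      using lam by (simp add: power2_eq_square field_simps)
    finally show ?thesis by simp
  qed
  show ?thesis using 2 3 4 5 by (simp add: abs_le_iff)
qed

section \<open>A local bound by the gradient on graph domains\<close>

lemma Cc_inf_L2:
  assumes "\<psi> \<in> Cc_inf U" "V \<in> sets lebesgue"
  shows "L2_on V \<psi>"
proof -
  obtain B where B: "\<And>x. \<bar>\<psi> x\<bar> \<le> B" using Cc_inf_bounded[OF assms(1)] by metis
  have L: "L1_loc UNIV \<psi>" by (rule L1_loc_bounded[OF smooth_measurable[OF Cc_inf_smooth[OF assms(1)]] B])
  have "integrable (lebesgue_on UNIV) (\<lambda>x. \<psi> x * \<psi> x)"
    by (rule Cc_inf_mult_integrable[OF open_UNIV L Cc_inf_mono[OF assms(1)]]) simp
  then have "L2_on UNIV \<psi>"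
    by (simp add: L2_on_def power2_eq_square smooth_measurable[OF Cc_inf_smooth[OF assms(1)]] lebesgue_on_UNIV_eq)
  then show ?thesis by (rule L2_on_subset) (use assms in auto)
qed

lemma Cc_inf_L2_norm:
  assumes "\<psi> \<in> Cc_inf U" "open U"
  shows "L2_norm U \<psi> = L2_norm UNIV \<psi>"
  unfolding L2_norm_def
  by (subst integral_lebesgue_on_eq(1)[of U UNIV _ "\<lambda>x. (norm (\<psi> x))\<^sup>2"])
     (use assms Cc_inf_outside[OF assms(1)] in \<open>auto simp: lebesgue_open\<close>)

text \<open>The image of the measure with density \<open>\<psi>\<close> under the dilation about \<open>p\<close> with factor \<open>\<mu>\<close>.\<close>

definition dilate :: "real^'d::finite \<Rightarrow> real \<Rightarrow> (real^'d \<Rightarrow> real) \<Rightarrow> real^'d \<Rightarrow> real" where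
  "dilate p \<mu> \<psi> y = \<psi> (p + (1 / \<mu>) *\<^sub>R (y - p)) / \<mu> ^ CARD('d)"

lemma dilate_one [simp]: "dilate p 1 \<psi> = \<psi>"
  by (simp add: dilate_def fun_eq_iff)

lemma dilate_affine: "p + (1 / \<mu>) *\<^sub>R (y - p) = (p - (1 / \<mu>) *\<^sub>R p) + (1 / \<mu>) *\<^sub>R y"
  for p y :: "real^'d::finite"
  by (simp add: algebra_simps)

lemma dilate_smooth: "smooth \<psi> \<Longrightarrow> smooth (dilate p \<mu> \<psi>)"
proof -
  assume "smooth \<psi>"
  from smooth_mult[OF smooth_affine[OF this, of "p - (1 / \<mu>) *\<^sub>R p" "1 / \<mu>"] smooth_const[of "1 / \<mu> ^ CARD('a)"]]
  show ?thesis by (simp add: dilate_def[abs_def] dilate_affine)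
qed

lemma dilate_Cc_inf:
  fixes \<psi> :: "real^'d::finite \<Rightarrow> real"
  assumes \<psi>: "\<psi> \<in> Cc_inf U" and \<mu>: "\<mu> > 0" and sub: "\<And>x. x \<in> U \<Longrightarrow> p + \<mu> *\<^sub>R (x - p) \<in> S"
  shows "dilate p \<mu> \<psi> \<in> Cc_inf S"
proof -
  obtain T where T: "compact T" "T \<subseteq> U" "\<And>x. x \<notin> T \<Longrightarrow> \<psi> x = 0" "smooth \<psi>" using \<psi> by (metis Cc_infE)
  show ?thesis
  proof (rule Cc_infI[OF dilate_smooth[OF T(4)], of "(\<lambda>x. p + \<mu> *\<^sub>R (x - p)) ` T"])
    show "compact ((\<lambda>x. p + \<mu> *\<^sub>R (x - p)) ` T)"
      by (intro compact_continuous_image T(1) continuous_intros)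
    show "(\<lambda>x. p + \<mu> *\<^sub>R (x - p)) ` T \<subseteq> S" using sub T(2) by auto
    fix y assume y: "y \<notin> (\<lambda>x. p + \<mu> *\<^sub>R (x - p)) ` T"
    have "y = p + \<mu> *\<^sub>R ((p + (1 / \<mu>) *\<^sub>R (y - p)) - p)" using \<mu> by simp
    then have "p + (1 / \<mu>) *\<^sub>R (y - p) \<notin> T" using y by blast
    then show "dilate p \<mu> \<psi> y = 0" by (simp add: dilate_def T(3))
  qed
qed

lemma integral_dilation:
  fixes h :: "real^'d::finite \<Rightarrow> real"
  assumes h: "h \<in> borel_measurable borel" and c: "c > 0"
  shows "(\<integral>y. h (t + c *\<^sub>R y) \<partial>lebesgue) = (\<integral>y. h y \<partial>lebesgue) / c ^ CARD('d)"
proof -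
  have "(\<integral>y. h y \<partial>lborel) = c ^ CARD('d) * (\<integral>y. h (t + c *\<^sub>R y) \<partial>lborel)"
    using c h by (subst lborel_affine[of c t]) (auto simp: integral_density integral_distr)
  moreover have "(\<lambda>y. h (t + c *\<^sub>R y)) \<in> borel_measurable borel" using h by measurable
  ultimately show ?thesis using h c by (simp add: integral_completion)
qed

lemma dilate_L2_norm:
  fixes \<psi> :: "real^'d::finite \<Rightarrow> real"
  assumes \<psi>: "\<psi> \<in> Cc_inf U" and \<mu>: "\<mu> > 0"
  shows "L2_norm UNIV (dilate p \<mu> \<psi>) = L2_norm UNIV \<psi> / sqrt (\<mu> ^ CARD('d))"
proof -
  have "\<psi> \<in> borel_measurable borel"
    by (intro borel_measurable_continuous_onI smooth_continuous_on Cc_inf_smooth[OF \<psi>])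
  then have m: "(\<lambda>y. (\<psi> y)\<^sup>2) \<in> borel_measurable borel" by measurable
  have "(\<integral>y. (dilate p \<mu> \<psi> y)\<^sup>2 \<partial>lebesgue)
      = (\<integral>y. (\<psi> ((p - (1 / \<mu>) *\<^sub>R p) + (1 / \<mu>) *\<^sub>R y))\<^sup>2 \<partial>lebesgue) / (\<mu> ^ CARD('d))\<^sup>2"
    unfolding dilate_def dilate_affine power_divide by simp
  also have "\<dots> = (\<integral>y. (\<psi> y)\<^sup>2 \<partial>lebesgue) / \<mu> ^ CARD('d)"
    using integral_dilation[OF m, of "1 / \<mu>" "p - (1 / \<mu>) *\<^sub>R p"] \<mu>
    by (simp add: power2_eq_square power_divide)
  finally show ?thesis by (simp add: L2_norm_def lebesgue_on_UNIV_eq real_sqrt_divide)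
qed

text \<open>The derivative of \<^const>\<open>dilate\<close> in the factor \<open>\<mu>\<close>; it is the negative of a divergence.\<close>

definition dilate_deriv :: "real^'d::finite \<Rightarrow> real \<Rightarrow> (real^'d \<Rightarrow> real) \<Rightarrow> real^'d \<Rightarrow> real" where
  "dilate_deriv p \<mu> \<psi> y = - (\<Sum>\<alpha>\<in>UNIV. (y - p) $ \<alpha> * pd \<alpha> \<psi> (p + (1 / \<mu>) *\<^sub>R (y - p))) / \<mu>\<^sup>2 / \<mu> ^ CARD('d)
     - real CARD('d) * \<psi> (p + (1 / \<mu>) *\<^sub>R (y - p)) / \<mu> / \<mu> ^ CARD('d)"

lemma dilate_has_derivative:
  fixes \<psi> :: "real^'d::finite \<Rightarrow> real"
  assumes \<psi>: "smooth \<psi>" and \<mu>: "\<mu> > 0"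
  shows "((\<lambda>\<mu>. dilate p \<mu> \<psi> y) has_real_derivative dilate_deriv p \<mu> \<psi> y) (at \<mu>)"
proof -
  let ?z = "p + (1 / \<mu>) *\<^sub>R (y - p)"
  let ?s = "\<Sum>\<alpha>\<in>UNIV. (y - p) $ \<alpha> * pd \<alpha> \<psi> ?z"
  have "((\<lambda>\<mu>. p + (1 / \<mu>) *\<^sub>R (y - p)) has_derivative (\<lambda>h. (- (h / \<mu>\<^sup>2)) *\<^sub>R (y - p))) (at \<mu>)"
    using \<mu> by (auto intro!: derivative_eq_intros simp: power2_eq_square divide_inverse)
  from has_derivative_compose[OF this has_derivative_pd[OF smooth_differentiable[OF \<psi>]]]
  have "((\<lambda>\<mu>. \<psi> (p + (1 / \<mu>) *\<^sub>R (y - p))) has_derivative (\<lambda>h. \<Sum>\<alpha>\<in>UNIV. ((- (h / \<mu>\<^sup>2)) *\<^sub>R (y - p)) $ \<alpha> * pd \<alpha> \<psi> ?z)) (at \<mu>)" .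
  moreover have "(\<lambda>h. \<Sum>\<alpha>\<in>UNIV. ((- (h / \<mu>\<^sup>2)) *\<^sub>R (y - p)) $ \<alpha> * pd \<alpha> \<psi> ?z) = (*) (- ?s / \<mu>\<^sup>2)"
  proof
    fix h
    have "((- (h / \<mu>\<^sup>2)) *\<^sub>R (y - p)) $ \<alpha> * c = - (h / \<mu>\<^sup>2) * ((y - p) $ \<alpha> * c)" for \<alpha> c
      by (simp only: vector_scaleR_component real_scaleR_def mult.assoc)
    then show "(\<Sum>\<alpha>\<in>UNIV. ((- (h / \<mu>\<^sup>2)) *\<^sub>R (y - p)) $ \<alpha> * pd \<alpha> \<psi> ?z) = - ?s / \<mu>\<^sup>2 * h"
      by (simp only: flip: sum_distrib_left) simp
  qed
  ultimately have D: "((\<lambda>\<mu>. \<psi> (p + (1 / \<mu>) *\<^sub>R (y - p))) has_real_derivative - ?s / \<mu>\<^sup>2) (at \<mu>)"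
    by (simp add: has_field_derivative_def)
  have P: "((\<lambda>\<mu>. \<mu> ^ CARD('d)) has_real_derivative real CARD('d) * \<mu> ^ (CARD('d) - 1)) (at \<mu>)"
    by (auto intro!: derivative_eq_intros)
  have n: "\<mu> ^ CARD('d) = \<mu> * \<mu> ^ (CARD('d) - 1)"
    by (rule power_eq_if[THEN trans]) simp
  have "(- ?s / \<mu>\<^sup>2 * \<mu> ^ CARD('d) - \<psi> ?z * (real CARD('d) * \<mu> ^ (CARD('d) - 1))) / (\<mu> ^ CARD('d) * \<mu> ^ CARD('d))
      = - ?s / \<mu>\<^sup>2 / \<mu> ^ CARD('d) - \<psi> ?z * real CARD('d) * (\<mu> ^ (CARD('d) - 1) / (\<mu> ^ CARD('d) * \<mu> ^ CARD('d)))"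
    using \<mu> by (simp add: diff_divide_distrib)
  also have "\<mu> ^ (CARD('d) - 1) / (\<mu> ^ CARD('d) * \<mu> ^ CARD('d)) = 1 / (\<mu> * \<mu> ^ CARD('d))"
    unfolding n using \<mu> by simp
  finally have "(- ?s / \<mu>\<^sup>2 * \<mu> ^ CARD('d) - \<psi> ?z * (real CARD('d) * \<mu> ^ (CARD('d) - 1))) / (\<mu> ^ CARD('d) * \<mu> ^ CARD('d))
      = dilate_deriv p \<mu> \<psi> y"
    by (simp add: dilate_deriv_def)
  with DERIV_divide[OF D P] \<mu> show ?thesis by (simp add: dilate_def[abs_def])
qed

lemma pd_dilate:
  fixes \<psi> :: "real^'d::finite \<Rightarrow> real"
  assumes \<psi>: "smooth \<psi>"
  shows "pd \<alpha> (dilate p \<mu> \<psi>) y = pd \<alpha> \<psi> (p + (1 / \<mu>) *\<^sub>R (y - p)) / \<mu> / \<mu> ^ CARD('d)"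
proof -
  have s: "smooth (\<lambda>y. \<psi> ((p - (1 / \<mu>) *\<^sub>R p) + (1 / \<mu>) *\<^sub>R y))" by (rule smooth_affine[OF \<psi>])
  have "pd \<alpha> (\<lambda>y. \<psi> ((p - (1 / \<mu>) *\<^sub>R p) + (1 / \<mu>) *\<^sub>R y) * (1 / \<mu> ^ CARD('d))) y
      = (1 / \<mu> * pd \<alpha> \<psi> ((p - (1 / \<mu>) *\<^sub>R p) + (1 / \<mu>) *\<^sub>R y)) * (1 / \<mu> ^ CARD('d))"
    by (subst pd_mult) (auto intro!: smooth_differentiable s smooth_const simp: pd_affine[OF smooth_differentiable[OF \<psi>]])
  then show ?thesis by (simp add: dilate_def[abs_def] dilate_affine)
qed

lemma dilate_deriv_divergence:
  fixes \<psi> :: "real^'d::finite \<Rightarrow> real"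
  assumes \<psi>: "smooth \<psi>" and \<mu>: "\<mu> > 0"
  shows "dilate_deriv p \<mu> \<psi> y = - (\<Sum>\<alpha>\<in>UNIV. pd \<alpha> (\<lambda>y. ((y - p) $ \<alpha> / \<mu>) * dilate p \<mu> \<psi> y) y)"
proof -
  let ?z = "p + (1 / \<mu>) *\<^sub>R (y - p)"
  have "pd \<alpha> (\<lambda>y. ((y - p) $ \<alpha> / \<mu>) * dilate p \<mu> \<psi> y) y
      = (y - p) $ \<alpha> * pd \<alpha> \<psi> ?z / \<mu>\<^sup>2 / \<mu> ^ CARD('d) + \<psi> ?z / \<mu> / \<mu> ^ CARD('d)" for \<alpha>
  proof -
    have D: "((\<lambda>y. (y - p) $ \<alpha> / \<mu>) has_derivative (\<lambda>h. h $ \<alpha> / \<mu>)) (at y)"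
    proof -
      have "((\<lambda>y. (y $ \<alpha> - p $ \<alpha>) * (1 / \<mu>)) has_derivative (\<lambda>h. (h $ \<alpha> - 0) * (1 / \<mu>))) (at y)"
        by (intro has_derivative_mult_left has_derivative_diff has_derivative_const
            bounded_linear_imp_has_derivative[OF bounded_linear_vec_nth])
      then show ?thesis by simp
    qed
    then have "pd \<alpha> (\<lambda>y. (y - p) $ \<alpha> / \<mu>) y = 1 / \<mu>" by (rule pd_eqI[THEN trans]) (simp add: axis_def)
    then show ?thesis
      unfolding pd_mult[OF differentiableI[OF D] smooth_differentiable[OF dilate_smooth[OF \<psi>]]]
      by (simp add: pd_dilate[OF \<psi>] dilate_def[of p \<mu> \<psi> y] power2_eq_square)
  qed
  then show ?thesis
    by (simp add: dilate_deriv_def sum.distrib sum_divide_distrib)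
qed

text \<open>The pairing of \<open>f\<close> with the dilated test function is differentiable in the factor \<open>\<mu>\<close>. Since the
  derivative of the dilated function is a divergence, the derivative of the pairing is the pairing of
  the weak gradient with the dilated function times the field $(y-p)/\mu$, of length at most \<open>\<rho>\<close> on
  its support. The estimate is the mean value inequality between the factors 1 and \<open>L\<close>.\<close>

lemma weak_gradient_dilation:
  fixes f :: "real^'d::finite \<Rightarrow> real"
  assumes S: "open S" and G: "\<And>\<alpha>. has_weak_partial S \<alpha> f (\<lambda>x. G x $ \<alpha>)" and L2: "L2_on S G" and L: "L \<ge> 1"
    and \<psi>: "\<psi> \<in> Cc_inf U"
    and sub: "\<And>x \<mu>. x \<in> U \<Longrightarrow> 1 \<le> \<mu> \<Longrightarrow> \<mu> \<le> L \<Longrightarrow> p + \<mu> *\<^sub>R (x - p) \<in> S"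
    and \<rho>: "\<And>x. x \<in> U \<Longrightarrow> norm (x - p) \<le> \<rho>" "\<rho> \<ge> 0"
  shows "\<bar>(\<integral>x. f x * \<psi> x \<partial>lebesgue_on S) - (\<integral>x. f x * dilate p L \<psi> x \<partial>lebesgue_on S)\<bar>
    \<le> \<rho> * (L2_norm S G * L2_norm UNIV \<psi>) * (L - 1)"
proof -
  let ?M = "lebesgue_on S"
  let ?d = "real CARD('d)"
  obtain T where T: "compact T" "T \<subseteq> U" "\<And>x. x \<notin> T \<Longrightarrow> \<psi> x = 0" "smooth \<psi>" using \<psi> by (metis Cc_infE)
  have f: "L1_loc S f" and g: "L1_loc S (\<lambda>x. G x $ \<alpha>)" for \<alpha> using G by (auto simp: has_weak_partial_def)
  define F where "F \<mu> = (\<integral>x. f x * dilate p \<mu> \<psi> x \<partial>?M)" for \<mu>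
  define F' where "F' \<mu> = (\<integral>x. f x * dilate_deriv p \<mu> \<psi> x \<partial>?M)" for \<mu>
  have dil: "dilate p \<mu> \<psi> \<in> Cc_inf S" if "\<mu> \<in> {1..L}" for \<mu>
    using that by (intro dilate_Cc_inf[OF \<psi>] sub) auto
  define W where "W \<mu> \<alpha> y = ((y - p) $ \<alpha> / \<mu>) * dilate p \<mu> \<psi> y" for \<mu> \<alpha> y
  have W: "W \<mu> \<alpha> \<in> Cc_inf S" if "\<mu> \<in> {1..L}" for \<mu> \<alpha>
  proof -
    have "smooth (\<lambda>y. (y $ \<alpha> - p $ \<alpha>) * (1 / \<mu>))"
      by (intro smooth_mult smooth_diff smooth_const smooth_component)
    then show ?thesis
      using dil[OF that] unfolding W_def[abs_def] by (intro Cc_inf_mult) auto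
  qed
  have dd: "dilate_deriv p \<mu> \<psi> y = - (\<Sum>\<alpha>\<in>UNIV. pd \<alpha> (W \<mu> \<alpha>) y)" if "\<mu> \<in> {1..L}" for \<mu> y
    using dilate_deriv_divergence[OF T(4), of \<mu> p y] that by (simp add: W_def[abs_def])
  have F'_bound: "\<bar>F' \<mu>\<bar> \<le> \<rho> * (L2_norm S G * L2_norm UNIV \<psi>)" if \<mu>: "\<mu> \<in> {1..L}" for \<mu>
  proof -
    have iW: "integrable ?M (\<lambda>x. f x * pd \<alpha> (W \<mu> \<alpha>) x)" "integrable ?M (\<lambda>x. G x $ \<alpha> * W \<mu> \<alpha> x)" for \<alpha>
      by (intro Cc_inf_mult_integrable[OF S] f g Cc_inf_pd W[OF \<mu>])+
    have "F' \<mu> = (\<integral>x. - (\<Sum>\<alpha>\<in>UNIV. f x * pd \<alpha> (W \<mu> \<alpha>) x) \<partial>?M)"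
      by (simp add: F'_def dd[OF \<mu>] sum_distrib_left)
    also have "\<dots> = - (\<Sum>\<alpha>\<in>UNIV. \<integral>x. f x * pd \<alpha> (W \<mu> \<alpha>) x \<partial>?M)"
      using iW by (simp add: Bochner_Integration.integral_sum)
    also have "\<dots> = (\<Sum>\<alpha>\<in>UNIV. \<integral>x. G x $ \<alpha> * W \<mu> \<alpha> x \<partial>?M)"
      using G W[OF \<mu>] S by (simp add: has_weak_partial_lebesgue_on sum_negf)
    also have "\<dots> = (\<integral>x. (\<Sum>\<alpha>\<in>UNIV. G x $ \<alpha> * W \<mu> \<alpha> x) \<partial>?M)"
      using iW by (simp add: Bochner_Integration.integral_sum)
    finally have F': "F' \<mu> = (\<integral>x. (\<Sum>\<alpha>\<in>UNIV. G x $ \<alpha> * W \<mu> \<alpha> x) \<partial>?M)" .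
    have pw: "\<bar>\<Sum>\<alpha>\<in>UNIV. G x $ \<alpha> * W \<mu> \<alpha> x\<bar> \<le> \<rho> * (norm (G x) * norm (dilate p \<mu> \<psi> x))" for x
    proof -
      let ?z = "p + (1 / \<mu>) *\<^sub>R (x - p)"
      have "(\<Sum>\<alpha>\<in>UNIV. G x $ \<alpha> * W \<mu> \<alpha> x) = (G x \<bullet> (?z - p)) * dilate p \<mu> \<psi> x"
        by (simp add: W_def inner_vec_def sum_distrib_right sum_distrib_left mult_ac)
      moreover have "\<bar>(G x \<bullet> (?z - p)) * dilate p \<mu> \<psi> x\<bar> \<le> \<rho> * (norm (G x) * norm (dilate p \<mu> \<psi> x))"
      proof (cases "?z \<in> T")
        case True
        have "\<bar>G x \<bullet> (?z - p)\<bar> \<le> norm (G x) * norm (?z - p)" by (rule Cauchy_Schwarz_ineq2)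
        also have "\<dots> \<le> norm (G x) * \<rho>" using True T(2) by (intro mult_left_mono \<rho>(1)) auto
        finally have "\<bar>G x \<bullet> (?z - p)\<bar> * \<bar>dilate p \<mu> \<psi> x\<bar> \<le> norm (G x) * \<rho> * \<bar>dilate p \<mu> \<psi> x\<bar>"
          by (rule mult_right_mono) simp
        then show ?thesis by (simp add: abs_mult mult_ac)
      qed (simp add: dilate_def T(3))
      ultimately show ?thesis by simp
    qed
    have dL2: "L2_on S (dilate p \<mu> \<psi>)" "L2_on UNIV (dilate p \<mu> \<psi>)"
      using S by (auto intro!: Cc_inf_L2[OF dil[OF \<mu>]] simp: lebesgue_open)
    have bi: "integrable ?M (\<lambda>x. \<rho> * (norm (G x) * norm (dilate p \<mu> \<psi> x)))"
      by (intro integrable_mult_right L2_integrable_products L2 dL2)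
    have si: "integrable ?M (\<lambda>x. \<Sum>\<alpha>\<in>UNIV. G x $ \<alpha> * W \<mu> \<alpha> x)"
      using iW by (intro Bochner_Integration.integrable_sum) auto
    have "\<bar>F' \<mu>\<bar> \<le> (\<integral>x. \<rho> * (norm (G x) * norm (dilate p \<mu> \<psi> x)) \<partial>?M)"
      unfolding F' using si bi pw by (intro order_trans[OF integral_abs_bound] integral_mono) auto
    also have "\<dots> \<le> \<rho> * (L2_norm S G * L2_norm S (dilate p \<mu> \<psi>))"
      using L2_integrable_products(2)[OF L2 dL2(1)] \<rho>(2) by (simp add: mult_left_mono)
    also have "\<dots> \<le> \<rho> * (L2_norm S G * L2_norm UNIV \<psi>)"
    proof (intro mult_left_mono \<rho>(2))
      have "L2_norm S (dilate p \<mu> \<psi>) \<le> L2_norm UNIV (dilate p \<mu> \<psi>)"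
        using dL2 S by (intro L2_norm_subset) (auto simp: lebesgue_open)
      also have "\<dots> = L2_norm UNIV \<psi> / sqrt (\<mu> ^ CARD('d))"
        using \<mu> by (intro dilate_L2_norm[OF \<psi>]) auto
      also have "\<dots> \<le> L2_norm UNIV \<psi> / 1"
        using \<mu> by (intro divide_left_mono) auto
      finally show "L2_norm S (dilate p \<mu> \<psi>) \<le> L2_norm UNIV \<psi>" by simp
    qed simp
    finally show ?thesis .
  qed
  obtain b where b: "\<And>x. \<bar>\<psi> x\<bar> \<le> b" using Cc_inf_bounded[OF \<psi>] by metis
  have "\<forall>\<alpha>. \<exists>b. \<forall>x. \<bar>pd \<alpha> \<psi> x\<bar> \<le> b" using Cc_inf_bounded[OF Cc_inf_pd[OF \<psi>]] by metis
  then obtain b' where b': "\<And>\<alpha> x. \<bar>pd \<alpha> \<psi> x\<bar> \<le> b' \<alpha>" by metis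
  (* A Lipschitz constant in the factor, uniform on the interval: it dominates the difference quotients. *)
  define B where "B = (\<Sum>\<alpha>\<in>UNIV. \<rho> * b' \<alpha>) + ?d * b"
  have b0: "b \<ge> 0" using b[of undefined] by linarith
  have b'0: "b' \<alpha> \<ge> 0" for \<alpha> using b'[of \<alpha> undefined] by linarith
  have B0: "B \<ge> 0" using b0 b'0 \<rho>(2) by (auto simp: B_def intro!: add_nonneg_nonneg sum_nonneg mult_nonneg_nonneg)
  have dB: "\<bar>dilate_deriv p \<mu> \<psi> y\<bar> \<le> B" if \<mu>: "\<mu> \<in> {1..L}" for \<mu> y
  proof -
    let ?z = "p + (1 / \<mu>) *\<^sub>R (y - p)"
    have m1: "\<mu> > 0" "\<mu> * \<mu> ^ CARD('d) \<ge> 1"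
      using \<mu> mult_mono[of 1 \<mu> 1 "\<mu> ^ CARD('d)"] by auto
    have "dilate_deriv p \<mu> \<psi> y = - ((\<Sum>\<alpha>\<in>UNIV. (?z - p) $ \<alpha> * pd \<alpha> \<psi> ?z) + ?d * \<psi> ?z) / (\<mu> * \<mu> ^ CARD('d))"
    proof -
      have "(\<Sum>\<alpha>\<in>UNIV. (y - p) $ \<alpha> * pd \<alpha> \<psi> ?z) = \<mu> * (\<Sum>\<alpha>\<in>UNIV. (?z - p) $ \<alpha> * pd \<alpha> \<psi> ?z)"
        using m1 by (simp add: sum_distrib_left)
      then show ?thesis
        unfolding dilate_deriv_def using m1 by (simp only:) (simp add: power2_eq_square field_simps)
    qed
    moreover have "\<bar>(\<Sum>\<alpha>\<in>UNIV. (?z - p) $ \<alpha> * pd \<alpha> \<psi> ?z) + ?d * \<psi> ?z\<bar> \<le> B"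
    proof -
      have t: "\<bar>(?z - p) $ \<alpha> * pd \<alpha> \<psi> ?z\<bar> \<le> \<rho> * b' \<alpha>" for \<alpha>
      proof (cases "?z \<in> T")
        case True
        then have "\<bar>(?z - p) $ \<alpha>\<bar> \<le> \<rho>"
          using T(2) by (intro order_trans[OF component_le_norm_cart \<rho>(1)]) auto
        then show ?thesis unfolding abs_mult using b' \<rho>(2) by (intro mult_mono) auto
      next
        case False
        have "pd \<alpha> \<psi> ?z = 0"
          by (intro pd_locally_const[of "- T" ?z \<psi> 0]) (use T False in \<open>auto simp: compact_imp_closed open_Compl\<close>)
        then show ?thesis using \<rho>(2) b'0 by simp
      qed
      have "\<bar>(\<Sum>\<alpha>\<in>UNIV. (?z - p) $ \<alpha> * pd \<alpha> \<psi> ?z) + ?d * \<psi> ?z\<bar>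
          \<le> (\<Sum>\<alpha>\<in>UNIV. \<bar>(?z - p) $ \<alpha> * pd \<alpha> \<psi> ?z\<bar>) + ?d * \<bar>\<psi> ?z\<bar>"
      proof (rule order_trans[OF abs_triangle_ineq], rule add_mono[OF sum_abs])
        show "\<bar>?d * \<psi> ?z\<bar> \<le> ?d * \<bar>\<psi> ?z\<bar>" by (simp add: abs_mult)
      qed
      also have "\<dots> \<le> B" unfolding B_def by (intro add_mono sum_mono t mult_left_mono b) auto
      finally show ?thesis .
    qed
    ultimately have "\<bar>dilate_deriv p \<mu> \<psi> y\<bar> \<le> B / (\<mu> * \<mu> ^ CARD('d))"
      using m1 by (simp add: divide_right_mono)
    also have "\<dots> \<le> B / 1" using m1 B0 by (intro divide_left_mono) auto
    finally show ?thesis by simp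
  qed
  (* One compact set contains the supports of all dilates. *)
  define T' where "T' = (\<lambda>(\<mu>, x). p + \<mu> *\<^sub>R (x - p)) ` ({1..L} \<times> T)"
  have T': "compact T'" "T' \<subseteq> S"
  proof -
    have "continuous_on ({1..L} \<times> T) (\<lambda>z. p + fst z *\<^sub>R (snd z - p))" by (intro continuous_intros)
    then have "compact ((\<lambda>z. p + fst z *\<^sub>R (snd z - p)) ` ({1..L} \<times> T))"
      by (intro compact_continuous_image compact_Times T(1)) auto
    then show "compact T'" by (simp add: T'_def case_prod_unfold)
    show "T' \<subseteq> S" using sub T(2) by (auto simp: T'_def)
  qed
  have out: "dilate p \<mu> \<psi> y = 0" if "y \<notin> T'" "\<mu> \<in> {1..L}" for \<mu> y
  proof -
    have eq: "y = p + \<mu> *\<^sub>R ((p + (1 / \<mu>) *\<^sub>R (y - p)) - p)" using that by simp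
    have "p + (1 / \<mu>) *\<^sub>R (y - p) \<notin> T"
    proof
      assume "p + (1 / \<mu>) *\<^sub>R (y - p) \<in> T"
      then have "y \<in> T'"
        unfolding T'_def using that(2) eq by (intro image_eqI[of _ _ "(\<mu>, p + (1 / \<mu>) *\<^sub>R (y - p))"]) auto
      with that(1) show False by simp
    qed
    then show ?thesis by (simp add: dilate_def T(3))
  qed
  have lip: "\<bar>dilate p \<nu> \<psi> y - dilate p \<mu> \<psi> y\<bar> \<le> B * indicator T' y * \<bar>\<nu> - \<mu>\<bar>"
    if "\<mu> \<in> {1..L}" "\<nu> \<in> {1..L}" for \<mu> \<nu> y
  proof (cases "y \<in> T'")
    case True
    have "norm (dilate p \<nu> \<psi> y - dilate p \<mu> \<psi> y) \<le> B * norm (\<nu> - \<mu>)"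
    proof (rule field_differentiable_bound[where S = "{1..L}" and f' = "\<lambda>\<mu>. dilate_deriv p \<mu> \<psi> y"])
      show "((\<lambda>\<mu>. dilate p \<mu> \<psi> y) has_real_derivative dilate_deriv p z \<psi> y) (at z within {1..L})"
        if "z \<in> {1..L}" for z
        using that by (intro has_field_derivative_at_within[OF dilate_has_derivative[OF T(4)]]) auto
    qed (use dB that in auto)
    then show ?thesis using True by simp
  qed (use out that in auto)
  have F: "(F has_real_derivative F' \<mu>) (at \<mu> within {1..L})" if \<mu>: "\<mu> \<in> {1..L}" for \<mu>
    unfolding has_field_derivative_iff tendsto_at_iff_sequentially
  proof (intro allI impI)
    fix X assume X: "\<forall>i. X i \<in> {1..L} - {\<mu>}" "X \<longlonglongrightarrow> \<mu>"
    have iF: "integrable ?M (\<lambda>x. f x * dilate p \<nu> \<psi> x)" if "\<nu> \<in> {1..L}" for \<nu>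
      by (intro Cc_inf_mult_integrable[OF S f] dil that)
    have q: "(F (X i) - F \<mu>) / (X i - \<mu>) = (\<integral>x. f x * ((dilate p (X i) \<psi> x - dilate p \<mu> \<psi> x) / (X i - \<mu>)) \<partial>?M)" for i
    proof -
      have Xi: "X i \<in> {1..L}" using X by blast
      have "F (X i) - F \<mu> = (\<integral>x. f x * dilate p (X i) \<psi> x - f x * dilate p \<mu> \<psi> x \<partial>?M)"
        unfolding F_def using iF[OF Xi] iF[OF \<mu>] by simp
      moreover have "f x * ((a - b) / c) = (f x * a - f x * b) / c" for x and a b c :: real
        by (simp add: right_diff_distrib)
      ultimately show ?thesis by (simp only: integral_divide_zero)
    qed
    have mf: "f \<in> borel_measurable ?M" by (rule L1_loc_measurable[OF S f])
    have md: "dilate p \<nu> \<psi> \<in> borel_measurable ?M" for \<nu>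
      by (intro measurable_restrict_space1 smooth_measurable dilate_smooth T(4))
    have wm: "(\<lambda>x. B * indicator T' x) \<in> borel_measurable lebesgue"
      by (intro borel_measurable_times borel_measurable_const borel_measurable_indicator lebesgue_compact T')
    have "(\<lambda>i. \<integral>x. f x * ((dilate p (X i) \<psi> x - dilate p \<mu> \<psi> x) / (X i - \<mu>)) \<partial>?M)
        \<longlonglongrightarrow> (\<integral>x. f x * dilate_deriv p \<mu> \<psi> x \<partial>?M)"
    proof (rule integral_dominated_convergence[where w = "\<lambda>x. \<bar>f x * (B * indicator T' x)\<bar>"])
      have "integrable ?M (\<lambda>x. f x * (B * indicator T' x))"
        by (rule L1_loc_mult_integrable[OF S f T' wm, of B]) (use B0 in \<open>auto simp: indicator_def\<close>)
      then show "integrable ?M (\<lambda>x. \<bar>f x * (B * indicator T' x)\<bar>)" by (rule integrable_abs)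
      show "(\<lambda>x. f x * ((dilate p (X i) \<psi> x - dilate p \<mu> \<psi> x) / (X i - \<mu>))) \<in> borel_measurable ?M" for i
        using mf md by measurable
      have "dilate_deriv p \<mu> \<psi> \<in> borel_measurable ?M"
      proof -
        have "dilate_deriv p \<mu> \<psi> = (\<lambda>y. - (\<Sum>\<alpha>\<in>UNIV. pd \<alpha> (W \<mu> \<alpha>) y))" by (rule ext) (rule dd[OF \<mu>])
        moreover have "(\<lambda>y. - (\<Sum>\<alpha>\<in>UNIV. pd \<alpha> (W \<mu> \<alpha>) y)) \<in> borel_measurable ?M"
          by (intro measurable_restrict_space1 smooth_measurable smooth_uminus smooth_sum smooth_pd Cc_inf_smooth[OF W[OF \<mu>]]) auto
        ultimately show ?thesis by simp
      qed
      then show "(\<lambda>x. f x * dilate_deriv p \<mu> \<psi> x) \<in> borel_measurable ?M"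
        using mf by measurable
      show "AE x in ?M. (\<lambda>i. f x * ((dilate p (X i) \<psi> x - dilate p \<mu> \<psi> x) / (X i - \<mu>))) \<longlonglongrightarrow> f x * dilate_deriv p \<mu> \<psi> x"
      proof (intro AE_I2 tendsto_mult tendsto_const)
        fix x
        have "((\<lambda>\<mu>. dilate p \<mu> \<psi> x) has_real_derivative dilate_deriv p \<mu> \<psi> x) (at \<mu> within {1..L})"
          using \<mu> by (intro has_field_derivative_at_within[OF dilate_has_derivative[OF T(4)]]) auto
        then show "(\<lambda>i. (dilate p (X i) \<psi> x - dilate p \<mu> \<psi> x) / (X i - \<mu>)) \<longlonglongrightarrow> dilate_deriv p \<mu> \<psi> x"
          using X unfolding has_field_derivative_iff tendsto_at_iff_sequentially by (auto simp: o_def)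
      qed
      show "AE x in ?M. norm (f x * ((dilate p (X i) \<psi> x - dilate p \<mu> \<psi> x) / (X i - \<mu>))) \<le> \<bar>f x * (B * indicator T' x)\<bar>" for i
      proof (rule AE_I2)
        fix x
        have Xi: "X i \<in> {1..L}" "X i \<noteq> \<mu>" using X by blast+
        have "\<bar>(dilate p (X i) \<psi> x - dilate p \<mu> \<psi> x) / (X i - \<mu>)\<bar> \<le> B * indicator T' x"
          using lip[OF \<mu> Xi(1), of x] Xi(2) by (simp add: field_simps)
        then have "\<bar>f x\<bar> * \<bar>(dilate p (X i) \<psi> x - dilate p \<mu> \<psi> x) / (X i - \<mu>)\<bar> \<le> \<bar>f x\<bar> * (B * indicator T' x)"
          by (rule mult_left_mono) simp
        then show "norm (f x * ((dilate p (X i) \<psi> x - dilate p \<mu> \<psi> x) / (X i - \<mu>))) \<le> \<bar>f x * (B * indicator T' x)\<bar>"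
          using B0 by (simp add: abs_mult)
      qed
    qed
    then show "((\<lambda>y. (F y - F \<mu>) / (y - \<mu>)) \<circ> X) \<longlonglongrightarrow> F' \<mu>"
      by (simp add: o_def q F'_def)
  qed
  have "norm (F 1 - F L) \<le> \<rho> * (L2_norm S G * L2_norm UNIV \<psi>) * norm (1 - L)"
    by (rule field_differentiable_bound[where S = "{1..L}" and f' = F']) (use F F'_bound L in auto)
  then show ?thesis using L by (simp add: F_def)
qed

lemma graph_domain_open:
  assumes "K-lipschitz_on UNIV \<phi>" shows "open (graph_domain \<phi>)"
  unfolding graph_domain_def
proof (rule open_Collect_less)
  have "continuous_on UNIV \<phi>" by (rule lipschitz_on_continuous_on[OF assms])
  then show "continuous_on UNIV (\<lambda>x::real^'a option. \<phi> (\<chi> i. x $ Some i))"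
    by (rule continuous_on_compose2) (auto intro!: continuous_on_vec_lambda continuous_intros)
  show "continuous_on UNIV (\<lambda>x::real^'a option. x $ None)" by (intro continuous_intros)
qed

lemma norm_horizontal_le: "norm (\<chi> i. x $ Some i) \<le> norm x" for x :: "real^'n::finite option"
proof -
  have "(norm (\<chi> i. x $ Some i))\<^sup>2 = (\<Sum>i\<in>UNIV. (norm (x $ Some i))\<^sup>2)"
    by (simp add: norm_square_components)
  also have "\<dots> = (\<Sum>j\<in>range Some. (norm (x $ j))\<^sup>2)" by (subst sum.reindex) auto
  also have "\<dots> \<le> (\<Sum>j\<in>UNIV. (norm (x $ j))\<^sup>2)" by (rule sum_mono2) auto
  also have "\<dots> = (norm x)\<^sup>2" by (rule norm_square_components[symmetric])
  finally show ?thesis by (rule power2_le_imp_le) simp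
qed

text \<open>Dilations about a point sufficiently far below the centre of a ball move the part of the
  domain in the ball upwards inside a cone that the graph does not meet.\<close>

lemma graph_domain_dilation:
  fixes \<phi> :: "real^'n::finite \<Rightarrow> real"
  assumes K: "K-lipschitz_on UNIV \<phi>" and x: "x \<in> graph_domain \<phi>" "x \<in> ball x0 R" and \<mu>: "\<mu> \<ge> 1"
    and p: "p = x0 - axis None ((K + 1) * R)"
  shows "p + \<mu> *\<^sub>R (x - p) \<in> graph_domain \<phi>"
proof -
  let ?h = "\<lambda>x::real^'n option. (\<chi> i. x $ Some i) :: real^'n"
  let ?y = "p + \<mu> *\<^sub>R (x - p)"
  have K0: "K \<ge> 0" by (rule lipschitz_on_nonneg[OF K])
  have r: "norm (x - x0) \<le> R" using x(2) by (simp add: dist_norm norm_minus_commute)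
  have hp: "?h p = ?h x0" by (simp add: p vec_eq_iff axis_def)
  have "?h ?y - ?h x = (\<mu> - 1) *\<^sub>R ?h (x - x0)"
    using hp by (simp add: vec_eq_iff algebra_simps)
  then have "dist (?h ?y) (?h x) = (\<mu> - 1) * norm (?h (x - x0))" using \<mu> by (simp add: dist_norm)
  also have "\<dots> \<le> (\<mu> - 1) * R" using \<mu> r norm_horizontal_le[of "x - x0"] by (intro mult_left_mono) auto
  finally have "dist (?h ?y) (?h x) \<le> (\<mu> - 1) * R" .
  then have "K * dist (?h ?y) (?h x) \<le> K * ((\<mu> - 1) * R)" using K0 by (rule mult_left_mono)
  moreover have "dist (\<phi> (?h ?y)) (\<phi> (?h x)) \<le> K * dist (?h ?y) (?h x)"
    using K by (rule lipschitz_onD) auto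
  ultimately have 1: "\<phi> (?h ?y) \<le> \<phi> (?h x) + K * ((\<mu> - 1) * R)" by (simp add: dist_real_def abs_le_iff)
  have "\<bar>(x - x0) $ None\<bar> \<le> R" using component_le_norm_cart[of "x - x0" None] r by linarith
  then have "(x - p) $ None \<ge> K * R" by (simp add: p axis_def algebra_simps abs_le_iff)
  then have "(\<mu> - 1) * (x - p) $ None \<ge> (\<mu> - 1) * (K * R)" using \<mu> by (intro mult_left_mono) auto
  moreover have "?y $ None = x $ None + (\<mu> - 1) * (x - p) $ None" by (simp add: algebra_simps)
  ultimately have "?y $ None \<ge> x $ None + K * ((\<mu> - 1) * R)" by (simp add: mult_ac)
  moreover have "x $ None > \<phi> (?h x)" using x(1) by (simp add: graph_domain_def)
  ultimately have "?y $ None > \<phi> (?h ?y)" using 1 by linarith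
  then show ?thesis by (simp add: graph_domain_def)
qed

text \<open>A test function on $\Omega \cap B_R$ is dilated by the factor $s^2$ about the point at depth $(K+1)R$
  below the centre. The dilated function lives in a ball of radius $2(K+2)s^2 R$, and its $L^2$ norm is
  smaller by the factor $s^{-d} \le s^{-3}$; the difference of the pairings costs the gradient.\<close>

lemma local_bound_step:
  fixes \<phi> :: "real^'n::finite \<Rightarrow> real" and f :: "real^'n option \<Rightarrow> real"
  assumes d: "CARD('n option) \<ge> 3" and K: "K-lipschitz_on UNIV \<phi>" and \<Omega>: "\<Omega> = graph_domain \<phi>"
    and G: "\<And>\<alpha>. has_weak_partial \<Omega> \<alpha> f (\<lambda>x. G x $ \<alpha>)" and L2: "L2_on \<Omega> G"
    and f2: "\<And>R. L2_on (\<Omega> \<inter> ball x0 R) f" and R: "R > 0" and s: "s \<ge> 1"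
  shows "L2_norm (\<Omega> \<inter> ball x0 R) f \<le> L2_norm (\<Omega> \<inter> ball x0 (2 * (K + 2) * s\<^sup>2 * R)) f / s ^ 3
    + (K + 2) * (s\<^sup>2 - 1) * R * L2_norm \<Omega> G"
proof -
  have K0: "K \<ge> 0" by (rule lipschitz_on_nonneg[OF K])
  have op: "open \<Omega>" unfolding \<Omega> by (rule graph_domain_open[OF K])
  let ?U = "\<Omega> \<inter> ball x0 R" and ?V = "\<Omega> \<inter> ball x0 (2 * (K + 2) * s\<^sup>2 * R)"
  let ?C = "L2_norm ?V f / s ^ 3 + (K + 2) * (s\<^sup>2 - 1) * R * L2_norm \<Omega> G"
  define p where "p = x0 - axis None ((K + 1) * R)"
  have s2: "s\<^sup>2 \<ge> 1" using s by (simp add: one_le_power)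
  have opU: "open ?U" and opV: "open ?V" using op by auto
  have f1: "L1_loc \<Omega> f" using G[of None] by (simp add: has_weak_partial_def)
  have dp: "norm (x0 - p) = (K + 1) * R" using K0 R by (simp add: p_def norm_axis_vec)
  have \<rho>: "norm (x - p) \<le> (K + 2) * R" if "x \<in> ?U" for x
    using that norm_triangle_ineq[of "x - x0" "x0 - p"] dp by (auto simp: dist_norm norm_minus_commute algebra_simps)
  have C0: "?C \<ge> 0" using K0 s s2 R by (intro add_nonneg_nonneg mult_nonneg_nonneg divide_nonneg_nonneg) auto
  have bound: "\<bar>\<integral>x. f x * \<psi> x \<partial>lebesgue_on ?U\<bar> \<le> ?C * sqrt (\<integral>x. (\<psi> x)\<^sup>2 \<partial>lebesgue_on ?U)" if \<psi>: "\<psi> \<in> Cc_inf ?U" for \<psi>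
  proof -
    have dilV: "dilate p (s\<^sup>2) \<psi> \<in> Cc_inf ?V"
    proof (rule dilate_Cc_inf[OF \<psi>])
      fix x assume x: "x \<in> ?U"
      have "p + s\<^sup>2 *\<^sub>R (x - p) \<in> \<Omega>"
        using graph_domain_dilation[OF K _ _ s2 p_def] x \<Omega> by auto
      moreover have "norm (x0 - (p + s\<^sup>2 *\<^sub>R (x - p))) < 2 * (K + 2) * s\<^sup>2 * R"
      proof -
        have "norm (x0 - (p + s\<^sup>2 *\<^sub>R (x - p))) = norm ((x0 - p) - s\<^sup>2 *\<^sub>R (x - p))"
          by (simp add: algebra_simps)
        also have "\<dots> \<le> norm (x0 - p) + norm (s\<^sup>2 *\<^sub>R (x - p))" by (rule norm_triangle_ineq4)
        also have "\<dots> \<le> (K + 1) * R + s\<^sup>2 * ((K + 2) * R)" using \<rho>[OF x] dp by (auto intro!: mult_left_mono)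
        finally have 1: "norm (x0 - (p + s\<^sup>2 *\<^sub>R (x - p))) \<le> (K + 1) * R + s\<^sup>2 * ((K + 2) * R)" .
        have 2: "(K + 1) * R < (K + 2) * R" using R by simp
        have 3: "(K + 2) * R \<le> s\<^sup>2 * ((K + 2) * R)" using mult_right_mono[OF s2, of "(K + 2) * R"] K0 R by simp
        have 4: "2 * (K + 2) * s\<^sup>2 * R = s\<^sup>2 * ((K + 2) * R) + s\<^sup>2 * ((K + 2) * R)" by (simp add: algebra_simps)
        show ?thesis using 1 2 3 unfolding 4 by linarith
      qed
      ultimately show "p + s\<^sup>2 *\<^sub>R (x - p) \<in> ?V" by (simp add: dist_norm)
    qed (use s2 in linarith)
    have "(\<integral>x. f x * \<psi> x \<partial>lebesgue_on ?U) = (\<integral>x. f x * \<psi> x \<partial>lebesgue_on \<Omega>)"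
      by (rule integral_lebesgue_on_eq) (use op opU Cc_inf_outside[OF \<psi>] in \<open>auto simp: lebesgue_open\<close>)
    moreover have "(\<integral>x. f x * dilate p (s\<^sup>2) \<psi> x \<partial>lebesgue_on ?V) = (\<integral>x. f x * dilate p (s\<^sup>2) \<psi> x \<partial>lebesgue_on \<Omega>)"
      by (rule integral_lebesgue_on_eq) (use op opV Cc_inf_outside[OF dilV] in \<open>auto simp: lebesgue_open\<close>)
    moreover have "\<bar>(\<integral>x. f x * \<psi> x \<partial>lebesgue_on \<Omega>) - (\<integral>x. f x * dilate p (s\<^sup>2) \<psi> x \<partial>lebesgue_on \<Omega>)\<bar>
        \<le> ((K + 2) * R) * (L2_norm \<Omega> G * L2_norm UNIV \<psi>) * (s\<^sup>2 - 1)"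
    proof (rule weak_gradient_dilation[OF op G L2 s2 \<psi>])
      show "p + \<mu> *\<^sub>R (x - p) \<in> \<Omega>" if "x \<in> ?U" "1 \<le> \<mu>" for x \<mu>
        using graph_domain_dilation[OF K _ _ that(2) p_def] that \<Omega> by auto
    qed (use \<rho> K0 R in auto)
    moreover have "\<bar>\<integral>x. f x * dilate p (s\<^sup>2) \<psi> x \<partial>lebesgue_on ?V\<bar> \<le> L2_norm ?V f * (L2_norm UNIV \<psi> / s ^ 3)"
    proof -
      have "\<bar>\<integral>x. f x * dilate p (s\<^sup>2) \<psi> x \<partial>lebesgue_on ?V\<bar> \<le> L2_norm ?V f * L2_norm ?V (dilate p (s\<^sup>2) \<psi>)"
        using L2_inner(2)[OF f2 Cc_inf_L2[OF dilV]] opV by (simp add: lebesgue_open)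
      also have "L2_norm ?V (dilate p (s\<^sup>2) \<psi>) = L2_norm UNIV \<psi> / sqrt ((s\<^sup>2) ^ CARD('n option))"
        using s2 by (simp only: Cc_inf_L2_norm[OF dilV opV] dilate_L2_norm[OF \<psi>])
      also have "sqrt ((s\<^sup>2) ^ CARD('n option)) = s ^ CARD('n option)"
        unfolding real_sqrt_power using s by (simp del: card_option)
      also have "L2_norm UNIV \<psi> / s ^ CARD('n option) \<le> L2_norm UNIV \<psi> / s ^ 3"
        using s d by (intro divide_left_mono power_increasing) auto
      finally show ?thesis by (simp add: mult_left_mono)
    qed
    ultimately have "\<bar>\<integral>x. f x * \<psi> x \<partial>lebesgue_on ?U\<bar>
        \<le> ((K + 2) * R) * (L2_norm \<Omega> G * L2_norm UNIV \<psi>) * (s\<^sup>2 - 1) + L2_norm ?V f * (L2_norm UNIV \<psi> / s ^ 3)"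
      by linarith
    also have "\<dots> = ?C * L2_norm UNIV \<psi>" by (simp add: algebra_simps)
    also have "L2_norm UNIV \<psi> = sqrt (\<integral>x. (\<psi> x)\<^sup>2 \<partial>lebesgue_on ?U)"
      using Cc_inf_L2_norm[OF \<psi> opU] by (simp add: L2_norm_def)
    finally show ?thesis .
  qed
  have "(\<integral>x. (f x)\<^sup>2 \<partial>lebesgue_on ?U) \<le> ?C\<^sup>2"
    by (rule L2_duality(2)[OF opU L1_loc_subset[OF f1] C0 bound]) auto
  then have "(L2_norm ?U f)\<^sup>2 \<le> ?C\<^sup>2" unfolding L2_norm_square by simp
  then show ?thesis using C0 by (rule power2_le_imp_le)
qed

text \<open>The absolute values make the constant positive for every \<open>K\<close>.\<close>

definition local_bound_const :: "'m::finite itself \<Rightarrow> real \<Rightarrow> real" where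
  "local_bound_const _ K = real CARD('m) * (2 * ((\<bar>K\<bar> + 2) * ((4 * (\<bar>K\<bar> + 2))\<^sup>2 - 1)))"

text \<open>For a component $u^i$ let $a(R) = \|u^i\|_{L^2(\Omega \cap B_R)} / R$. The preceding lemma gives
  $a(R) \le a(\kappa R)/2 + H$, where \<open>H\<close> is a multiple of the norm of the gradient. The quantity \<open>a\<close> is
  bounded because \<open>u\<close> lies in $L^{2d/(d-2)}$, so its supremum is at most $2H$.\<close>

lemma graph_domain_local_bound:
  fixes \<phi> :: "real^'n::finite \<Rightarrow> real" and u :: "real^'n option \<Rightarrow> real^'m::finite"
  assumes d: "CARD('n option) \<ge> 3" and K: "K-lipschitz_on UNIV \<phi>" and \<Omega>: "\<Omega> = graph_domain \<phi>"
    and u: "Y12 \<Omega> u" and R: "R > 0"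
  shows "L2_norm (\<Omega> \<inter> ball x0 R) u \<le> local_bound_const TYPE('m) K * R * L2_norm \<Omega> (wgrad \<Omega> u)"
proof -
  have K0: "K \<ge> 0" by (rule lipschitz_on_nonneg[OF K])
  have op: "open \<Omega>" unfolding \<Omega> by (rule graph_domain_open[OF K])
  (* With this factor the radius grows by kappa and kappa / s^3 = 1 / 2. *)
  define s where "s = 4 * (K + 2)"
  define \<kappa> where "\<kappa> = 2 * (K + 2) * s\<^sup>2"
  define H where "H = (K + 2) * (s\<^sup>2 - 1) * L2_norm \<Omega> (wgrad \<Omega> u)"
  have s: "s \<ge> 1" "s > 0" using K0 by (auto simp: s_def)
  have s2: "s\<^sup>2 \<ge> 1" using s by (simp add: one_le_power)
  have \<kappa>: "\<kappa> > 0" using K0 s by (simp add: \<kappa>_def)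
  have uR: "L2_on (\<Omega> \<inter> ball x0 R) u" for R
    by (rule Y12_local_L2(1)[OF d op u, of _ 1]) (use emeasure_ball_finite in auto)
  have L2: "L2_on \<Omega> (wgrad \<Omega> u)" using u op by (simp add: Y12_iff)
  let ?q = "sobolev_exponent TYPE('n option)"
  let ?n = "real CARD('n option)"
  let ?I = "\<integral>x. norm (u x) powr ?q \<partial>lebesgue_on \<Omega>"
  define D where "D = sqrt (unit_ball_vol ?n + ?I)"
  have I0: "?I \<ge> 0" by simp
  (* The level R^(1 - d/2) makes both terms of the bound scale like R^2. *)
  have a_bound: "L2_norm (\<Omega> \<inter> ball x0 R) u \<le> D * R" if R: "R > 0" for R
  proof -
    have "(L2_norm (\<Omega> \<inter> ball x0 R) u)\<^sup>2 \<le> (R powr (1 - ?n / 2))\<^sup>2 * measure lebesgue (ball x0 R)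
        + (R powr (1 - ?n / 2)) powr (2 - ?q) * ?I"
      using R by (intro Y12_local_L2(2)[OF d op u]) (use emeasure_ball_finite in auto)
    also have "(R powr (1 - ?n / 2)) powr (2 - ?q) = R\<^sup>2"
    proof -
      have "(1 - ?n / 2) * (2 - ?q) = 2" using d by (simp add: sobolev_exponent_def field_simps)
      then show ?thesis using R by (simp add: powr_powr powr_numeral)
    qed
    also have "(R powr (1 - ?n / 2))\<^sup>2 * measure lebesgue (ball x0 R) = unit_ball_vol ?n * R\<^sup>2"
    proof -
      have "(R powr (1 - ?n / 2))\<^sup>2 * R ^ CARD('n option) = R\<^sup>2" by (rule powr_scaling[OF R])
      then show ?thesis unfolding measure_ball_power(1)[OF R] by (simp add: mult_ac del: card_option)
    qed
    finally have "(L2_norm (\<Omega> \<inter> ball x0 R) u)\<^sup>2 \<le> (unit_ball_vol ?n + ?I) * R\<^sup>2" by (simp add: algebra_simps)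
    also have "\<dots> = (D * R)\<^sup>2" using I0 by (simp add: D_def power_mult_distrib)
    finally show ?thesis by (rule power2_le_imp_le) (use R I0 in \<open>auto simp: D_def\<close>)
  qed
  have comp: "L2_norm (\<Omega> \<inter> ball x0 R) (\<lambda>x. u x $ i) \<le> 2 * H * R" for i
  proof -
    define a where "a R = L2_norm (\<Omega> \<inter> ball x0 R) (\<lambda>x. u x $ i) / R" for R
    have step: "a R \<le> a (\<kappa> * R) / 2 + H" if R: "R > 0" for R
    proof -
      have "L2_norm (\<Omega> \<inter> ball x0 R) (\<lambda>x. u x $ i) \<le> L2_norm (\<Omega> \<inter> ball x0 (2 * (K + 2) * s\<^sup>2 * R)) (\<lambda>x. u x $ i) / s ^ 3
          + (K + 2) * (s\<^sup>2 - 1) * R * L2_norm \<Omega> (\<lambda>x. wgrad \<Omega> u x $ i)"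
        by (rule local_bound_step[OF d K \<Omega> _ L2_on_component[OF L2] L2_on_component[OF uR] R s(1)])
           (use u op in \<open>auto simp: Y12_iff has_weak_gradient_def\<close>)
      also have "\<dots> \<le> L2_norm (\<Omega> \<inter> ball x0 (\<kappa> * R)) (\<lambda>x. u x $ i) / s ^ 3 + (K + 2) * (s\<^sup>2 - 1) * R * L2_norm \<Omega> (wgrad \<Omega> u)"
        unfolding \<kappa>_def using K0 s2 R by (intro add_left_mono mult_left_mono L2_norm_component[OF L2] mult_nonneg_nonneg) auto
      finally have "a R \<le> L2_norm (\<Omega> \<inter> ball x0 (\<kappa> * R)) (\<lambda>x. u x $ i) / s ^ 3 / R + H"
        using R by (simp add: a_def H_def field_simps)
      also have "L2_norm (\<Omega> \<inter> ball x0 (\<kappa> * R)) (\<lambda>x. u x $ i) / s ^ 3 / R = a (\<kappa> * R) / 2"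
      proof -
        have "\<kappa> * 2 = (4 * (K + 2)) * s\<^sup>2" by (simp add: \<kappa>_def algebra_simps)
        also have "\<dots> = s ^ 3" by (simp add: s_def power2_eq_square power3_eq_cube)
        finally have "s ^ 3 * R = (\<kappa> * R) * 2" by simp
        then show ?thesis by (simp add: a_def)
      qed
      finally show ?thesis .
    qed
    have aD: "a R \<le> D" if "R > 0" for R
      using a_bound[OF that] L2_norm_component[OF uR, of R i] that by (simp add: a_def divide_le_eq)
    define A where "A = Sup (a ` {0<..})"
    have bdd: "bdd_above (a ` {0<..})" using aD by (auto intro!: bdd_aboveI[of _ D])
    have aA: "a R \<le> A" if "R > 0" for R
      unfolding A_def using that by (intro cSup_upper bdd) auto
    have "A \<le> A / 2 + H"
      unfolding A_def
    proof (rule cSup_least)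
      fix y assume "y \<in> a ` {0<..}"
      then obtain R where R: "R > 0" "y = a R" by auto
      have "a (\<kappa> * R) \<le> A" using \<kappa> R by (intro aA) auto
      then show "y \<le> Sup (a ` {0<..}) / 2 + H" using step[OF R(1)] R(2) by (simp add: A_def)
    qed auto
    then have "a R \<le> 2 * H" using aA[OF R] by simp
    then show ?thesis using R by (simp add: a_def field_simps)
  qed
  have "L2_norm (\<Omega> \<inter> ball x0 R) u \<le> real CARD('m) * (2 * H * R)"
    by (rule L2_norm_components[OF L2_on_component[OF uR] comp])
  then show ?thesis using K0 by (simp add: H_def s_def local_bound_const_def mult_ac)
qed

section \<open>Neumann solutions away from the support of the data\<close>

lemma Cc_inf_vec_component: "f \<in> Cc_inf_vec S \<Longrightarrow> (\<lambda>x. f x $ i) \<in> Cc_inf S"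
  by (simp add: Cc_inf_vec_def)

lemma Cc_inf_vec_outside: "f \<in> Cc_inf_vec S \<Longrightarrow> x \<notin> S \<Longrightarrow> f x = 0"
  using Cc_inf_outside[OF Cc_inf_vec_component] by (fastforce simp: vec_eq_iff)

lemma Cc_inf_vec_mono: "f \<in> Cc_inf_vec S \<Longrightarrow> S \<subseteq> S' \<Longrightarrow> f \<in> Cc_inf_vec S'"
  by (auto simp: Cc_inf_vec_def intro: Cc_inf_mono)

lemma Cc_inf_vec_measurable: "f \<in> Cc_inf_vec U \<Longrightarrow> f \<in> borel_measurable (lebesgue_on S)"
  by (intro measurable_vec_lambda measurable_restrict_space1 smooth_measurable Cc_inf_smooth Cc_inf_vec_component)

lemma Cc_inf_vec_L2: "f \<in> Cc_inf_vec U \<Longrightarrow> V \<in> sets lebesgue \<Longrightarrow> L2_on V f"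
  by (rule L2_on_components) (rule Cc_inf_L2[OF Cc_inf_vec_component])

lemma Cc_inf_vec_axis: "\<psi> \<in> Cc_inf S \<Longrightarrow> (\<lambda>x. axis k (\<psi> x)) \<in> Cc_inf_vec S"
  unfolding Cc_inf_vec_def
proof safe
  fix i assume "\<psi> \<in> Cc_inf S"
  then show "(\<lambda>x. axis k (\<psi> x) $ i) \<in> Cc_inf S"
    by (cases "i = k") (simp_all add: axis_def Cc_inf_zero)
qed

lemma Cc_inf_vec_integrable:
  fixes f :: "real^'d::finite \<Rightarrow> real^'m::finite"
  assumes "f \<in> Cc_inf_vec U" "V \<in> sets lebesgue"
  shows "integrable (lebesgue_on V) f"
proof -
  have "integrable (lebesgue_on V) (\<lambda>x. \<Sum>i\<in>UNIV. f x $ i *\<^sub>R axis i (1::real))"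
    by (intro Bochner_Integration.integrable_sum integrable_scaleR_left
        Cc_inf_integrable[OF Cc_inf_vec_component[OF assms(1)] assms(2)])
  moreover have "(\<Sum>i\<in>UNIV. f x $ i *\<^sub>R axis i (1::real)) = f x" for x
    using basis_expansion[of "f x"] by (simp add: scalar_mult_eq_scaleR)
  ultimately show ?thesis by simp
qed

text \<open>The form in which (LB') is applied: the norms are real numbers, and any pointwise bound for the
  data replaces their essential supremum.\<close>

lemma cond_LB_bound:
  fixes A :: "('d::finite, 'm::finite) coeffs"
  assumes d: "CARD('d) \<ge> 3" and S: "open S" and LB: "cond_LB S A C1"
    and f: "f \<in> Cc_inf_vec S" and u: "neumann_solution S A f u \<or> neumann_solution S (adjoint_coeffs A) f u"
    and x: "x \<in> S" and R: "R > 0" and F: "\<And>z. z \<in> S \<inter> ball x R \<Longrightarrow> norm (f z) \<le> F" "F \<ge> 0"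
  shows "AE z in lebesgue_on (S \<inter> ball x (R / 2)).
    norm (u z) \<le> C1 * (R powr (- (real CARD('d) / 2)) * L2_norm (S \<inter> ball x R) u + R\<^sup>2 * F)"
proof -
  let ?B = "C1 * (R powr (- (real CARD('d) / 2)) * L2_norm (S \<inter> ball x R) u + R\<^sup>2 * F)"
  have C1: "C1 > 0" using LB by (simp add: cond_LB_def)
  have u12: "Y12 S u" using u neumann_solution_Y12 by blast
  have op: "open (S \<inter> ball x r)" for r using S by auto
  have uL2: "L2_on (S \<inter> ball x R) u"
    by (rule Y12_local_L2(1)[OF d S u12, of _ 1]) (use emeasure_ball_finite in auto)
  have "Linf_norm (S \<inter> ball x R) f \<le> ennreal F"
    unfolding Linf_norm_def
  proof (rule esssup_I)
    show "(\<lambda>x. ennreal (norm (f x))) \<in> borel_measurable (lebesgue_on (S \<inter> ball x R))"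
      using Cc_inf_vec_measurable[OF f] by measurable
    show "AE x in lebesgue_on (S \<inter> ball x R). ennreal (norm (f x)) \<le> ennreal F"
      using F lebesgue_open[OF op] by (auto simp: AE_restrict_space_iff intro!: ennreal_leI)
  qed
  then have "ennreal C1 * (ennreal (R powr (- (real CARD('d) / 2))) * Lp_norm 2 (S \<inter> ball x R) u
      + ennreal (R\<^sup>2) * Linf_norm (S \<inter> ball x R) f) \<le>
    ennreal C1 * (ennreal (R powr (- (real CARD('d) / 2))) * ennreal (L2_norm (S \<inter> ball x R) u)
      + ennreal (R\<^sup>2) * ennreal F)"
    unfolding Lp_norm_two[OF lebesgue_open[OF op] uL2] by (intro mult_left_mono add_left_mono) auto
  also have "\<dots> = ennreal ?B"
    using C1 F(2) by (simp add: ennreal_mult ennreal_plus)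
  finally have "Linf_norm (S \<inter> ball x (R / 2)) u \<le> ennreal ?B"
    using LB f u x R unfolding cond_LB_def by (meson order_trans)
  then have "AE z in lebesgue_on (S \<inter> ball x (R / 2)). ennreal (norm (u z)) \<le> ennreal ?B"
    using esssup_AE[of "\<lambda>z. ennreal (norm (u z))" "lebesgue_on (S \<inter> ball x (R / 2))"]
    by (auto simp: Linf_norm_def elim!: eventually_mono intro: order_trans)
  moreover have "?B \<ge> 0" using C1 F(2) by (intro mult_nonneg_nonneg add_nonneg_nonneg) auto
  ultimately show ?thesis by (auto simp: ennreal_le_iff)
qed

lemma cond_LB_adjoint: "cond_LB S A C1 \<Longrightarrow> cond_LB S (adjoint_coeffs A) C1"
  unfolding cond_LB_def adjoint_adjoint by blast

text \<open>The locale is closed under passing to the adjoint coefficients. Domain and coefficients enter the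
  constants below only through \<open>lam\<close>, \<open>M\<close> and \<open>Cb\<close>; on a graph domain the bound with constant \<open>Cb\<close> is
  \<open>graph_domain_local_bound\<close>.\<close>

locale elliptic_domain =
  fixes S :: "(real^'d::finite) set" and A :: "('d, 'm::finite) coeffs" and lam M Cb :: real
  assumes dim: "CARD('d) \<ge> 3" and S: "open S" and A: "elliptic_coeffs lam M A" and lam: "lam > 0"
    and M: "M > 0" and Cb: "Cb > 0"
    and local_bound: "\<And>(u :: real^'d \<Rightarrow> real^'m) x R. Y12 S u \<Longrightarrow> R > 0 \<Longrightarrow>
      L2_norm (S \<inter> ball x R) u \<le> Cb * R * L2_norm S (wgrad S u)"
begin

lemma elliptic_domain_adjoint: "elliptic_domain S (adjoint_coeffs A) lam M Cb"
  by unfold_locales (use dim S A lam M Cb local_bound elliptic_coeffs_adjoint in auto)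

lemma local_L2: "Y12 S (u :: real^'d \<Rightarrow> real^'m) \<Longrightarrow> L2_on (S \<inter> ball x R) u"
  by (rule Y12_local_L2(1)[OF dim S, of _ _ 1]) (use emeasure_ball_finite in auto)

lemma sets_ball: "S \<inter> ball x R \<in> sets lebesgue"
  using S by (intro lebesgue_open) auto

lemma integral_on_support:
  fixes f v :: "real^'d \<Rightarrow> real^'m"
  assumes "f \<in> Cc_inf_vec (S \<inter> ball z R)"
  shows "(\<integral>x. f x \<bullet> v x \<partial>lebesgue_on S) = (\<integral>x. f x \<bullet> v x \<partial>lebesgue_on (S \<inter> ball z R))"
  by (rule integral_lebesgue_on_eq)
     (use S sets_ball Cc_inf_vec_outside[OF assms] in \<open>auto simp: lebesgue_open\<close>)

text \<open>The solution is tested with itself. The data live in a ball of radius \<open>R\<close>, where the local bound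
  replaces the norm of \<open>u\<close> by that of its gradient, and one factor cancels.\<close>

lemma energy_estimate:
  assumes f: "f \<in> Cc_inf_vec (S \<inter> ball z R)" and u: "neumann_solution S A f u" and R: "R > 0"
  shows "lam * L2_norm S (wgrad S u) \<le> Cb * R * L2_norm S f"
proof -
  let ?X = "L2_norm S (wgrad S u)"
  have u12: "Y12 S u" by (rule neumann_solution_Y12[OF u])
  have D: "L2_on S (wgrad S u)" using u12 S by (simp add: Y12_iff)
  have "lam * ?X\<^sup>2 = (\<integral>x. lam * (norm (wgrad S u x))\<^sup>2 \<partial>lebesgue_on S)"
    by (simp add: L2_norm_square)
  also have "\<dots> \<le> (\<integral>x. coeff_form A x (wgrad S u x) (wgrad S u x) \<partial>lebesgue_on S)"
  proof (rule integral_mono[OF _ coeff_form_integral(1)[OF A D D]])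
    show "integrable (lebesgue_on S) (\<lambda>x. lam * (norm (wgrad S u x))\<^sup>2)"
      using D unfolding L2_on_def by (intro integrable_mult_right) auto
    show "lam * (norm (wgrad S u x))\<^sup>2 \<le> coeff_form A x (wgrad S u x) (wgrad S u x)" for x
      using A unfolding elliptic_coeffs_def by blast
  qed
  also have "\<dots> = (\<integral>x. f x \<bullet> u x \<partial>lebesgue_on (S \<inter> ball z R))"
    unfolding neumann_solution_test[OF S u u12] by (rule integral_on_support[OF f])
  also have "\<dots> \<le> L2_norm (S \<inter> ball z R) f * L2_norm (S \<inter> ball z R) u"
    using L2_inner(2)[OF Cc_inf_vec_L2[OF f sets_ball] local_L2[OF u12]] by (simp add: abs_le_iff)
  also have "\<dots> \<le> L2_norm S f * (Cb * R * ?X)"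
    using S by (intro mult_mono local_bound u12 R L2_norm_subset[OF Cc_inf_vec_L2[OF f]] sets_ball)
      (auto simp: lebesgue_open)
  finally have "lam * ?X * ?X \<le> Cb * R * L2_norm S f * ?X" by (simp add: power2_eq_square mult_ac)
  then show ?thesis
  proof (cases "?X = 0")
    case True
    then show ?thesis using Cb R by simp
  next
    case False
    then have "?X > 0" using L2_norm_nonneg[of S "wgrad S u"] by linarith
    then show ?thesis using \<open>lam * ?X * ?X \<le> Cb * R * L2_norm S f * ?X\<close> by simp
  qed
qed

lemma reciprocity:
  assumes w: "neumann_solution S A g w" and u: "neumann_solution S (adjoint_coeffs A) f u"
  shows "(\<integral>x. g x \<bullet> u x \<partial>lebesgue_on S) = (\<integral>x. f x \<bullet> w x \<partial>lebesgue_on S)"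
  using neumann_solution_test[OF S w neumann_solution_Y12[OF u]]
    neumann_solution_test[OF S u neumann_solution_Y12[OF w]]
  by (simp add: coeff_form_adjoint)

lemma balls_apart: "dist x z \<ge> 2 * R \<Longrightarrow> ball x R \<inter> ball z R = {}"
  by (intro disjoint_ballI) auto

text \<open>The data vanish near \<open>z0\<close>, so (LB') has no source term there. The $L^2$ norm of \<open>w\<close> near \<open>z0\<close> is bounded
  by the local bound, and the gradient by the energy estimate.\<close>

lemma L2_Linf_off_diagonal:
  assumes LB: "cond_LB S A C1" and g: "g \<in> Cc_inf_vec (S \<inter> ball x0 R)" and w: "neumann_solution S A g w"
    and z0: "z0 \<in> S" and R: "R > 0" and dist: "dist x0 z0 \<ge> 2 * R"
  shows "AE z in lebesgue_on (S \<inter> ball z0 (R / 2)).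
    norm (w z) \<le> C1 * (R powr (- (real CARD('d) / 2)) * (Cb * R * (Cb * R * L2_norm S g / lam)))"
proof -
  have C1: "C1 > 0" using LB by (simp add: cond_LB_def)
  have w12: "Y12 S w" by (rule neumann_solution_Y12[OF w])
  have "AE z in lebesgue_on (S \<inter> ball z0 (R / 2)).
      norm (w z) \<le> C1 * (R powr (- (real CARD('d) / 2)) * L2_norm (S \<inter> ball z0 R) w + R\<^sup>2 * 0)"
  proof (rule cond_LB_bound[OF dim S LB Cc_inf_vec_mono[OF g] disjI1[OF w] z0 R])
    show "norm (g z) \<le> 0" if "z \<in> S \<inter> ball z0 R" for z
      using that balls_apart[OF dist] Cc_inf_vec_outside[OF g, of z] by (auto simp: disjoint_iff)
  qed auto
  moreover have "C1 * (R powr (- (real CARD('d) / 2)) * L2_norm (S \<inter> ball z0 R) w + R\<^sup>2 * 0)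
      \<le> C1 * (R powr (- (real CARD('d) / 2)) * (Cb * R * (Cb * R * L2_norm S g / lam)))"
  proof -
    have "L2_norm S (wgrad S w) \<le> Cb * R * L2_norm S g / lam"
      using energy_estimate[OF g w R] lam by (simp add: pos_le_divide_eq mult.commute)
    then have "Cb * R * L2_norm S (wgrad S w) \<le> Cb * R * (Cb * R * L2_norm S g / lam)"
      using Cb R by (intro mult_left_mono) auto
    then have "L2_norm (S \<inter> ball z0 R) w \<le> Cb * R * (Cb * R * L2_norm S g / lam)"
      using local_bound[OF w12 R, of z0] by linarith
    then show ?thesis
      unfolding mult_zero_right add_0_right using C1 by (intro mult_left_mono) auto
  qed
  ultimately show ?thesis by (auto elim!: eventually_mono intro: order_trans)
qed

definition off_diagonal_const :: "real \<Rightarrow> real" where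
  "off_diagonal_const C1 = real CARD('m) * (C1 * C1 * (Cb * Cb / lam))"

text \<open>The previous bound maps $L^2$ to $L^\infty$ between separated balls. Testing against it gives
  its dual, from $L^1$ to $L^2$, and a second use of (LB') gives the bound from $L^1$ to $L^\infty$.\<close>

lemma L1_Linf_off_diagonal:
  assumes LB: "cond_LB S A C1"
    and ex: "\<And>g. g \<in> Cc_inf_vec S \<Longrightarrow> \<exists>w. neumann_solution S A g w"
    and f: "f \<in> Cc_inf_vec (S \<inter> ball z0 (R / 2))" and u: "neumann_solution S (adjoint_coeffs A) f u"
    and z0: "z0 \<in> S" and x0: "x0 \<in> S" and R: "R > 0" and dist: "dist x0 z0 \<ge> 2 * R"
  shows "AE x in lebesgue_on (S \<inter> ball x0 (R / 2)).
    norm (u x) \<le> off_diagonal_const C1 * R powr (2 - real CARD('d)) * (\<integral>x. norm (f x) \<partial>lebesgue_on S)"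
proof -
  let ?n = "real CARD('d)"
  let ?U = "S \<inter> ball x0 R" and ?V = "S \<inter> ball z0 (R / 2)"
  let ?F = "\<integral>x. norm (f x) \<partial>lebesgue_on S"
  have opU: "open ?U" using S by auto
  have C1: "C1 > 0" using LB by (simp add: cond_LB_def)
  have u12: "Y12 S u" by (rule neumann_solution_Y12[OF u])
  have uL2: "L2_on ?U u" by (rule local_L2[OF u12])
  define c where "c = C1 * (R powr (- (?n / 2)) * (Cb * R * (Cb * R / lam)))"
  have c0: "c \<ge> 0" using C1 Cb R lam by (simp add: c_def)
  have fi: "integrable (lebesgue_on V) (\<lambda>x. norm (f x))" if "V \<in> sets lebesgue" for V
    by (intro integrable_norm Cc_inf_vec_integrable[OF f that])
  have F0: "?F \<ge> 0" by simp
  have FV: "?F = (\<integral>x. norm (f x) \<partial>lebesgue_on ?V)"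
    by (rule integral_lebesgue_on_eq)
       (use S sets_ball Cc_inf_vec_outside[OF f] in \<open>auto simp: lebesgue_open\<close>)
  have comp: "L2_norm ?U (\<lambda>x. u x $ i) \<le> c * ?F" for i
  proof -
    have "(\<integral>x. (u x $ i)\<^sup>2 \<partial>lebesgue_on ?U) \<le> (c * ?F)\<^sup>2"
    proof (rule L2_duality(2)[OF opU])
      show "L1_loc ?U (\<lambda>x. u x $ i)" by (rule Y12_component_L1_loc[OF u12]) auto
      show "c * ?F \<ge> 0" using c0 F0 by simp
      fix \<psi> assume \<psi>: "\<psi> \<in> Cc_inf ?U"
      let ?g = "\<lambda>x. axis i (\<psi> x) :: real^'m"
      have g: "?g \<in> Cc_inf_vec ?U" by (rule Cc_inf_vec_axis[OF \<psi>])
      obtain w where w: "neumann_solution S A ?g w" using ex[OF Cc_inf_vec_mono[OF g]] by auto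
      have w12: "Y12 S w" by (rule neumann_solution_Y12[OF w])
      have gL2: "L2_norm S ?g = sqrt (\<integral>x. (\<psi> x)\<^sup>2 \<partial>lebesgue_on ?U)"
      proof -
        have "L2_norm S ?g = L2_norm S \<psi>" by (simp add: L2_norm_def norm_axis_vec)
        also have "\<dots> = L2_norm ?U \<psi>"
          using Cc_inf_L2_norm[OF \<psi> opU] Cc_inf_L2_norm[OF Cc_inf_mono[OF \<psi>] S] by simp
        finally show ?thesis by (simp add: L2_norm_def)
      qed
      have "(\<integral>x. u x $ i * \<psi> x \<partial>lebesgue_on ?U) = (\<integral>x. ?g x \<bullet> u x \<partial>lebesgue_on ?U)"
        by (simp add: inner_axis' mult.commute)
      also have "\<dots> = (\<integral>x. ?g x \<bullet> u x \<partial>lebesgue_on S)" by (rule integral_on_support[OF g, symmetric])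
      also have "\<dots> = (\<integral>x. f x \<bullet> w x \<partial>lebesgue_on S)" by (rule reciprocity[OF w u])
      also have "\<dots> = (\<integral>x. f x \<bullet> w x \<partial>lebesgue_on ?V)" by (rule integral_on_support[OF f])
      finally have eq: "(\<integral>x. u x $ i * \<psi> x \<partial>lebesgue_on ?U) = (\<integral>x. f x \<bullet> w x \<partial>lebesgue_on ?V)" .
      have AEw: "AE z in lebesgue_on ?V. norm (w z) \<le> c * L2_norm S ?g"
        using L2_Linf_off_diagonal[OF LB g w z0 R dist] by (simp add: c_def mult_ac)
      have fw: "integrable (lebesgue_on ?V) (\<lambda>x. f x \<bullet> w x)"
        by (rule L2_inner(1)[OF Cc_inf_vec_L2[OF f sets_ball] local_L2[OF w12]])
      have "\<bar>\<integral>x. f x \<bullet> w x \<partial>lebesgue_on ?V\<bar> \<le> (\<integral>x. norm (f x) * (c * L2_norm S ?g) \<partial>lebesgue_on ?V)"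
      proof (rule order_trans[OF integral_abs_bound integral_mono_AE])
        show "AE x in lebesgue_on ?V. \<bar>f x \<bullet> w x\<bar> \<le> norm (f x) * (c * L2_norm S ?g)"
          using AEw
        proof eventually_elim
          case (elim x)
          have "\<bar>f x \<bullet> w x\<bar> \<le> norm (f x) * norm (w x)" by (rule Cauchy_Schwarz_ineq2)
          also have "\<dots> \<le> norm (f x) * (c * L2_norm S ?g)" using elim by (intro mult_left_mono) auto
          finally show ?case .
        qed
      qed (use fw fi[OF sets_ball] in auto)
      also have "\<dots> = c * ?F * L2_norm S ?g" by (simp add: FV)
      finally show "\<bar>\<integral>x. u x $ i * \<psi> x \<partial>lebesgue_on ?U\<bar> \<le> c * ?F * sqrt (\<integral>x. (\<psi> x)\<^sup>2 \<partial>lebesgue_on ?U)"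
        unfolding eq gL2 .
    qed
    then have "(L2_norm ?U (\<lambda>x. u x $ i))\<^sup>2 \<le> (c * ?F)\<^sup>2" unfolding L2_norm_square by simp
    then show ?thesis by (rule power2_le_imp_le) (use c0 F0 in simp)
  qed
  have uU: "L2_norm ?U u \<le> real CARD('m) * (c * ?F)"
    by (rule L2_norm_components[OF L2_on_component[OF uL2] comp])
  have "AE x in lebesgue_on (S \<inter> ball x0 (R / 2)).
      norm (u x) \<le> C1 * (R powr (- (?n / 2)) * L2_norm ?U u + R\<^sup>2 * 0)"
  proof (rule cond_LB_bound[OF dim S LB Cc_inf_vec_mono[OF f] disjI2[OF u] x0 R])
    show "norm (f z) \<le> 0" if "z \<in> ?U" for z
    proof -
      have "z \<notin> ball z0 R" using that balls_apart[OF dist] by (auto simp: disjoint_iff)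
      then have "z \<notin> S \<inter> ball z0 (R / 2)" using R by auto
      then show ?thesis using Cc_inf_vec_outside[OF f] by simp
    qed
  qed auto
  moreover have "C1 * (R powr (- (?n / 2)) * L2_norm ?U u + R\<^sup>2 * 0) \<le> off_diagonal_const C1 * R powr (2 - ?n) * ?F"
  proof -
    have "C1 * (R powr (- (?n / 2)) * L2_norm ?U u + R\<^sup>2 * 0) \<le> C1 * (R powr (- (?n / 2)) * (real CARD('m) * (c * ?F)))"
      using uU C1 by (simp add: mult_left_mono)
    also have "\<dots> = off_diagonal_const C1 * (R powr (- (?n / 2)) * R powr (- (?n / 2)) * R\<^sup>2) * ?F"
      by (simp add: off_diagonal_const_def c_def power2_eq_square mult_ac)
    also have "R powr (- (?n / 2)) * R powr (- (?n / 2)) * R\<^sup>2 = R powr (- (?n / 2) + - (?n / 2) + 2)"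
      using R by (simp only: powr_add powr_numeral)
    also have "- (?n / 2) + - (?n / 2) + 2 = 2 - ?n" by simp
    finally show ?thesis .
  qed
  ultimately show ?thesis by (auto elim!: eventually_mono intro: order_trans)
qed

end

section \<open>The pointwise bound on the Neumann function\<close>

lemma AE_continuous_le:
  fixes h :: "'a::euclidean_space \<Rightarrow> real"
  assumes U: "open U" and h: "continuous_on U h" and le: "AE x in lebesgue_on U. h x \<le> c" and x: "x \<in> U"
  shows "h x \<le> c"
proof (rule ccontr)
  assume "\<not> h x \<le> c"
  let ?V = "U \<inter> h -` {c<..}"
  have V: "open ?V" by (rule continuous_open_preimage[OF h U]) auto
  have "AE x in lebesgue. x \<notin> ?V"
    using le lebesgue_open[OF U] by (auto simp: AE_restrict_space_iff elim!: eventually_mono)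
  then have "?V \<in> null_sets lebesgue"
    using AE_iff_null_sets[OF lebesgue_open[OF V]] by simp
  then have "negligible ?V" by (simp add: negligible_iff_null_sets)
  moreover have "?V \<noteq> {}" using x \<open>\<not> h x \<le> c\<close> by auto
  ultimately show False using open_not_negligible[OF V] by simp
qed

definition delta_sequence ::
  "(real^'d::finite) set \<Rightarrow> real^'d \<Rightarrow> (nat \<Rightarrow> real^'d \<Rightarrow> real) \<Rightarrow> bool" where
  "delta_sequence S z \<eta> \<longleftrightarrow> (\<forall>n. \<eta> n \<in> Cc_inf (S \<inter> ball z (1 / real (Suc n))) \<and> (\<forall>x. 0 \<le> \<eta> n x)
     \<and> (\<integral>x. \<eta> n x \<partial>lebesgue_on S) = 1)"

lemma delta_sequence_exists:
  assumes S: "open S" and z: "z \<in> S"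
  obtains \<eta> where "delta_sequence S z \<eta>"
proof -
  obtain e where e: "e > 0" "ball z e \<subseteq> S" using S z by (metis open_contains_ball)
  define r where "r n = min (e / 2) (1 / (2 * real (Suc n)))" for n
  have r0: "r n > 0" for n using e(1) by (simp add: r_def)
  have r: "r n > 0" "0 \<le> r n / 2" "r n / 2 < r n" for n using r0[of n] by auto
  define c where "c n y = cutoff (r n / 2) (r n) (y - z)" for n y
  have rs: "cball z (r n) \<subseteq> S \<inter> ball z (1 / real (Suc n))" for n
  proof -
    have "r n < e" using e(1) by (auto simp: r_def)
    moreover have "r n < 1 / real (Suc n)"
    proof -
      have "r n \<le> 1 / (2 * real (Suc n))" by (simp add: r_def)
      also have "\<dots> < 1 / real (Suc n)" by (simp add: field_simps)
      finally show ?thesis .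
    qed
    ultimately show ?thesis using e(2) by fastforce
  qed
  have c: "c n \<in> Cc_inf (S \<inter> ball z (1 / real (Suc n)))" for n
    unfolding c_def[abs_def] by (rule Cc_inf_mono[OF cutoff_compact_support[OF r(2,3)] rs])
  have c0: "c n y \<ge> 0" for n y unfolding c_def by (rule cutoff_range(1)[OF r(2,3)])
  define J where "J n = (\<integral>x. c n x \<partial>lebesgue_on S)" for n
  have ci: "integrable (lebesgue_on S) (c n)" for n
    by (rule Cc_inf_integrable[OF c lebesgue_open[OF S]])
  have J: "J n > 0" for n
  proof (rule ccontr)
    assume "\<not> J n > 0"
    moreover have "J n \<ge> 0" unfolding J_def using c0 by simp
    ultimately have "J n = 0" by simp
    then have "AE x in lebesgue_on S. c n x = 0"
      using integral_nonneg_eq_0_iff_AE[OF ci[of n]] c0 by (auto simp: J_def)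
    then have "AE x in lebesgue_on S. c n x \<le> 0" by eventually_elim simp
    then have "c n z \<le> 0"
      by (rule AE_continuous_le[OF S smooth_continuous_on[OF Cc_inf_smooth[OF c]] _ z])
    moreover have "c n z = 1" unfolding c_def using r by (intro cutoff_inside[of "r n / 2" "r n"]) auto
    ultimately show False by simp
  qed
  have "delta_sequence S z (\<lambda>n x. (1 / J n) * c n x)"
    unfolding delta_sequence_def
  proof (intro allI conjI)
    fix n
    show "(\<lambda>x. (1 / J n) * c n x) \<in> Cc_inf (S \<inter> ball z (1 / real (Suc n)))"
      by (rule Cc_inf_mult[OF smooth_const c])
    show "0 \<le> 1 / J n * c n x" for x using J[of n] c0[of n x] by simp
    have "(\<integral>x. 1 / J n * c n x \<partial>lebesgue_on S) = 1 / J n * J n" unfolding J_def by simp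
    then show "(\<integral>x. 1 / J n * c n x \<partial>lebesgue_on S) = 1" using J[of n] by simp
  qed
  then show ?thesis by (rule that)
qed

lemma delta_sequence_bound:
  fixes h :: "real^'d::finite \<Rightarrow> 'b::euclidean_space"
  assumes S: "open S" and \<eta>: "delta_sequence S z \<eta>"
    and B: "\<And>y. y \<in> S \<Longrightarrow> dist z y < 1 / real (Suc n) \<Longrightarrow> norm (h y) \<le> B" "B \<ge> 0"
  shows "norm (\<integral>y. \<eta> n y *\<^sub>R h y \<partial>lebesgue_on S) \<le> B"
proof -
  have c: "\<eta> n \<in> Cc_inf (S \<inter> ball z (1 / real (Suc n)))" and p: "\<And>x. 0 \<le> \<eta> n x"
    and one: "(\<integral>x. \<eta> n x \<partial>lebesgue_on S) = 1" using \<eta> by (auto simp: delta_sequence_def)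
  have i: "integrable (lebesgue_on S) (\<eta> n)" by (rule Cc_inf_integrable[OF c lebesgue_open[OF S]])
  have "norm (\<integral>y. \<eta> n y *\<^sub>R h y \<partial>lebesgue_on S) \<le> (\<integral>y. norm (\<eta> n y *\<^sub>R h y) \<partial>lebesgue_on S)"
    by (rule integral_norm_bound)
  also have "\<dots> \<le> (\<integral>y. \<eta> n y * B \<partial>lebesgue_on S)"
  proof (rule integral_mono')
    show "integrable (lebesgue_on S) (\<lambda>y. \<eta> n y * B)" using i by simp
    show "norm (\<eta> n y *\<^sub>R h y) \<le> \<eta> n y * B" if "y \<in> space (lebesgue_on S)" for y
    proof (cases "dist z y < 1 / real (Suc n)")
      case True
      then show ?thesis using B(1)[of y] that p by (simp add: mult_left_mono)
    next
      case False
      then have "\<eta> n y = 0" by (intro Cc_inf_outside[OF c]) auto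
      then show ?thesis by simp
    qed
    show "0 \<le> \<eta> n y * B" for y using p B(2) by simp
  qed
  also have "\<dots> = B" using one by simp
  finally show ?thesis .
qed

lemma delta_sequence_limit:
  fixes h :: "real^'d::finite \<Rightarrow> 'b::euclidean_space"
  assumes S: "open S" and \<eta>: "delta_sequence S z \<eta>" and V: "open V" "z \<in> V" and h: "continuous_on V h"
  shows "(\<lambda>n. \<integral>y. \<eta> n y *\<^sub>R h y \<partial>lebesgue_on S) \<longlonglongrightarrow> h z"
proof (rule LIMSEQ_I)
  fix \<epsilon> :: real assume \<epsilon>: "\<epsilon> > 0"
  have "\<exists>\<delta>>0. \<forall>y\<in>V. dist y z < \<delta> \<longrightarrow> dist (h y) (h z) < \<epsilon> / 2"
    using h V(2) \<epsilon> unfolding continuous_on_iff by (metis half_gt_zero)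
  then obtain \<delta>1 where \<delta>1: "\<delta>1 > 0" "\<And>y. y \<in> V \<Longrightarrow> dist y z < \<delta>1 \<Longrightarrow> dist (h y) (h z) < \<epsilon> / 2" by blast
  obtain \<delta>2 where \<delta>2: "\<delta>2 > 0" "ball z \<delta>2 \<subseteq> V" using V by (metis open_contains_ball)
  obtain N where N: "1 / real (Suc N) < min \<delta>1 \<delta>2"
    using reals_Archimedean[of "min \<delta>1 \<delta>2"] \<delta>1(1) \<delta>2(1) by (auto simp: inverse_eq_divide)
  have "norm ((\<integral>y. \<eta> n y *\<^sub>R h y \<partial>lebesgue_on S) - h z) < \<epsilon>" if n: "n \<ge> N" for n
  proof -
    have c: "\<eta> n \<in> Cc_inf (S \<inter> ball z (1 / real (Suc n)))"
      and one: "(\<integral>x. \<eta> n x \<partial>lebesgue_on S) = 1" using \<eta> by (auto simp: delta_sequence_def)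
    have "1 / real (Suc n) \<le> 1 / real (Suc N)" using n by (simp add: frac_le)
    then have small: "1 / real (Suc n) < \<delta>1" "1 / real (Suc n) < \<delta>2" using N by auto
    obtain T where T: "compact T" "T \<subseteq> S \<inter> ball z (1 / real (Suc n))" "\<And>x. x \<notin> T \<Longrightarrow> \<eta> n x = 0"
      using c by (metis Cc_infE)
    have TV: "T \<subseteq> V" using T(2) small \<delta>2(2) by fastforce
    have i: "integrable (lebesgue_on S) (\<eta> n)" by (rule Cc_inf_integrable[OF c lebesgue_open[OF S]])
    have ih: "integrable (lebesgue_on S) (\<lambda>y. \<eta> n y *\<^sub>R h y)"
    proof -
      have "continuous_on T (\<lambda>y. \<eta> n y *\<^sub>R h y)"
        by (intro continuous_on_scaleR smooth_continuous_on Cc_inf_smooth[OF c] continuous_on_subset[OF h TV])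
      then have "integrable lborel (\<lambda>y. indicator T y *\<^sub>R (\<eta> n y *\<^sub>R h y))"
        by (rule borel_integrable_compact[OF T(1)])
      then have "integrable lebesgue (\<lambda>y. indicator T y *\<^sub>R (\<eta> n y *\<^sub>R h y))"
        using integrable_completion[OF borel_measurable_integrable] by blast
      then have "integrable (lebesgue_on T) (\<lambda>y. \<eta> n y *\<^sub>R h y)"
        using T(1) by (simp add: integrable_restrict_space lebesgue_compact)
      then show ?thesis
        by (subst integral_lebesgue_on_eq(2)[of _ T _ "\<lambda>y. \<eta> n y *\<^sub>R h y"])
           (use T S in \<open>auto simp: lebesgue_open lebesgue_compact\<close>)
    qed
    have "(\<integral>y. \<eta> n y *\<^sub>R h y \<partial>lebesgue_on S) - h z = (\<integral>y. \<eta> n y *\<^sub>R h y \<partial>lebesgue_on S) - (\<integral>y. \<eta> n y *\<^sub>R h z \<partial>lebesgue_on S)"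
      using one i by simp
    also have "\<dots> = (\<integral>y. \<eta> n y *\<^sub>R (h y - h z) \<partial>lebesgue_on S)"
      using ih i by (simp add: scaleR_diff_right)
    also have "norm \<dots> \<le> \<epsilon> / 2"
    proof (rule delta_sequence_bound[OF S \<eta>])
      fix y assume "y \<in> S" "dist z y < 1 / real (Suc n)"
      then have "y \<in> V" "dist y z < \<delta>1" using small \<delta>2(2) by (auto simp: dist_commute)
      from \<delta>1(2)[OF this] show "norm (h y - h z) \<le> \<epsilon> / 2" by (simp add: dist_norm)
    qed (use \<epsilon> in simp)
    finally show ?thesis using \<epsilon> by simp
  qed
  then show "\<exists>no. \<forall>n\<ge>no. norm ((\<integral>y. \<eta> n y *\<^sub>R h y \<partial>lebesgue_on S) - h z) < \<epsilon>" by blast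
qed

lemma real_mat_transpose: "real_mat (transpose B) = transpose (real_mat B)"
  by (simp add: real_mat_def transpose_def vec_eq_iff)

lemma norm_column_le: "norm (column k B) \<le> norm B" for B :: "real^'m::finite^'n::finite"
  unfolding norm_vec_def[of "column k B"] norm_vec_def[of B]
  by (rule L2_set_mono) (auto simp: column_def component_le_norm_cart)

lemma norm_row_le: "norm (row k B) \<le> norm B" for B :: "real^'m::finite^'n::finite"
  by (simp add: row_def Finite_Cartesian_Product.norm_nth_le)

lemma norm_transpose: "norm (transpose B) = norm B" for B :: "real^'n::finite^'m::finite"
proof -
  have "(norm (transpose B))\<^sup>2 = (\<Sum>i\<in>UNIV. \<Sum>j\<in>UNIV. (norm (B $ j $ i))\<^sup>2)"
    by (simp only: norm_square_components transpose_def vec_lambda_beta)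
  also have "\<dots> = (\<Sum>j\<in>UNIV. \<Sum>i\<in>UNIV. (norm (B $ j $ i))\<^sup>2)" by (rule sum.swap)
  also have "\<dots> = (norm B)\<^sup>2" by (simp add: norm_square_components)
  finally show ?thesis by (simp add: power2_eq_iff_nonneg)
qed

lemma transpose_mult_axis: "transpose B *v axis k c = c *\<^sub>R row k B" for B :: "real^'m^'n::finite"
proof -
  have "(\<Sum>j\<in>UNIV. B $ j $ i * axis k c $ j) = B $ k $ i * c" for i
  proof -
    have "(\<Sum>j\<in>UNIV. B $ j $ i * axis k c $ j) = (\<Sum>j\<in>UNIV. if j = k then B $ j $ i * c else 0)"
      by (rule sum.cong) (auto simp: axis_def)
    then show ?thesis by simp
  qed
  then show ?thesis
    by (simp add: matrix_vector_mult_def transpose_def row_def vec_eq_iff mult.commute)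
qed

lemma neumann_function_solution:
  fixes N :: "('d::finite, 'm::finite) kernel"
  assumes "open S" "neumann_function S A N" "f \<in> Cc_inf_vec S"
  shows "neumann_solution S (adjoint_coeffs A) f (\<lambda>x. \<integral>y. transpose (real_mat (N y x)) *v f y \<partial>lebesgue_on S)"
  using assms by (simp add: neumann_function_def set_integral_lebesgue_on lebesgue_open)

lemma neumann_pair_adjoint: "neumann_pair S A N Nt \<Longrightarrow> neumann_pair S (adjoint_coeffs A) Nt N"
proof -
  assume NP: "neumann_pair S A N Nt"
  then have "\<forall>x\<in>S. \<forall>y\<in>S. x \<noteq> y \<longrightarrow> N x y = transpose (Nt y x)"
    by (simp add: neumann_pair_def transpose_transpose)
  with NP show ?thesis
    unfolding neumann_pair_def adjoint_adjoint insert_commute[of Nt N] by (elim conjE) (intro conjI; assumption)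
qed

lemma neumann_pair_continuous:
  assumes "neumann_pair S A N Nt" "y \<in> S"
  shows "continuous_on (S - {y}) (\<lambda>x. real_mat (N x y))"
  using assms by (simp add: neumann_pair_def)

lemma neumann_pair_transpose:
  assumes "neumann_pair S A N Nt" "x \<in> S" "y \<in> S" "x \<noteq> y"
  shows "real_mat (Nt x y) = transpose (real_mat (N y x))"
  using assms by (simp add: neumann_pair_def real_mat_transpose)

lemma continuous_on_row: "continuous_on U h \<Longrightarrow> continuous_on U (\<lambda>x. row k (h x))"
  for h :: "'a::topological_space \<Rightarrow> real^'m::finite^'n::finite"
  by (simp add: row_def continuous_on_component)

lemma continuous_on_column: "continuous_on U h \<Longrightarrow> continuous_on U (\<lambda>x. column k (h x))"
  for h :: "'a::topological_space \<Rightarrow> real^'m::finite^'n::finite"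
  unfolding column_def by (intro continuous_on_vec_lambda continuous_on_component)

context elliptic_domain
begin

definition pointwise_const :: "real \<Rightarrow> real" where
  "pointwise_const C1 = real CARD('m) * (off_diagonal_const C1 * 2 powr (real CARD('d) - 2))"

lemma neumann_solution_exists:
  assumes "neumann_pair S A N Nt" "g \<in> Cc_inf_vec S"
  shows "\<exists>w. neumann_solution S A g w"
  using neumann_function_solution[OF S _ assms(2), of "adjoint_coeffs A" Nt] assms(1)
  by (auto simp: neumann_pair_def)

text \<open>Data that concentrate at \<open>z0\<close> have norm 1 in $L^1$, and the corresponding solutions converge to a row
  of \<open>N\<close> because \<open>N\<close> is continuous in its first variable off the pole. The resulting bound holds
  almost everywhere in the second variable. It extends to the point \<open>x0\<close> because the row of \<open>N\<close> is a
  column of \<open>Nt\<close> with exchanged arguments, which is continuous in that variable.\<close>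

lemma neumann_function_pointwise:
  assumes NP: "neumann_pair S A N Nt" and LB: "cond_LB S A C1" and z0: "z0 \<in> S" and x0: "x0 \<in> S" and ne: "z0 \<noteq> x0"
  shows "norm (real_mat (N z0 x0)) \<le> pointwise_const C1 * norm (z0 - x0) powr (2 - real CARD('d))"
proof -
  let ?n = "real CARD('d)"
  define R where "R = dist x0 z0 / 2"
  have R: "R > 0" "dist x0 z0 \<ge> 2 * R" using ne by (auto simp: R_def)
  let ?B = "off_diagonal_const C1 * R powr (2 - ?n)"
  obtain \<eta> where \<eta>: "delta_sequence S z0 \<eta>" using delta_sequence_exists[OF S z0] .
  obtain n0 where n0: "1 / real (Suc n0) < R / 2"
    using reals_Archimedean[of "R / 2"] R(1) by (auto simp: inverse_eq_divide)
  have rowb: "norm (row k (real_mat (N z0 x0))) \<le> ?B" for k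
  proof -
    let ?f = "\<lambda>n y. axis k (\<eta> n y) :: real^'m"
    let ?u = "\<lambda>n x. \<integral>y. \<eta> n y *\<^sub>R row k (real_mat (N y x)) \<partial>lebesgue_on S"
    have AE1: "AE x in lebesgue_on (S \<inter> ball x0 (R / 2)). norm (?u n x) \<le> ?B" if n: "n \<ge> n0" for n
    proof -
      have c: "\<eta> n \<in> Cc_inf (S \<inter> ball z0 (1 / real (Suc n)))" and p: "\<And>x. 0 \<le> \<eta> n x"
        and one: "(\<integral>x. \<eta> n x \<partial>lebesgue_on S) = 1" using \<eta> by (auto simp: delta_sequence_def)
      have "1 / real (Suc n) \<le> 1 / real (Suc n0)" using n by (simp add: frac_le)
      then have "1 / real (Suc n) \<le> R / 2" using n0 by linarith
      then have "\<eta> n \<in> Cc_inf (S \<inter> ball z0 (R / 2))" by (intro Cc_inf_mono[OF c]) auto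
      then have f: "?f n \<in> Cc_inf_vec (S \<inter> ball z0 (R / 2))" by (rule Cc_inf_vec_axis)
      have "neumann_solution S (adjoint_coeffs A) (?f n) (?u n)"
        using neumann_function_solution[OF S _ Cc_inf_vec_mono[OF f], of A N] NP
        unfolding transpose_mult_axis by (simp add: neumann_pair_def)
      from L1_Linf_off_diagonal[OF LB neumann_solution_exists[OF NP] f this z0 x0 R] show ?thesis
        using one p by (simp add: norm_axis_vec)
    qed
    have "AE x in lebesgue_on (S \<inter> ball x0 (R / 2)). \<forall>n. n \<ge> n0 \<longrightarrow> norm (?u n x) \<le> ?B"
      using AE1 by (simp add: AE_all_countable)
    moreover have "AE x in lebesgue_on (S \<inter> ball x0 (R / 2)). x \<in> S \<inter> ball x0 (R / 2)"
      using sets_ball by (auto simp: AE_restrict_space_iff)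
    ultimately have "AE x in lebesgue_on (S \<inter> ball x0 (R / 2)). norm (column k (real_mat (Nt x z0))) \<le> ?B"
    proof eventually_elim
      case (elim x)
      then have xS: "x \<in> S" and xz: "z0 \<noteq> x" using R by (auto simp: dist_commute)
      have "(\<lambda>n. \<integral>y. \<eta> n y *\<^sub>R row k (real_mat (N y x)) \<partial>lebesgue_on S) \<longlonglongrightarrow> row k (real_mat (N z0 x))"
        using S z0 xz neumann_pair_continuous[OF NP xS]
        by (intro delta_sequence_limit[OF S \<eta>, of "S - {x}"] continuous_on_row) auto
      then have "norm (row k (real_mat (N z0 x))) \<le> ?B"
        using elim(1) by (intro LIMSEQ_le_const2[OF tendsto_norm]) blast+
      moreover have "column k (real_mat (Nt x z0)) = row k (real_mat (N z0 x))"
        using neumann_pair_transpose[OF NP xS z0] xz by (auto simp: column_transpose)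
      ultimately show ?case by simp
    qed
    then have "norm (column k (real_mat (Nt x0 z0))) \<le> ?B"
    proof (rule AE_continuous_le[rotated 2])
      show "open (S \<inter> ball x0 (R / 2))" using S by auto
      show "x0 \<in> S \<inter> ball x0 (R / 2)" using x0 R by auto
      have "continuous_on (S - {z0}) (\<lambda>x. column k (real_mat (Nt x z0)))"
        by (intro continuous_on_column neumann_pair_continuous[OF neumann_pair_adjoint[OF NP] z0])
      moreover have "z0 \<notin> ball x0 (R / 2)" using R by auto
      ultimately show "continuous_on (S \<inter> ball x0 (R / 2)) (\<lambda>x. norm (column k (real_mat (Nt x z0))))"
        by (intro continuous_on_norm) (auto elim: continuous_on_subset)
    qed
    moreover have "column k (real_mat (Nt x0 z0)) = row k (real_mat (N z0 x0))"
      using neumann_pair_transpose[OF NP x0 z0] ne by (auto simp: column_transpose)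
    ultimately show ?thesis by simp
  qed
  have "norm (real_mat (N z0 x0)) \<le> (\<Sum>k\<in>UNIV. norm (real_mat (N z0 x0) $ k))"
    unfolding norm_vec_def by (rule L2_set_le_sum) simp
  also have "\<dots> \<le> (\<Sum>k\<in>(UNIV::'m set). ?B)"
    using rowb by (intro sum_mono) (simp add: row_def)
  also have "\<dots> = real CARD('m) * (off_diagonal_const C1 * (dist x0 z0 / 2) powr (2 - ?n))"
    by (simp add: R_def)
  also have "(dist x0 z0 / 2) powr (2 - ?n) = 2 powr (?n - 2) * norm (z0 - x0) powr (2 - ?n)"
    by (simp add: powr_divide dist_norm norm_minus_commute powr_diff field_simps)
  finally show ?thesis by (simp add: pointwise_const_def mult_ac)
qed

end

section \<open>Rescaled cutoffs\<close>

text \<open>A bound for the slope of the cutoff at unit scale, depending on the dimension only; at scale \<open>R\<close> it is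
  divided by \<open>R\<close>.\<close>

definition cutoff_slope :: "'d::finite itself \<Rightarrow> real \<Rightarrow> real \<Rightarrow> real" where
  "cutoff_slope _ a b = (SOME B. B > 0 \<and> (\<forall>x::real^'d. norm (gradient (cutoff a b) x) \<le> B))"

lemma tame_cutoff_cutoff: "0 \<le> a \<Longrightarrow> a < b \<Longrightarrow> tame_cutoff (cutoff a b)"
  using tame_cutoff_test_function[OF cutoff_compact_support[of a b 0]] by simp

lemma cutoff_slope:
  assumes "0 \<le> a" "a < b"
  shows "cutoff_slope TYPE('d::finite) a b > 0"
    and "norm (gradient (cutoff a b) (x::real^'d)) \<le> cutoff_slope TYPE('d) a b"
proof -
  obtain B where "B > 0" "\<And>x::real^'d. norm (gradient (cutoff a b) x) \<le> B"
    using tame_cutoff_gradient_bounded[OF tame_cutoff_cutoff[OF assms]] by metis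
  then have "\<exists>B. B > 0 \<and> (\<forall>x::real^'d. norm (gradient (cutoff a b) x) \<le> B)" by blast
  from someI_ex[OF this]
  show "cutoff_slope TYPE('d) a b > 0"
    and "norm (gradient (cutoff a b) (x::real^'d)) \<le> cutoff_slope TYPE('d) a b"
    unfolding cutoff_slope_def by blast+
qed

definition cutoff_at :: "real^'d::finite \<Rightarrow> real \<Rightarrow> real \<Rightarrow> real \<Rightarrow> real^'d \<Rightarrow> real" where
  "cutoff_at z R a b x = cutoff a b ((1 / R) *\<^sub>R (x - z))"

context
  fixes z :: "real^'d::finite" and R a b :: real
  assumes R: "R > 0" and ab: "0 \<le> a" "a < b"
begin

lemma cutoff_at_affine: "cutoff_at z R a b = (\<lambda>x. cutoff a b (- ((1 / R) *\<^sub>R z) + (1 / R) *\<^sub>R x))"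
  by (simp add: cutoff_at_def fun_eq_iff algebra_simps)

lemma cutoff_at_smooth: "smooth (cutoff_at z R a b)"
  unfolding cutoff_at_affine by (rule smooth_affine[OF smooth_cutoff[OF ab]])

lemma cutoff_at_range: "0 \<le> cutoff_at z R a b x" "cutoff_at z R a b x \<le> 1"
  unfolding cutoff_at_def using cutoff_range[OF ab] by auto

lemma norm_rescaled: "norm ((1 / R) *\<^sub>R (x - z)) = dist z x / R"
  using R by (simp add: dist_norm norm_minus_commute)

lemma cutoff_at_inside: "dist z x \<le> a * R \<Longrightarrow> cutoff_at z R a b x = 1"
  unfolding cutoff_at_def using R by (intro cutoff_inside[OF ab]) (simp only: norm_rescaled pos_divide_le_eq)

lemma cutoff_at_outside: "dist z x \<ge> b * R \<Longrightarrow> cutoff_at z R a b x = 0"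
  unfolding cutoff_at_def using R by (intro cutoff_outside[OF ab]) (simp only: norm_rescaled pos_le_divide_eq)

lemma cutoff_at_support: "cutoff_at z R a b \<in> Cc_inf (cball z (b * R))"
  by (rule Cc_infI[OF cutoff_at_smooth compact_cball subset_refl]) (auto intro: cutoff_at_outside)

lemma cutoff_at_tame: "tame_cutoff (cutoff_at z R a b)"
  by (rule tame_cutoff_test_function[OF cutoff_at_support])

lemma cutoff_at_gradient_bound: "norm (gradient (cutoff_at z R a b) x) \<le> cutoff_slope TYPE('d) a b / R"
proof -
  have "gradient (cutoff_at z R a b) x = (1 / R) *\<^sub>R gradient (cutoff a b) (- ((1 / R) *\<^sub>R z) + (1 / R) *\<^sub>R x)"
    unfolding gradient_def cutoff_at_affine pd_affine[OF smooth_differentiable[OF smooth_cutoff[OF ab]]]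
    by (simp only: vec_eq_iff vec_lambda_beta vector_scaleR_component real_scaleR_def simp_thms)
  then show ?thesis using cutoff_slope(2)[OF ab, of "- ((1 / R) *\<^sub>R z) + (1 / R) *\<^sub>R x"] R
    by (simp add: divide_right_mono)
qed

lemma cutoff_at_gradient_inside: "dist z x < a * R \<Longrightarrow> gradient (cutoff_at z R a b) x = 0"
proof -
  assume "dist z x < a * R"
  then have "pd \<alpha> (cutoff_at z R a b) x = 0" for \<alpha>
    by (intro pd_locally_const[of "ball z (a * R)" x _ 1]) (auto intro: cutoff_at_inside)
  then show ?thesis by (simp add: gradient_def vec_eq_iff)
qed

lemma cutoff_at_gradient_outside: "dist z x > b * R \<Longrightarrow> gradient (cutoff_at z R a b) x = 0"
proof -
  assume "dist z x > b * R"
  then have "pd \<alpha> (cutoff_at z R a b) x = 0" for \<alpha>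
    by (intro pd_locally_const[of "- cball z (b * R)" x _ 0]) (auto intro: cutoff_at_outside)
  then show ?thesis by (simp add: gradient_def vec_eq_iff)
qed

end

section \<open>The gradient of the Neumann function away from the pole\<close>

context elliptic_domain
begin

lemma caccioppoli_source_free:
  assumes u: "neumann_solution S A f u" and \<theta>: "tame_cutoff \<theta>"
    and f: "\<And>x. x \<in> S \<Longrightarrow> \<theta> x \<noteq> 0 \<Longrightarrow> f x = 0"
  shows "L2_norm S (\<lambda>x. \<theta> x *\<^sub>R wgrad S u x)
    \<le> 2 * form_bound TYPE('d) TYPE('m) M / lam * L2_norm S (\<lambda>x. outer (u x) (gradient \<theta> x))"
proof -
  let ?c = "form_bound TYPE('d) TYPE('m) M"
  let ?X = "L2_norm S (\<lambda>x. \<theta> x *\<^sub>R wgrad S u x)" and ?Y = "L2_norm S (\<lambda>x. outer (u x) (gradient \<theta> x))"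
  have c0: "?c \<ge> 0" using form_bound_pos[OF M] by (rule less_imp_le)
  have "(\<theta> x)\<^sup>2 * (f x \<bullet> u x) = 0" if "x \<in> S" for x using f[OF that] by (cases "\<theta> x = 0") auto
  then have "(\<integral>x. (\<theta> x)\<^sup>2 * (f x \<bullet> u x) \<partial>lebesgue_on S) = (\<integral>x. 0 \<partial>lebesgue_on S)"
    by (intro Bochner_Integration.integral_cong) auto
  then have "lam * ?X\<^sup>2 \<le> 4 * ?c\<^sup>2 / lam * ?Y\<^sup>2"
    using caccioppoli[OF dim S A lam u \<theta>] by simp
  then have "?X\<^sup>2 \<le> (2 * ?c / lam * ?Y)\<^sup>2"
    using lam by (simp add: power2_eq_square field_simps)
  then show ?thesis
    by (rule power2_le_imp_le) (use c0 lam in simp)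
qed

definition annulus_const :: "real \<Rightarrow> real" where
  "annulus_const P = 2 * form_bound TYPE('d) TYPE('m) M / lam * (P * 4 powr (real CARD('d) - 2)
     * cutoff_slope TYPE('d) (1 / 2) 1 * sqrt (unit_ball_vol (real CARD('d)) * 2 ^ CARD('d)))"

text \<open>The cutoff vanishes for distances below $r/2$ from \<open>y\<close> and is 1 from distance \<open>r\<close> on. Its gradient
  lives in the annulus between, where \<open>u\<close> has size $r^{2-d}$.\<close>

lemma exterior_gradient_bound:
  assumes u: "neumann_solution S A f u" and f: "\<And>x. x \<in> S \<Longrightarrow> dist y x \<ge> r / 2 \<Longrightarrow> f x = 0"
    and r: "r > 0" and P: "P \<ge> 0"
    and bound: "\<And>x. x \<in> S \<Longrightarrow> dist y x \<ge> r / 2 \<Longrightarrow> norm (u x) \<le> P * (r / 4) powr (2 - real CARD('d))"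
  shows "L2_norm (S - cball y r) (wgrad S u) \<le> annulus_const P * r powr (1 - real CARD('d) / 2)"
proof -
  let ?n = "real CARD('d)"
  let ?\<beta> = "cutoff_at y r (1 / 2) 1"
  let ?\<zeta> = "\<lambda>x. 1 - ?\<beta> x"
  let ?c = "form_bound TYPE('d) TYPE('m) M"
  have ab: "(0::real) \<le> 1 / 2" "(1 / 2 :: real) < 1" by auto
  have \<zeta>: "tame_cutoff ?\<zeta>" by (rule tame_cutoff_complement[OF cutoff_at_tame[OF r ab]])
  have u12: "Y12 S u" by (rule neumann_solution_Y12[OF u])
  have D: "L2_on S (wgrad S u)" using u12 S by (simp add: Y12_iff)
  let ?X = "L2_norm S (\<lambda>x. ?\<zeta> x *\<^sub>R wgrad S u x)" and ?Y = "L2_norm S (\<lambda>x. outer (u x) (gradient ?\<zeta> x))"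
  have c0: "?c \<ge> 0" using form_bound_pos[OF M] by (rule less_imp_le)
  have XY: "?X \<le> 2 * ?c / lam * ?Y"
  proof (rule caccioppoli_source_free[OF u \<zeta>])
    fix x assume x: "x \<in> S" "?\<zeta> x \<noteq> 0"
    have "dist y x \<ge> r / 2"
    proof (rule ccontr)
      assume "\<not> dist y x \<ge> r / 2"
      then have "?\<beta> x = 1" by (intro cutoff_at_inside[OF r ab]) auto
      with x(2) show False by simp
    qed
    with x(1) show "f x = 0" by (rule f)
  qed
  let ?B = "P * (r / 4) powr (2 - ?n) * (cutoff_slope TYPE('d) (1 / 2) 1 / r)"
  have Y: "?Y \<le> ?B * sqrt (unit_ball_vol ?n * (2 * r) ^ CARD('d))"
  proof (rule L2_norm_bounded[OF lebesgue_open[OF S] L2_on_outer_gradient[OF dim S u12 \<zeta>]])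
    fix x assume x: "x \<in> S"
    show "norm (outer (u x) (gradient ?\<zeta> x)) \<le> ?B"
    proof (cases "dist y x \<ge> r / 2")
      case True
      then show ?thesis
        unfolding norm_outer gradient_complement[OF cutoff_at_smooth[OF r ab]] norm_minus_cancel
        by (intro mult_mono bound x cutoff_at_gradient_bound[OF r ab]) (use P in auto)
    next
      case False
      then have "gradient ?\<beta> x = 0" by (intro cutoff_at_gradient_inside[OF r ab]) auto
      then show ?thesis
        unfolding norm_outer gradient_complement[OF cutoff_at_smooth[OF r ab]]
        using P r cutoff_slope(1)[OF ab, where 'd='d] by simp
    qed
  next
    fix x assume "x \<in> S" "dist y x \<ge> 2 * r"
    then have "gradient ?\<beta> x = 0" using r by (intro cutoff_at_gradient_outside[OF r ab]) auto
    then have "norm (outer (u x) (gradient ?\<zeta> x)) = 0"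
      unfolding norm_outer gradient_complement[OF cutoff_at_smooth[OF r ab]] by simp
    then show "outer (u x) (gradient ?\<zeta> x) = 0" by simp
  qed (use P r cutoff_slope(1)[OF ab, where 'd='d] in auto)
  have eq: "?B * sqrt (unit_ball_vol ?n * (2 * r) ^ CARD('d))
      = P * 4 powr (?n - 2) * cutoff_slope TYPE('d) (1 / 2) 1 * sqrt (unit_ball_vol ?n * 2 ^ CARD('d)) * r powr (1 - ?n / 2)"
  proof -
    have "?B * sqrt (unit_ball_vol ?n * (2 * r) ^ CARD('d)) = P * cutoff_slope TYPE('d) (1 / 2) 1
        * ((r / 4) powr (2 - ?n) / r * sqrt (unit_ball_vol ?n * 2 ^ CARD('d) * r ^ CARD('d)))"
      by (simp add: power_mult_distrib mult_ac)
    then show ?thesis unfolding annulus_scaling[OF r zero_less_numeral] by (simp add: mult_ac)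
  qed
  have "L2_norm (S - cball y r) (wgrad S u) \<le> L2_norm (S - cball y r) (\<lambda>x. ?\<zeta> x *\<^sub>R wgrad S u x)"
  proof (rule L2_norm_mono)
    have sub: "S - cball y r \<in> sets lebesgue" using S by (intro lebesgue_open) auto
    show "L2_on (S - cball y r) (\<lambda>x. ?\<zeta> x *\<^sub>R wgrad S u x)"
      by (rule L2_on_subset[OF L2_on_scale[OF D \<zeta>]]) (use S sub in \<open>auto simp: lebesgue_open\<close>)
    show "L2_on (S - cball y r) (wgrad S u)"
      by (rule L2_on_subset[OF D]) (use S sub in \<open>auto simp: lebesgue_open\<close>)
    have "?\<beta> x = 0" if "x \<notin> cball y r" for x
      using that by (intro cutoff_at_outside[OF r ab]) auto
    then show "AE x in lebesgue_on (S - cball y r). norm (wgrad S u x) \<le> norm (?\<zeta> x *\<^sub>R wgrad S u x)"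
      using sub by (auto simp: AE_restrict_space_iff)
  qed
  also have "\<dots> \<le> ?X"
    by (rule L2_norm_subset[OF L2_on_scale[OF D \<zeta>]]) (use S in \<open>auto simp: lebesgue_open intro!: lebesgue_open\<close>)
  also have "?X \<le> 2 * ?c / lam * (?B * sqrt (unit_ball_vol ?n * (2 * r) ^ CARD('d)))"
    using XY Y c0 lam by (intro order_trans[OF XY] mult_left_mono) auto
  finally show ?thesis unfolding eq by (simp add: annulus_const_def mult_ac)
qed

definition gradient_const :: "real \<Rightarrow> real" where
  "gradient_const P = (real CARD('m))\<^sup>2 * real CARD('d) * annulus_const P"

text \<open>The solutions with data concentrating at \<open>y\<close> converge pointwise to a column of \<open>N\<close> and are bounded
  away from \<open>y\<close> uniformly. By dominated convergence their weak gradients, paired with test functions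
  supported away from \<open>y\<close>, converge to that of \<open>N\<close>; duality turns the bound on the pairings into an
  $L^2$ bound.\<close>

lemma kernel_gradient_bound:
  fixes N Nt :: "('d, 'm) kernel"
  assumes NP: "neumann_pair S A N Nt" and P: "P \<ge> 0"
    and pw: "\<And>x z. x \<in> S \<Longrightarrow> z \<in> S \<Longrightarrow> x \<noteq> z \<Longrightarrow> norm (real_mat (N x z)) \<le> P * norm (x - z) powr (2 - real CARD('d))"
    and y: "y \<in> S" and r: "r > 0"
  shows "L2_on (S - cball y r) (kernel_grad S N y)"
    and "L2_norm (S - cball y r) (kernel_grad S N y)
      \<le> gradient_const P * r powr (1 - real CARD('d) / 2)"
proof -
  let ?n = "real CARD('d)"
  let ?U = "S - cball y r"
  let ?E = "annulus_const P * r powr (1 - ?n / 2)"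
  have U: "open ?U" using S by auto
  obtain \<eta> where \<eta>: "delta_sequence S y \<eta>" using delta_sequence_exists[OF S y] .
  obtain n0 where n0: "1 / real (Suc n0) < r / 4"
    using reals_Archimedean[of "r / 4"] r by (auto simp: inverse_eq_divide)
  have small: "1 / real (Suc n) < r / 4" if "n \<ge> n0" for n
  proof -
    have "1 / real (Suc n) \<le> 1 / real (Suc n0)" using that by (simp add: frac_le)
    then show ?thesis using n0 by linarith
  qed
  have comp: "L2_on ?U (\<lambda>x. wgrad S (kernel_col N y k) x $ i $ \<alpha>) \<and>
      L2_norm ?U (\<lambda>x. wgrad S (kernel_col N y k) x $ i $ \<alpha>) \<le> ?E" for k i \<alpha>
  proof -
    let ?f = "\<lambda>n z. axis k (\<eta> n z) :: real^'m"
    define u where "u n x = (\<integral>z. \<eta> n z *\<^sub>R row k (real_mat (Nt z x)) \<partial>lebesgue_on S)" for n x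
    have f: "?f n \<in> Cc_inf_vec (S \<inter> ball y (1 / real (Suc n)))" for n
      using \<eta> by (intro Cc_inf_vec_axis) (auto simp: delta_sequence_def)
    have sol: "neumann_solution S A (?f n) (u n)" for n
      using neumann_function_solution[OF S _ Cc_inf_vec_mono[OF f], of "adjoint_coeffs A" Nt n] NP
      unfolding transpose_mult_axis u_def[abs_def] by (simp add: neumann_pair_def)
    (* The data stay within r / 4 of y, so a point at distance r / 2 keeps distance r / 4 from them. *)
    have ub: "norm (u n x) \<le> P * (r / 4) powr (2 - ?n)" if n: "n \<ge> n0" and x: "x \<in> S" "dist y x \<ge> r / 2" for n x
      unfolding u_def
    proof (rule delta_sequence_bound[OF S \<eta>])
      fix z assume z: "z \<in> S" "dist y z < 1 / real (Suc n)"
      have "dist x z \<ge> r / 4"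
        using small[OF n] z(2) x(2) dist_triangle[of y x z] by (simp add: dist_commute)
      then have ne: "x \<noteq> z" and xz: "norm (x - z) \<ge> r / 4" using r by (auto simp: dist_norm)
      have "row k (real_mat (Nt z x)) = column k (real_mat (N x z))"
        using neumann_pair_transpose[OF NP z(1) x(1)] ne by (auto simp: row_transpose)
      then have "norm (row k (real_mat (Nt z x))) \<le> norm (real_mat (N x z))" by (simp add: norm_column_le)
      also have "\<dots> \<le> P * norm (x - z) powr (2 - ?n)" by (rule pw[OF x(1) z(1) ne])
      also have "\<dots> \<le> P * (r / 4) powr (2 - ?n)"
        using P xz r dim by (intro mult_left_mono powr_mono2') auto
      finally show "norm (row k (real_mat (Nt z x))) \<le> P * (r / 4) powr (2 - ?n)" .
    qed (use P in simp)
    have lim: "(\<lambda>n. u n x) \<longlonglongrightarrow> kernel_col N y k x" if x: "x \<in> S" "x \<noteq> y" for x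
    proof -
      have "(\<lambda>n. u n x) \<longlonglongrightarrow> row k (real_mat (Nt y x))"
        unfolding u_def using S y x neumann_pair_continuous[OF neumann_pair_adjoint[OF NP] x(1)]
        by (intro delta_sequence_limit[OF S \<eta>, of "S - {x}"] continuous_on_row) auto
      moreover have "row k (real_mat (Nt y x)) = kernel_col N y k x"
        using neumann_pair_transpose[OF NP y x(1)] x(2) by (auto simp: row_transpose kernel_col_def)
      ultimately show ?thesis by simp
    qed
    have gb: "L2_norm ?U (wgrad S (u n)) \<le> ?E" if n: "n \<ge> n0" for n
    proof (rule exterior_gradient_bound[OF sol _ r P ub[OF n]])
      fix x assume "dist y x \<ge> r / 2"
      then have "x \<notin> ball y (1 / real (Suc n))" using small[OF n] r by auto
      then show "?f n x = 0" by (intro Cc_inf_vec_outside[OF f]) auto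
    qed
    have W: "has_weak_gradient S (kernel_col N y k) (wgrad S (kernel_col N y k))"
      using NP y by (intro wgrad_weak_gradient) (auto simp: neumann_pair_def neumann_function_def)
    then have Wp: "has_weak_partial S \<alpha> (\<lambda>x. kernel_col N y k x $ i) (\<lambda>x. wgrad S (kernel_col N y k) x $ i $ \<alpha>)"
      by (auto simp: has_weak_gradient_def)
    have up: "has_weak_partial S \<alpha> (\<lambda>x. u n x $ i) (\<lambda>x. wgrad S (u n) x $ i $ \<alpha>)" for n
      using neumann_solution_Y12[OF sol[of n]] S by (auto simp: Y12_iff has_weak_gradient_def)
    have L1: "L1_loc ?U (\<lambda>x. wgrad S (kernel_col N y k) x $ i $ \<alpha>)"
      using Wp L1_loc_subset[of S _ ?U] by (auto simp: has_weak_partial_def)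
    have bnd: "\<bar>\<integral>x. wgrad S (kernel_col N y k) x $ i $ \<alpha> * \<psi> x \<partial>lebesgue_on ?U\<bar>
        \<le> ?E * sqrt (\<integral>x. (\<psi> x)\<^sup>2 \<partial>lebesgue_on ?U)" if \<psi>: "\<psi> \<in> Cc_inf ?U" for \<psi>
    proof -
      have \<psi>S: "\<psi> \<in> Cc_inf S" by (rule Cc_inf_mono[OF \<psi>]) auto
      have restr: "(\<integral>x. g x * \<psi> x \<partial>lebesgue_on ?U) = (\<integral>x. g x * \<psi> x \<partial>lebesgue_on S)" for g :: "real^'d \<Rightarrow> real"
        by (rule integral_lebesgue_on_eq) (use S U Cc_inf_outside[OF \<psi>] in \<open>auto simp: lebesgue_open\<close>)
      have b: "\<bar>\<integral>x. u n x $ i * pd \<alpha> \<psi> x \<partial>lebesgue_on S\<bar> \<le> ?E * L2_norm ?U \<psi>" if n: "n \<ge> n0" for n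
      proof -
        have D: "L2_on ?U (wgrad S (u n))"
          using neumann_solution_Y12[OF sol[of n]] S U
          by (intro L2_on_subset[of S _ ?U]) (auto simp: Y12_iff lebesgue_open)
        have "\<bar>\<integral>x. u n x $ i * pd \<alpha> \<psi> x \<partial>lebesgue_on S\<bar> = \<bar>\<integral>x. wgrad S (u n) x $ i $ \<alpha> * \<psi> x \<partial>lebesgue_on ?U\<bar>"
          using up[of n] \<psi>S S by (simp add: has_weak_partial_lebesgue_on restr)
        also have "\<dots> \<le> L2_norm ?U (\<lambda>x. wgrad S (u n) x $ i $ \<alpha>) * L2_norm ?U \<psi>"
          using L2_inner(2)[OF L2_on_component[OF L2_on_component[OF D]] Cc_inf_L2[OF \<psi> lebesgue_open[OF U]]] by simp
        also have "\<dots> \<le> ?E * L2_norm ?U \<psi>"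
        proof (rule mult_right_mono)
          have "L2_norm ?U (\<lambda>x. wgrad S (u n) x $ i $ \<alpha>) \<le> L2_norm ?U (\<lambda>x. wgrad S (u n) x $ i)"
            by (rule L2_norm_component[OF L2_on_component[OF D]])
          also have "\<dots> \<le> L2_norm ?U (wgrad S (u n))" by (rule L2_norm_component[OF D])
          finally show "L2_norm ?U (\<lambda>x. wgrad S (u n) x $ i $ \<alpha>) \<le> ?E" using gb[OF n] by linarith
        qed simp
        finally show ?thesis .
      qed
      have dom: "(\<lambda>n. \<integral>x. u (n + n0) x $ i * pd \<alpha> \<psi> x \<partial>lebesgue_on S)
          \<longlonglongrightarrow> (\<integral>x. kernel_col N y k x $ i * pd \<alpha> \<psi> x \<partial>lebesgue_on S)"
      proof (rule integral_dominated_convergence[where w = "\<lambda>x. P * (r / 4) powr (2 - ?n) * \<bar>pd \<alpha> \<psi> x\<bar>"])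
        have p\<psi>: "pd \<alpha> \<psi> \<in> Cc_inf ?U" by (rule Cc_inf_pd[OF \<psi>])
        have pm: "pd \<alpha> \<psi> \<in> borel_measurable (lebesgue_on S)"
          by (intro measurable_restrict_space1 smooth_measurable Cc_inf_smooth[OF p\<psi>])
        show "(\<lambda>x. kernel_col N y k x $ i * pd \<alpha> \<psi> x) \<in> borel_measurable (lebesgue_on S)"
          using Wp by (intro borel_measurable_times pm L1_loc_measurable S) (auto simp: has_weak_partial_def)
        show "(\<lambda>x. u (n + n0) x $ i * pd \<alpha> \<psi> x) \<in> borel_measurable (lebesgue_on S)" for n
          using up by (intro borel_measurable_times pm L1_loc_measurable S) (auto simp: has_weak_partial_def)
        show "integrable (lebesgue_on S) (\<lambda>x. P * (r / 4) powr (2 - ?n) * \<bar>pd \<alpha> \<psi> x\<bar>)"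
          by (intro integrable_mult_right integrable_abs Cc_inf_integrable[OF p\<psi> lebesgue_open[OF S]])
        have out: "pd \<alpha> \<psi> x = 0" if "x \<notin> ?U" for x by (rule Cc_inf_outside[OF p\<psi> that])
        show "AE x in lebesgue_on S. (\<lambda>n. u (n + n0) x $ i * pd \<alpha> \<psi> x) \<longlonglongrightarrow> kernel_col N y k x $ i * pd \<alpha> \<psi> x"
        proof (rule AE_I2)
          fix x assume "x \<in> space (lebesgue_on S)"
          then have xS: "x \<in> S" by simp
          show "(\<lambda>n. u (n + n0) x $ i * pd \<alpha> \<psi> x) \<longlonglongrightarrow> kernel_col N y k x $ i * pd \<alpha> \<psi> x"
          proof (cases "x \<in> ?U")
            case True
            then have "x \<noteq> y" using r by auto
            then show ?thesis by (intro tendsto_intros tendsto_vec_nth LIMSEQ_ignore_initial_segment lim xS)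
          qed (simp add: out)
        qed
        show "AE x in lebesgue_on S. norm (u (n + n0) x $ i * pd \<alpha> \<psi> x) \<le> P * (r / 4) powr (2 - ?n) * \<bar>pd \<alpha> \<psi> x\<bar>" for n
        proof (rule AE_I2)
          fix x assume "x \<in> space (lebesgue_on S)"
          then have xS: "x \<in> S" by simp
          show "norm (u (n + n0) x $ i * pd \<alpha> \<psi> x) \<le> P * (r / 4) powr (2 - ?n) * \<bar>pd \<alpha> \<psi> x\<bar>"
          proof (cases "x \<in> ?U")
            case True
            then have "\<bar>u (n + n0) x $ i\<bar> \<le> P * (r / 4) powr (2 - ?n)"
              using r by (intro order_trans[OF component_le_norm_cart ub] xS) auto
            then show ?thesis by (simp add: abs_mult mult_right_mono)
          qed (simp add: out)
        qed
      qed
      have "\<bar>\<integral>x. kernel_col N y k x $ i * pd \<alpha> \<psi> x \<partial>lebesgue_on S\<bar> \<le> ?E * L2_norm ?U \<psi>"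
        by (rule LIMSEQ_le_const2[OF tendsto_rabs[OF dom]]) (use b in auto)
      then show ?thesis
        using Wp \<psi>S S by (simp add: has_weak_partial_lebesgue_on restr L2_norm_def)
    qed
    have E0: "?E \<ge> 0" using gb[OF order_refl] L2_norm_nonneg order_trans by blast
    have i: "integrable (lebesgue_on ?U) (\<lambda>x. (wgrad S (kernel_col N y k) x $ i $ \<alpha>)\<^sup>2)"
      and le: "(\<integral>x. (wgrad S (kernel_col N y k) x $ i $ \<alpha>)\<^sup>2 \<partial>lebesgue_on ?U) \<le> ?E\<^sup>2"
      by (rule L2_duality[OF U L1 E0 bnd], assumption)+
    have "L2_on ?U (\<lambda>x. wgrad S (kernel_col N y k) x $ i $ \<alpha>)"
      using i L1_loc_measurable[OF U L1] by (simp add: L2_on_def)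
    moreover have "(L2_norm ?U (\<lambda>x. wgrad S (kernel_col N y k) x $ i $ \<alpha>))\<^sup>2 \<le> ?E\<^sup>2"
      unfolding L2_norm_square using le by simp
    then have "L2_norm ?U (\<lambda>x. wgrad S (kernel_col N y k) x $ i $ \<alpha>) \<le> ?E"
      by (rule power2_le_imp_le) (rule E0)
    ultimately show ?thesis by blast
  qed
  have kg: "kernel_grad S N y x $ k = wgrad S (kernel_col N y k) x" for x k by (simp add: kernel_grad_def)
  have a: "L2_on ?U (\<lambda>x. wgrad S (kernel_col N y k) x $ i)" for k i
    by (rule L2_on_components) (use comp in blast)
  have b: "L2_on ?U (\<lambda>x. kernel_grad S N y x $ k)" for k
    unfolding kg by (rule L2_on_components) (rule a)
  show "L2_on ?U (kernel_grad S N y)" by (rule L2_on_components) (rule b)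
  have 1: "L2_norm ?U (\<lambda>x. wgrad S (kernel_col N y k) x $ i) \<le> ?n * ?E" for k i
    by (rule L2_norm_components) (use comp in blast)+
  have 2: "L2_norm ?U (\<lambda>x. kernel_grad S N y x $ k) \<le> real CARD('m) * (?n * ?E)" for k
    unfolding kg by (rule L2_norm_components[OF a 1])
  have "L2_norm ?U (kernel_grad S N y) \<le> real CARD('m) * (real CARD('m) * (?n * ?E))"
    by (rule L2_norm_components[OF b 2])
  then show "L2_norm ?U (kernel_grad S N y)
      \<le> gradient_const P * r powr (1 - ?n / 2)"
    by (simp add: gradient_const_def power2_eq_square mult_ac)
qed

end

section \<open>Integrals of functions of weak type\<close>

lemma exists_dyadic_level:
  fixes s \<tau> :: real
  assumes "\<tau> > 0" "s > \<tau>"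
  obtains k :: nat where "2 ^ k * \<tau> < s" "s \<le> 2 ^ Suc k * \<tau>"
proof -
  obtain n :: nat where "s / \<tau> < 2 ^ n" using real_arch_pow[of 2 "s / \<tau>"] by auto
  then have ex: "s \<le> 2 ^ n * \<tau>" using assms by (simp add: field_simps)
  define m where "m = (LEAST n. s \<le> 2 ^ n * \<tau>)"
  have m: "s \<le> 2 ^ m * \<tau>" unfolding m_def by (rule LeastI[where P = "\<lambda>n. s \<le> 2 ^ n * \<tau>", OF ex])
  have "m \<noteq> 0" using m assms by (intro notI) simp
  then obtain k where k: "m = Suc k" by (cases m) auto
  then have "\<not> s \<le> 2 ^ k * \<tau>" unfolding m_def by (metis lessI not_less_Least)
  then show ?thesis using that[of k] m k by auto
qed

lemma term_le_suminf_ennreal: "f k \<le> (\<Sum>k. f k)" for f :: "nat \<Rightarrow> ennreal"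
  using sum_le_suminf[of f "{k}"] by simp

lemma two_power_powr: "(2 ^ k) powr a = (2 powr a) ^ k" for a :: real
  by (induction k) (auto simp: powr_mult)

definition weak_type_const :: "real \<Rightarrow> real \<Rightarrow> real" where
  "weak_type_const p q = 2 powr p / (1 - 2 powr (p - q))"

lemma weak_type_const_pos: "p < q \<Longrightarrow> weak_type_const p q > 0"
  by (simp add: weak_type_const_def powr_less_one)

text \<open>Below the level \<open>\<tau>\<close> the measure of \<open>E\<close> is used, above it the weak type bound at the levels $2^k \tau$.
  The resulting geometric series has ratio $2^{p-q} < 1$.\<close>

lemma weak_type_integral_finite_measure:
  fixes g :: "'a::euclidean_space \<Rightarrow> real"
  assumes E: "E \<in> sets lebesgue" and V: "emeasure lebesgue E \<le> ennreal V" "V \<ge> 0"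
    and g: "g \<in> borel_measurable (lebesgue_on E)" "\<And>x. g x \<ge> 0"
    and weak: "\<And>t. t > 0 \<Longrightarrow> emeasure lebesgue {x \<in> E. g x > t} \<le> ennreal (C * t powr (- q))"
    and p: "0 < p" "p < q" and C: "C \<ge> 0" and \<tau>: "\<tau> > 0"
  shows "(\<integral>\<^sup>+x. ennreal (g x powr p) \<partial>lebesgue_on E)
    \<le> ennreal (\<tau> powr p * V + weak_type_const p q * C * \<tau> powr (p - q))"
proof -
  let ?M = "lebesgue_on E"
  let ?A = "\<lambda>k. {x \<in> E. g x > 2 ^ k * \<tau>}"
  have A: "?A k \<in> sets ?M" for k
  proof -
    have "{x \<in> space ?M. g x > 2 ^ k * \<tau>} \<in> sets ?M" using g(1) by measurable
    then show ?thesis using E by simp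
  qed
  have Al: "?A k \<in> sets lebesgue" for k using A[of k] E by (simp add: sets_restrict_space_iff)
  have pw: "ennreal (g x powr p) \<le> ennreal (\<tau> powr p) + (\<Sum>k. ennreal ((2 ^ Suc k * \<tau>) powr p) * indicator (?A k) x)"
    if x: "x \<in> E" for x
  proof (cases "g x \<le> \<tau>")
    case True
    then have "g x powr p \<le> \<tau> powr p" using p g(2) by (intro powr_mono2) auto
    then show ?thesis by (simp add: add_increasing2 ennreal_leI)
  next
    case False
    then obtain k where k: "2 ^ k * \<tau> < g x" "g x \<le> 2 ^ Suc k * \<tau>"
      using exists_dyadic_level[OF \<tau>, of "g x"] by auto
    have "ennreal (g x powr p) \<le> ennreal ((2 ^ Suc k * \<tau>) powr p) * indicator (?A k) x"
      using k x p g(2) by (auto intro!: ennreal_leI powr_mono2)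
    also have "\<dots> \<le> (\<Sum>k. ennreal ((2 ^ Suc k * \<tau>) powr p) * indicator (?A k) x)"
      by (rule term_le_suminf_ennreal)
    finally show ?thesis by (simp add: add_increasing)
  qed
  have "(\<integral>\<^sup>+x. ennreal (g x powr p) \<partial>?M)
      \<le> (\<integral>\<^sup>+x. ennreal (\<tau> powr p) + (\<Sum>k. ennreal ((2 ^ Suc k * \<tau>) powr p) * indicator (?A k) x) \<partial>?M)"
    by (rule nn_integral_mono) (use pw in simp)
  also have "\<dots> = ennreal (\<tau> powr p) * emeasure ?M E + (\<Sum>k. ennreal ((2 ^ Suc k * \<tau>) powr p) * emeasure ?M (?A k))"
    using A E by (subst nn_integral_add) (auto simp: nn_integral_suminf nn_integral_cmult_indicator intro!: borel_measurable_suminf_order)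
  also have "\<dots> \<le> ennreal (\<tau> powr p * V) + (\<Sum>k. ennreal (2 powr p * C * \<tau> powr (p - q) * (2 powr (p - q)) ^ k))"
  proof (intro add_mono suminf_le allI)
    show "ennreal (\<tau> powr p) * emeasure ?M E \<le> ennreal (\<tau> powr p * V)"
      using V E by (simp add: emeasure_restrict_space ennreal_mult mult_left_mono)
    fix k
    have "ennreal ((2 ^ Suc k * \<tau>) powr p) * emeasure ?M (?A k)
        \<le> ennreal ((2 ^ Suc k * \<tau>) powr p) * ennreal (C * (2 ^ k * \<tau>) powr (- q))"
      using weak[of "2 ^ k * \<tau>"] \<tau> E Al by (intro mult_left_mono) (auto simp: emeasure_restrict_space)
    also have "\<dots> = ennreal (2 powr p * C * \<tau> powr (p - q) * (2 powr (p - q)) ^ k)"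
    proof -
      have "(2 ^ Suc k * \<tau>) powr p * (C * (2 ^ k * \<tau>) powr (- q)) = 2 powr p * C * \<tau> powr (p - q) * (2 powr (p - q)) ^ k"
      proof -
        have 1: "(2 ^ Suc k * \<tau>) powr p = 2 powr p * (2 ^ k) powr p * \<tau> powr p"
          using \<tau> by (simp add: powr_mult)
        have 2: "(2 ^ k * \<tau>) powr (- q) = (2 ^ k) powr (- q) * \<tau> powr (- q)"
          using \<tau> by (simp add: powr_mult)
        have 3: "(2 ^ k) powr p * (2 ^ k) powr (- q) = (2 powr (p - q)) ^ k"
          by (simp flip: powr_add two_power_powr)
        have 4: "\<tau> powr p * \<tau> powr (- q) = \<tau> powr (p - q)" by (simp flip: powr_add)
        have 5: "a * b * c * (C * (e * f)) = a * C * (c * f) * (b * e)" for a b c e f by (simp add: mult_ac)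
        show ?thesis unfolding 1 2 5 3 4 ..
      qed
      then show ?thesis using C by (simp flip: ennreal_mult)
    qed
    finally show "ennreal ((2 ^ Suc k * \<tau>) powr p) * emeasure ?M (?A k)
        \<le> ennreal (2 powr p * C * \<tau> powr (p - q) * (2 powr (p - q)) ^ k)" .
  qed auto
  also have "(\<Sum>k. ennreal (2 powr p * C * \<tau> powr (p - q) * (2 powr (p - q)) ^ k))
      = ennreal (2 powr p * C * \<tau> powr (p - q) * (1 / (1 - 2 powr (p - q))))"
    using C p by (intro suminf_ennreal_eq sums_mult geometric_sums) (auto simp: powr_less_one)
  also have "ennreal (\<tau> powr p * V) + \<dots> = ennreal (\<tau> powr p * V + weak_type_const p q * C * \<tau> powr (p - q))"
  proof -
    have "0 \<le> 2 powr p * C * \<tau> powr (p - q) * (1 / (1 - 2 powr (p - q)))"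
      using C p by (intro mult_nonneg_nonneg divide_nonneg_nonneg) (auto simp: powr_less_one less_imp_le)
    then show ?thesis
      using V by (subst ennreal_plus[symmetric]) (auto simp: weak_type_const_def mult_ac)
  qed
  finally show ?thesis .
qed

definition weak_type_tail_const :: "real \<Rightarrow> real \<Rightarrow> real" where
  "weak_type_tail_const p q = 2 powr q / (1 - 2 powr (q - p))"

lemma weak_type_tail_const_pos: "q < p \<Longrightarrow> weak_type_tail_const p q > 0"
  by (simp add: weak_type_tail_const_def powr_less_one)

text \<open>The levels $2^{-k} \Gamma$ decrease from the upper bound. The geometric series has ratio $2^{q-p} < 1$.\<close>

lemma weak_type_integral_bounded:
  fixes g :: "'a::euclidean_space \<Rightarrow> real"
  assumes E: "E \<in> sets lebesgue"
    and g: "g \<in> borel_measurable (lebesgue_on E)" "\<And>x. g x \<ge> 0" "\<And>x. x \<in> E \<Longrightarrow> g x \<le> \<Gamma>"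
    and weak: "\<And>t. t > 0 \<Longrightarrow> emeasure lebesgue {x \<in> E. g x > t} \<le> ennreal (C * t powr (- q))"
    and p: "0 < p" "q < p" and C: "C \<ge> 0" and \<Gamma>: "\<Gamma> > 0"
  shows "(\<integral>\<^sup>+x. ennreal (g x powr p) \<partial>lebesgue_on E) \<le> ennreal (weak_type_tail_const p q * C * \<Gamma> powr (p - q))"
proof -
  let ?M = "lebesgue_on E"
  let ?A = "\<lambda>k. {x \<in> E. g x > \<Gamma> / 2 ^ Suc k}"
  have A: "?A k \<in> sets ?M" for k
  proof -
    have "{x \<in> space ?M. g x > \<Gamma> / 2 ^ Suc k} \<in> sets ?M" using g(1) by measurable
    then show ?thesis using E by simp
  qed
  have Al: "?A k \<in> sets lebesgue" for k using A[of k] E by (simp add: sets_restrict_space_iff)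
  have pw: "ennreal (g x powr p) \<le> (\<Sum>k. ennreal ((\<Gamma> / 2 ^ k) powr p) * indicator (?A k) x)"
    if x: "x \<in> E" for x
  proof (cases "g x = 0")
    case False
    then have g0: "g x > 0" using g(2)[of x] by simp
    obtain n :: nat where "\<Gamma> / g x < 2 ^ n" using real_arch_pow[of 2 "\<Gamma> / g x"] by auto
    then have "\<Gamma> / 2 ^ n < g x" using g0 by (simp add: field_simps)
    moreover have "\<Gamma> / 2 ^ Suc n \<le> \<Gamma> / 2 ^ n" using \<Gamma> by (simp add: field_simps)
    ultimately have ex: "\<Gamma> / 2 ^ Suc n < g x" by linarith
    define k where "k = (LEAST n. \<Gamma> / 2 ^ Suc n < g x)"
    have k: "\<Gamma> / 2 ^ Suc k < g x" unfolding k_def by (rule LeastI[where P = "\<lambda>n. \<Gamma> / 2 ^ Suc n < g x", OF ex])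
    have "g x \<le> \<Gamma> / 2 ^ k"
    proof (cases k)
      case (Suc j)
      then have "\<not> \<Gamma> / 2 ^ Suc j < g x" unfolding k_def by (metis lessI not_less_Least)
      then show ?thesis using Suc by simp
    qed (use g(3)[OF x] in simp)
    then have "ennreal (g x powr p) \<le> ennreal ((\<Gamma> / 2 ^ k) powr p) * indicator (?A k) x"
      using k x p g0 by (auto intro!: ennreal_leI powr_mono2)
    also have "\<dots> \<le> (\<Sum>k. ennreal ((\<Gamma> / 2 ^ k) powr p) * indicator (?A k) x)"
      by (rule term_le_suminf_ennreal)
    finally show ?thesis .
  qed simp
  have "(\<integral>\<^sup>+x. ennreal (g x powr p) \<partial>?M) \<le> (\<integral>\<^sup>+x. (\<Sum>k. ennreal ((\<Gamma> / 2 ^ k) powr p) * indicator (?A k) x) \<partial>?M)"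
    by (rule nn_integral_mono) (use pw in simp)
  also have "\<dots> = (\<Sum>k. ennreal ((\<Gamma> / 2 ^ k) powr p) * emeasure ?M (?A k))"
    using A by (simp add: nn_integral_suminf nn_integral_cmult_indicator)
  also have "\<dots> \<le> (\<Sum>k. ennreal (2 powr q * C * \<Gamma> powr (p - q) * (2 powr (q - p)) ^ k))"
  proof (intro suminf_le allI)
    fix k
    have "ennreal ((\<Gamma> / 2 ^ k) powr p) * emeasure ?M (?A k)
        \<le> ennreal ((\<Gamma> / 2 ^ k) powr p) * ennreal (C * (\<Gamma> / 2 ^ Suc k) powr (- q))"
      using weak[of "\<Gamma> / 2 ^ Suc k"] \<Gamma> E Al by (intro mult_left_mono) (auto simp: emeasure_restrict_space)
    also have "\<dots> = ennreal (2 powr q * C * \<Gamma> powr (p - q) * (2 powr (q - p)) ^ k)"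
    proof -
      have "(\<Gamma> / 2 ^ k) powr p * (C * (\<Gamma> / 2 ^ Suc k) powr (- q)) = 2 powr q * C * \<Gamma> powr (p - q) * (2 powr (q - p)) ^ k"
      proof -
        have 1: "(\<Gamma> / 2 ^ k) powr p = \<Gamma> powr p * (2 ^ k) powr (- p)"
          using \<Gamma> by (simp add: powr_divide powr_minus_divide)
        have 2: "(\<Gamma> / 2 ^ Suc k) powr (- q) = \<Gamma> powr (- q) * (2 powr q * (2 ^ k) powr q)"
          using \<Gamma> by (simp add: powr_divide powr_mult powr_minus_divide)
        have 3: "(2 ^ k) powr (- p) * (2 ^ k) powr q = (2 powr (q - p)) ^ k"
          by (simp flip: powr_add two_power_powr)
        have 4: "\<Gamma> powr p * \<Gamma> powr (- q) = \<Gamma> powr (p - q)" by (simp flip: powr_add)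
        have 5: "c * b * (C * (f * (a * e))) = a * C * (c * f) * (b * e)" for a b c e f by (simp add: mult_ac)
        show ?thesis unfolding 1 2 5 3 4 ..
      qed
      then show ?thesis using C by (simp flip: ennreal_mult)
    qed
    finally show "ennreal ((\<Gamma> / 2 ^ k) powr p) * emeasure ?M (?A k)
        \<le> ennreal (2 powr q * C * \<Gamma> powr (p - q) * (2 powr (q - p)) ^ k)" .
  qed auto
  also have "\<dots> = ennreal (2 powr q * C * \<Gamma> powr (p - q) * (1 / (1 - 2 powr (q - p))))"
    using C p by (intro suminf_ennreal_eq sums_mult geometric_sums) (auto simp: powr_less_one)
  also have "\<dots> = ennreal (weak_type_tail_const p q * C * \<Gamma> powr (p - q))"
    by (simp add: weak_type_tail_const_def mult_ac)
  finally show ?thesis .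
qed

text \<open>The level $r^{-d/q}$ makes the contributions below and above it scale alike.\<close>

lemma weak_type_Lp_ball:
  fixes G :: "real^'d::finite \<Rightarrow> 'b::euclidean_space"
  assumes S: "S \<in> sets lebesgue" and G: "G \<in> borel_measurable (lebesgue_on S)"
    and weak: "\<And>t. t > 0 \<Longrightarrow> emeasure lebesgue {x \<in> S. norm (G x) > t} \<le> ennreal (C * t powr (- q))"
    and p: "0 < p" "p < q" and C: "C \<ge> 0" and r: "r > 0"
  shows "Lp_norm p (S \<inter> ball y r) G
    \<le> ennreal ((unit_ball_vol (real CARD('d)) + weak_type_const p q * C) powr (1 / p) * r powr (real CARD('d) / p - real CARD('d) / q))"
proof -
  let ?n = "real CARD('d)"
  let ?E = "S \<inter> ball y r"
  let ?\<tau> = "r powr (- (?n / q))"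
  let ?K = "unit_ball_vol ?n + weak_type_const p q * C"
  have E: "?E \<in> sets lebesgue" using S by auto
  have q: "q > 0" using p by linarith
  have w: "emeasure lebesgue {x \<in> ?E. norm (G x) > t} \<le> ennreal (C * t powr (- q))" if t: "t > 0" for t
  proof -
    have "emeasure lebesgue {x \<in> ?E. norm (G x) > t} \<le> emeasure lebesgue {x \<in> S. norm (G x) > t}"
      by (intro emeasure_mono superlevel_set_measurable S G) auto
    then show ?thesis using weak[OF t] by (rule order_trans)
  qed
  have "(\<integral>\<^sup>+x. ennreal (norm (G x) powr p) \<partial>lebesgue_on ?E)
      \<le> ennreal (?\<tau> powr p * (unit_ball_vol ?n * r ^ CARD('d)) + weak_type_const p q * C * ?\<tau> powr (p - q))"
  proof (rule weak_type_integral_finite_measure[OF E _ _ _ _ w p C])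
    show "emeasure lebesgue ?E \<le> ennreal (unit_ball_vol ?n * r ^ CARD('d))"
      unfolding measure_ball_power(2)[OF r, of y, symmetric] by (intro emeasure_mono) auto
    show "(\<lambda>x. norm (G x)) \<in> borel_measurable (lebesgue_on ?E)"
    proof -
      have "G \<in> borel_measurable (lebesgue_on ?E)" by (rule measurable_restrict_mono[OF G]) auto
      then show ?thesis by measurable
    qed
  qed (use r in auto)
  also have "?\<tau> powr p * (unit_ball_vol ?n * r ^ CARD('d)) + weak_type_const p q * C * ?\<tau> powr (p - q)
      = ?K * r powr (?n - ?n * p / q)"
  proof -
    have "?\<tau> powr p * r ^ CARD('d) = r powr (?n - ?n * p / q)"
      using r by (simp add: powr_powr flip: powr_realpow powr_add)
    moreover have "?\<tau> powr (p - q) = r powr (?n - ?n * p / q)"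
    proof -
      have "- (?n / q) * (p - q) = ?n - ?n * p / q" using q by (simp add: field_simps)
      then show ?thesis by (simp add: powr_powr)
    qed
    moreover have "?\<tau> powr p * (unit_ball_vol ?n * r ^ CARD('d)) = unit_ball_vol ?n * (?\<tau> powr p * r ^ CARD('d))"
      by (simp only: mult_ac)
    ultimately show ?thesis by (simp add: algebra_simps)
  qed
  finally have int: "(\<integral>\<^sup>+x. ennreal (norm (G x) powr p) \<partial>lebesgue_on ?E) \<le> ennreal (?K * r powr (?n - ?n * p / q))" .
  have K0: "?K \<ge> 0" using weak_type_const_pos[OF p(2)] C by (intro add_nonneg_nonneg) auto
  have "Lp_norm p ?E G \<le> ennreal ((?K * r powr (?n - ?n * p / q)) powr (1 / p))"
    by (rule Lp_norm_le[OF E p(1) _ int]) (use K0 in simp)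
  also have "(?K * r powr (?n - ?n * p / q)) powr (1 / p) = ?K powr (1 / p) * r powr (?n / p - ?n / q)"
  proof -
    have e: "(?n - ?n * p / q) * (1 / p) = ?n / p - ?n / q" using p q by (simp add: field_simps)
    show ?thesis using K0 by (subst powr_mult) (simp_all only: powr_powr e powr_ge_zero)
  qed
  finally show ?thesis .
qed

lemma Lp_norm_sphere:
  fixes G :: "real^'d::finite \<Rightarrow> 'b::euclidean_space"
  shows "Lp_norm p (S - ball y r) G = Lp_norm p (S - cball y r) G"
proof -
  have "sphere y r \<in> null_sets lebesgue"
    using negligible_sphere[of y r] by (simp add: negligible_iff_null_sets)
  then have "AE x in lebesgue. x \<notin> sphere y r" by (rule AE_not_in)
  then have "(\<integral>\<^sup>+x\<in>S - ball y r. ennreal (norm (G x) powr p) \<partial>lebesgue)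
      = (\<integral>\<^sup>+x\<in>S - cball y r. ennreal (norm (G x) powr p) \<partial>lebesgue)"
    by (intro nn_integral_cong_AE) (auto elim!: eventually_mono simp: indicator_def)
  then show ?thesis by (simp add: Lp_norm_def)
qed

section \<open>Global estimates for the Neumann function\<close>

definition kernel_weak_const :: "real \<Rightarrow> real \<Rightarrow> real" where
  "kernel_weak_const d P = unit_ball_vol d * P powr (d / (d - 2))"

definition kernel_tail_const :: "real \<Rightarrow> real \<Rightarrow> real" where
  "kernel_tail_const d P = (weak_type_tail_const (2 * d / (d - 2)) (d / (d - 2)) * kernel_weak_const d P
     * P powr (d / (d - 2))) powr ((d - 2) / (2 * d))"

definition gradient_weak_const :: "real \<Rightarrow> real \<Rightarrow> real" where
  "gradient_weak_const d K = unit_ball_vol d + K\<^sup>2"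

definition weak_type_ball_const :: "real \<Rightarrow> real \<Rightarrow> real \<Rightarrow> real \<Rightarrow> real" where
  "weak_type_ball_const d C p q = (unit_ball_vol d + weak_type_const p q * C) powr (1 / p)"

lemma power_decay_superlevel:
  fixes y :: "real^'d::finite" and F :: "real^'d \<Rightarrow> real"
  assumes d: "CARD('d) \<ge> 3" and P: "P > 0" and t: "t > 0"
    and F: "\<And>x. x \<in> S \<Longrightarrow> x \<noteq> y \<Longrightarrow> F x \<le> P * norm (x - y) powr (2 - real CARD('d))"
  shows "emeasure lebesgue {x \<in> S. F x > t}
    \<le> ennreal (kernel_weak_const (real CARD('d)) P * t powr (- (real CARD('d) / (real CARD('d) - 2))))"
proof -
  let ?n = "real CARD('d)"
  have n: "?n > 2" using d by simp
  define \<rho> where "\<rho> = (P / t) powr (1 / (?n - 2))"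
  have \<rho>: "\<rho> > 0" using P t by (simp add: \<rho>_def)
  have "{x \<in> S. F x > t} \<subseteq> ball y \<rho>"
  proof
    fix x assume "x \<in> {x \<in> S. F x > t}"
    then have x: "x \<in> S" "F x > t" by auto
    show "x \<in> ball y \<rho>"
    proof (cases "x = y")
      case False
      then have s: "norm (x - y) > 0" by simp
      have "t < P * norm (x - y) powr (2 - ?n)" using F[OF x(1) False] x(2) by linarith
      also have "norm (x - y) powr (2 - ?n) = 1 / norm (x - y) powr (?n - 2)"
        using powr_minus_divide[of "norm (x - y)" "?n - 2"] by simp
      finally have "norm (x - y) powr (?n - 2) < P / t"
        using s t P by (simp add: field_simps)
      then have "(norm (x - y) powr (?n - 2)) powr (1 / (?n - 2)) < \<rho>"
        unfolding \<rho>_def using n by (intro powr_less_mono2) auto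
      moreover have "(norm (x - y) powr (?n - 2)) powr (1 / (?n - 2)) = norm (x - y)"
        using n s by (simp add: powr_powr)
      ultimately show ?thesis by (simp add: dist_norm norm_minus_commute)
    qed (use \<rho> in simp)
  qed
  then have "emeasure lebesgue {x \<in> S. F x > t} \<le> emeasure lebesgue (ball y \<rho>)"
    by (rule emeasure_mono) auto
  also have "\<dots> = ennreal (unit_ball_vol ?n * \<rho> ^ CARD('d))" by (rule measure_ball_power(2)[OF \<rho>])
  also have "\<rho> ^ CARD('d) = P powr (?n / (?n - 2)) * t powr (- (?n / (?n - 2)))"
  proof -
    have "\<rho> ^ CARD('d) = \<rho> powr ?n" using \<rho> by (simp add: powr_realpow)
    also have "\<dots> = (P / t) powr (?n / (?n - 2))" by (simp add: \<rho>_def powr_powr)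
    also have "\<dots> = P powr (?n / (?n - 2)) * t powr (- (?n / (?n - 2)))"
      using P t by (simp add: powr_divide powr_minus_divide)
    finally show ?thesis .
  qed
  finally show ?thesis by (simp add: kernel_weak_const_def mult_ac)
qed

text \<open>At distance less than $\rho = t^{-1/(d-1)}$ from the pole the volume of the ball is used, and outside
  Chebyshev's inequality with the $L^2$ bound. For this radius both have order $t^{-d/(d-1)}$.\<close>

lemma exterior_L2_superlevel:
  fixes G :: "real^'d::finite \<Rightarrow> 'b::euclidean_space"
  assumes d: "CARD('d) \<ge> 3" and S: "open S" and G: "G \<in> borel_measurable (lebesgue_on S)"
    and L2: "\<And>r. r > 0 \<Longrightarrow> L2_on (S - cball y r) G"
    and le: "\<And>r. r > 0 \<Longrightarrow> L2_norm (S - cball y r) G \<le> K * r powr (1 - real CARD('d) / 2)" and t: "t > 0"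
  shows "emeasure lebesgue {x \<in> S. norm (G x) > t}
    \<le> ennreal (gradient_weak_const (real CARD('d)) K * t powr (- (real CARD('d) / (real CARD('d) - 1))))"
proof -
  let ?n = "real CARD('d)"
  have n: "?n > 2" using d by simp
  define \<rho> where "\<rho> = t powr (- (1 / (?n - 1)))"
  have \<rho>: "\<rho> > 0" using t by (simp add: \<rho>_def)
  let ?U = "S - cball y \<rho>"
  have U: "?U \<in> sets lebesgue" using S by (intro lebesgue_open) auto
  let ?A = "{x \<in> ?U. norm (G x) > t}"
  have "{x \<in> S. norm (G x) > t} - cball y \<rho> \<in> sets lebesgue"
    using superlevel_set_measurable[OF lebesgue_open[OF S] G] by auto
  moreover have "{x \<in> S. norm (G x) > t} - cball y \<rho> = ?A" by auto
  ultimately have A: "?A \<in> sets lebesgue" by simp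
  have int: "(\<integral>x. (norm (G x))\<^sup>2 \<partial>lebesgue_on ?U) \<le> (K * \<rho> powr (1 - ?n / 2))\<^sup>2"
    using power_mono[OF le[OF \<rho>] L2_norm_nonneg, of 2] by (simp add: L2_norm_square)
  have "ennreal (t\<^sup>2) * emeasure lebesgue ?A = (\<integral>\<^sup>+x. ennreal (t\<^sup>2) * indicator ?A x \<partial>lebesgue)"
    using A by (simp add: nn_integral_cmult_indicator)
  also have "\<dots> \<le> (\<integral>\<^sup>+x\<in>?U. ennreal ((norm (G x))\<^sup>2) \<partial>lebesgue)"
    using t by (intro nn_integral_mono) (auto simp: indicator_def intro!: ennreal_leI power_mono)
  also have "\<dots> = ennreal (\<integral>x. (norm (G x))\<^sup>2 \<partial>lebesgue_on ?U)"
    using L2[OF \<rho>] unfolding nn_integral_set_lebesgue_on[OF U]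
    by (intro nn_integral_eq_integral) (auto simp: L2_on_def)
  also have "\<dots> \<le> ennreal ((K * \<rho> powr (1 - ?n / 2))\<^sup>2)" using int by (rule ennreal_leI)
  finally have m: "ennreal (t\<^sup>2) * emeasure lebesgue ?A \<le> ennreal ((K * \<rho> powr (1 - ?n / 2))\<^sup>2)" .
  have "emeasure lebesgue ?A = ennreal (1 / t\<^sup>2) * (ennreal (t\<^sup>2) * emeasure lebesgue ?A)"
    using t by (simp add: mult.assoc[symmetric] ennreal_mult[symmetric])
  also have "\<dots> \<le> ennreal (1 / t\<^sup>2) * ennreal ((K * \<rho> powr (1 - ?n / 2))\<^sup>2)" using m by (rule mult_left_mono) simp
  also have "\<dots> = ennreal (1 / t\<^sup>2 * (K * \<rho> powr (1 - ?n / 2))\<^sup>2)" by (rule ennreal_mult[symmetric]) auto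
  also have "1 / t\<^sup>2 * (K * \<rho> powr (1 - ?n / 2))\<^sup>2 = K\<^sup>2 * t powr (- (?n / (?n - 1)))"
  proof -
    have "(\<rho> powr (1 - ?n / 2))\<^sup>2 = t powr ((?n - 2) / (?n - 1))"
    proof -
      have "(\<rho> powr (1 - ?n / 2))\<^sup>2 = \<rho> powr (2 - ?n)" by (simp add: power2_eq_square flip: powr_add)
      also have "\<dots> = t powr (- (1 / (?n - 1)) * (2 - ?n))" unfolding \<rho>_def by (rule powr_powr)
      also have "- (1 / (?n - 1)) * (2 - ?n) = (?n - 2) / (?n - 1)" using n by (simp add: field_simps)
      finally show ?thesis .
    qed
    moreover have "1 / t\<^sup>2 = t powr (- 2)" using t by (simp add: powr_minus_divide powr_numeral)
    moreover have "t powr (- 2) * t powr ((?n - 2) / (?n - 1)) = t powr (- (?n / (?n - 1)))"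
    proof -
      have "- 2 + (?n - 2) / (?n - 1) = - (?n / (?n - 1))" using n by (simp add: field_simps)
      then show ?thesis by (simp flip: powr_add)
    qed
    ultimately show ?thesis by (simp add: power_mult_distrib mult_ac)
  qed
  finally have far: "emeasure lebesgue ?A \<le> ennreal (K\<^sup>2 * t powr (- (?n / (?n - 1))))" .
  have "emeasure lebesgue (cball y \<rho>) = ennreal (unit_ball_vol ?n * \<rho> ^ CARD('d))"
    using emeasure_cball[of \<rho> y] \<rho> by simp
  also have "\<rho> ^ CARD('d) = t powr (- (?n / (?n - 1)))"
    using \<rho> by (simp add: powr_realpow[symmetric]) (simp add: \<rho>_def powr_powr)
  finally have near: "emeasure lebesgue (cball y \<rho>) = ennreal (unit_ball_vol ?n * t powr (- (?n / (?n - 1))))" .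
  have "emeasure lebesgue {x \<in> S. norm (G x) > t} \<le> emeasure lebesgue (cball y \<rho> \<union> ?A)"
    using A by (intro emeasure_mono) auto
  also have "\<dots> \<le> emeasure lebesgue (cball y \<rho>) + emeasure lebesgue ?A"
    using A by (intro emeasure_subadditive) auto
  also have "\<dots> \<le> ennreal (unit_ball_vol ?n * t powr (- (?n / (?n - 1)))) + ennreal (K\<^sup>2 * t powr (- (?n / (?n - 1))))"
    unfolding near using far by (rule add_left_mono)
  also have "\<dots> = ennreal (gradient_weak_const ?n K * t powr (- (?n / (?n - 1))))"
    by (subst ennreal_plus[symmetric]) (auto simp: gradient_weak_const_def algebra_simps)
  finally show ?thesis .
qed

context elliptic_domain
begin

lemma kernel_measurable:
  assumes "neumann_pair S A N Nt" "y \<in> S"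
  shows "(\<lambda>x. real_mat (N x y)) \<in> borel_measurable (lebesgue_on S)"
proof (intro measurable_vec_lambda)
  fix i k
  have "has_weak_gradient S (kernel_col N y k) (wgrad S (kernel_col N y k))"
    using assms by (intro wgrad_weak_gradient) (auto simp: neumann_pair_def neumann_function_def)
  then have "(\<lambda>x. kernel_col N y k x $ i) \<in> borel_measurable (lebesgue_on S)"
    by (intro L1_loc_measurable S) (auto simp: has_weak_gradient_def has_weak_partial_def)
  then show "(\<lambda>x. real_mat (N x y) $ i $ k) \<in> borel_measurable (lebesgue_on S)"
    by (simp add: kernel_col_def column_def)
qed

lemma kernel_grad_measurable:
  assumes "neumann_pair S A N Nt" "y \<in> S"
  shows "kernel_grad S N y \<in> borel_measurable (lebesgue_on S)"
proof (intro measurable_vec_lambda)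
  fix k i \<alpha>
  have "has_weak_gradient S (kernel_col N y k) (wgrad S (kernel_col N y k))"
    using assms by (intro wgrad_weak_gradient) (auto simp: neumann_pair_def neumann_function_def)
  then have "(\<lambda>x. wgrad S (kernel_col N y k) x $ i $ \<alpha>) \<in> borel_measurable (lebesgue_on S)"
    by (intro L1_loc_measurable S) (auto simp: has_weak_gradient_def has_weak_partial_def)
  then show "(\<lambda>x. kernel_grad S N y x $ k $ i $ \<alpha>) \<in> borel_measurable (lebesgue_on S)"
    by (simp add: kernel_grad_def)
qed

text \<open>The first and the third bound follow from weak type $d/(d-2)$: outside a ball the kernel is bounded, so
  the exponent may exceed $d/(d-2)$, and in a ball it has to be smaller. The fifth follows in the same
  way from weak type $d/(d-1)$ of the gradient.\<close>

lemma kernel_estimates: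
  fixes N Nt :: "('d, 'm) kernel"
  assumes NP: "neumann_pair S A N Nt" and P: "P > 0"
    and pw: "\<And>x z. x \<in> S \<Longrightarrow> z \<in> S \<Longrightarrow> x \<noteq> z \<Longrightarrow> norm (real_mat (N x z)) \<le> P * norm (x - z) powr (2 - real CARD('d))"
    and d: "d = real CARD('d)" and y: "y \<in> S"
  shows "r > 0 \<Longrightarrow> Lp_norm (2 * d / (d - 2)) (S - ball y r) (\<lambda>x. real_mat (N x y)) \<le> ennreal (kernel_tail_const d P * r powr (1 - d / 2))"
    and "r > 0 \<Longrightarrow> Lp_norm 2 (S - ball y r) (kernel_grad S N y) \<le> ennreal (gradient_const P * r powr (1 - d / 2))"
    and "r > 0 \<Longrightarrow> 1 \<le> p \<Longrightarrow> p < d / (d - 2) \<Longrightarrow> Lp_norm p (S \<inter> ball y r) (\<lambda>x. real_mat (N x y))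
      \<le> ennreal (weak_type_ball_const d (kernel_weak_const d P) p (d / (d - 2)) * r powr (2 - d + d / p))"
    and "t > 0 \<Longrightarrow> emeasure lebesgue {x \<in> S. norm (real_mat (N x y)) > t} \<le> ennreal (kernel_weak_const d P * t powr (- (d / (d - 2))))"
    and "r > 0 \<Longrightarrow> 1 \<le> p \<Longrightarrow> p < d / (d - 1) \<Longrightarrow> Lp_norm p (S \<inter> ball y r) (kernel_grad S N y)
      \<le> ennreal (weak_type_ball_const d (gradient_weak_const d (gradient_const P)) p (d / (d - 1)) * r powr (1 - d + d / p))"
    and "t > 0 \<Longrightarrow> emeasure lebesgue {x \<in> S. norm (kernel_grad S N y x) > t}
      \<le> ennreal (gradient_weak_const d (gradient_const P) * t powr (- (d / (d - 1))))"
proof -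
  have d3: "d > 2" using dim d by simp
  have kw0: "kernel_weak_const d P \<ge> 0" using d by (simp add: kernel_weak_const_def)
  have gw0: "gradient_weak_const d (gradient_const P) \<ge> 0" using d by (simp add: gradient_weak_const_def)
  have Sl: "S \<in> sets lebesgue" by (rule lebesgue_open[OF S])
  note mN = kernel_measurable[OF NP y]
  note mG = kernel_grad_measurable[OF NP y]
  have weakN: "emeasure lebesgue {x \<in> S. norm (real_mat (N x y)) > t} \<le> ennreal (kernel_weak_const d P * t powr (- (d / (d - 2))))"
    if "t > 0" for t
    unfolding d by (rule power_decay_superlevel[OF dim P that]) (use pw y in auto)
  have kg: "L2_on (S - cball y r) (kernel_grad S N y)"
    "L2_norm (S - cball y r) (kernel_grad S N y) \<le> gradient_const P * r powr (1 - d / 2)" if "r > 0" for r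
    unfolding d
    by (rule kernel_gradient_bound[OF NP less_imp_le[OF P] _ y that], rule pw, assumption+)+
  have weakG: "emeasure lebesgue {x \<in> S. norm (kernel_grad S N y x) > t}
      \<le> ennreal (gradient_weak_const d (gradient_const P) * t powr (- (d / (d - 1))))" if "t > 0" for t
    unfolding d by (rule exterior_L2_superlevel[OF dim S mG _ _ that]) (use kg d in auto)
  show "t > 0 \<Longrightarrow> emeasure lebesgue {x \<in> S. norm (real_mat (N x y)) > t} \<le> ennreal (kernel_weak_const d P * t powr (- (d / (d - 2))))"
    by (rule weakN)
  show "t > 0 \<Longrightarrow> emeasure lebesgue {x \<in> S. norm (kernel_grad S N y x) > t}
      \<le> ennreal (gradient_weak_const d (gradient_const P) * t powr (- (d / (d - 1))))"
    by (rule weakG)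
  show "Lp_norm p (S \<inter> ball y r) (\<lambda>x. real_mat (N x y))
      \<le> ennreal (weak_type_ball_const d (kernel_weak_const d P) p (d / (d - 2)) * r powr (2 - d + d / p))"
    if "r > 0" "1 \<le> p" "p < d / (d - 2)"
  proof -
    have e: "d / p - d / (d / (d - 2)) = 2 - d + d / p" using d3 by simp
    have "0 < p" using that(2) by simp
    from weak_type_Lp_ball[OF Sl mN weakN this that(3) kw0 that(1), of y, folded d] show ?thesis
      unfolding e weak_type_ball_const_def .
  qed
  show "Lp_norm p (S \<inter> ball y r) (kernel_grad S N y)
      \<le> ennreal (weak_type_ball_const d (gradient_weak_const d (gradient_const P)) p (d / (d - 1)) * r powr (1 - d + d / p))"
    if "r > 0" "1 \<le> p" "p < d / (d - 1)"
  proof -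
    have e: "d / p - d / (d / (d - 1)) = 1 - d + d / p" using d3 by simp
    have "0 < p" using that(2) by simp
    from weak_type_Lp_ball[OF Sl mG weakG this that(3) gw0 that(1), of y, folded d] show ?thesis
      unfolding e weak_type_ball_const_def .
  qed
  show "Lp_norm 2 (S - ball y r) (kernel_grad S N y) \<le> ennreal (gradient_const P * r powr (1 - d / 2))"
    if r: "r > 0"
  proof -
    have "S - cball y r \<in> sets lebesgue" using S by (intro lebesgue_open) auto
    then show ?thesis
      using kg(2)[OF r] by (simp add: Lp_norm_sphere Lp_norm_two[OF _ kg(1)[OF r]] ennreal_leI)
  qed
  show "Lp_norm (2 * d / (d - 2)) (S - ball y r) (\<lambda>x. real_mat (N x y)) \<le> ennreal (kernel_tail_const d P * r powr (1 - d / 2))"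
    if r: "r > 0"
  proof -
    let ?E = "S - ball y r" and ?p = "2 * d / (d - 2)" and ?q = "d / (d - 2)" and ?\<Gamma> = "P * r powr (2 - d)"
    let ?W = "weak_type_tail_const ?p ?q * kernel_weak_const d P"
    have E: "?E \<in> sets lebesgue" using Sl by auto
    have pq: "0 < ?p" "?q < ?p" using d3 by (auto simp: field_simps)
    have W0: "?W \<ge> 0" using weak_type_tail_const_pos[OF pq(2)] kw0 by (intro mult_nonneg_nonneg) auto
    have "(\<integral>\<^sup>+x. ennreal (norm (real_mat (N x y)) powr ?p) \<partial>lebesgue_on ?E) \<le> ennreal (?W * ?\<Gamma> powr (?p - ?q))"
    proof (rule weak_type_integral_bounded[OF E _ _ _ _ pq kw0])
      have "(\<lambda>x. real_mat (N x y)) \<in> borel_measurable (lebesgue_on ?E)"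
        by (rule measurable_restrict_mono[OF mN]) auto
      then show "(\<lambda>x. norm (real_mat (N x y))) \<in> borel_measurable (lebesgue_on ?E)" by measurable
      fix x assume x: "x \<in> ?E"
      then have ne: "x \<noteq> y" and far: "norm (x - y) \<ge> r" using r by (auto simp: dist_norm norm_minus_commute)
      have "norm (real_mat (N x y)) \<le> P * norm (x - y) powr (2 - d)" unfolding d by (rule pw) (use x y ne in auto)
      also have "\<dots> \<le> ?\<Gamma>" using P far r d3 by (intro mult_left_mono powr_mono2') auto
      finally show "norm (real_mat (N x y)) \<le> ?\<Gamma>" .
    next
      fix t :: real assume t: "t > 0"
      have "emeasure lebesgue {x \<in> ?E. norm (real_mat (N x y)) > t} \<le> emeasure lebesgue {x \<in> S. norm (real_mat (N x y)) > t}"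
        by (intro emeasure_mono superlevel_set_measurable Sl mN) auto
      then show "emeasure lebesgue {x \<in> ?E. norm (real_mat (N x y)) > t} \<le> ennreal (kernel_weak_const d P * t powr (- ?q))"
        using weakN[OF t] by (rule order_trans)
    qed (use P r in auto)
    from Lp_norm_le[OF E pq(1) _ this]
    have "Lp_norm ?p ?E (\<lambda>x. real_mat (N x y)) \<le> ennreal ((?W * ?\<Gamma> powr (?p - ?q)) powr (1 / ?p))"
      using W0 by simp
    also have "(?W * ?\<Gamma> powr (?p - ?q)) powr (1 / ?p) = kernel_tail_const d P * r powr (1 - d / 2)"
    proof -
      have "?p - ?q = ?q" by (simp flip: diff_divide_distrib)
      moreover have "?\<Gamma> powr ?q = P powr ?q * r powr (- d)"
      proof -
        have "(2 - d) * ?q = - d" using d3 by (simp add: field_simps)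
        then show ?thesis using P r by (simp add: powr_mult powr_powr)
      qed
      moreover have "(?W * (P powr ?q * r powr (- d))) powr (1 / ?p) = (?W * P powr ?q) powr (1 / ?p) * r powr (1 - d / 2)"
      proof -
        have e: "- d * (1 / ?p) = 1 - d / 2" using d3 by (simp add: field_simps)
        have "(?W * (P powr ?q * r powr (- d))) powr (1 / ?p) = ((?W * P powr ?q) * r powr (- d)) powr (1 / ?p)"
          by (simp only: mult.assoc)
        also have "\<dots> = (?W * P powr ?q) powr (1 / ?p) * (r powr (- d)) powr (1 / ?p)"
          by (rule powr_mult)
        also have "(r powr (- d)) powr (1 / ?p) = r powr (1 - d / 2)" by (simp only: powr_powr e)
        finally show ?thesis .
      qed
      moreover have "1 / ?p = (d - 2) / (2 * d)" by simp
      ultimately show ?thesis by (simp add: kernel_tail_const_def)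
    qed
    finally show ?thesis .
  qed
qed

end

section \<open>From the pointwise bound to local boundedness\<close>

definition riesz_const :: "real \<Rightarrow> real" where
  "riesz_const d = unit_ball_vol d + weak_type_const 1 (d / (d - 2)) * kernel_weak_const d 1"

text \<open>The kernel is of weak type $d/(d-2) > 1$ with a constant that does not depend on the pole \<open>y\<close>, so the
  ball may lie anywhere.\<close>

lemma riesz_kernel_integral:
  fixes z :: "real^'d::finite"
  assumes d: "CARD('d) \<ge> 3" and R: "R > 0"
  shows "(\<integral>\<^sup>+x\<in>ball z R. ennreal (norm (y - x) powr (2 - real CARD('d))) \<partial>lborel)
    \<le> ennreal (riesz_const (real CARD('d)) * R\<^sup>2)"
proof -
  let ?n = "real CARD('d)"
  let ?q = "?n / (?n - 2)"
  let ?g = "\<lambda>x. norm (y - x) powr (2 - ?n)"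
  have n: "?n > 2" using d by simp
  have q: "1 < ?q" using n by (simp add: field_simps)
  have gm: "?g \<in> borel_measurable borel" by measurable
  have "(\<integral>\<^sup>+x. ennreal (?g x powr 1) \<partial>lebesgue_on (ball z R))
      \<le> ennreal ((R powr (2 - ?n)) powr 1 * (unit_ball_vol ?n * R ^ CARD('d))
        + weak_type_const 1 ?q * kernel_weak_const ?n 1 * (R powr (2 - ?n)) powr (1 - ?q))"
  proof (rule weak_type_integral_finite_measure)
    show "emeasure lebesgue (ball z R) \<le> ennreal (unit_ball_vol ?n * R ^ CARD('d))"
      unfolding measure_ball_power(2)[OF R] ..
    show "?g \<in> borel_measurable (lebesgue_on (ball z R))"
      using gm by (intro measurable_restrict_space1 measurable_completion) simp
    show "emeasure lebesgue {x \<in> ball z R. t < ?g x} \<le> ennreal (kernel_weak_const ?n 1 * t powr (- ?q))" if "t > 0" for t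
      by (rule power_decay_superlevel[OF d _ that, of 1 "ball z R" y]) (auto simp: norm_minus_commute)
  qed (use R q in \<open>auto simp: kernel_weak_const_def\<close>)
  also have "(\<integral>\<^sup>+x. ennreal (?g x powr 1) \<partial>lebesgue_on (ball z R)) = (\<integral>\<^sup>+x\<in>ball z R. ennreal (?g x) \<partial>lborel)"
  proof -
    have [measurable]: "ball z R \<in> sets borel" by simp
    have "(\<lambda>x. ennreal (?g x) * indicator (ball z R) x) \<in> borel_measurable lborel" using gm by measurable
    then show ?thesis by (simp add: nn_integral_set_lebesgue_on[symmetric] nn_integral_completion)
  qed
  also have "(R powr (2 - ?n)) powr 1 * (unit_ball_vol ?n * R ^ CARD('d))
        + weak_type_const 1 ?q * kernel_weak_const ?n 1 * (R powr (2 - ?n)) powr (1 - ?q)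
      = (unit_ball_vol ?n + weak_type_const 1 ?q * kernel_weak_const ?n 1) * R\<^sup>2"
  proof -
    have "R powr (2 - ?n) * R ^ CARD('d) = R\<^sup>2"
    proof -
      have "R powr (2 - ?n) * R ^ CARD('d) = R powr (2 - ?n + ?n)"
        using R by (simp only: powr_add powr_realpow)
      then show ?thesis using R by (simp add: powr_numeral)
    qed
    moreover have "(R powr (2 - ?n)) powr (1 - ?q) = R\<^sup>2"
    proof -
      have "(2 - ?n) * (1 - ?q) = 2" using n by (simp add: field_simps)
      then show ?thesis using R by (simp add: powr_powr powr_numeral)
    qed
    ultimately show ?thesis by (simp add: algebra_simps)
  qed
  finally show ?thesis by (simp add: riesz_const_def)
qed

lemma riesz_const_nonneg: "d > 2 \<Longrightarrow> riesz_const d \<ge> 0"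
  using weak_type_const_pos[of 1 "d / (d - 2)"]
  by (auto simp: riesz_const_def kernel_weak_const_def field_simps intro!: add_nonneg_nonneg mult_nonneg_nonneg)

context elliptic_domain
begin

lemma outer_gradient_L2_le:
  assumes u: "Y12 S u" and \<theta>: "tame_cutoff \<theta>" and R: "R > 0" and \<Gamma>: "\<Gamma> \<ge> 0"
    and bound: "\<And>x. norm (gradient \<theta> x) \<le> \<Gamma> / R" and out: "\<And>x. dist z x \<ge> R \<Longrightarrow> gradient \<theta> x = 0"
  shows "L2_norm S (\<lambda>x. outer (u x) (gradient \<theta> x)) \<le> \<Gamma> / R * L2_norm (S \<inter> ball z R) (u :: real^'d \<Rightarrow> real^'m)"
proof -
  let ?V = "S \<inter> ball z R"
  have V: "?V \<in> sets lebesgue" by (rule sets_ball)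
  have O: "L2_on S (\<lambda>x. outer (u x) (gradient \<theta> x))" by (rule L2_on_outer_gradient[OF dim S u \<theta>])
  have uV: "L2_on ?V u" by (rule local_L2[OF u])
  have cu: "L2_on ?V (\<lambda>x. (\<Gamma> / R) *\<^sub>R u x)"
  proof (rule L2_on_bound[OF uV, of _ "\<Gamma> / R"])
    show "(\<lambda>x. (\<Gamma> / R) *\<^sub>R u x) \<in> borel_measurable (lebesgue_on ?V)"
      using uV borel_measurable_scaleR[OF borel_measurable_const] by (auto simp: L2_on_def)
  qed (use \<Gamma> R in simp)
  have "L2_norm S (\<lambda>x. outer (u x) (gradient \<theta> x)) = L2_norm ?V (\<lambda>x. outer (u x) (gradient \<theta> x))"
    unfolding L2_norm_def
    by (intro arg_cong[where f = sqrt] integral_lebesgue_on_eq)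
       (use S V out in \<open>auto simp: lebesgue_open norm_outer\<close>)
  also have "\<dots> \<le> L2_norm ?V (\<lambda>x. (\<Gamma> / R) *\<^sub>R u x)"
  proof (rule L2_norm_mono[OF cu])
    show "L2_on ?V (\<lambda>x. outer (u x) (gradient \<theta> x))"
      by (rule L2_on_subset[OF O]) (use S V in \<open>auto simp: lebesgue_open\<close>)
    have "norm (outer (u x) (gradient \<theta> x)) \<le> norm ((\<Gamma> / R) *\<^sub>R u x)" for x
      using mult_left_mono[OF bound[of x] norm_ge_zero[of "u x"]] \<Gamma> R by (simp add: norm_outer mult_ac)
    then show "AE x in lebesgue_on ?V. norm (outer (u x) (gradient \<theta> x)) \<le> norm ((\<Gamma> / R) *\<^sub>R u x)" by simp
  qed
  also have "\<dots> = \<Gamma> / R * L2_norm ?V u"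
    using \<Gamma> R by (simp add: L2_norm_def power_mult_distrib power_divide real_sqrt_mult real_sqrt_divide)
  finally show ?thesis .
qed

text \<open>Both solutions are tested with the cut off other solution. The form evaluated at the two full
  gradients cancels, and only terms with the gradient of the cutoff remain.\<close>

lemma localized_reciprocity:
  assumes u: "neumann_solution S A f u" and w: "neumann_solution S (adjoint_coeffs A) g w" and \<zeta>: "tame_cutoff \<zeta>"
  shows "(\<integral>x. g x \<bullet> (\<zeta> x *\<^sub>R u x) \<partial>lebesgue_on S) = (\<integral>x. f x \<bullet> (\<zeta> x *\<^sub>R w x) \<partial>lebesgue_on S)
    + (\<integral>x. coeff_form A x (outer (u x) (gradient \<zeta> x)) (wgrad S w x) \<partial>lebesgue_on S)
    - (\<integral>x. coeff_form A x (wgrad S u x) (outer (w x) (gradient \<zeta> x)) \<partial>lebesgue_on S)"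
proof -
  let ?M = "lebesgue_on S"
  have u12: "Y12 S u" and w12: "Y12 S w" using u w neumann_solution_Y12 by blast+
  note vu = Y12_mult[OF dim S u12 \<zeta>] and vw = Y12_mult[OF dim S w12 \<zeta>]
  have Du: "L2_on S (wgrad S u)" and Dw: "L2_on S (wgrad S w)" using u12 w12 S by (auto simp: Y12_iff)
  have mv: "wgrad S (\<lambda>x. \<zeta> x *\<^sub>R u x) \<in> borel_measurable ?M" "wgrad S (\<lambda>x. \<zeta> x *\<^sub>R w x) \<in> borel_measurable ?M"
    using vu(1) vw(1) S by (auto simp: Y12_iff L2_on_def)
  have zDu: "L2_on S (\<lambda>x. \<zeta> x *\<^sub>R wgrad S u x)" by (rule L2_on_scale[OF Du \<zeta>])
  have Ou: "L2_on S (\<lambda>x. outer (u x) (gradient \<zeta> x))" and Ow: "L2_on S (\<lambda>x. outer (w x) (gradient \<zeta> x))"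
    by (intro L2_on_outer_gradient dim S u12 w12 \<zeta>)+
  note ci = coeff_form_integral(1)[OF A]
  have 1: "(\<integral>x. g x \<bullet> (\<zeta> x *\<^sub>R u x) \<partial>?M)
      = (\<integral>x. coeff_form A x (\<zeta> x *\<^sub>R wgrad S u x) (wgrad S w x) + coeff_form A x (outer (u x) (gradient \<zeta> x)) (wgrad S w x) \<partial>?M)"
    unfolding neumann_solution_test[OF S w vu(1), symmetric] coeff_form_adjoint
  proof (rule integral_cong_AE)
    show "AE x in ?M. coeff_form A x (wgrad S (\<lambda>x. \<zeta> x *\<^sub>R u x) x) (wgrad S w x)
        = coeff_form A x (\<zeta> x *\<^sub>R wgrad S u x) (wgrad S w x) + coeff_form A x (outer (u x) (gradient \<zeta> x)) (wgrad S w x)"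
      using vu(2) by eventually_elim (simp add: coeff_form_add_left)
  qed (use mv Dw ci[OF zDu Dw] ci[OF Ou Dw] in \<open>auto simp: L2_on_def intro!: coeff_form_measurable[OF A]\<close>)
  have 2: "(\<integral>x. f x \<bullet> (\<zeta> x *\<^sub>R w x) \<partial>?M)
      = (\<integral>x. coeff_form A x (\<zeta> x *\<^sub>R wgrad S u x) (wgrad S w x) + coeff_form A x (wgrad S u x) (outer (w x) (gradient \<zeta> x)) \<partial>?M)"
    unfolding neumann_solution_test[OF S u vw(1), symmetric]
  proof (rule integral_cong_AE)
    show "AE x in ?M. coeff_form A x (wgrad S u x) (wgrad S (\<lambda>x. \<zeta> x *\<^sub>R w x) x)
        = coeff_form A x (\<zeta> x *\<^sub>R wgrad S u x) (wgrad S w x) + coeff_form A x (wgrad S u x) (outer (w x) (gradient \<zeta> x))"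
      using vw(2) by eventually_elim (simp add: coeff_form_add_right coeff_form_scale_right coeff_form_scale_left)
  qed (use mv Du ci[OF zDu Dw] ci[OF Du Ow] in \<open>auto simp: L2_on_def intro!: coeff_form_measurable[OF A]\<close>)
  show ?thesis
    unfolding 1 2 using ci[OF zDu Dw] ci[OF Ou Dw] ci[OF Du Ow] by simp
qed

text \<open>By the pointwise bound $|w|$ is at most the Riesz potential of $|\psi|$. After exchanging the
  integrals, the kernel is integrated over the ball for each fixed pole.\<close>

lemma kernel_potential_integral:
  fixes N :: "('d, 'm) kernel"
  assumes P: "P \<ge> 0"
    and pw: "\<And>x z. x \<in> S \<Longrightarrow> z \<in> S \<Longrightarrow> x \<noteq> z \<Longrightarrow> norm (real_mat (N x z)) \<le> P * norm (x - z) powr (2 - real CARD('d))"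
    and \<psi>: "\<psi> \<in> Cc_inf S" and R: "R > 0"
    and w: "w = (\<lambda>x. \<integral>y. transpose (real_mat (N y x)) *v axis k (\<psi> y) \<partial>lebesgue_on S)"
  shows "(\<integral>\<^sup>+x. ennreal (norm (w x)) \<partial>lebesgue_on (S \<inter> ball z R))
    \<le> ennreal (P * riesz_const (real CARD('d)) * R\<^sup>2 * (\<integral>x. \<bar>\<psi> x\<bar> \<partial>lebesgue_on S))"
proof -
  let ?n = "real CARD('d)"
  let ?V = "S \<inter> ball z R"
  let ?I = "\<integral>x. \<bar>\<psi> x\<bar> \<partial>lebesgue_on S"
  let ?F = "\<lambda>(x, y). indicator (ball z R) x * ennreal (P * \<bar>\<psi> y\<bar> * norm (y - x) powr (2 - ?n))"
  have \<psi>b: "\<psi> \<in> borel_measurable borel"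
    by (intro borel_measurable_continuous_onI smooth_continuous_on Cc_inf_smooth[OF \<psi>])
  have pt: "ennreal (norm (w x)) \<le> (\<integral>\<^sup>+y. ennreal (P * \<bar>\<psi> y\<bar> * norm (y - x) powr (2 - ?n)) \<partial>lborel)" if x: "x \<in> S" for x
  proof -
    let ?h = "\<lambda>y. \<psi> y *\<^sub>R row k (real_mat (N y x))"
    have wx: "w x = (\<integral>y. ?h y \<partial>lebesgue_on S)" unfolding w transpose_mult_axis ..
    have "ennreal (norm (w x)) \<le> (\<integral>\<^sup>+y. ennreal (norm (?h y)) \<partial>lebesgue_on S)"
    proof (cases "integrable (lebesgue_on S) ?h")
      case True
      then show ?thesis unfolding wx by (rule integral_norm_bound_ennreal)
    qed (simp add: wx not_integrable_integral_eq)
    also have "\<dots> \<le> (\<integral>\<^sup>+y. ennreal (P * \<bar>\<psi> y\<bar> * norm (y - x) powr (2 - ?n)) \<partial>lebesgue_on S)"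
    proof (rule nn_integral_mono_AE)
      have "AE y in lebesgue. y \<noteq> x"
        using AE_not_in[of "{x}" lebesgue] by (simp add: null_sets_completionI)
      then have "AE y in lebesgue_on S. y \<noteq> x" using S by (auto simp: AE_restrict_space_iff lebesgue_open elim: eventually_mono)
      moreover have "AE y in lebesgue_on S. y \<in> S" using S by (auto simp: AE_restrict_space_iff lebesgue_open)
      ultimately show "AE y in lebesgue_on S. ennreal (norm (?h y)) \<le> ennreal (P * \<bar>\<psi> y\<bar> * norm (y - x) powr (2 - ?n))"
      proof eventually_elim
        case (elim y)
        have "norm (row k (real_mat (N y x))) \<le> norm (real_mat (N y x))" by (rule norm_row_le)
        also have "\<dots> \<le> P * norm (y - x) powr (2 - ?n)" using elim x by (intro pw) auto
        finally have "\<bar>\<psi> y\<bar> * norm (row k (real_mat (N y x))) \<le> \<bar>\<psi> y\<bar> * (P * norm (y - x) powr (2 - ?n))"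
          by (rule mult_left_mono) simp
        then show ?case by (intro ennreal_leI) (simp add: mult_ac)
      qed
    qed
    also have "\<dots> \<le> (\<integral>\<^sup>+y. ennreal (P * \<bar>\<psi> y\<bar> * norm (y - x) powr (2 - ?n)) \<partial>lebesgue)"
      unfolding nn_integral_set_lebesgue_on[OF lebesgue_open[OF S], symmetric]
      by (intro nn_integral_mono) (auto simp: indicator_def)
    also have "\<dots> = (\<integral>\<^sup>+y. ennreal (P * \<bar>\<psi> y\<bar> * norm (y - x) powr (2 - ?n)) \<partial>lborel)"
      using \<psi>b by (intro nn_integral_completion) measurable
    finally show ?thesis .
  qed
  have Fm: "?F \<in> borel_measurable (lborel \<Otimes>\<^sub>M lborel)"
  proof -
    note [measurable] = \<psi>b
    have [measurable]: "ball z R \<in> sets borel" by simp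
    have "?F \<in> borel_measurable (borel \<Otimes>\<^sub>M borel)" unfolding case_prod_beta by measurable
    then show ?thesis
      by (simp cong: measurable_cong_sets add: sets_pair_measure_cong[OF sets_lborel sets_lborel])
  qed
  have "(\<integral>\<^sup>+x. ennreal (norm (w x)) \<partial>lebesgue_on ?V) = (\<integral>\<^sup>+x\<in>?V. ennreal (norm (w x)) \<partial>lebesgue)"
    by (rule nn_integral_set_lebesgue_on[OF sets_ball, symmetric])
  also have "\<dots> \<le> (\<integral>\<^sup>+x. (\<integral>\<^sup>+y. ?F (x, y) \<partial>lborel) \<partial>lebesgue)"
  proof (rule nn_integral_mono)
    fix x
    show "ennreal (norm (w x)) * indicator ?V x \<le> (\<integral>\<^sup>+y. ?F (x, y) \<partial>lborel)"
      using pt[of x] by (auto simp: indicator_def)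
  qed
  also have "\<dots> = (\<integral>\<^sup>+x. (\<integral>\<^sup>+y. ?F (x, y) \<partial>lborel) \<partial>lborel)"
    using Fm by (intro nn_integral_completion lborel.borel_measurable_nn_integral_fst)
  also have "\<dots> = (\<integral>\<^sup>+y. (\<integral>\<^sup>+x. ?F (x, y) \<partial>lborel) \<partial>lborel)"
    by (rule lborel_pair.Fubini[OF Fm, symmetric])
  also have "\<dots> \<le> (\<integral>\<^sup>+y. ennreal (P * \<bar>\<psi> y\<bar>) * ennreal (riesz_const ?n * R\<^sup>2) \<partial>lborel)"
  proof (rule nn_integral_mono)
    fix y
    have "(\<integral>\<^sup>+x. ?F (x, y) \<partial>lborel) = (\<integral>\<^sup>+x. ennreal (P * \<bar>\<psi> y\<bar>) * (ennreal (norm (y - x) powr (2 - ?n)) * indicator (ball z R) x) \<partial>lborel)"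
      using P by (intro nn_integral_cong) (simp add: ennreal_mult mult_ac)
    also have "\<dots> = ennreal (P * \<bar>\<psi> y\<bar>) * (\<integral>\<^sup>+x\<in>ball z R. ennreal (norm (y - x) powr (2 - ?n)) \<partial>lborel)"
    proof -
      have [measurable]: "ball z R \<in> sets borel" by simp
      show ?thesis by (rule nn_integral_cmult) measurable
    qed
    also have "\<dots> \<le> ennreal (P * \<bar>\<psi> y\<bar>) * ennreal (riesz_const ?n * R\<^sup>2)"
      by (intro mult_left_mono riesz_kernel_integral[OF dim R]) auto
    finally show "(\<integral>\<^sup>+x. ?F (x, y) \<partial>lborel) \<le> ennreal (P * \<bar>\<psi> y\<bar>) * ennreal (riesz_const ?n * R\<^sup>2)" .
  qed
  also have "\<dots> = (\<integral>\<^sup>+y. ennreal \<bar>\<psi> y\<bar> \<partial>lborel) * ennreal (P * (riesz_const ?n * R\<^sup>2))"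
  proof -
    have rc: "riesz_const ?n \<ge> 0" using dim by (intro riesz_const_nonneg) simp
    have "(\<integral>\<^sup>+y. ennreal (P * \<bar>\<psi> y\<bar>) * ennreal (riesz_const ?n * R\<^sup>2) \<partial>lborel)
        = (\<integral>\<^sup>+y. ennreal \<bar>\<psi> y\<bar> * ennreal (P * (riesz_const ?n * R\<^sup>2)) \<partial>lborel)"
      using P rc by (intro nn_integral_cong) (simp add: mult_ac flip: ennreal_mult)
    also have "\<dots> = (\<integral>\<^sup>+y. ennreal \<bar>\<psi> y\<bar> \<partial>lborel) * ennreal (P * (riesz_const ?n * R\<^sup>2))"
      using \<psi>b by (intro nn_integral_multc) measurable
    finally show ?thesis .
  qed
  also have "(\<integral>\<^sup>+y. ennreal \<bar>\<psi> y\<bar> \<partial>lborel) = ennreal ?I"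
  proof -
    have "(\<integral>\<^sup>+y. ennreal \<bar>\<psi> y\<bar> \<partial>lborel) = (\<integral>\<^sup>+y. ennreal \<bar>\<psi> y\<bar> \<partial>lebesgue_on UNIV)"
      using \<psi>b by (simp add: lebesgue_on_UNIV_eq nn_integral_completion)
    also have "\<dots> = ennreal (\<integral>y. \<bar>\<psi> y\<bar> \<partial>lebesgue_on UNIV)"
      by (intro nn_integral_eq_integral integrable_abs Cc_inf_integrable[OF \<psi>]) auto
    also have "(\<integral>y. \<bar>\<psi> y\<bar> \<partial>lebesgue_on UNIV) = ?I"
      by (rule integral_lebesgue_on_eq) (use S Cc_inf_outside[OF \<psi>] in \<open>auto simp: lebesgue_open\<close>)
    finally show ?thesis .
  qed
  also have "ennreal ?I * ennreal (P * (riesz_const ?n * R\<^sup>2)) = ennreal (P * riesz_const ?n * R\<^sup>2 * ?I)"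
    by (subst ennreal_mult'[symmetric]) (auto simp: mult_ac)
  finally show ?thesis .
qed

definition inner_slope :: real where "inner_slope = cutoff_slope TYPE('d) (5 / 8) (6 / 8)"

definition annulus_slope :: real where
  "annulus_slope = cutoff_slope TYPE('d) (6 / 8) (7 / 8) + cutoff_slope TYPE('d) (9 / 16) (10 / 16)"

definition local_gradient_const :: real where
  "local_gradient_const = sqrt ((1 + 4 * (form_bound TYPE('d) TYPE('m) M)\<^sup>2 / lam * annulus_slope\<^sup>2) / lam)"

definition kernel_annulus_const :: "real \<Rightarrow> real" where
  "kernel_annulus_const P = P * 16 powr (real CARD('d) - 2) * sqrt (unit_ball_vol (real CARD('d)))"

text \<open>The three summands belong to the three integrals on the right of \<open>localized_reciprocity\<close>: the source,
  the gradient of the dual solution and the gradient of the solution.\<close>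

definition local_sup_const :: "real \<Rightarrow> real" where
  "local_sup_const P = P * riesz_const (real CARD('d))
     + form_bound TYPE('d) TYPE('m) M * (2 * form_bound TYPE('d) TYPE('m) M / lam) * inner_slope * annulus_slope * kernel_annulus_const P
     + form_bound TYPE('d) TYPE('m) M * local_gradient_const * inner_slope * kernel_annulus_const P * (1 + sqrt (unit_ball_vol (real CARD('d))))"

text \<open>The dual solution has its data at distance below $R/2$ from \<open>z\<close>, and the inner cutoff has its gradient
  at distances between $5R/8$ and $6R/8$. The annular cutoff is 1 there and vanishes below $9R/16$, so its
  support keeps distance $R/16$ from the data, and it is 0 again before the distance reaches \<open>R\<close>.\<close>

definition annulus_cutoff :: "real^'d \<Rightarrow> real \<Rightarrow> real^'d \<Rightarrow> real" where
  "annulus_cutoff z R x = cutoff_at z R (6 / 8) (7 / 8) x * (1 - cutoff_at z R (9 / 16) (10 / 16) x)"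

context
  fixes z :: "real^'d" and R :: real
  assumes R: "R > 0"
begin

lemma annulus_cutoff_tame: "tame_cutoff (annulus_cutoff z R)"
  unfolding annulus_cutoff_def[abs_def]
  by (intro tame_cutoff_mult tame_cutoff_complement cutoff_at_tame R) auto

lemma annulus_cutoff_inside: "dist z x \<le> 9 / 16 * R \<Longrightarrow> annulus_cutoff z R x = 0"
  unfolding annulus_cutoff_def using cutoff_at_inside[OF R, of "9 / 16" "10 / 16" z x] by simp

lemma annulus_cutoff_outside: "dist z x \<ge> R \<Longrightarrow> annulus_cutoff z R x = 0"
  unfolding annulus_cutoff_def using cutoff_at_outside[OF R, of "6 / 8" "7 / 8" z x] R by simp

lemma annulus_cutoff_middle: "5 / 8 * R \<le> dist z x \<Longrightarrow> dist z x \<le> 6 / 8 * R \<Longrightarrow> annulus_cutoff z R x = 1"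
  unfolding annulus_cutoff_def
  using cutoff_at_outside[OF R, of "9 / 16" "10 / 16" z x] cutoff_at_inside[OF R, of "6 / 8" "7 / 8" z x] by simp

lemma annulus_cutoff_range: "0 \<le> annulus_cutoff z R x" "annulus_cutoff z R x \<le> 1"
  unfolding annulus_cutoff_def
  using cutoff_at_range[OF R, of "6 / 8" "7 / 8" z x] cutoff_at_range[OF R, of "9 / 16" "10 / 16" z x]
  by (auto intro: mult_le_one)

lemma annulus_cutoff_gradient:
  "gradient (annulus_cutoff z R) x = cutoff_at z R (6 / 8) (7 / 8) x *\<^sub>R (- gradient (cutoff_at z R (9 / 16) (10 / 16)) x)
    + (1 - cutoff_at z R (9 / 16) (10 / 16) x) *\<^sub>R gradient (cutoff_at z R (6 / 8) (7 / 8)) x"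
proof -
  have s1: "smooth (cutoff_at z R (6 / 8) (7 / 8))" and s2: "smooth (cutoff_at z R (9 / 16) (10 / 16))"
    by (auto intro!: cutoff_at_smooth[OF R])
  show ?thesis
    unfolding annulus_cutoff_def[abs_def] gradient_mult[OF s1 smooth_diff[OF smooth_const s2]] gradient_complement[OF s2] ..
qed

lemma annulus_cutoff_gradient_zero:
  "dist z x < 9 / 16 * R \<or> R \<le> dist z x \<Longrightarrow> gradient (annulus_cutoff z R) x = 0"
  unfolding annulus_cutoff_gradient
  using cutoff_at_inside[OF R, of "9 / 16" "10 / 16" z x] cutoff_at_gradient_inside[OF R, of "9 / 16" "10 / 16" z x]
    cutoff_at_outside[OF R, of "6 / 8" "7 / 8" z x] cutoff_at_gradient_outside[OF R, of "6 / 8" "7 / 8" z x] R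
  by auto

lemma annulus_cutoff_gradient_bound: "norm (gradient (annulus_cutoff z R) x) \<le> annulus_slope / R"
proof -
  let ?a = "cutoff_at z R (6 / 8) (7 / 8)" and ?b = "cutoff_at z R (9 / 16) (10 / 16)"
  have ra: "0 \<le> ?a x" "?a x \<le> 1" and rb: "0 \<le> ?b x" "?b x \<le> 1"
    by (auto intro!: cutoff_at_range[OF R])
  have ga: "norm (gradient ?a x) \<le> cutoff_slope TYPE('d) (6 / 8) (7 / 8) / R"
    and gb: "norm (gradient ?b x) \<le> cutoff_slope TYPE('d) (9 / 16) (10 / 16) / R"
    by (auto intro!: cutoff_at_gradient_bound[OF R])
  have "norm (gradient (annulus_cutoff z R) x) \<le> norm (?a x *\<^sub>R (- gradient ?b x)) + norm ((1 - ?b x) *\<^sub>R gradient ?a x)"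
    unfolding annulus_cutoff_gradient by (rule norm_triangle_ineq)
  also have "\<dots> = ?a x * norm (gradient ?b x) + (1 - ?b x) * norm (gradient ?a x)"
    using ra rb by simp
  also have "\<dots> \<le> 1 * norm (gradient ?b x) + 1 * norm (gradient ?a x)"
    using ra rb by (intro add_mono mult_right_mono) auto
  also have "\<dots> \<le> annulus_slope / R" using ga gb by (simp add: annulus_slope_def add_divide_distrib)
  finally show ?thesis .
qed

end

lemma annulus_slope_pos: "annulus_slope > 0"
  unfolding annulus_slope_def by (intro add_pos_pos cutoff_slope(1)) auto

lemma inner_slope_pos: "inner_slope > 0"
  unfolding inner_slope_def by (intro cutoff_slope(1)) auto

lemma L2_norm_one:
  assumes R: "R > 0"
  shows "L2_on (S \<inter> ball z R) (\<lambda>x. 1 :: real)"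
    and "L2_norm (S \<inter> ball z R) (\<lambda>x. 1 :: real) \<le> sqrt (unit_ball_vol (real CARD('d)) * R ^ CARD('d))"
proof -
  have "S \<inter> ball z R \<in> lmeasurable"
    using sets_ball lmeasurable_ball[of z R] by (metis fmeasurable_Int_fmeasurable inf.commute lebesgue_open[OF S])
  then show *: "L2_on (S \<inter> ball z R) (\<lambda>x. 1 :: real)"
    unfolding L2_on_def by (auto intro!: finite_measure.integrable_const finite_measure_lebesgue_on)
  show "L2_norm (S \<inter> ball z R) (\<lambda>x. 1 :: real) \<le> sqrt (unit_ball_vol (real CARD('d)) * R ^ CARD('d))"
    using L2_norm_bounded[OF sets_ball *, of 1 R z] R by auto
qed

lemma local_L1_le:
  fixes u :: "real^'d \<Rightarrow> real^'m"
  assumes u: "L2_on (S \<inter> ball z R) u" and R: "R > 0"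
  shows "integrable (lebesgue_on (S \<inter> ball z R)) (\<lambda>x. norm (u x))"
    and "(\<integral>x. norm (u x) \<partial>lebesgue_on (S \<inter> ball z R))
      \<le> sqrt (unit_ball_vol (real CARD('d)) * R ^ CARD('d)) * L2_norm (S \<inter> ball z R) u"
proof -
  note * = L2_integrable_products[OF L2_norm_one(1)[OF R] u]
  show "integrable (lebesgue_on (S \<inter> ball z R)) (\<lambda>x. norm (u x))" using *(1) by simp
  have "(\<integral>x. norm (u x) \<partial>lebesgue_on (S \<inter> ball z R)) \<le> L2_norm (S \<inter> ball z R) (\<lambda>x. 1 :: real) * L2_norm (S \<inter> ball z R) u"
    using *(2) by simp
  also have "\<dots> \<le> sqrt (unit_ball_vol (real CARD('d)) * R ^ CARD('d)) * L2_norm (S \<inter> ball z R) u"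
    by (intro mult_right_mono L2_norm_one(2)[OF R]) simp
  finally show "(\<integral>x. norm (u x) \<partial>lebesgue_on (S \<inter> ball z R))
      \<le> sqrt (unit_ball_vol (real CARD('d)) * R ^ CARD('d)) * L2_norm (S \<inter> ball z R) u" .
qed

text \<open>In the Caccioppoli inequality the source term is at most $\|f\|_\infty \|u\|_{L^1}$. By the Cauchy-Schwarz
  inequality this is a product \<open>a * b\<close> of the two quantities on the right, and $2ab \le (a+b)^2$.\<close>

lemma annulus_gradient_estimate:
  assumes u: "neumann_solution S A f u" and R: "R > 0" and F: "F \<ge> 0"
    and f: "\<And>x. x \<in> S \<inter> ball z R \<Longrightarrow> norm (f x) \<le> F"
  shows "L2_norm S (\<lambda>x. annulus_cutoff z R x *\<^sub>R wgrad S u x)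
    \<le> local_gradient_const * (F * R * sqrt (unit_ball_vol (real CARD('d)) * R ^ CARD('d)) + L2_norm (S \<inter> ball z R) u / R)"
proof -
  let ?\<theta> = "annulus_cutoff z R"
  let ?V = "S \<inter> ball z R"
  let ?c = "form_bound TYPE('d) TYPE('m) M"
  let ?sq = "sqrt (unit_ball_vol (real CARD('d)) * R ^ CARD('d))"
  let ?X = "L2_norm S (\<lambda>x. ?\<theta> x *\<^sub>R wgrad S u x)" and ?Y = "L2_norm S (\<lambda>x. outer (u x) (gradient ?\<theta> x))"
  let ?a = "F * R * ?sq" and ?b = "L2_norm ?V u / R"
  let ?k = "4 * ?c\<^sup>2 / lam * annulus_slope\<^sup>2"
  have u12: "Y12 S u" by (rule neumann_solution_Y12[OF u])
  have \<theta>: "tame_cutoff ?\<theta>" by (rule annulus_cutoff_tame[OF R])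
  have Y: "?Y \<le> annulus_slope / R * L2_norm ?V u"
    by (rule outer_gradient_L2_le[OF u12 \<theta> R less_imp_le[OF annulus_slope_pos] annulus_cutoff_gradient_bound[OF R]])
       (simp add: annulus_cutoff_gradient_zero[OF R])
  have "(\<integral>x. (?\<theta> x)\<^sup>2 * (f x \<bullet> u x) \<partial>lebesgue_on S) = (\<integral>x. (?\<theta> x)\<^sup>2 * (f x \<bullet> u x) \<partial>lebesgue_on ?V)"
    by (rule integral_lebesgue_on_eq) (use S sets_ball annulus_cutoff_outside[OF R] in \<open>auto simp: lebesgue_open\<close>)
  also have "\<dots> \<le> (\<integral>x. F * norm (u x) \<partial>lebesgue_on ?V)"
  proof (rule integral_mono')
    show "integrable (lebesgue_on ?V) (\<lambda>x. F * norm (u x))"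
      by (intro integrable_mult_right local_L1_le(1)[OF local_L2[OF u12] R])
    fix x assume "x \<in> space (lebesgue_on ?V)"
    then have x: "x \<in> ?V" using sets_ball by simp
    have "f x \<bullet> u x \<le> norm (f x) * norm (u x)" by (rule norm_cauchy_schwarz)
    also have "\<dots> \<le> F * norm (u x)" using f[OF x] by (rule mult_right_mono) simp
    finally have "f x \<bullet> u x \<le> F * norm (u x)" .
    then have "(?\<theta> x)\<^sup>2 * (f x \<bullet> u x) \<le> (?\<theta> x)\<^sup>2 * (F * norm (u x))" by (rule mult_left_mono) simp
    also have "\<dots> \<le> 1 * (F * norm (u x))"
      using annulus_cutoff_range[OF R, of z x] F by (intro mult_right_mono) (auto simp: power_le_one)
    finally show "(?\<theta> x)\<^sup>2 * (f x \<bullet> u x) \<le> F * norm (u x)" by simp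
    show "0 \<le> F * norm (u x)" using F by simp
  qed
  also have "\<dots> \<le> F * (?sq * L2_norm ?V u)"
    using local_L1_le(2)[OF local_L2[OF u12] R] F by (simp add: mult_left_mono)
  also have "\<dots> = ?a * ?b" using R by simp
  finally have fu: "(\<integral>x. (?\<theta> x)\<^sup>2 * (f x \<bullet> u x) \<partial>lebesgue_on S) \<le> ?a * ?b" .
  have ab: "?a \<ge> 0" "?b \<ge> 0" using F R by (auto intro!: mult_nonneg_nonneg)
  have k0: "?k \<ge> 0" using lam by simp
  have "lam * ?X\<^sup>2 \<le> 2 * (?a * ?b) + 4 * ?c\<^sup>2 / lam * ?Y\<^sup>2"
    using caccioppoli[OF dim S A lam u \<theta>] fu by linarith
  also have "4 * ?c\<^sup>2 / lam * ?Y\<^sup>2 \<le> 4 * ?c\<^sup>2 / lam * (annulus_slope / R * L2_norm ?V u)\<^sup>2"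
    using lam Y by (intro mult_left_mono power_mono) auto
  also have "\<dots> = ?k * ?b\<^sup>2" by (simp add: power_mult_distrib power_divide)
  also have "2 * (?a * ?b) + ?k * ?b\<^sup>2 \<le> (1 + ?k) * (?a + ?b)\<^sup>2"
  proof -
    have "2 * (?a * ?b) \<le> (?a + ?b)\<^sup>2" by (simp add: power2_sum)
    moreover have "?k * ?b\<^sup>2 \<le> ?k * (?a + ?b)\<^sup>2" using ab k0 by (intro mult_left_mono power_mono) auto
    ultimately show ?thesis by (simp add: algebra_simps)
  qed
  finally have "?X\<^sup>2 \<le> (1 + ?k) / lam * (?a + ?b)\<^sup>2" using lam by (simp add: field_simps)
  also have "\<dots> = (local_gradient_const * (?a + ?b))\<^sup>2"
    using k0 lam by (simp add: local_gradient_const_def power_mult_distrib)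
  finally show ?thesis
    by (rule power2_le_imp_le) (use ab k0 lam in \<open>auto simp: local_gradient_const_def intro!: mult_nonneg_nonneg\<close>)
qed

text \<open>For a test function \<open>\<psi>\<close> on the half ball let \<open>w\<close> solve the adjoint problem with data \<open>\<psi>\<close> in the \<open>k\<close>-th
  component. Since the inner cutoff is 1 on the half ball, \<open>localized_reciprocity\<close> writes the pairing of
  $u^k$ and \<open>\<psi>\<close> as a sum of three integrals (\<open>T1\<close>, \<open>T2\<close>, \<open>T3\<close>). Each of them is bounded by a multiple of the
  $L^1$ norm of \<open>\<psi>\<close>, and \<open>Linf_duality\<close> applies.\<close>

lemma local_boundedness:
  fixes N Nt :: "('d, 'm) kernel"
  assumes NP: "neumann_pair S A N Nt" and P: "P \<ge> 0"
    and pw: "\<And>x z. x \<in> S \<Longrightarrow> z \<in> S \<Longrightarrow> x \<noteq> z \<Longrightarrow> norm (real_mat (N x z)) \<le> P * norm (x - z) powr (2 - real CARD('d))"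
    and u: "neumann_solution S A f u" and R: "R > 0" and F: "F \<ge> 0"
    and f: "\<And>x. x \<in> S \<inter> ball z R \<Longrightarrow> norm (f x) \<le> F"
  shows "AE x in lebesgue_on (S \<inter> ball z (R / 2)). norm (u x) \<le>
    real CARD('m) * (local_sup_const P * (R powr (- (real CARD('d) / 2)) * L2_norm (S \<inter> ball z R) u + R\<^sup>2 * F))"
proof -
  interpret adj: elliptic_domain S "adjoint_coeffs A" lam M Cb by (rule elliptic_domain_adjoint)
  let ?n = "real CARD('d)"
  let ?V = "S \<inter> ball z R" and ?U = "S \<inter> ball z (R / 2)"
  let ?c = "form_bound TYPE('d) TYPE('m) M"
  let ?\<omega> = "unit_ball_vol ?n"
  let ?sq = "sqrt (?\<omega> * R ^ CARD('d))"
  let ?\<zeta> = "cutoff_at z R (5 / 8) (6 / 8)" and ?\<theta> = "annulus_cutoff z R"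
  let ?N2 = "L2_norm ?V u"
  let ?T = "R powr (- (?n / 2)) * ?N2 + R\<^sup>2 * F"
  let ?\<rho> = "riesz_const ?n"
  have ab: "(0::real) \<le> 5 / 8" "(5 / 8 :: real) < 6 / 8" by auto
  have c0: "?c \<ge> 0" using form_bound_pos[OF M] by (rule less_imp_le)
  have \<zeta>: "tame_cutoff ?\<zeta>" by (rule cutoff_at_tame[OF R ab])
  have \<theta>: "tame_cutoff ?\<theta>" by (rule annulus_cutoff_tame[OF R])
  have opU: "open ?U" using S by auto
  have u12: "Y12 S u" by (rule neumann_solution_Y12[OF u])
  have Du: "L2_on S (wgrad S u)" using u12 S by (simp add: Y12_iff)
  have \<zeta>grad: "dist z x \<ge> 5 / 8 * R \<and> dist z x \<le> 6 / 8 * R" if "gradient ?\<zeta> x \<noteq> 0" for x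
    using that cutoff_at_gradient_inside[OF R ab, of z x] cutoff_at_gradient_outside[OF R ab, of z x] by fastforce
  have \<zeta>bound: "norm (gradient ?\<zeta> x) \<le> inner_slope / R" for x
    unfolding inner_slope_def by (rule cutoff_at_gradient_bound[OF R ab])
  have Ou: "L2_norm S (\<lambda>x. outer (u x) (gradient ?\<zeta> x)) \<le> inner_slope / R * ?N2"
  proof (rule outer_gradient_L2_le[OF u12 \<zeta> R less_imp_le[OF inner_slope_pos] \<zeta>bound])
    show "gradient ?\<zeta> x = 0" if "dist z x \<ge> R" for x using \<zeta>grad[of x] that R by fastforce
  qed
  have comp: "AE x in lebesgue_on ?U. \<bar>u x $ k\<bar> \<le> local_sup_const P * ?T" for k
  proof (rule Linf_duality[OF opU])
    show "L1_loc ?U (\<lambda>x. u x $ k)" by (rule Y12_component_L1_loc[OF u12]) auto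
    have "?\<rho> \<ge> 0" using dim by (intro riesz_const_nonneg) simp
    moreover have lg0: "local_gradient_const \<ge> 0" unfolding local_gradient_const_def using lam by simp
    moreover have ka0: "kernel_annulus_const P \<ge> 0" unfolding kernel_annulus_const_def using P by simp
    ultimately have "local_sup_const P \<ge> 0"
      unfolding local_sup_const_def using P c0 lam inner_slope_pos annulus_slope_pos
      by (intro add_nonneg_nonneg mult_nonneg_nonneg) auto
    then show "local_sup_const P * ?T \<ge> 0" using F by (intro mult_nonneg_nonneg add_nonneg_nonneg) auto
    fix \<psi> assume \<psi>: "\<psi> \<in> Cc_inf ?U"
    have \<psi>S: "\<psi> \<in> Cc_inf S" by (rule Cc_inf_mono[OF \<psi>]) auto
    let ?g = "\<lambda>x. axis k (\<psi> x) :: real^'m"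
    define I where "I = (\<integral>x. \<bar>\<psi> x\<bar> \<partial>lebesgue_on S)"
    have I0: "I \<ge> 0" by (simp add: I_def)
    have g: "?g \<in> Cc_inf_vec ?U" by (rule Cc_inf_vec_axis[OF \<psi>])
    have gS: "?g \<in> Cc_inf_vec S" by (rule Cc_inf_vec_axis[OF \<psi>S])
    define w where "w = (\<lambda>x. \<integral>y. transpose (real_mat (N y x)) *v ?g y \<partial>lebesgue_on S)"
    have w: "neumann_solution S (adjoint_coeffs A) ?g w"
      unfolding w_def using NP by (intro neumann_function_solution[OF S _ gS]) (simp add: neumann_pair_def)
    have w12: "Y12 S w" by (rule neumann_solution_Y12[OF w])
    have Dw: "L2_on S (wgrad S w)" using w12 S by (simp add: Y12_iff)
    let ?Bw = "P * (R / 16) powr (2 - ?n) * I"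
    have Bw0: "?Bw \<ge> 0" using P I0 by simp
    have wb: "norm (w x) \<le> ?Bw" if x: "x \<in> S" "dist z x \<ge> 9 / 16 * R" for x
    proof -
      have "norm (w x) \<le> (\<integral>y. norm (\<psi> y *\<^sub>R row k (real_mat (N y x))) \<partial>lebesgue_on S)"
        unfolding w_def transpose_mult_axis by (rule integral_norm_bound)
      also have "\<dots> \<le> (\<integral>y. \<bar>\<psi> y\<bar> * (P * (R / 16) powr (2 - ?n)) \<partial>lebesgue_on S)"
      proof (rule integral_mono')
        show "integrable (lebesgue_on S) (\<lambda>y. \<bar>\<psi> y\<bar> * (P * (R / 16) powr (2 - ?n)))"
          by (intro integrable_mult_left integrable_abs Cc_inf_integrable[OF \<psi> lebesgue_open[OF S]])
        show "0 \<le> \<bar>\<psi> y\<bar> * (P * (R / 16) powr (2 - ?n))" for y using P by simp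
        fix y assume "y \<in> space (lebesgue_on S)"
        then have y: "y \<in> S" by simp
        show "norm (\<psi> y *\<^sub>R row k (real_mat (N y x))) \<le> \<bar>\<psi> y\<bar> * (P * (R / 16) powr (2 - ?n))"
        proof (cases "y \<in> ?U")
          case True
          then have "dist z y < R / 2" by simp
          then have far: "norm (y - x) \<ge> R / 16"
            using x(2) dist_triangle[of z x y] by (simp add: dist_norm norm_minus_commute)
          then have ne: "y \<noteq> x" using R by auto
          have "norm (row k (real_mat (N y x))) \<le> norm (real_mat (N y x))" by (rule norm_row_le)
          also have "\<dots> \<le> P * norm (y - x) powr (2 - ?n)" by (rule pw[OF y x(1) ne])
          also have "\<dots> \<le> P * (R / 16) powr (2 - ?n)"
            using P far R dim by (intro mult_left_mono powr_mono2') auto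
          finally have "\<bar>\<psi> y\<bar> * norm (row k (real_mat (N y x))) \<le> \<bar>\<psi> y\<bar> * (P * (R / 16) powr (2 - ?n))"
            by (rule mult_left_mono) simp
          then show ?thesis by simp
        next
          case False
          then have "\<psi> y = 0" by (rule Cc_inf_outside[OF \<psi>])
          then show ?thesis by simp
        qed
      qed
      also have "\<dots> = ?Bw" by (simp add: I_def)
      finally show ?thesis .
    qed
    have Ow: "L2_norm S (\<lambda>x. outer (w x) (gradient \<xi> x)) \<le> ?Bw * (\<Gamma> / R) * ?sq"
      if \<xi>: "tame_cutoff \<xi>" and b: "\<And>x. norm (gradient \<xi> x) \<le> \<Gamma> / R" and \<Gamma>: "\<Gamma> > 0"
        and z0: "\<And>x. dist z x < 9 / 16 * R \<or> R \<le> dist z x \<Longrightarrow> gradient \<xi> x = 0" for \<xi> \<Gamma>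
    proof (rule L2_norm_bounded[OF lebesgue_open[OF S] L2_on_outer_gradient[OF dim S w12 \<xi>] _ _ R])
      show "norm (outer (w x) (gradient \<xi> x)) \<le> ?Bw * (\<Gamma> / R)" if x: "x \<in> S" for x
      proof (cases "dist z x < 9 / 16 * R")
        case True
        then have "gradient \<xi> x = 0" by (intro z0) auto
        then show ?thesis unfolding norm_outer using Bw0 \<Gamma> R by simp
      next
        case False
        then show ?thesis unfolding norm_outer using Bw0 by (intro mult_mono wb x b) auto
      qed
      show "outer (w x) (gradient \<xi> x) = 0" if "dist z x \<ge> R" for x
      proof -
        have "gradient \<xi> x = 0" by (intro z0) (use that in auto)
        then have "norm (outer (w x) (gradient \<xi> x)) = 0" unfolding norm_outer by simp
        then show ?thesis by simp
      qed
      show "?Bw * (\<Gamma> / R) \<ge> 0" by (rule mult_nonneg_nonneg[OF Bw0]) (use \<Gamma> R in simp)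
    qed
    have \<zeta>w: "L2_norm S (\<lambda>x. outer (w x) (gradient ?\<zeta> x)) \<le> ?Bw * (inner_slope / R) * ?sq"
    proof (rule Ow[OF \<zeta> \<zeta>bound inner_slope_pos])
      show "gradient ?\<zeta> x = 0" if "dist z x < 9 / 16 * R \<or> R \<le> dist z x" for x
        using \<zeta>grad[of x] that R by fastforce
    qed
    have \<theta>w: "L2_norm S (\<lambda>x. outer (w x) (gradient ?\<theta> x)) \<le> ?Bw * (annulus_slope / R) * ?sq"
      by (rule Ow[OF \<theta> annulus_cutoff_gradient_bound[OF R] annulus_slope_pos annulus_cutoff_gradient_zero[OF R]])
    have \<theta>Dw: "L2_norm S (\<lambda>x. ?\<theta> x *\<^sub>R wgrad S w x) \<le> 2 * ?c / lam * (?Bw * (annulus_slope / R) * ?sq)"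
    proof -
      have "L2_norm S (\<lambda>x. ?\<theta> x *\<^sub>R wgrad S w x) \<le> 2 * ?c / lam * L2_norm S (\<lambda>x. outer (w x) (gradient ?\<theta> x))"
      proof (rule adj.caccioppoli_source_free[OF w \<theta>])
        fix x assume "x \<in> S" "?\<theta> x \<noteq> 0"
        then have "\<not> dist z x \<le> 9 / 16 * R" using annulus_cutoff_inside[OF R] by auto
        then have "x \<notin> ?U" using R by auto
        then show "?g x = 0" by (rule Cc_inf_vec_outside[OF g])
      qed
      also have "\<dots> \<le> 2 * ?c / lam * (?Bw * (annulus_slope / R) * ?sq)"
        using \<theta>w c0 lam by (intro mult_left_mono) auto
      finally show ?thesis .
    qed
    have \<theta>Du: "L2_norm S (\<lambda>x. ?\<theta> x *\<^sub>R wgrad S u x) \<le> local_gradient_const * (F * R * ?sq + ?N2 / R)"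
      by (rule annulus_gradient_estimate[OF u R F f])
    (* The annular cutoff may be inserted next to a full gradient, for which no local bound is at hand. *)
    have swap: "gradient ?\<zeta> x \<noteq> 0 \<Longrightarrow> ?\<theta> x = 1" for x
      using \<zeta>grad[of x] annulus_cutoff_middle[OF R, of z x] by blast
    have zero: "coeff_form A x (outer a 0) \<eta> = 0" "coeff_form A x \<eta> (outer a 0) = 0" for x a \<eta>
      by (simp_all add: coeff_form_def outer_def)
    have T2: "\<bar>\<integral>x. coeff_form A x (outer (u x) (gradient ?\<zeta> x)) (wgrad S w x) \<partial>lebesgue_on S\<bar>
        \<le> ?c * ((inner_slope / R * ?N2) * (2 * ?c / lam * (?Bw * (annulus_slope / R) * ?sq)))"
    proof -
      have "coeff_form A x (outer (u x) (gradient ?\<zeta> x)) (wgrad S w x)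
          = coeff_form A x (outer (u x) (gradient ?\<zeta> x)) (?\<theta> x *\<^sub>R wgrad S w x)" for x
        by (cases "gradient ?\<zeta> x = 0") (simp_all add: zero swap)
      then have "\<bar>\<integral>x. coeff_form A x (outer (u x) (gradient ?\<zeta> x)) (wgrad S w x) \<partial>lebesgue_on S\<bar>
          \<le> ?c * (L2_norm S (\<lambda>x. outer (u x) (gradient ?\<zeta> x)) * L2_norm S (\<lambda>x. ?\<theta> x *\<^sub>R wgrad S w x))"
        using coeff_form_integral(2)[OF A L2_on_outer_gradient[OF dim S u12 \<zeta>] L2_on_scale[OF Dw \<theta>]] by simp
      also have "\<dots> \<le> ?c * ((inner_slope / R * ?N2) * (2 * ?c / lam * (?Bw * (annulus_slope / R) * ?sq)))"
        using c0 Ou \<theta>Dw inner_slope_pos R by (intro mult_left_mono mult_mono) auto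
      finally show ?thesis .
    qed
    have T3: "\<bar>\<integral>x. coeff_form A x (wgrad S u x) (outer (w x) (gradient ?\<zeta> x)) \<partial>lebesgue_on S\<bar>
        \<le> ?c * (local_gradient_const * (F * R * ?sq + ?N2 / R) * (?Bw * (inner_slope / R) * ?sq))"
    proof -
      have "coeff_form A x (wgrad S u x) (outer (w x) (gradient ?\<zeta> x))
          = coeff_form A x (?\<theta> x *\<^sub>R wgrad S u x) (outer (w x) (gradient ?\<zeta> x))" for x
        by (cases "gradient ?\<zeta> x = 0") (simp_all add: zero swap)
      then have "\<bar>\<integral>x. coeff_form A x (wgrad S u x) (outer (w x) (gradient ?\<zeta> x)) \<partial>lebesgue_on S\<bar>
          \<le> ?c * (L2_norm S (\<lambda>x. ?\<theta> x *\<^sub>R wgrad S u x) * L2_norm S (\<lambda>x. outer (w x) (gradient ?\<zeta> x)))"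
        using coeff_form_integral(2)[OF A L2_on_scale[OF Du \<theta>] L2_on_outer_gradient[OF dim S w12 \<zeta>]] by simp
      also have "\<dots> \<le> ?c * (local_gradient_const * (F * R * ?sq + ?N2 / R) * (?Bw * (inner_slope / R) * ?sq))"
        using c0 \<theta>Du \<zeta>w order_trans[OF L2_norm_nonneg \<theta>Du] by (intro mult_left_mono mult_mono) auto
      finally show ?thesis .
    qed
    have T1: "\<bar>\<integral>x. f x \<bullet> (?\<zeta> x *\<^sub>R w x) \<partial>lebesgue_on S\<bar> \<le> F * (P * ?\<rho> * R\<^sup>2 * I)"
    proof -
      have wi: "integrable (lebesgue_on ?V) (\<lambda>x. norm (w x))" by (rule local_L1_le(1)[OF local_L2[OF w12] R])
      have "(\<integral>\<^sup>+x. ennreal (norm (w x)) \<partial>lebesgue_on ?V) \<le> ennreal (P * ?\<rho> * R\<^sup>2 * I)"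
        unfolding I_def by (rule kernel_potential_integral[OF P _ \<psi>S R w_def]) (rule pw)
      then have "ennreal (\<integral>x. norm (w x) \<partial>lebesgue_on ?V) \<le> ennreal (P * ?\<rho> * R\<^sup>2 * I)"
        unfolding nn_integral_eq_integral[OF wi AE_I2[OF norm_ge_zero]] .
      then have wI: "(\<integral>x. norm (w x) \<partial>lebesgue_on ?V) \<le> P * ?\<rho> * R\<^sup>2 * I"
        using P I0 \<open>?\<rho> \<ge> 0\<close> by (subst (asm) ennreal_le_iff) auto
      have "(\<integral>x. f x \<bullet> (?\<zeta> x *\<^sub>R w x) \<partial>lebesgue_on S) = (\<integral>x. f x \<bullet> (?\<zeta> x *\<^sub>R w x) \<partial>lebesgue_on ?V)"
      proof (rule integral_lebesgue_on_eq)
        fix x assume "x \<in> S" "x \<notin> ?V"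
        then have "?\<zeta> x = 0" using R by (intro cutoff_at_outside[OF R ab]) auto
        then show "f x \<bullet> (?\<zeta> x *\<^sub>R w x) = 0" by simp
      qed (use S sets_ball in \<open>auto simp: lebesgue_open\<close>)
      also have "\<bar>\<dots>\<bar> \<le> (\<integral>x. \<bar>f x \<bullet> (?\<zeta> x *\<^sub>R w x)\<bar> \<partial>lebesgue_on ?V)" by (rule integral_abs_bound)
      also have "\<dots> \<le> (\<integral>x. F * norm (w x) \<partial>lebesgue_on ?V)"
      proof (rule integral_mono')
        show "integrable (lebesgue_on ?V) (\<lambda>x. F * norm (w x))" by (rule integrable_mult_right[OF wi])
        show "0 \<le> F * norm (w x)" for x using F by simp
        fix x assume "x \<in> space (lebesgue_on ?V)"
        then have x: "x \<in> ?V" using sets_ball by simp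
        have "\<bar>f x \<bullet> (?\<zeta> x *\<^sub>R w x)\<bar> \<le> norm (f x) * norm (?\<zeta> x *\<^sub>R w x)" by (rule Cauchy_Schwarz_ineq2)
        also have "norm (?\<zeta> x *\<^sub>R w x) \<le> norm (w x)"
          using cutoff_at_range[OF R ab, of z x] by (simp add: mult_left_le_one_le)
        then have "norm (f x) * norm (?\<zeta> x *\<^sub>R w x) \<le> F * norm (w x)" using f[OF x] F by (intro mult_mono) auto
        finally show "\<bar>f x \<bullet> (?\<zeta> x *\<^sub>R w x)\<bar> \<le> F * norm (w x)" .
      qed
      also have "\<dots> = F * (\<integral>x. norm (w x) \<partial>lebesgue_on ?V)" by simp
      also have "\<dots> \<le> F * (P * ?\<rho> * R\<^sup>2 * I)" using wI F by (rule mult_left_mono)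
      finally show ?thesis .
    qed
    have "(\<integral>x. u x $ k * \<psi> x \<partial>lebesgue_on ?U) = (\<integral>x. ?g x \<bullet> (?\<zeta> x *\<^sub>R u x) \<partial>lebesgue_on S)"
    proof (rule integral_lebesgue_on_eq)
      show "u x $ k * \<psi> x = ?g x \<bullet> (?\<zeta> x *\<^sub>R u x)" if "x \<in> ?U" for x
      proof -
        have "?\<zeta> x = 1" using that R by (intro cutoff_at_inside[OF R ab]) auto
        then show ?thesis by (simp add: inner_axis' mult.commute)
      qed
      show "?g x \<bullet> (?\<zeta> x *\<^sub>R u x) = 0" if "x \<notin> ?U" for x
        unfolding Cc_inf_vec_outside[OF g that] by (rule inner_zero_left)
    qed (use S opU in \<open>auto simp: lebesgue_open\<close>)
    also have "\<dots> = (\<integral>x. f x \<bullet> (?\<zeta> x *\<^sub>R w x) \<partial>lebesgue_on S)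
      + (\<integral>x. coeff_form A x (outer (u x) (gradient ?\<zeta> x)) (wgrad S w x) \<partial>lebesgue_on S)
      - (\<integral>x. coeff_form A x (wgrad S u x) (outer (w x) (gradient ?\<zeta> x)) \<partial>lebesgue_on S)"
      by (rule localized_reciprocity[OF u w \<zeta>])
    finally have "\<bar>\<integral>x. u x $ k * \<psi> x \<partial>lebesgue_on ?U\<bar> \<le> F * (P * ?\<rho> * R\<^sup>2 * I)
      + ?c * ((inner_slope / R * ?N2) * (2 * ?c / lam * (?Bw * (annulus_slope / R) * ?sq)))
      + ?c * (local_gradient_const * (F * R * ?sq + ?N2 / R) * (?Bw * (inner_slope / R) * ?sq))"
      using T1 T2 T3 by linarith
    also have "\<dots> \<le> local_sup_const P * ?T * I"
    proof -
      let ?Q = "kernel_annulus_const P"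
      have sc: "?Bw * (\<Gamma> / R) * ?sq = \<Gamma> * ?Q * R powr (1 - ?n / 2) * I" for \<Gamma>
      proof -
        have "?Bw * (\<Gamma> / R) * ?sq = P * I * \<Gamma> * ((R / 16) powr (2 - ?n) / R * ?sq)" by simp
        then show ?thesis unfolding annulus_scaling[OF R zero_less_numeral] by (simp add: kernel_annulus_const_def)
      qed
      have p1: "R powr (1 - ?n / 2) / R = R powr (- (?n / 2))"
      proof -
        have "R powr (1 - ?n / 2) / R = R powr (1 - ?n / 2) * R powr (- 1)" using R by (simp add: powr_minus_divide)
        also have "\<dots> = R powr (1 - ?n / 2 + - 1)" by (rule powr_add[symmetric])
        finally show ?thesis by simp
      qed
      have p2: "R * ?sq * R powr (1 - ?n / 2) = sqrt ?\<omega> * R\<^sup>2"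
      proof -
        have "R * ?sq * R powr (1 - ?n / 2) = sqrt ?\<omega> * (R powr 1 * R powr (?n / 2) * R powr (1 - ?n / 2))"
          using R by (simp add: real_sqrt_mult sqrt_power_eq_powr)
        also have "R powr 1 * R powr (?n / 2) * R powr (1 - ?n / 2) = R powr (1 + ?n / 2 + (1 - ?n / 2))"
          by (simp only: powr_add)
        also have "\<dots> = R\<^sup>2" using R by (simp add: powr_numeral)
        finally show ?thesis .
      qed
      have e2: "?c * ((inner_slope / R * ?N2) * (2 * ?c / lam * (annulus_slope * ?Q * R powr (1 - ?n / 2) * I)))
          = ?c * (2 * ?c / lam) * inner_slope * annulus_slope * ?Q * (R powr (1 - ?n / 2) / R * ?N2) * I"
        by (simp add: mult_ac)
      have e3: "?c * (local_gradient_const * (F * R * ?sq + ?N2 / R) * (inner_slope * ?Q * R powr (1 - ?n / 2) * I))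
          = ?c * local_gradient_const * inner_slope * ?Q * ((R * ?sq * R powr (1 - ?n / 2)) * F + R powr (1 - ?n / 2) / R * ?N2) * I"
        by (simp add: algebra_simps)
      (* The products are abbreviated to keep the final comparison linear in t and h. *)
      define t where "t = R powr (- (?n / 2)) * ?N2"
      define h where "h = R\<^sup>2 * F"
      have t0: "t \<ge> 0" and h0: "h \<ge> 0" using F by (auto simp: t_def h_def)
      define k1 where "k1 = P * ?\<rho>"
      define k2 where "k2 = ?c * (2 * ?c / lam) * inner_slope * annulus_slope * ?Q"
      define k3 where "k3 = ?c * local_gradient_const * inner_slope * ?Q"
      have k0: "k1 \<ge> 0" "k2 \<ge> 0" "k3 \<ge> 0"
        unfolding k1_def k2_def k3_def using P \<open>?\<rho> \<ge> 0\<close> c0 lam inner_slope_pos annulus_slope_pos ka0 lg0 by auto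
      have "F * (P * ?\<rho> * R\<^sup>2 * I) + k2 * (R powr (- (?n / 2)) * ?N2) * I
          + k3 * ((sqrt ?\<omega> * R\<^sup>2) * F + R powr (- (?n / 2)) * ?N2) * I
          = (k1 * h + k2 * t + k3 * (sqrt ?\<omega> * h + t)) * I"
        by (simp add: k1_def t_def h_def algebra_simps)
      also have "\<dots> \<le> (k1 * (t + h) + k2 * (t + h) + k3 * (1 + sqrt ?\<omega>) * (t + h)) * I"
      proof (intro mult_right_mono add_mono I0)
        show "k1 * h \<le> k1 * (t + h)" "k2 * t \<le> k2 * (t + h)" using k0 t0 h0 by (auto intro!: mult_left_mono)
        have "sqrt ?\<omega> * h + t \<le> (1 + sqrt ?\<omega>) * (t + h)" using t0 h0 by (simp add: algebra_simps)
        then show "k3 * (sqrt ?\<omega> * h + t) \<le> k3 * (1 + sqrt ?\<omega>) * (t + h)"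
          using k0(3) by (simp add: mult.assoc mult_left_mono)
      qed
      also have "\<dots> = local_sup_const P * ?T * I"
        by (simp add: local_sup_const_def k1_def k2_def k3_def t_def h_def algebra_simps)
      finally show ?thesis unfolding sc e2 e3 p1 p2 k2_def k3_def .
    qed
    also have "I = (\<integral>x. \<bar>\<psi> x\<bar> \<partial>lebesgue_on ?U)"
      unfolding I_def by (rule integral_lebesgue_on_eq) (use S opU Cc_inf_outside[OF \<psi>] in \<open>auto simp: lebesgue_open\<close>)
    finally show "\<bar>\<integral>x. u x $ k * \<psi> x \<partial>lebesgue_on ?U\<bar> \<le> local_sup_const P * ?T * (\<integral>x. \<bar>\<psi> x\<bar> \<partial>lebesgue_on ?U)" .
  qed
  have "AE x in lebesgue_on ?U. \<forall>k. \<bar>u x $ k\<bar> \<le> local_sup_const P * ?T"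
    by (rule AE_all_countable[THEN iffD2]) (use comp in blast)
  then show ?thesis
  proof eventually_elim
    case (elim x)
    have "norm (u x) \<le> (\<Sum>k\<in>UNIV. \<bar>u x $ k\<bar>)" by (rule norm_le_l1_cart)
    also have "\<dots> \<le> (\<Sum>k\<in>(UNIV::'m set). local_sup_const P * ?T)" using elim by (intro sum_mono) auto
    finally show ?case by simp
  qed
qed

text \<open>The absolute value and the added 1 make the constant positive for every \<open>P\<close>.\<close>

definition LB_const :: "real \<Rightarrow> real" where
  "LB_const P = \<bar>real CARD('m) * local_sup_const P\<bar> + 1"

text \<open>The data are continuous, so their essential supremum bounds them at every point.\<close>

lemma Linf_norm_bounds:
  fixes f :: "real^'d \<Rightarrow> real^'m"
  assumes f: "f \<in> Cc_inf_vec S"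
  obtains F where "F \<ge> 0" "Linf_norm (S \<inter> ball z R) f = ennreal F" "\<And>x. x \<in> S \<inter> ball z R \<Longrightarrow> norm (f x) \<le> F"
proof -
  let ?V = "S \<inter> ball z R"
  have V: "open ?V" using S by auto
  have "\<forall>i. \<exists>B. \<forall>x. \<bar>f x $ i\<bar> \<le> B" using Cc_inf_bounded[OF Cc_inf_vec_component[OF f]] by metis
  then obtain B where B: "\<And>i x. \<bar>f x $ i\<bar> \<le> B i" by metis
  have "norm (f x) \<le> (\<Sum>i\<in>UNIV. B i)" for x
    by (rule order_trans[OF norm_le_l1_cart]) (intro sum_mono B)
  then have "Linf_norm ?V f \<le> ennreal (\<Sum>i\<in>UNIV. B i)"
    unfolding Linf_norm_def using Cc_inf_vec_measurable[OF f, of ?V]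
    by (intro esssup_I AE_I2 ennreal_leI) auto
  then obtain F where F: "F \<ge> 0" "Linf_norm ?V f = ennreal F"
    by (metis ennreal_cases ennreal_less_top le_less_trans less_irrefl)
  have "AE x in lebesgue_on ?V. ennreal (norm (f x)) \<le> ennreal F"
    unfolding F(2)[symmetric] Linf_norm_def by (rule esssup_AE)
  then have AE: "AE x in lebesgue_on ?V. norm (f x) \<le> F" using F(1) by simp
  have "continuous_on ?V f"
  proof -
    have "continuous_on ?V (\<lambda>x. \<chi> i. f x $ i)"
      by (intro continuous_on_vec_lambda smooth_continuous_on Cc_inf_smooth[OF Cc_inf_vec_component[OF f]])
    then show ?thesis by simp
  qed
  then have "norm (f x) \<le> F" if "x \<in> ?V" for x
    by (intro AE_continuous_le[OF V continuous_on_norm AE that])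
  then show ?thesis using F that by blast
qed

lemma cond_LB_from_pointwise:
  fixes N Nt :: "('d, 'm) kernel"
  assumes NP: "neumann_pair S A N Nt" and P: "P \<ge> 0"
    and pw: "\<And>x z. x \<in> S \<Longrightarrow> z \<in> S \<Longrightarrow> x \<noteq> z \<Longrightarrow> norm (real_mat (N x z)) \<le> P * norm (x - z) powr (2 - real CARD('d))"
  shows "cond_LB S A (LB_const P)"
  unfolding cond_LB_def
proof (intro conjI ballI allI impI)
  interpret adj: elliptic_domain S "adjoint_coeffs A" lam M Cb by (rule elliptic_domain_adjoint)
  let ?n = "real CARD('d)"
  show "0 < LB_const P" by (simp add: LB_const_def)
  have pwt: "norm (real_mat (Nt x z)) \<le> P * norm (x - z) powr (2 - ?n)" if "x \<in> S" "z \<in> S" "x \<noteq> z" for x z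
    using pw[OF that(2,1)] that neumann_pair_transpose[OF NP that] by (simp add: norm_transpose norm_minus_commute)
  fix f u x and R :: real
  assume f: "f \<in> Cc_inf_vec S" and u: "neumann_solution S A f u \<or> neumann_solution S (adjoint_coeffs A) f u"
    and x: "x \<in> S" and R: "R > 0"
  let ?V = "S \<inter> ball x R" and ?U = "S \<inter> ball x (R / 2)"
  have u12: "Y12 S u" using u neumann_solution_Y12 by blast
  obtain F where F: "F \<ge> 0" "Linf_norm ?V f = ennreal F" "\<And>y. y \<in> ?V \<Longrightarrow> norm (f y) \<le> F"
    using Linf_norm_bounds[OF f, of x R] by blast
  let ?T = "R powr (- (?n / 2)) * L2_norm ?V u + R\<^sup>2 * F"
  have T0: "?T \<ge> 0" using F(1) by (intro add_nonneg_nonneg mult_nonneg_nonneg) auto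
  have "AE y in lebesgue_on ?U. norm (u y) \<le> real CARD('m) * (local_sup_const P * ?T)"
    using u
  proof
    assume "neumann_solution S A f u"
    then show ?thesis by (rule local_boundedness[OF NP P _ _ R F(1), rotated]) (rule F(3), assumption, rule pw)
  next
    assume "neumann_solution S (adjoint_coeffs A) f u"
    then show ?thesis
      by (rule adj.local_boundedness[OF neumann_pair_adjoint[OF NP] P _ _ R F(1), rotated]) (rule F(3), assumption, rule pwt)
  qed
  moreover have "real CARD('m) * (local_sup_const P * ?T) \<le> LB_const P * ?T"
    using mult_right_mono[OF _ T0, of "real CARD('m) * local_sup_const P" "LB_const P"]
    by (simp add: LB_const_def mult.assoc)
  ultimately have AE: "AE y in lebesgue_on ?U. norm (u y) \<le> LB_const P * ?T"
    by (auto elim!: eventually_mono)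
  have "u \<in> borel_measurable (lebesgue_on S)" using u12 S by (simp add: Y12_iff)
  then have um: "u \<in> borel_measurable (lebesgue_on ?U)" by (rule measurable_restrict_mono) auto
  have "Linf_norm ?U u \<le> ennreal (LB_const P * ?T)"
    unfolding Linf_norm_def
  proof (rule esssup_I)
    show "(\<lambda>x. ennreal (norm (u x))) \<in> borel_measurable (lebesgue_on ?U)" using um by measurable
    show "AE y in lebesgue_on ?U. ennreal (norm (u y)) \<le> ennreal (LB_const P * ?T)"
      using AE by eventually_elim (rule ennreal_leI)
  qed
  also have "\<dots> = ennreal (LB_const P) * (ennreal (R powr (- (?n / 2))) * Lp_norm 2 ?V u + ennreal (R\<^sup>2) * Linf_norm ?V f)"
    unfolding F(2) Lp_norm_two[OF sets_ball local_L2[OF u12]]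
    using F(1) by (simp add: ennreal_mult ennreal_plus LB_const_def)
  finally show "Linf_norm ?U u \<le> ennreal (LB_const P) * (ennreal (R powr (- (?n / 2))) * Lp_norm 2 ?V u + ennreal (R\<^sup>2) * Linf_norm ?V f)" .
qed

end

section \<open>Constants that depend only on the structure\<close>

lemma local_bound_const_pos: "local_bound_const TYPE('m::finite) K > 0"
proof -
  have "1 < (4 * (\<bar>K\<bar> + 2))\<^sup>2"
    by (rule one_less_power) auto
  then show ?thesis
    unfolding local_bound_const_def by (intro mult_pos_pos) auto
qed

lemma graph_domain_elliptic:
  fixes \<phi> :: "real^'n::finite \<Rightarrow> real" and A :: "('n option, 'm::finite) coeffs"
  assumes "CARD('n option) \<ge> 3" "K-lipschitz_on UNIV \<phi>" "elliptic_coeffs lam M A" "lam > 0" "M > 0"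
  shows "elliptic_domain (graph_domain \<phi>) A lam M (local_bound_const TYPE('m) K)"
  by unfold_locales
     (use assms graph_domain_open local_bound_const_pos graph_domain_local_bound[OF assms(1,2) refl] in auto)

theorem theorem5p2:
  fixes d lam M K :: real
  assumes "d = real CARD('n::finite option)" and "d \<ge> 3"
    and "lam > 0" and "M > 0"
  shows
    "(\<forall>C1>0. \<exists>C>0. \<exists>Cp :: real \<Rightarrow> real. (\<forall>p. Cp p > 0) \<and>
       (\<forall>(\<phi> :: real^'n \<Rightarrow> real) (A :: ('n option, 'm::finite) coeffs) N Nt \<Omega>.
          \<Omega> = graph_domain \<phi> \<and> K-lipschitz_on UNIV \<phi> \<and> elliptic_coeffs lam M A \<and>
          cond_IH \<Omega> A \<and> neumann_pair \<Omega> A N Nt \<and> cond_LB \<Omega> A C1 \<longrightarrow>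
          (\<forall>x\<in>\<Omega>. \<forall>y\<in>\<Omega>. x \<noteq> y \<longrightarrow> norm (real_mat (N x y)) \<le> C * norm (x - y) powr (2 - d)) \<and>
          (\<forall>G\<in>{N, Nt}. \<forall>y\<in>\<Omega>. \<forall>r>0.
             Lp_norm (2 * d / (d - 2)) (\<Omega> - ball y r) (\<lambda>x. real_mat (G x y))
               + Lp_norm 2 (\<Omega> - ball y r) (kernel_grad \<Omega> G y) \<le> ennreal (C * r powr (1 - d / 2)) \<and>
             (\<forall>p. 1 \<le> p \<and> p < d / (d - 2) \<longrightarrow>
                Lp_norm p (\<Omega> \<inter> ball y r) (\<lambda>x. real_mat (G x y))
                  \<le> ennreal (Cp p * r powr (2 - d + d / p))) \<and>
             (\<forall>t>0. emeasure lebesgue {x \<in> \<Omega>. norm (real_mat (G x y)) > t}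
                  \<le> ennreal (C * t powr (- (d / (d - 2))))) \<and>
             (\<forall>p. 1 \<le> p \<and> p < d / (d - 1) \<longrightarrow>
                Lp_norm p (\<Omega> \<inter> ball y r) (kernel_grad \<Omega> G y)
                  \<le> ennreal (Cp p * r powr (1 - d + d / p))) \<and>
             (\<forall>t>0. emeasure lebesgue {x \<in> \<Omega>. norm (kernel_grad \<Omega> G y x) > t}
                  \<le> ennreal (C * t powr (- (d / (d - 1)))))))) \<and>
     (\<forall>C2::real. \<exists>C1>0.
       (\<forall>(\<phi> :: real^'n \<Rightarrow> real) (A :: ('n option, 'm::finite) coeffs) N Nt \<Omega>.
          \<Omega> = graph_domain \<phi> \<and> K-lipschitz_on UNIV \<phi> \<and> elliptic_coeffs lam M A \<and>
          cond_IH \<Omega> A \<and> neumann_pair \<Omega> A N Nt \<and>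
          (\<forall>x\<in>\<Omega>. \<forall>y\<in>\<Omega>. x \<noteq> y \<longrightarrow> norm (real_mat (N x y)) \<le> C2 * norm (x - y) powr (2 - d)) \<longrightarrow>
          cond_LB \<Omega> A C1))"
    (is "?A \<and> ?B" is "(\<forall>C1>0. \<exists>C>0. \<exists>Cp. _ \<and> (\<forall>\<phi> A N Nt \<Omega>. ?hyp C1 \<phi> A N Nt \<Omega> \<longrightarrow> ?pointwise C N \<Omega> \<and>
      (\<forall>G\<in>{N, Nt}. \<forall>y\<in>\<Omega>. \<forall>r>0. ?bounds C Cp \<Omega> G y r))) \<and> (\<forall>C2::real. \<exists>C1>0. ?LB C2 C1)")
proof (intro conjI)
  let ?Cb = "local_bound_const TYPE('m) K"
  have dim: "CARD('n option) \<ge> 3" using assms(1,2) by linarith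
  have domain: "elliptic_domain \<Omega> A lam M ?Cb"
    if "\<Omega> = graph_domain \<phi>" "K-lipschitz_on UNIV \<phi>" "elliptic_coeffs lam M A"
    for \<phi> :: "real^'n \<Rightarrow> real" and A :: "('n option, 'm) coeffs" and \<Omega>
    unfolding that(1) by (rule graph_domain_elliptic[OF dim that(2,3) assms(3,4)])
  show ?A
  proof (intro allI impI)
    fix C1 :: real
    (* The constants of the locale are known to be positive only for a domain and coefficients that satisfy
       its assumptions. The absolute values and the added 1 cover the case that there are none. *)
    define P where "P = \<bar>elliptic_domain.pointwise_const TYPE('n option) TYPE('m) lam ?Cb C1\<bar> + 1"
    define Q where "Q = elliptic_domain.gradient_const TYPE('n option) TYPE('m) lam M P"
    define C where "C = P + \<bar>kernel_tail_const d P\<bar> + \<bar>Q\<bar> + \<bar>kernel_weak_const d P\<bar> + \<bar>gradient_weak_const d Q\<bar>"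
    define Cp where "Cp p = \<bar>weak_type_ball_const d (kernel_weak_const d P) p (d / (d - 2))\<bar>
        + \<bar>weak_type_ball_const d (gradient_weak_const d Q) p (d / (d - 1))\<bar> + 1" for p
    have P: "P > 0" by (simp add: P_def)
    have C: "P \<le> C" "kernel_tail_const d P + Q \<le> C" "kernel_weak_const d P \<le> C" "gradient_weak_const d Q \<le> C"
      using P by (auto simp: C_def)
    have Cp: "weak_type_ball_const d (kernel_weak_const d P) p (d / (d - 2)) \<le> Cp p"
      "weak_type_ball_const d (gradient_weak_const d Q) p (d / (d - 1)) \<le> Cp p" for p
      by (auto simp: Cp_def)
    have weaken: "ennreal (c * s powr e) \<le> ennreal (c' * s powr e)" if "c \<le> c'" for c c' s e :: real
      using that by (intro ennreal_leI mult_right_mono) auto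
    have pointwise: "norm (real_mat (N x z)) \<le> P * norm (x - z) powr (2 - d)"
      if "elliptic_domain \<Omega> A lam M ?Cb" "neumann_pair \<Omega> A N Nt" "cond_LB \<Omega> A C1" "x \<in> \<Omega>" "z \<in> \<Omega>" "x \<noteq> z"
      for \<Omega> and A :: "('n option, 'm) coeffs" and N Nt x z
    proof -
      have "elliptic_domain.pointwise_const TYPE('n option) TYPE('m) lam ?Cb C1 * norm (x - z) powr (2 - d)
          \<le> P * norm (x - z) powr (2 - d)"
        by (rule mult_right_mono) (auto simp: P_def)
      with elliptic_domain.neumann_function_pointwise[OF that] show ?thesis
        unfolding assms(1) by linarith
    qed
    have bounds: "?bounds C Cp \<Omega> N y r"
      if dom: "elliptic_domain \<Omega> A lam M ?Cb" and NP: "neumann_pair \<Omega> A N Nt" and LB: "cond_LB \<Omega> A C1"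
        and y: "y \<in> \<Omega>" and r: "r > 0"
      for \<Omega> and A :: "('n option, 'm) coeffs" and N Nt y r
    proof -
      have pw: "norm (real_mat (N x z)) \<le> P * norm (x - z) powr (2 - real CARD('n option))"
        if "x \<in> \<Omega>" "z \<in> \<Omega>" "x \<noteq> z" for x z
        using pointwise[OF dom NP LB that] unfolding assms(1) .
      note est = elliptic_domain.kernel_estimates[OF dom NP P _ assms(1) y, folded Q_def]
      show ?thesis
      proof (intro conjI allI impI; (elim conjE)?)
        have tail: "Lp_norm (2 * d / (d - 2)) (\<Omega> - ball y r) (\<lambda>x. real_mat (N x y))
            \<le> ennreal (kernel_tail_const d P * r powr (1 - d / 2))"
          by (rule est(1)) (rule pw, assumption+, rule r)
        have grad: "Lp_norm 2 (\<Omega> - ball y r) (kernel_grad \<Omega> N y) \<le> ennreal (Q * r powr (1 - d / 2))"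
          by (rule est(2)) (rule pw, assumption+, rule r)
        have "Lp_norm (2 * d / (d - 2)) (\<Omega> - ball y r) (\<lambda>x. real_mat (N x y))
               + Lp_norm 2 (\<Omega> - ball y r) (kernel_grad \<Omega> N y)
            \<le> ennreal (\<bar>kernel_tail_const d P\<bar> * r powr (1 - d / 2)) + ennreal (\<bar>Q\<bar> * r powr (1 - d / 2))"
          by (intro add_mono order.trans[OF tail weaken] order.trans[OF grad weaken]) auto
        also have "\<dots> = ennreal ((\<bar>kernel_tail_const d P\<bar> + \<bar>Q\<bar>) * r powr (1 - d / 2))"
          by (simp add: ring_distribs ennreal_plus)
        also have "\<dots> \<le> ennreal (C * r powr (1 - d / 2))"
          using P by (intro weaken) (auto simp: C_def)
        finally show "Lp_norm (2 * d / (d - 2)) (\<Omega> - ball y r) (\<lambda>x. real_mat (N x y))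
               + Lp_norm 2 (\<Omega> - ball y r) (kernel_grad \<Omega> N y) \<le> ennreal (C * r powr (1 - d / 2))" .
      next
        fix p assume p: "1 \<le> p" "p < d / (d - 2)"
        show "Lp_norm p (\<Omega> \<inter> ball y r) (\<lambda>x. real_mat (N x y)) \<le> ennreal (Cp p * r powr (2 - d + d / p))"
          by (rule order.trans[OF est(3) weaken[OF Cp(1)]]) (rule pw, assumption+, rule r, rule p, rule p)
      next
        fix t :: real assume "t > 0"
        then show "emeasure lebesgue {x \<in> \<Omega>. norm (real_mat (N x y)) > t} \<le> ennreal (C * t powr (- (d / (d - 2))))"
          by (intro order.trans[OF est(4) weaken[OF C(3)]]) (rule pw, assumption+)
      next
        fix p assume p: "1 \<le> p" "p < d / (d - 1)"
        show "Lp_norm p (\<Omega> \<inter> ball y r) (kernel_grad \<Omega> N y) \<le> ennreal (Cp p * r powr (1 - d + d / p))"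
          by (rule order.trans[OF est(5) weaken[OF Cp(2)]]) (rule pw, assumption+, rule r, rule p, rule p)
      next
        fix t :: real assume "t > 0"
        then show "emeasure lebesgue {x \<in> \<Omega>. norm (kernel_grad \<Omega> N y x) > t} \<le> ennreal (C * t powr (- (d / (d - 1))))"
          by (intro order.trans[OF est(6) weaken[OF C(4)]]) (rule pw, assumption+)
      qed
    qed
    show "\<exists>C>0. \<exists>Cp :: real \<Rightarrow> real. (\<forall>p. Cp p > 0) \<and>
        (\<forall>\<phi> A N Nt \<Omega>. ?hyp C1 \<phi> A N Nt \<Omega> \<longrightarrow>
          ?pointwise C N \<Omega> \<and> (\<forall>G\<in>{N, Nt}. \<forall>y\<in>\<Omega>. \<forall>r>0. ?bounds C Cp \<Omega> G y r))"
    proof (rule exI[of _ C], rule conjI, use P C(1) in linarith, rule exI[of _ Cp], rule conjI)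
      show "\<forall>p. Cp p > 0" by (auto simp: Cp_def)
      show "\<forall>\<phi> A N Nt \<Omega>. ?hyp C1 \<phi> A N Nt \<Omega> \<longrightarrow>
          ?pointwise C N \<Omega> \<and> (\<forall>G\<in>{N, Nt}. \<forall>y\<in>\<Omega>. \<forall>r>0. ?bounds C Cp \<Omega> G y r)"
      proof (intro allI impI, elim conjE)
        fix \<phi> :: "real^'n \<Rightarrow> real" and A :: "('n option, 'm) coeffs" and N Nt \<Omega>
        assume "\<Omega> = graph_domain \<phi>" "K-lipschitz_on UNIV \<phi>" "elliptic_coeffs lam M A"
          and NP: "neumann_pair \<Omega> A N Nt" and LB: "cond_LB \<Omega> A C1"
        then have dom: "elliptic_domain \<Omega> A lam M ?Cb" by (intro domain)
        show "?pointwise C N \<Omega> \<and> (\<forall>G\<in>{N, Nt}. \<forall>y\<in>\<Omega>. \<forall>r>0. ?bounds C Cp \<Omega> G y r)"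
        proof (rule conjI; intro ballI allI impI)
          fix x y assume "x \<in> \<Omega>" "y \<in> \<Omega>" "x \<noteq> y"
          from pointwise[OF dom NP LB this] show "norm (real_mat (N x y)) \<le> C * norm (x - y) powr (2 - d)"
            by (rule order.trans) (rule mult_right_mono, rule C(1), simp)
        next
          fix G y and r :: real assume G: "G \<in> {N, Nt}" and y: "y \<in> \<Omega>" and r: "r > 0"
          from G consider "G = N" | "G = Nt" by blast
          then show "?bounds C Cp \<Omega> G y r"
          proof cases
            case 1
            show ?thesis unfolding 1 by (rule bounds[OF dom NP LB y r])
          next
            case 2
            show ?thesis unfolding 2
              by (rule bounds[OF elliptic_domain.elliptic_domain_adjoint[OF dom] neumann_pair_adjoint[OF NP]
                    cond_LB_adjoint[OF LB] y r])
          qed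
        qed
      qed
    qed
  qed
  show ?B
  proof
    fix C2 :: real
    let ?L = "elliptic_domain.LB_const TYPE('n option) TYPE('m) lam M \<bar>C2\<bar>"
    have LB: "cond_LB \<Omega> A ?L"
      if gd: "\<Omega> = graph_domain \<phi>" "K-lipschitz_on UNIV \<phi>" "elliptic_coeffs lam M A" and NP: "neumann_pair \<Omega> A N Nt"
        and pw: "\<forall>x\<in>\<Omega>. \<forall>y\<in>\<Omega>. x \<noteq> y \<longrightarrow> norm (real_mat (N x y)) \<le> C2 * norm (x - y) powr (2 - d)"
      for \<phi> :: "real^'n \<Rightarrow> real" and A :: "('n option, 'm) coeffs" and N Nt \<Omega>
    proof (rule elliptic_domain.cond_LB_from_pointwise[OF domain[OF gd] NP])
      show "\<bar>C2\<bar> \<ge> 0" by simp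
      fix x z assume "x \<in> \<Omega>" "z \<in> \<Omega>" "x \<noteq> z"
      with pw have "norm (real_mat (N x z)) \<le> C2 * norm (x - z) powr (2 - d)" by blast
      also have "\<dots> \<le> \<bar>C2\<bar> * norm (x - z) powr (2 - d)" by (rule mult_right_mono) auto
      finally show "norm (real_mat (N x z)) \<le> \<bar>C2\<bar> * norm (x - z) powr (2 - real CARD('n option))"
        unfolding assms(1) .
    qed
    (* The other value is for the case that no domain and operator satisfy the hypotheses. *)
    let ?C1 = "if ?L > 0 then ?L else 1"
    show "\<exists>C1>0. ?LB C2 C1"
    proof (rule exI[of _ ?C1], rule conjI)
      show "?C1 > 0" by simp
      show "?LB C2 ?C1"
      proof (intro allI impI, elim conjE)
        fix \<phi> :: "real^'n \<Rightarrow> real" and A :: "('n option, 'm) coeffs" and N Nt \<Omega>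
        assume "\<Omega> = graph_domain \<phi>" "K-lipschitz_on UNIV \<phi>" "elliptic_coeffs lam M A" "neumann_pair \<Omega> A N Nt"
          "\<forall>x\<in>\<Omega>. \<forall>y\<in>\<Omega>. x \<noteq> y \<longrightarrow> norm (real_mat (N x y)) \<le> C2 * norm (x - y) powr (2 - d)"
        then have L: "cond_LB \<Omega> A ?L" by (rule LB)
        then have "?L > 0" by (simp add: cond_LB_def)
        then show "cond_LB \<Omega> A ?C1" using L by simp
      qed
    qed
  qed
qed

end
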